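(* Let $1\le p<\infty$, let $a\in\mathbb{D}$, $\theta\in\mathbb{R}$, and let $\varphi(z)=e^{i\theta}\frac{z-a}{1-\overline{a}z}$ be a Möbius transformation of the unit disc $\mathbb{D}$. Let $u$ be the exhaustion function of $\mathbb{D}$ defined by $u=f_0-\rho$, where $f_0(z)=-(1-x)^{3/4}$ for $z=x+iy$ and $\rho$ is the solution of the Dirichlet problem $\Delta\rho=0$ in $\mathbb{D}$, $\rho=f_0$ on $\partial\mathbb{D}$. Let $\mu_u$ be the boundary Monge-Ampère measure of $u$ and write $d\mu_u=\beta\,d\sigma$. Then the following are equivalent: (i) $C_{\varphi}$ is a bounded operator on the space $H^{p}_{u}(\mathbb{D})$; (ii) there exists a constant $K>0$ such that $\int_{E}\beta(\varphi^{*-1}(\eta))\,d\sigma(\eta)\le K\int_{E}\beta(\eta)\,d\sigma(\eta)$ for all measurable $E\subset\partial\mathbb{D}$; (iii) $\varphi(1)=1$.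
   Context: $C_\varphi(f)=f\circ\varphi$ is the composition operator; $\varphi^{*}$ is the boundary map $\varphi|_{\partial\mathbb{D}}:\partial\mathbb{D}\to\partial\mathbb{D}$ and $\varphi^{*-1}$ its inverse. $u$ is a negative, continuous, subharmonic exhaustion function for $\mathbb{D}$ with finite mass $\int_{\mathbb{D}}dd^c u<\infty$. Here, for subharmonic $v$, $dd^c v$ denotes the positive Borel measure given by a fixed positive constant multiple of the distributional Laplacian $\Delta v$ (the choice of constant is immaterial). With $B_u(r)=\{u<r\}$, $S_u(r)=\{u=r\}$, $u_r=\max\{u,r\}$ for $r<0$, put $\mu_{u,r}=dd^c u_r-\chi_{\mathbb{D}\setminus B_u(r)}\,dd^c u$, a positive measure supported on $S_u(r)$. $H^p_u(\mathbb{D})$ is the Banach space of holomorphic $f$ on $\mathbb{D}$ with $\limsup_{r\to0^-}\int_{S_u(r)}|f|^p\,d\mu_{u,r}<\infty$, with norm $\|f\|_{H^p_u}=\left(\lim_{r\to0^-}\int_{S_u(r)}|f|^p\,d\mu_{u,r}\right)^{1/p}$. The boundary Monge-Ampère measure $\mu_u$ is the weak-* limit (as measures on $\overline{\mathbb{D}}$) of $\mu_{u,r}$ as $r\to0^-$; it is supported on $\partial\mathbb{D}$ and is absolutely continuous with respect to arc length $\sigma$ on $\partial\mathbb{D}$ (normalized so that the Poisson kernel $P$ satisfies $\int_{\partial\mathbb{D}}P(z,\xi)\,d\sigma(\xi)=1$), with density $\beta(\xi)=\int_{\mathbb{D}}P(z,\xi)\,dd^c u(z)$. *)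

theory Defs
  imports "HOL-Complex_Analysis.Complex_Analysis"
begin

abbreviation unit_disc :: "complex set" where
  "unit_disc \<equiv> ball 0 1"

abbreviation unit_circle :: "complex set" where
  "unit_circle \<equiv> sphere 0 1"


subsection \<open>Smooth functions, the Laplacian, harmonic functions\<close>

text \<open>Derivative of \<open>f\<close> in the real direction \<open>v\<close>; the partial derivatives in \<open>x\<close> and \<open>y\<close>
  are the cases \<open>v = 1\<close> and \<open>v = \<i>\<close>.\<close>

definition pderiv_dir :: "complex \<Rightarrow> (complex \<Rightarrow> real) \<Rightarrow> complex \<Rightarrow> real" where
  "pderiv_dir v f z = frechet_derivative f (at z) v"

primrec Ck_on :: "nat \<Rightarrow> complex set \<Rightarrow> (complex \<Rightarrow> real) \<Rightarrow> bool" where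
  "Ck_on 0 S f \<longleftrightarrow> continuous_on S f"
| "Ck_on (Suc k) S f \<longleftrightarrow> (\<forall>z\<in>S. f differentiable (at z)) \<and>
     Ck_on k S (pderiv_dir 1 f) \<and> Ck_on k S (pderiv_dir \<i> f)"

definition laplacian :: "(complex \<Rightarrow> real) \<Rightarrow> complex \<Rightarrow> real" where
  "laplacian f z = pderiv_dir 1 (pderiv_dir 1 f) z + pderiv_dir \<i> (pderiv_dir \<i> f) z"

definition harmonic_on :: "complex set \<Rightarrow> (complex \<Rightarrow> real) \<Rightarrow> bool" where
  "harmonic_on S f \<longleftrightarrow> Ck_on 2 S f \<and> (\<forall>z\<in>S. laplacian f z = 0)"

definition test_function :: "(complex \<Rightarrow> real) \<Rightarrow> bool" where
  "test_function \<psi> \<longleftrightarrow> (\<forall>k. Ck_on k UNIV \<psi>) \<and>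
     (\<exists>K. compact K \<and> K \<subseteq> unit_disc \<and> (\<forall>z. z \<notin> K \<longrightarrow> \<psi> z = 0))"


subsection \<open>The measure \<open>dd\<^sup>c v\<close>\<close>

text \<open>\<open>M\<close> is the positive Radon measure on the disc that represents \<open>\<kappa>\<close> times the
  distributional Laplacian of \<open>v\<close>.  Measures on the disc are Borel measures on the complex plane
  for which the complement of the disc is a null set.  The number \<open>\<kappa> > 0\<close> is the
  normalising constant of \<open>dd\<^sup>c\<close>.\<close>

definition is_ddc :: "real \<Rightarrow> (complex \<Rightarrow> real) \<Rightarrow> complex measure \<Rightarrow> bool" where
  "is_ddc \<kappa> v M \<longleftrightarrow> sets M = sets borel \<and> emeasure M (- unit_disc) = 0 \<and>
     (\<forall>K. compact K \<and> K \<subseteq> unit_disc \<longrightarrow> emeasure M K < \<infinity>) \<and>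
     (\<forall>\<psi>. test_function \<psi> \<longrightarrow>
        (LINT z|M. \<psi> z) = \<kappa> * (LINT z:unit_disc|lborel. v z * laplacian \<psi> z))"

text \<open>Such a measure is unique, and it exists when \<open>v\<close> is subharmonic on the disc.\<close>

definition ddc :: "real \<Rightarrow> (complex \<Rightarrow> real) \<Rightarrow> complex measure" where
  "ddc \<kappa> v = (THE M. is_ddc \<kappa> v M)"


subsection \<open>Monge-Ampere measures of an exhaustion function\<close>

definition sublevel :: "(complex \<Rightarrow> real) \<Rightarrow> real \<Rightarrow> complex set" where
  "sublevel u r = {z \<in> unit_disc. u z < r}"

definition level :: "(complex \<Rightarrow> real) \<Rightarrow> real \<Rightarrow> complex set" where
  "level u r = {z \<in> unit_disc. u z = r}"

definition MA_measure :: "real \<Rightarrow> (complex \<Rightarrow> real) \<Rightarrow> real \<Rightarrow> complex measure" where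
  "MA_measure \<kappa> u r =
     diff_measure (ddc \<kappa> (\<lambda>z. max (u z) r))
       (density (ddc \<kappa> u) (indicator (unit_disc - sublevel u r)))"

text \<open>\<open>\<mu>\<close> is the weak-* limit of the measures \<open>MA_measure \<kappa> u r\<close>, as measures on the closed disc.\<close>

definition is_boundary_MA_measure ::
    "real \<Rightarrow> (complex \<Rightarrow> real) \<Rightarrow> complex measure \<Rightarrow> bool" where
  "is_boundary_MA_measure \<kappa> u \<mu> \<longleftrightarrow>
     sets \<mu> = sets borel \<and> finite_measure \<mu> \<and> emeasure \<mu> (- cball 0 1) = 0 \<and>
     (\<forall>h :: complex \<Rightarrow> real. continuous_on (cball 0 1) h \<longrightarrow>
        ((\<lambda>r. LINT z:cball 0 1|MA_measure \<kappa> u r. h z) \<longlongrightarrow> (LINT z:cball 0 1|\<mu>. h z)) (at_left 0))"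

text \<open>Arc length on the unit circle, of total mass 1, as a Borel measure on the plane.\<close>

definition arc_length :: "complex measure" where
  "arc_length = distr (uniform_measure lborel {0..<2 * pi}) borel cis"


subsection \<open>The spaces \<open>H\<^sup>p\<^sub>u\<close>\<close>

definition Hp_integral ::
    "real \<Rightarrow> (complex \<Rightarrow> real) \<Rightarrow> real \<Rightarrow> (complex \<Rightarrow> complex) \<Rightarrow> real \<Rightarrow> ennreal" where
  "Hp_integral \<kappa> u p f r = (\<integral>\<^sup>+z\<in>level u r. ennreal (cmod (f z) powr p) \<partial>MA_measure \<kappa> u r)"

text \<open>An element of \<open>H\<^sup>p\<^sub>u\<close> is represented by any function on the plane that extends it;
  only the values on the disc matter.\<close>

definition Hp :: "real \<Rightarrow> (complex \<Rightarrow> real) \<Rightarrow> real \<Rightarrow> (complex \<Rightarrow> complex) set" where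
  "Hp \<kappa> u p = {f. f holomorphic_on unit_disc \<and> Limsup (at_left 0) (Hp_integral \<kappa> u p f) < \<infinity>}"

definition Hp_norm :: "real \<Rightarrow> (complex \<Rightarrow> real) \<Rightarrow> real \<Rightarrow> (complex \<Rightarrow> complex) \<Rightarrow> real" where
  "Hp_norm \<kappa> u p f = enn2real (Lim (at_left 0) (Hp_integral \<kappa> u p f)) powr (1 / p)"

definition composition_operator ::
    "(complex \<Rightarrow> complex) \<Rightarrow> (complex \<Rightarrow> complex) \<Rightarrow> complex \<Rightarrow> complex" where
  "composition_operator \<phi> f = f \<circ> \<phi>"

text \<open>Boundedness of a (linear) operator on \<open>H\<^sup>p\<^sub>u\<close>; composition operators are linear by
  construction.\<close>

definition bounded_operator_on_Hp ::
    "real \<Rightarrow> (complex \<Rightarrow> real) \<Rightarrow> real \<Rightarrow> ((complex \<Rightarrow> complex) \<Rightarrow> complex \<Rightarrow> complex) \<Rightarrow> bool" where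
  "bounded_operator_on_Hp \<kappa> u p T \<longleftrightarrow>
     (\<forall>f \<in> Hp \<kappa> u p. T f \<in> Hp \<kappa> u p) \<and>
     (\<exists>C. \<forall>f \<in> Hp \<kappa> u p. Hp_norm \<kappa> u p (T f) \<le> C * Hp_norm \<kappa> u p f)"

end

theory Submission
  imports Defs
begin

unbundle no fps_syntax

text \<open>
  Write \<open>\<rho> = Re G\<close> with \<open>G\<close> given by an explicit power series whose derivative converges
  absolutely on the closed disc, so that \<open>u\<close> is as smooth up to the circle as \<open>(1 - Re z) powr (3/4)\<close> is.
  By Hopf's lemma the radial derivative of \<open>u\<close> is comparable to \<open>(1 - Re z) powr (- 1/4)\<close> near the
  circle.  Hence the level sets of \<open>u\<close> near the circle are radial graphs; in the polar angle,
  \<open>dd\<^sup>c max u r\<close> charges them with the density \<open>|z|\<^sup>2 |\<nabla>u|\<^sup>2\<close> over the logarithmic radial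
  derivative, and \<open>\<beta>\<close> is comparable to \<open>(1 - Re \<xi>) powr (- 1/4)\<close>.  It has a pole at 1 and no other singularity, which makes the domination
  of \<open>\<beta> \<circ> \<phi>\<^sup>-\<^sup>1\<close> by \<open>\<beta>\<close> equivalent to \<open>\<phi> 1 = 1\<close>.

  If \<open>\<phi> 1 = b \<noteq> 1\<close>, then functions concentrated at \<open>b\<close> have bounded \<open>\<beta>\<close>-weight near their peak, while
  their compositions with \<open>\<phi>\<close> peak at the pole of \<open>\<beta>\<close>, so \<open>C\<^sub>\<phi>\<close> is unbounded.
  Conversely, if \<open>\<phi> 1 = 1\<close> then \<open>\<Delta>u \<le> K \<Delta>(u \<circ> \<phi>)\<close>, hence \<open>u \<ge> K (u \<circ> \<phi>)\<close> by the maximum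
  principle, and the formula
  \<open>\<integral> g d\<mu>\<^sub>r = \<integral>\<^bsub>u<r\<^esub> g \<Delta>u + \<integral> (r - u)\<^sup>+ \<Delta>g\<close> for \<open>g = |f|\<^sup>p\<close>, transported by \<open>\<phi>\<close>, bounds
  the means of \<open>f \<circ> \<phi>\<close> at level \<open>r\<close> by \<open>K\<close> times those of \<open>f\<close> at level \<open>r/K\<close>.
\<close>

section \<open>Holomorphic change of variables in the plane\<close>

text \<open>On the circle \<open>1 - Re z\<close> is of order \<open>t\<^sup>2\<close> near 1, so
  the boundary values behave like |t| to the power 3/2 and their Fourier coefficients decay like n
  to the power -5/2. The derivative of the harmonic part therefore stays continuous up to the
  circle, and the singular factor \<open>(1 - Re z) powr (- 1/4)\<close> in the gradient of
  \<open>u\<close> comes from the explicit summand alone. Dividing it out leaves functions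
  continuous on the closed disc, to which compactness applies even at 1. An element of the Hardy
  space need not have continuous boundary values, so an inequality between boundary densities
  controls the operator only on functions continuous up to the circle. That is enough for the
  necessity of \<phi> 1 = 1, where explicit test functions are used. Sufficiency is proved inside
  the disc instead: the inequality for \<open>u\<close> holds at each point, hence the means are
  compared at every level before any limit is taken. For this reason (i) and (ii) are not compared
  with each other, but each of them with (iii).\<close>

lemma lborel_complex_vec:
  "(lborel :: complex measure) = distr lborel borel (\<lambda>v::real^2. Complex (v$1) (v$2))"
proof (rule lborel_eqI)
  fix l u :: complex assume le: "\<And>b. b \<in> Basis \<Longrightarrow> l \<bullet> b \<le> u \<bullet> b"
  have le': "Re l \<le> Re u" "Im l \<le> Im u"
    using le[of 1] le[of \<i>] by (auto simp: Basis_complex_def)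
  let ?a = "(\<chi> i. if i = 1 then Re l else Im l) :: real^2"
  let ?b = "(\<chi> i. if i = 1 then Re u else Im u) :: real^2"
  have "(\<lambda>v::real^2. Complex (v$1) (v$2)) -` box l u = box ?a ?b"
    by (auto simp: mem_box_cart forall_2 in_box_complex_iff)
  moreover have "emeasure lborel (box ?a ?b) = ennreal ((Re u - Re l) * (Im u - Im l))"
  proof -
    have "emeasure lborel (cbox ?a ?b) = ennreal (measure lborel (cbox ?a ?b))"
      by (rule emeasure_eq_ennreal_measure) (use emeasure_lborel_cbox_finite[of ?a ?b] in auto)
    also have "measure lborel (cbox ?a ?b) = (Re u - Re l) * (Im u - Im l)"
      using le' by (subst content_cbox_cart) (auto simp: interval_eq_empty_cart UNIV_2)
    finally show ?thesis
      by (simp only: emeasure_lborel_box_eq emeasure_lborel_cbox_eq)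
  qed
  moreover have "(\<lambda>v::real^2. Complex (v$1) (v$2)) \<in> borel_measurable borel"
    by (intro borel_measurable_continuous_onI continuous_intros)
  ultimately show "emeasure (distr lborel borel (\<lambda>v::real^2. Complex (v$1) (v$2))) (box l u) =
      (\<Prod>b\<in>Basis. (u - l) \<bullet> b)"
    by (subst emeasure_distr) (auto simp: Basis_complex_def)
qed simp

text \<open>The form suited to Fubini, for integration along lines and for polar coordinates; the
  vector form above carries the determinant formula for changes of variables.\<close>

lemma lborel_complex_pair:
  "(lborel :: complex measure) = distr (lborel \<Otimes>\<^sub>M lborel) borel (\<lambda>(x, y). Complex x y)"
proof (rule lborel_eqI)
  fix l u :: complex assume le: "\<And>b. b \<in> Basis \<Longrightarrow> l \<bullet> b \<le> u \<bullet> b"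
  have le': "Re l \<le> Re u" "Im l \<le> Im u"
    using le[of 1] le[of \<i>] by (auto simp: Basis_complex_def)
  have "(\<lambda>(x, y). Complex x y) -` box l u = {Re l<..<Re u} \<times> {Im l<..<Im u}"
    by (auto simp: in_box_complex_iff)
  moreover have "(\<lambda>p. Complex (fst p) (snd p)) \<in> borel_measurable borel"
    by (intro borel_measurable_continuous_onI continuous_intros)
  then have "(\<lambda>(x, y). Complex x y) \<in> borel_measurable (lborel \<Otimes>\<^sub>M lborel)"
    by (simp add: lborel_prod case_prod_beta)
  ultimately show "emeasure (distr (lborel \<Otimes>\<^sub>M lborel) borel (\<lambda>(x, y). Complex x y)) (box l u) =
      (\<Prod>b\<in>Basis. (u - l) \<bullet> b)"
    using le' by (subst emeasure_distr)
      (auto simp: Basis_complex_def space_pair_measure lborel.emeasure_pair_measure_Times ennreal_mult)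
qed simp

text \<open>By the Cauchy-Riemann equations the real Jacobian determinant of a holomorphic map is
  the squared modulus of its derivative; the identification with \<open>real^2\<close> then reduces
  the claim to the real change of variables.\<close>

lemma emeasure_holomorphic_image:
  fixes f f' :: "complex \<Rightarrow> complex"
  assumes T: "T \<in> sets borel" and fT: "f ` T \<in> sets borel"
    and der: "\<And>z. z \<in> T \<Longrightarrow> (f has_field_derivative f' z) (at z)"
    and inj: "inj_on f T" and f'm: "f' \<in> borel_measurable borel"
  shows "emeasure lborel (f ` T) = (\<integral>\<^sup>+z\<in>T. ennreal ((cmod (f' z))\<^sup>2) \<partial>lborel)"
proof -
  let ?i = "\<lambda>v::real^2. Complex (v$1) (v$2)"
  let ?j = "\<lambda>z. (\<chi> i. if i = 1 then Re z else Im z) :: real^2"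
  have ij [simp]: "?i (?j z) = z" for z by (simp add: complex_eq_iff)
  have ji [simp]: "?j (?i v) = v" for v by (simp add: vec_eq_iff forall_2)
  have im [measurable]: "?i \<in> borel_measurable borel"
    by (intro borel_measurable_continuous_onI continuous_intros)
  have bj: "bounded_linear ?j"
    unfolding linear_conv_bounded_linear[symmetric]
    by (rule linearI) (auto simp: vec_eq_iff)
  have bi: "bounded_linear ?i"
    unfolding linear_conv_bounded_linear[symmetric]
    by (rule linearI) (auto simp: complex_eq_iff)
  define S where "S = ?i -` T"
  define g where "g = (\<lambda>v. ?j (f (?i v)))"
  define g' where "g' = (\<lambda>v h. ?j (f' (?i v) * ?i h))"
  have Sb: "S \<in> sets borel"
    using measurable_sets[OF im T] by (simp add: S_def)
  have gS: "g ` S = ?i -` (f ` T)"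
  proof (intro equalityI subsetI)
    fix v assume "v \<in> ?i -` (f ` T)"
    then obtain z where z: "z \<in> T" "?i v = f z" by auto
    then have "v = g (?j z)" by (metis g_def ij ji)
    moreover have "?j z \<in> S" using z by (simp add: S_def)
    ultimately show "v \<in> g ` S" by blast
  qed (auto simp: g_def S_def)
  have gSb: "g ` S \<in> sets borel"
    using measurable_sets[OF im fT] by (simp add: gS)
  have d: "(g has_derivative g' v) (at v within S)" if "v \<in> S" for v
  proof -
    have "(f has_derivative (\<lambda>h. f' (?i v) * h)) (at (?i v))"
      using der[of "?i v"] that by (simp add: S_def has_field_derivative_def)
    moreover have "(?i has_derivative ?i) (at v)"
      by (rule bounded_linear_imp_has_derivative[OF bi])
    ultimately have "((\<lambda>v. f (?i v)) has_derivative (\<lambda>h. f' (?i v) * ?i h)) (at v)"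
      using has_derivative_compose by fastforce
    from bounded_linear.has_derivative[OF bj this] show ?thesis
      unfolding g_def g'_def by (rule has_derivative_at_withinI)
  qed
  have injg: "inj_on g S"
  proof (rule inj_onI)
    fix v w assume "v \<in> S" "w \<in> S" "g v = g w"
    then have "f (?i v) = f (?i w)" unfolding g_def by (metis ij)
    then have "?i v = ?i w" using inj \<open>v \<in> S\<close> \<open>w \<in> S\<close> by (auto simp: S_def dest: inj_onD)
    then show "v = w" by (metis ji)
  qed
  \<comment> \<open>Multiplication by \<open>f'\<close> has the real matrix with rows (Re, -Im) and
    (Im, Re).\<close>
  have det: "\<bar>det (matrix (g' v))\<bar> = (cmod (f' (?i v)))\<^sup>2" for v
    unfolding cmod_power2
    by (simp add: det_2 matrix_def g'_def axis_def power2_eq_square)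
  \<comment> \<open>Being an equivalence, this also settles the case of infinite measure: if either
    side is finite, so is the other.\<close>
  have main: "g ` S \<in> lmeasurable \<and> measure lebesgue (g ` S) = m
     \<longleftrightarrow> ((\<lambda>x. (cmod (f' (?i x)))\<^sup>2) has_integral m) S" for m
    using has_measure_differentiable_image[OF _ d injg, of m] Sb by (simp add: det)
  have Sl: "S \<in> sets lebesgue" using Sb by simp
  have e1: "emeasure lborel (f ` T) = emeasure lborel (g ` S)"
    unfolding gS by (subst lborel_complex_vec, subst emeasure_distr) (use fT in auto)
  let ?h = "\<lambda>v. (cmod (f' (?i v)))\<^sup>2 * indicator S v"
  have hif: "(\<lambda>x. if x \<in> S then (cmod (f' (?i x)))\<^sup>2 else 0) = ?h"
    by (auto simp: fun_eq_iff)
  have hm: "?h \<in> borel_measurable borel" using Sb f'm by measurable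
  have e2: "(\<integral>\<^sup>+z\<in>T. ennreal ((cmod (f' z))\<^sup>2) \<partial>lborel) = (\<integral>\<^sup>+v. ennreal (?h v) \<partial>lborel)"
    using T f'm by (subst lborel_complex_vec, subst nn_integral_distr)
      (auto simp: S_def indicator_def intro!: nn_integral_cong)
  show ?thesis
  proof (cases "g ` S \<in> lmeasurable")
    case True
    define m where "m = measure lebesgue (g ` S)"
    have hi: "((\<lambda>x. (cmod (f' (?i x)))\<^sup>2) has_integral m) S"
      using main[of m] True m_def by blast
    then have "(?h has_integral m) UNIV"
      by (subst (asm) has_integral_restrict_UNIV[symmetric]) (simp add: hif)
    then have "(\<integral>\<^sup>+v. ennreal (?h v) \<partial>lborel) = ennreal m"
      using nn_integral_has_integral_lborel[OF hm] by auto
    moreover have "emeasure lborel (g ` S) = ennreal m"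
    proof -
      have "emeasure lborel (g ` S) = emeasure lebesgue (g ` S)" using gSb by simp
      also have "\<dots> = ennreal m" using True unfolding m_def
        by (rule emeasure_eq_measure2)
      finally show ?thesis .
    qed
    ultimately show ?thesis using e1 e2 by simp
  next
    case False
    have "emeasure lborel (g ` S) = \<infinity>"
      using False gSb by (simp add: fmeasurable_def less_top[symmetric])
    moreover have "(\<integral>\<^sup>+v. ennreal (?h v) \<partial>lborel) = \<infinity>"
    proof (rule ccontr)
      assume n: "(\<integral>\<^sup>+v. ennreal (?h v) \<partial>lborel) \<noteq> \<infinity>"
      then have "(?h has_integral enn2real (\<integral>\<^sup>+v. ennreal (?h v) \<partial>lborel)) UNIV"
        using hm by (intro nn_integral_has_integral) (auto simp: less_top[symmetric])
      then have "((\<lambda>x. (cmod (f' (?i x)))\<^sup>2) has_integral enn2real (\<integral>\<^sup>+v. ennreal (?h v) \<partial>lborel)) S"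
        by (subst has_integral_restrict_UNIV[symmetric]) (simp add: hif)
      then show False using main False by blast
    qed
    ultimately show ?thesis using e1 e2 by simp
  qed
qed

text \<open>Used twice: with \<open>exp\<close> it yields polar coordinates, with a disc
  automorphism the transport of area integrals.\<close>

lemma distr_holomorphic_lborel:
  fixes f f' :: "complex \<Rightarrow> complex"
  assumes S: "S \<in> sets borel" and fS: "f ` S \<in> sets borel"
    and der: "\<And>z. z \<in> S \<Longrightarrow> (f has_field_derivative f' z) (at z)"
    and inj: "inj_on f S"
    and fm: "f \<in> borel_measurable borel" and f'm: "f' \<in> borel_measurable borel"
  shows "distr (density lborel (\<lambda>z. ennreal ((cmod (f' z))\<^sup>2) * indicator S z)) borel f
    = density lborel (indicator (f ` S))"
proof (rule measure_eqI)
  fix A assume "A \<in> sets (distr (density lborel (\<lambda>z. ennreal ((cmod (f' z))\<^sup>2) * indicator S z)) borel f)"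
  then have A: "A \<in> sets borel" by simp
  have TA: "f -` A \<in> sets borel" using measurable_sets[OF fm A] by simp
  have im: "f ` (S \<inter> f -` A) = f ` S \<inter> A" by auto
  have "emeasure (distr (density lborel (\<lambda>z. ennreal ((cmod (f' z))\<^sup>2) * indicator S z)) borel f) A
     = (\<integral>\<^sup>+z\<in>f -` A. (ennreal ((cmod (f' z))\<^sup>2) * indicator S z) \<partial>lborel)"
    using A TA fm f'm S by (simp add: emeasure_distr emeasure_density)
  also have "\<dots> = (\<integral>\<^sup>+z\<in>S \<inter> f -` A. ennreal ((cmod (f' z))\<^sup>2) \<partial>lborel)"
    by (intro nn_integral_cong) (auto simp: indicator_def)
  also have "\<dots> = emeasure lborel (f ` (S \<inter> f -` A))"
    using S TA fS A
    by (intro emeasure_holomorphic_image[symmetric] der)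
       (auto simp: im f'm intro: inj_on_subset[OF inj])
  also have "\<dots> = emeasure (density lborel (indicator (f ` S))) A"
    using fS A by (simp add: im emeasure_density indicator_inter_arith[symmetric])
  finally show "emeasure (distr (density lborel (\<lambda>z. ennreal ((cmod (f' z))\<^sup>2) * indicator S z)) borel f) A
     = emeasure (density lborel (indicator (f ` S))) A" .
qed simp

section \<open>Partial derivatives and Green's identity\<close>

text \<open>Differentiation along a line obeys the one-variable rules, which makes products, chains
  and second derivatives direct to compute; Green's identity and the test at a maximum ask for
  nothing stronger.\<close>

definition has_line_derivative :: "(complex \<Rightarrow> real) \<Rightarrow> complex \<Rightarrow> real \<Rightarrow> complex \<Rightarrow> bool" where
  "has_line_derivative f v D z \<longleftrightarrow> ((\<lambda>t. f (z + of_real t * v)) has_real_derivative D) (at 0)"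

lemma has_line_derivative_frechet:
  assumes "(f has_derivative f') (at z)"
  shows "has_line_derivative f v (f' v) z"
proof -
  have "((\<lambda>t. z + of_real t * v) has_derivative (\<lambda>h. of_real h * v)) (at (0::real))"
    by (auto intro!: derivative_eq_intros)
  then have "((\<lambda>t. f (z + of_real t * v)) has_derivative (\<lambda>h. f' (of_real h * v))) (at (0::real))"
    using has_derivative_compose[of "\<lambda>t. z + of_real t * v" _ 0 UNIV f f'] assms by simp
  moreover have "f' (of_real h * v) = h * f' v" for h
    using linear_scale[OF has_derivative_linear[OF assms], of h v] by (simp add: scaleR_conv_of_real)
  ultimately show ?thesis
    unfolding has_line_derivative_def has_field_derivative_def by (simp add: mult.commute[of _ "f' v"])
qed

lemma has_line_derivative_field:
  assumes "(f has_field_derivative d) (at z)"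
  shows "has_line_derivative (\<lambda>z. Re (f z)) v (Re (d * v)) z"
proof -
  have "((\<lambda>z. Re (f z)) has_derivative (\<lambda>h. Re (d * h))) (at z)"
    using assms unfolding has_field_derivative_def by (rule bounded_linear.has_derivative[OF bounded_linear_Re])
  then show ?thesis by (rule has_line_derivative_frechet)
qed

lemma has_line_derivative_eventually:
  assumes "has_line_derivative f v D z" and "open S" "z \<in> S" and "\<And>w. w \<in> S \<Longrightarrow> f w = g w"
  shows "has_line_derivative g v D z"
proof -
  have "continuous (at 0) (\<lambda>t. z + of_real t * v)" by (intro continuous_intros)
  then have "eventually (\<lambda>t. z + of_real t * v \<in> S) (nhds (0::real))"
    using assms(2,3) by (auto simp: continuous_at_open eventually_nhds)
  then have "eventually (\<lambda>t. f (z + of_real t * v) = g (z + of_real t * v)) (nhds (0::real))"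
    by (rule eventually_mono) (use assms in auto)
  then show ?thesis
    using assms(1) unfolding has_line_derivative_def by (simp add: DERIV_cong_ev)
qed

lemma has_line_derivative_mult:
  assumes "has_line_derivative f v D z" "has_line_derivative g v E z"
  shows "has_line_derivative (\<lambda>z. f z * g z) v (D * g z + E * f z) z"
  using DERIV_mult[OF assms[unfolded has_line_derivative_def]]
  unfolding has_line_derivative_def by simp

lemma has_line_derivative_add:
  assumes "has_line_derivative f v D z" "has_line_derivative g v E z"
  shows "has_line_derivative (\<lambda>z. f z + g z) v (D + E) z"
  using DERIV_add[OF assms[unfolded has_line_derivative_def]]
  unfolding has_line_derivative_def by simp

lemma has_line_derivative_diff:
  assumes "has_line_derivative f v D z" "has_line_derivative g v E z"
  shows "has_line_derivative (\<lambda>z. f z - g z) v (D - E) z"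
  using DERIV_diff[OF assms[unfolded has_line_derivative_def]]
  unfolding has_line_derivative_def by simp

lemma has_line_derivative_const: "has_line_derivative (\<lambda>z. c) v 0 z"
  unfolding has_line_derivative_def by simp

lemma has_line_derivative_cmult:
  assumes "has_line_derivative f v D z"
  shows "has_line_derivative (\<lambda>z. c * f z) v (c * D) z"
  using has_line_derivative_mult[OF has_line_derivative_const[of c] assms] by (simp add: mult.commute)

lemma has_line_derivative_chain:
  assumes "has_line_derivative f v D z" "(h has_real_derivative E) (at (f z))"
  shows "has_line_derivative (\<lambda>z. h (f z)) v (E * D) z"
  using DERIV_chain2[of h E "\<lambda>t. f (z + of_real t * v)" 0] assms
  unfolding has_line_derivative_def by simp

lemma has_line_derivative_1_iff:
  "has_line_derivative f 1 D (Complex x y) \<longleftrightarrow> ((\<lambda>x. f (Complex x y)) has_real_derivative D) (at x)"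
proof -
  have "Complex x y + of_real t * 1 = Complex (x + t) y" for t by (simp add: complex_eq_iff)
  then show ?thesis
    unfolding has_line_derivative_def using DERIV_shift[of "\<lambda>x. f (Complex x y)" D 0 x]
    by (simp add: add.commute)
qed

lemma has_line_derivative_i_iff:
  "has_line_derivative f \<i> D (Complex x y) \<longleftrightarrow> ((\<lambda>y. f (Complex x y)) has_real_derivative D) (at y)"
proof -
  have "Complex x y + of_real t * \<i> = Complex x (y + t)" for t by (simp add: complex_eq_iff)
  then show ?thesis
    unfolding has_line_derivative_def using DERIV_shift[of "\<lambda>y. f (Complex x y)" D 0 y]
    by (simp add: add.commute)
qed

text \<open>A certificate of second order regularity whose derivatives are explicit functions. The
  Laplacian is then the sum of the last two arguments and can be read off after each
  construction.\<close>

definition pd2 :: "complex set \<Rightarrow> (complex \<Rightarrow> real) \<Rightarrow> (complex \<Rightarrow> real) \<Rightarrow> (complex \<Rightarrow> real)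
    \<Rightarrow> (complex \<Rightarrow> real) \<Rightarrow> (complex \<Rightarrow> real) \<Rightarrow> bool" where
  "pd2 S f fx fy fxx fyy \<longleftrightarrow>
     continuous_on S f \<and> continuous_on S fx \<and> continuous_on S fy \<and>
     continuous_on S fxx \<and> continuous_on S fyy \<and>
     (\<forall>z\<in>S. has_line_derivative f 1 (fx z) z \<and> has_line_derivative f \<i> (fy z) z \<and>
        has_line_derivative fx 1 (fxx z) z \<and> has_line_derivative fy \<i> (fyy z) z)"

lemma integrable_continuous_compact_support:
  fixes g :: "complex \<Rightarrow> real"
  assumes "continuous_on UNIV g" "compact K" "\<And>z. z \<notin> K \<Longrightarrow> g z = 0"
  shows "integrable lborel g"
proof -
  have "integrable lborel (\<lambda>z. indicator K z *\<^sub>R g z)"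
    using assms by (intro borel_integrable_compact) (auto intro: continuous_on_subset)
  moreover have "(\<lambda>z. indicator K z *\<^sub>R g z) = g"
    using assms(3) by (auto simp: fun_eq_iff indicator_def)
  ultimately show ?thesis by simp
qed

lemma integral_FTC_compact_support:
  fixes f g :: "real \<Rightarrow> real"
  assumes "\<And>x. (f has_real_derivative g x) (at x)" "\<And>x. isCont g x"
    and R: "R \<ge> 0" "\<And>x. \<bar>x\<bar> \<ge> R \<Longrightarrow> f x = 0" "\<And>x. \<bar>x\<bar> > R \<Longrightarrow> g x = 0"
  shows "(\<integral>x. g x \<partial>lborel) = 0"
proof -
  have "(\<integral>x. g x * indicator {- R..R} x \<partial>lborel) = f R - f (- R)"
    using assms by (intro integral_FTC_Icc_real) auto
  also have "\<dots> = 0" using R by simp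
  also have "(\<lambda>x. g x * indicator {- R..R} x) = g"
    using R(3) by (force simp: fun_eq_iff indicator_def not_le)
  finally show ?thesis .
qed

text \<open>One half of the divergence theorem for compactly supported fields: along each horizontal
  line the fundamental theorem of calculus gives 0, and Fubini collects the lines.\<close>

lemma integral_x_derivative_eq_0:
  fixes V g :: "complex \<Rightarrow> real"
  assumes g: "continuous_on UNIV g" and der: "\<And>z. has_line_derivative V 1 (g z) z"
    and K: "compact K" "\<And>z. z \<notin> K \<Longrightarrow> V z = 0" "\<And>z. z \<notin> K \<Longrightarrow> g z = 0"
  shows "integrable lborel g" "(\<integral>z. g z \<partial>lborel) = 0"
proof -
  show gi: "integrable lborel g" by (rule integrable_continuous_compact_support[OF g K(1,3)])
  obtain R where R: "\<And>z. z \<in> K \<Longrightarrow> cmod z < R" "R > 0"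
    using compact_imp_bounded[OF K(1)] by (auto simp: bounded_pos_less)
  have i0: "(\<integral>x. g (Complex x y) \<partial>lborel) = 0" for y
  proof (rule integral_FTC_compact_support[where f = "\<lambda>x. V (Complex x y)" and R = R])
    show "((\<lambda>x. V (Complex x y)) has_real_derivative g (Complex x y)) (at x)" for x
      using der has_line_derivative_1_iff by blast
    have "continuous_on UNIV (\<lambda>x. g (Complex x y))"
      by (intro continuous_on_compose2[OF g] continuous_intros) auto
    then show "isCont (\<lambda>x. g (Complex x y)) x" for x
      by (simp add: continuous_on_eq_continuous_at)
    have "Complex x y \<notin> K" if "\<bar>x\<bar> \<ge> R" for x
      using R(1)[of "Complex x y"] abs_Re_le_cmod[of "Complex x y"] that by auto
    then show "\<bar>x\<bar> \<ge> R \<Longrightarrow> V (Complex x y) = 0" "\<bar>x\<bar> > R \<Longrightarrow> g (Complex x y) = 0" for x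
      using K(2,3) by auto
  qed (use R in auto)
  have m: "(\<lambda>(x, y). Complex x y) \<in> borel_measurable (lborel \<Otimes>\<^sub>M lborel)"
  proof -
    have "(\<lambda>p. Complex (fst p) (snd p)) \<in> borel_measurable borel"
      by (intro borel_measurable_continuous_onI continuous_intros)
    then show ?thesis by (simp add: lborel_prod case_prod_beta)
  qed
  have gm: "g \<in> borel_measurable borel" using g by (rule borel_measurable_continuous_onI)
  have "integrable (lborel \<Otimes>\<^sub>M lborel) (\<lambda>p. g ((\<lambda>(x, y). Complex x y) p))"
    using gi by (subst (asm) lborel_complex_pair, subst (asm) integrable_distr_eq) (use m gm in auto)
  then have "integrable (lborel \<Otimes>\<^sub>M lborel) (\<lambda>(x, y). g (Complex x y))"
    by (simp add: case_prod_beta')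
  from lborel_pair.integral_snd[OF this]
  have "(\<integral>y. (\<integral>x. g (Complex x y) \<partial>lborel) \<partial>lborel) =
      (\<integral>p. g (case p of (x, y) \<Rightarrow> Complex x y) \<partial>(lborel \<Otimes>\<^sub>M lborel))"
    by (simp add: case_prod_beta')
  also have "\<dots> = (\<integral>z. g z \<partial>lborel)"
    by (subst lborel_complex_pair, subst integral_distr) (use m gm in auto)
  finally show "(\<integral>z. g z \<partial>lborel) = 0" by (simp add: i0)
qed

lemma integral_y_derivative_eq_0:
  fixes V g :: "complex \<Rightarrow> real"
  assumes g: "continuous_on UNIV g" and der: "\<And>z. has_line_derivative V \<i> (g z) z"
    and K: "compact K" "\<And>z. z \<notin> K \<Longrightarrow> V z = 0" "\<And>z. z \<notin> K \<Longrightarrow> g z = 0"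
  shows "integrable lborel g" "(\<integral>z. g z \<partial>lborel) = 0"
proof -
  show gi: "integrable lborel g" by (rule integrable_continuous_compact_support[OF g K(1,3)])
  obtain R where R: "\<And>z. z \<in> K \<Longrightarrow> cmod z < R" "R > 0"
    using compact_imp_bounded[OF K(1)] by (auto simp: bounded_pos_less)
  have i0: "(\<integral>y. g (Complex x y) \<partial>lborel) = 0" for x
  proof (rule integral_FTC_compact_support[where f = "\<lambda>y. V (Complex x y)" and R = R])
    show "((\<lambda>y. V (Complex x y)) has_real_derivative g (Complex x y)) (at y)" for y
      using der has_line_derivative_i_iff by blast
    have "continuous_on UNIV (\<lambda>y. g (Complex x y))"
      by (intro continuous_on_compose2[OF g] continuous_intros) auto
    then show "isCont (\<lambda>y. g (Complex x y)) y" for y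
      by (simp add: continuous_on_eq_continuous_at)
    have "Complex x y \<notin> K" if "\<bar>y\<bar> \<ge> R" for y
      using R(1)[of "Complex x y"] abs_Im_le_cmod[of "Complex x y"] that by auto
    then show "\<bar>y\<bar> \<ge> R \<Longrightarrow> V (Complex x y) = 0" "\<bar>y\<bar> > R \<Longrightarrow> g (Complex x y) = 0" for y
      using K(2,3) by auto
  qed (use R in auto)
  have m: "(\<lambda>(x, y). Complex x y) \<in> borel_measurable (lborel \<Otimes>\<^sub>M lborel)"
  proof -
    have "(\<lambda>p. Complex (fst p) (snd p)) \<in> borel_measurable borel"
      by (intro borel_measurable_continuous_onI continuous_intros)
    then show ?thesis by (simp add: lborel_prod case_prod_beta)
  qed
  have gm: "g \<in> borel_measurable borel" using g by (rule borel_measurable_continuous_onI)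
  have "integrable (lborel \<Otimes>\<^sub>M lborel) (\<lambda>p. g ((\<lambda>(x, y). Complex x y) p))"
    using gi by (subst (asm) lborel_complex_pair, subst (asm) integrable_distr_eq) (use m gm in auto)
  then have "integrable (lborel \<Otimes>\<^sub>M lborel) (\<lambda>(x, y). g (Complex x y))"
    by (simp add: case_prod_beta')
  from lborel_pair.integral_fst[OF this]
  have "(\<integral>x. (\<integral>y. g (Complex x y) \<partial>lborel) \<partial>lborel) =
      (\<integral>p. g (case p of (x, y) \<Rightarrow> Complex x y) \<partial>(lborel \<Otimes>\<^sub>M lborel))"
    by (simp add: case_prod_beta')
  also have "\<dots> = (\<integral>z. g z \<partial>lborel)"
    by (subst lborel_complex_pair, subst integral_distr) (use m gm in auto)
  finally show "(\<integral>z. g z \<partial>lborel) = 0" by (simp add: i0)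
qed

lemma continuous_on_extend_zero:
  fixes g :: "complex \<Rightarrow> real"
  assumes "continuous_on S g" "open S" "compact K" "K \<subseteq> S" "\<And>z. z \<in> S - K \<Longrightarrow> g z = 0"
  shows "continuous_on UNIV (\<lambda>z. if z \<in> S then g z else 0)"
proof -
  have "continuous_on (S \<union> - K) (\<lambda>z. if z \<in> S then g z else 0)"
  proof (rule continuous_on_open_Un)
    show "continuous_on S (\<lambda>z. if z \<in> S then g z else 0)"
      using assms(1) by (rule continuous_on_eq) auto
    show "continuous_on (- K) (\<lambda>z. if z \<in> S then g z else 0)"
      by (rule continuous_on_eq[OF continuous_on_const[of _ 0]]) (use assms in auto)
  qed (use assms compact_imp_closed in auto)
  moreover have "S \<union> - K = UNIV" using assms by auto
  ultimately show ?thesis by simp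
qed

lemma has_line_derivative_extend_zero:
  fixes g :: "complex \<Rightarrow> real"
  assumes "\<And>z. z \<in> S \<Longrightarrow> has_line_derivative g v (d z) z"
    "open S" "compact K" "K \<subseteq> S" "\<And>z. z \<in> S - K \<Longrightarrow> g z = 0"
  shows "has_line_derivative (\<lambda>z. if z \<in> S then g z else 0) v (if z \<in> S then d z else 0) z"
proof (cases "z \<in> S")
  case True
  then show ?thesis
    using has_line_derivative_eventually[OF assms(1)[OF True] assms(2) True] by auto
next
  case False
  have "has_line_derivative (\<lambda>z. if z \<in> S then g z else 0) v 0 z"
    by (rule has_line_derivative_eventually[OF has_line_derivative_const[of 0], where S = "- K"])
       (use assms False open_Compl[OF compact_imp_closed[OF assms(3)]] in auto)
  then show ?thesis using False by simp
qed

text \<open>The integrand is the divergence of the field a grad b - b grad a, which vanishes off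
  \<open>K\<close> together with \<open>a\<close>; the function \<open>b\<close> may behave
  arbitrarily near the boundary of \<open>S\<close>.\<close>

lemma green_identity:
  assumes a: "pd2 S a ax ay axx ayy" and b: "pd2 S b bx by' bxx byy"
    and S: "open S" and K: "compact K" "K \<subseteq> S"
    and z: "\<And>z. z \<in> S - K \<Longrightarrow> a z = 0 \<and> ax z = 0 \<and> ay z = 0 \<and> axx z = 0 \<and> ayy z = 0"
  shows "(LINT z:S|lborel. a z * (bxx z + byy z) - b z * (axx z + ayy z)) = 0"
proof -
  define V1 where "V1 = (\<lambda>z. a z * bx z - b z * ax z)"
  define V2 where "V2 = (\<lambda>z. a z * by' z - b z * ay z)"
  define g1 where "g1 = (\<lambda>z. a z * bxx z - b z * axx z)"
  define g2 where "g2 = (\<lambda>z. a z * byy z - b z * ayy z)"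
  note ca = a[unfolded pd2_def] and cb = b[unfolded pd2_def]
  have d1: "has_line_derivative V1 1 (g1 z) z" if "z \<in> S" for z
  proof -
    have "has_line_derivative V1 1 ((ax z * bx z + bxx z * a z) - (bx z * ax z + axx z * b z)) z"
      unfolding V1_def using ca cb that
      by (intro has_line_derivative_diff has_line_derivative_mult) auto
    then show ?thesis by (simp add: g1_def algebra_simps)
  qed
  have d2: "has_line_derivative V2 \<i> (g2 z) z" if "z \<in> S" for z
  proof -
    have "has_line_derivative V2 \<i> ((ay z * by' z + byy z * a z) - (by' z * ay z + ayy z * b z)) z"
      unfolding V2_def using ca cb that
      by (intro has_line_derivative_diff has_line_derivative_mult) auto
    then show ?thesis by (simp add: g2_def algebra_simps)
  qed
  have c1: "continuous_on S g1" and c2: "continuous_on S g2"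
    using ca cb unfolding g1_def g2_def by (auto intro!: continuous_intros)
  have z0: "V1 z = 0" "V2 z = 0" "g1 z = 0" "g2 z = 0" if "z \<in> S - K" for z
    using z[OF that] by (auto simp: V1_def V2_def g1_def g2_def)
  have I1: "integrable lborel (\<lambda>z. if z \<in> S then g1 z else 0)"
    "(\<integral>z. (if z \<in> S then g1 z else 0) \<partial>lborel) = 0"
    by (rule integral_x_derivative_eq_0[where V = "\<lambda>z. if z \<in> S then V1 z else 0" and K = K];
        (rule continuous_on_extend_zero[OF c1 S K] has_line_derivative_extend_zero[OF d1 S K] K)?;
        use z0 in auto)+
  have I2: "integrable lborel (\<lambda>z. if z \<in> S then g2 z else 0)"
    "(\<integral>z. (if z \<in> S then g2 z else 0) \<partial>lborel) = 0"
    by (rule integral_y_derivative_eq_0[where V = "\<lambda>z. if z \<in> S then V2 z else 0" and K = K];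
        (rule continuous_on_extend_zero[OF c2 S K] has_line_derivative_extend_zero[OF d2 S K] K)?;
        use z0 in auto)+
  have "(LINT z:S|lborel. a z * (bxx z + byy z) - b z * (axx z + ayy z))
     = (\<integral>z. (if z \<in> S then g1 z else 0) + (if z \<in> S then g2 z else 0) \<partial>lborel)"
    unfolding set_lebesgue_integral_def
    by (intro Bochner_Integration.integral_cong) (auto simp: g1_def g2_def algebra_simps)
  also have "\<dots> = 0" using I1 I2 by simp
  finally show ?thesis .
qed

section \<open>Uniqueness of the measure \<open>dd\<^sup>c v\<close>\<close>

text \<open>The factor \<open>t\<^sup>-\<^sup>k\<close> makes the family closed under differentiation, up to linear combinations.\<close>

definition flat :: "nat \<Rightarrow> real \<Rightarrow> real \<Rightarrow> real" where
  "flat k c t = (if t > 0 then exp (- (c / t)) / t ^ k else 0)"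

text \<open>The square makes the difference quotient at 0 tend to 0. It comes from the term of order
  \<open>k + 2\<close> in the series of \<open>exp (c / t)\<close>: two powers of \<open>t\<close>
  remain after division by \<open>t ^ k\<close>.\<close>

lemma flat_le_square:
  assumes "c > 0"
  obtains C where "C > 0" "\<And>t. \<bar>flat k c t\<bar> \<le> C * t\<^sup>2"
proof
  let ?C = "fact (k + 2) / c ^ (k + 2) :: real"
  show "?C > 0" using assms by simp
  fix t :: real
  show "\<bar>flat k c t\<bar> \<le> ?C * t\<^sup>2"
  proof (cases "t > 0")
    case True
    have "(c / t) ^ (k + 2) / fact (k + 2) \<le> exp (c / t)"
    proof -
      have "(\<Sum>n\<in>{k + 2}. (c / t) ^ n /\<^sub>R fact n) \<le> exp (c / t)"
        unfolding exp_def using assms True by (intro sum_le_suminf summable_exp_generic) auto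
      then show ?thesis by (simp add: divide_inverse mult.commute)
    qed
    then have "exp (- (c / t)) \<le> fact (k + 2) / (c / t) ^ (k + 2)"
      using assms True by (simp add: exp_minus field_simps del: power_Suc fact_Suc)
    also have "\<dots> = ?C * t\<^sup>2 * t ^ k"
      using assms True by (simp add: field_simps power2_eq_square del: fact_Suc)
    finally show ?thesis
      using True by (simp add: flat_def divide_le_eq del: fact_Suc)
  qed (use assms in \<open>auto simp: flat_def intro!: divide_nonneg_pos mult_nonneg_nonneg\<close>)
qed

lemma flat_has_derivative:
  assumes c: "c > 0"
  shows "(flat k c has_real_derivative c * flat (k + 2) c t - k * flat (k + 1) c t) (at t)"
proof (cases "t = 0")
  case True
  obtain C where C: "C > 0" "\<And>t. \<bar>flat k c t\<bar> \<le> C * t\<^sup>2" using flat_le_square[OF c] by blast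
  have "((\<lambda>h. (flat k c (0 + h) - flat k c 0) / h) \<longlongrightarrow> 0) (at 0)"
  proof (rule Lim_null_comparison)
    show "\<forall>\<^sub>F h in at 0. norm ((flat k c (0 + h) - flat k c 0) / h) \<le> C * \<bar>h\<bar>"
    proof (rule always_eventually, rule allI)
      fix h :: real
      show "norm ((flat k c (0 + h) - flat k c 0) / h) \<le> C * \<bar>h\<bar>"
        using C(2)[of h] C(1)
        by (cases "h = 0") (simp_all add: flat_def[of _ _ 0] divide_le_eq power2_eq_square abs_mult ac_simps)
    qed
    show "((\<lambda>h. C * \<bar>h\<bar>) \<longlongrightarrow> 0) (at 0)" by (auto intro!: tendsto_eq_intros)
  qed
  then show ?thesis using True by (simp add: DERIV_def flat_def)
next
  case False
  show ?thesis
  proof (cases "t > 0")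
    case t: True
    have "((\<lambda>t. exp (- (c / t)) / t ^ k) has_real_derivative
        (exp (- (c / t)) * (c / (t * t)) * t ^ k - exp (- (c / t)) * (k * t ^ (k - 1))) / (t ^ k * t ^ k)) (at t)"
      using t by (auto intro!: derivative_eq_intros)
    also have "(exp (- (c / t)) * (c / (t * t)) * t ^ k - exp (- (c / t)) * (k * t ^ (k - 1))) / (t ^ k * t ^ k)
       = c * flat (k + 2) c t - k * flat (k + 1) c t"
      using t by (cases k) (simp_all add: flat_def field_simps)
    finally show ?thesis
      by (rule has_field_derivative_transform_within_open[where S = "{0<..}"])
         (use t in \<open>auto simp: flat_def\<close>)
  next
    case t: False
    have "((\<lambda>t. 0) has_real_derivative 0) (at t)" by simp
    then have "(flat k c has_real_derivative 0) (at t)"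
      by (rule has_field_derivative_transform_within_open[where S = "{..<0}"])
         (use t False in \<open>auto simp: flat_def\<close>)
    then show ?thesis using t False by (simp add: flat_def)
  qed
qed

text \<open>A class of functions closed under partial derivatives that contains enough cut-off functions;
  its elements are smooth by induction alone.\<close>

inductive smooth_fun :: "(complex \<Rightarrow> real) \<Rightarrow> bool" where
  const: "smooth_fun (\<lambda>z. c)"
| Re: "smooth_fun Re"
| Im: "smooth_fun Im"
| add: "smooth_fun f \<Longrightarrow> smooth_fun g \<Longrightarrow> smooth_fun (\<lambda>z. f z + g z)"
| mult: "smooth_fun f \<Longrightarrow> smooth_fun g \<Longrightarrow> smooth_fun (\<lambda>z. f z * g z)"
| flat: "smooth_fun f \<Longrightarrow> c > 0 \<Longrightarrow> smooth_fun (\<lambda>z. flat k c (f z))"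

lemma smooth_fun_cmult: "smooth_fun f \<Longrightarrow> smooth_fun (\<lambda>z. c * f z)"
  using smooth_fun.mult[OF smooth_fun.const[of c]] .

lemma smooth_fun_diff: "smooth_fun f \<Longrightarrow> smooth_fun g \<Longrightarrow> smooth_fun (\<lambda>z. f z - g z)"
  using smooth_fun.add[OF _ smooth_fun_cmult[of g "-1"]] by simp

lemma smooth_fun_has_derivative:
  assumes "smooth_fun f"
  shows "\<exists>fx fy. smooth_fun fx \<and> smooth_fun fy \<and>
    (\<forall>z. (f has_derivative (\<lambda>h. fx z * Re h + fy z * Im h)) (at z))"
  using assms
proof induction
  case (const c)
  show ?case by (rule exI[of _ "\<lambda>z. 0"], rule exI[of _ "\<lambda>z. 0"]) (auto intro: smooth_fun.const)
next
  case Re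
  show ?case by (rule exI[of _ "\<lambda>z. 1"], rule exI[of _ "\<lambda>z. 0"])
    (auto intro: smooth_fun.const bounded_linear_imp_has_derivative bounded_linear_Re)
next
  case Im
  show ?case by (rule exI[of _ "\<lambda>z. 0"], rule exI[of _ "\<lambda>z. 1"])
    (auto intro: smooth_fun.const bounded_linear_imp_has_derivative bounded_linear_Im)
next
  case (add f g)
  then obtain fx fy gx gy where *: "smooth_fun fx" "smooth_fun fy" "smooth_fun gx" "smooth_fun gy"
    "\<And>z. (f has_derivative (\<lambda>h. fx z * Re h + fy z * Im h)) (at z)"
    "\<And>z. (g has_derivative (\<lambda>h. gx z * Re h + gy z * Im h)) (at z)" by blast
  show ?case
    by (rule exI[of _ "\<lambda>z. fx z + gx z"], rule exI[of _ "\<lambda>z. fy z + gy z"])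
       (use * in \<open>auto intro!: smooth_fun.add derivative_eq_intros simp: algebra_simps\<close>)
next
  case (mult f g)
  then obtain fx fy gx gy where *: "smooth_fun fx" "smooth_fun fy" "smooth_fun gx" "smooth_fun gy"
    "\<And>z. (f has_derivative (\<lambda>h. fx z * Re h + fy z * Im h)) (at z)"
    "\<And>z. (g has_derivative (\<lambda>h. gx z * Re h + gy z * Im h)) (at z)" by blast
  show ?case
    by (rule exI[of _ "\<lambda>z. f z * gx z + fx z * g z"], rule exI[of _ "\<lambda>z. f z * gy z + fy z * g z"])
       (use * mult in \<open>auto intro!: smooth_fun.add smooth_fun.mult derivative_eq_intros simp: algebra_simps\<close>)
next
  case (flat f c k)
  then obtain fx fy where *: "smooth_fun fx" "smooth_fun fy"
    "\<And>z. (f has_derivative (\<lambda>h. fx z * Re h + fy z * Im h)) (at z)" by blast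
  let ?d = "\<lambda>z. c * flat (k + 2) c (f z) - real k * flat (k + 1) c (f z)"
  have d: "smooth_fun ?d"
    using flat by (intro smooth_fun_diff smooth_fun_cmult smooth_fun.flat) auto
  have "((\<lambda>z. flat k c (f z)) has_derivative (\<lambda>h. ?d z * fx z * Re h + ?d z * fy z * Im h)) (at z)" for z
  proof -
    have "((\<lambda>z. flat k c (f z)) has_derivative (\<lambda>h. ?d z * (fx z * Re h + fy z * Im h))) (at z)"
      by (rule has_derivative_compose[OF *(3)])
         (use flat_has_derivative[OF flat(2), of k "f z"] in \<open>simp add: has_field_derivative_def\<close>)
    then show ?thesis by (simp add: algebra_simps)
  qed
  then show ?case
    by (intro exI[of _ "\<lambda>z. ?d z * fx z"] exI[of _ "\<lambda>z. ?d z * fy z"])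
       (use * d in \<open>auto intro: smooth_fun.mult\<close>)
qed

lemma smooth_fun_pderiv_dir:
  assumes "smooth_fun f"
  shows "smooth_fun (pderiv_dir 1 f)" "smooth_fun (pderiv_dir \<i> f)" "\<forall>z. f differentiable (at z)"
proof -
  obtain fx fy where *: "smooth_fun fx" "smooth_fun fy"
    "\<And>z. (f has_derivative (\<lambda>h. fx z * Re h + fy z * Im h)) (at z)"
    using smooth_fun_has_derivative[OF assms] by blast
  have "frechet_derivative f (at z) = (\<lambda>h. fx z * Re h + fy z * Im h)" for z
    using frechet_derivative_at[OF *(3)[of z]] by simp
  then have "pderiv_dir 1 f = fx" "pderiv_dir \<i> f = fy"
    by (auto simp: pderiv_dir_def)
  then show "smooth_fun (pderiv_dir 1 f)" "smooth_fun (pderiv_dir \<i> f)" using * by auto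
  show "\<forall>z. f differentiable (at z)" using *(3) by (auto simp: differentiable_def)
qed

lemma smooth_fun_continuous_on: "smooth_fun f \<Longrightarrow> continuous_on S f"
  by (meson smooth_fun_pderiv_dir(3) continuous_at_imp_continuous_on differentiable_imp_continuous_within)

lemma smooth_fun_Ck: "smooth_fun f \<Longrightarrow> Ck_on k S f"
  by (induction k arbitrary: f) (auto simp: smooth_fun_pderiv_dir smooth_fun_continuous_on)

lemma smooth_fun_test_function:
  assumes "smooth_fun \<psi>" "compact K" "K \<subseteq> unit_disc" "\<And>z. z \<notin> K \<Longrightarrow> \<psi> z = 0"
  shows "test_function \<psi>"
  using assms smooth_fun_Ck unfolding test_function_def by blast

lemma flat_tendsto_indicator:
  "(\<lambda>n. flat 0 (1 / real (Suc n)) t) \<longlonglongrightarrow> indicator {0<..} t"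
proof (cases "t > 0")
  case True
  have "(\<lambda>n. exp (- (1 / real (Suc n) / t))) \<longlonglongrightarrow> exp (- (0 / t))"
    using lim_inverse_n'[THEN LIMSEQ_Suc] True by (intro tendsto_intros) (auto simp: divide_inverse)
  then show ?thesis using True by (simp add: flat_def)
qed (simp add: flat_def)

lemma flat_bounds: "0 \<le> flat 0 c t" "c > 0 \<Longrightarrow> flat 0 c t \<le> 1"
  by (auto simp: flat_def)

lemma flat_mono:
  assumes "0 < c" "c \<le> d" "s \<le> t"
  shows "flat 0 d s \<le> flat 0 c t"
proof (cases "s > 0")
  case True
  then have "c / t \<le> d / s" using assms by (intro frac_le) auto
  then show ?thesis using True assms by (simp add: flat_def)
qed (simp add: flat_def)

text \<open>Smooth minorants of the indicator of an open box that increase to it with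
  \<open>n\<close>; open boxes form an intersection-stable generator of the Borel sets.\<close>

definition box_bump :: "complex \<Rightarrow> complex \<Rightarrow> nat \<Rightarrow> complex \<Rightarrow> real" where
  "box_bump l u n z =
     (flat 0 (1 / real (Suc n)) (Re z - Re l) * flat 0 (1 / real (Suc n)) (Re u - Re z)) *
     (flat 0 (1 / real (Suc n)) (Im z - Im l) * flat 0 (1 / real (Suc n)) (Im u - Im z))"

lemma smooth_fun_box_bump: "smooth_fun (box_bump l u n)"
  unfolding box_bump_def[abs_def]
  by (intro smooth_fun.intros smooth_fun_diff) auto

lemma box_bump_bounds: "0 \<le> box_bump l u n z" "box_bump l u n z \<le> 1"
  unfolding box_bump_def by (auto intro!: mult_nonneg_nonneg mult_le_one flat_bounds)

lemma box_bump_mono: "m \<le> n \<Longrightarrow> box_bump l u m z \<le> box_bump l u n z"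
  unfolding box_bump_def
  by (intro mult_mono flat_mono mult_nonneg_nonneg flat_bounds) (auto simp: frac_le)

lemma box_bump_tendsto: "(\<lambda>n. box_bump l u n z) \<longlonglongrightarrow> indicator (box l u) z"
proof -
  have "(\<lambda>n. box_bump l u n z) \<longlonglongrightarrow>
     (indicator {0<..} (Re z - Re l) * indicator {0<..} (Re u - Re z)) *
     (indicator {0<..} (Im z - Im l) * indicator {0<..} (Im u - Im z))"
    unfolding box_bump_def by (intro tendsto_mult flat_tendsto_indicator)
  moreover have "(indicator {0<..} (Re z - Re l) * indicator {0<..} (Re u - Re z)) *
     (indicator {0<..} (Im z - Im l) * indicator {0<..} (Im u - Im z)) = (indicator (box l u) z :: real)"
    by (auto simp: indicator_def in_box_complex_iff)
  ultimately show ?thesis by simp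
qed

text \<open>Increases with \<open>n\<close> to the indicator of the disc. Its support lies in a
  smaller closed disc, so its product with a box bump is a test function; the squared modulus is
  written in coordinates to fall under \<open>smooth_fun\<close>.\<close>

definition disc_bump :: "nat \<Rightarrow> complex \<Rightarrow> real" where
  "disc_bump n z = flat 0 (1 / real (Suc n)) ((1 - 1 / real (Suc n))\<^sup>2 - (Re z * Re z + Im z * Im z))"

lemma smooth_fun_disc_bump: "smooth_fun (disc_bump n)"
  unfolding disc_bump_def[abs_def]
  by (intro smooth_fun.intros smooth_fun_diff) auto

lemma disc_bump_eq_0: "z \<notin> cball 0 (1 - 1 / real (Suc n)) \<Longrightarrow> disc_bump n z = 0"
proof -
  assume "z \<notin> cball 0 (1 - 1 / real (Suc n))"
  then have "1 - 1 / real (Suc n) < cmod z" by simp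
  then have "(1 - 1 / real (Suc n))\<^sup>2 < (cmod z)\<^sup>2" by (intro power_strict_mono) auto
  then have "(1 - 1 / real (Suc n))\<^sup>2 - (Re z * Re z + Im z * Im z) < 0"
    by (simp only: cmod_power2) (simp add: power2_eq_square)
  then show ?thesis by (simp add: disc_bump_def flat_def)
qed

lemma disc_bump_bounds: "0 \<le> disc_bump n z" "disc_bump n z \<le> 1"
  unfolding disc_bump_def by (auto intro!: flat_bounds)

lemma disc_bump_mono: "m \<le> n \<Longrightarrow> disc_bump m z \<le> disc_bump n z"
  unfolding disc_bump_def
  by (intro flat_mono diff_mono power_mono) (auto simp: frac_le)

lemma disc_bump_tendsto: "(\<lambda>n. disc_bump n z) \<longlonglongrightarrow> indicator unit_disc z"
proof (cases "z \<in> unit_disc")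
  case False
  have "disc_bump n z = 0" for n
  proof (rule disc_bump_eq_0)
    have "1 - 1 / real (Suc n) < 1" by (simp del: of_nat_Suc)
    moreover have "1 \<le> cmod z" using False by simp
    ultimately have "1 - 1 / real (Suc n) < cmod z" by linarith
    then show "z \<notin> cball 0 (1 - 1 / real (Suc n))" by (simp del: of_nat_Suc)
  qed
  then show ?thesis using False by simp
next
  case True
  define a where "a = (\<lambda>n. (1 - 1 / real (Suc n))\<^sup>2 - (cmod z)\<^sup>2)"
  have cm: "(cmod z)\<^sup>2 = Re z * Re z + Im z * Im z"
    by (subst cmod_power2) (simp only: power2_eq_square)
  have a: "a \<longlonglongrightarrow> (1 - 0)\<^sup>2 - (cmod z)\<^sup>2"
    unfolding a_def using lim_inverse_n'[THEN LIMSEQ_Suc]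
    by (intro tendsto_intros) (auto simp: divide_inverse)
  have pos: "(1 - 0)\<^sup>2 - (cmod z)\<^sup>2 > 0"
    using True by (simp add: power_less_one_iff abs_square_less_1)
  have "(\<lambda>n. exp (- (1 / real (Suc n) / a n))) \<longlonglongrightarrow> exp (- (0 / ((1 - 0)\<^sup>2 - (cmod z)\<^sup>2)))"
    using lim_inverse_n'[THEN LIMSEQ_Suc] pos
    by (intro tendsto_intros a) (auto simp: divide_inverse)
  moreover have "eventually (\<lambda>n. exp (- (1 / real (Suc n) / a n)) = disc_bump n z) sequentially"
  proof (rule eventually_mono[OF order_tendstoD(1)[OF a pos]])
    fix n assume "a n > 0"
    moreover have "disc_bump n z = flat 0 (1 / real (Suc n)) (a n)"
      by (simp only: disc_bump_def a_def cm)
    ultimately show "exp (- (1 / real (Suc n) / a n)) = disc_bump n z"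
      by (simp only: flat_def if_True power_0 div_by_1)
  qed
  ultimately have "(\<lambda>n. disc_bump n z) \<longlonglongrightarrow> exp (- (0 / ((1 - 0)\<^sup>2 - (cmod z)\<^sup>2)))"
    by (rule Lim_transform_eventually)
  then show ?thesis using True by simp
qed

lemma test_function_continuous: "test_function \<psi> \<Longrightarrow> continuous_on UNIV \<psi>"
  unfolding test_function_def by (metis Ck_on.simps(1))

lemma is_ddc_integrable:
  fixes \<psi> :: "complex \<Rightarrow> real"
  assumes M: "is_ddc \<kappa> v M" and "continuous_on UNIV \<psi>" "compact K" "K \<subseteq> unit_disc" "\<And>z. z \<notin> K \<Longrightarrow> \<psi> z = 0"
  shows "integrable M \<psi>"
proof -
  obtain B where B: "\<And>z. z \<in> K \<Longrightarrow> norm (\<psi> z) \<le> B"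
    using compact_imp_bounded[OF compact_continuous_image[OF continuous_on_subset[OF assms(2)] assms(3)]]
    by (auto simp: bounded_iff)
  have s: "sets M = sets borel" using M by (simp add: is_ddc_def)
  have "K \<in> sets M" using s compact_imp_closed[OF assms(3)] by simp
  moreover have "\<psi> \<in> borel_measurable M"
    using borel_measurable_continuous_onI[OF assms(2)] s measurable_cong_sets by blast
  moreover have "emeasure M K < \<infinity>" using M assms by (auto simp: is_ddc_def)
  ultimately show ?thesis
    by (rule integrableI_bounded_set[where B = B]) (use assms B in auto)
qed

text \<open>Two such measures agree on products of disc and box bumps. Their total masses may be
  infinite, so a disc bump is kept as a density, which makes both measures finite; they then agree
  because they agree on boxes. Finally the disc bumps exhaust the disc, outside which neither
  measure has mass.\<close>

lemma is_ddc_unique: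
  assumes M: "is_ddc \<kappa> v M" and N: "is_ddc \<kappa> v N"
  shows "M = N"
proof -
  have sM [measurable_cong, simp]: "sets M = sets borel" and sN [measurable_cong, simp]: "sets N = sets borel"
    using M N by (auto simp: is_ddc_def)
  have spM: "space M = UNIV" and spN: "space N = UNIV"
    using sets_eq_imp_space_eq[OF sM] sets_eq_imp_space_eq[OF sN] by auto
  let ?K = "\<lambda>m. cball 0 (1 - 1 / real (Suc m)) :: complex set"
  let ?\<psi> = "\<lambda>l u m n z. disc_bump m z * box_bump l u n z"
  have K: "compact (?K m)" "?K m \<subseteq> unit_disc" for m
  proof -
    have "1 - 1 / real (Suc m) < 1" by (simp del: of_nat_Suc)
    then show "?K m \<subseteq> unit_disc" by (simp add: cball_subset_ball_iff del: of_nat_Suc)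
  qed simp
  have int_eq: "(\<integral>\<^sup>+z. ennreal (?\<psi> l u m n z) \<partial>M) = (\<integral>\<^sup>+z. ennreal (?\<psi> l u m n z) \<partial>N)" for l u m n
  proof -
    have sm: "smooth_fun (?\<psi> l u m n)"
      by (intro smooth_fun.mult smooth_fun_disc_bump smooth_fun_box_bump)
    have z: "?\<psi> l u m n z = 0" if "z \<notin> ?K m" for z using disc_bump_eq_0[OF that] by simp
    have t: "test_function (?\<psi> l u m n)" by (rule smooth_fun_test_function[OF sm K z])
    have nn: "?\<psi> l u m n z \<ge> 0" for z by (simp add: disc_bump_bounds box_bump_bounds)
    have i: "integrable M (?\<psi> l u m n)" "integrable N (?\<psi> l u m n)"
      using is_ddc_integrable[OF M smooth_fun_continuous_on[OF sm] K z]
        is_ddc_integrable[OF N smooth_fun_continuous_on[OF sm] K z] by auto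
    have "(\<integral>z. ?\<psi> l u m n z \<partial>M) = (\<integral>z. ?\<psi> l u m n z \<partial>N)"
      using M N t unfolding is_ddc_def by metis
    then show ?thesis using i nn by (subst (1 2) nn_integral_eq_integral) auto
  qed
  have [measurable]: "disc_bump m \<in> borel_measurable borel" "box_bump l u m \<in> borel_measurable borel" for l u m
    by (auto intro!: borel_measurable_continuous_onI smooth_fun_continuous_on smooth_fun_disc_bump smooth_fun_box_bump)
  have lim: "(\<lambda>n. \<integral>\<^sup>+z. ennreal (?\<psi> l u m n z) \<partial>L) \<longlonglongrightarrow> (\<integral>\<^sup>+z\<in>box l u. ennreal (disc_bump m z) \<partial>L)"
    if [measurable_cong]: "sets L = sets borel" for l u m L
  proof (rule nn_integral_LIMSEQ)
    show "incseq (\<lambda>n z. ennreal (?\<psi> l u m n z))"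
      by (auto simp: incseq_def le_fun_def intro!: ennreal_leI mult_left_mono box_bump_mono disc_bump_bounds)
    fix z
    have "(\<lambda>n. ?\<psi> l u m n z) \<longlonglongrightarrow> disc_bump m z * indicator (box l u) z"
      by (intro tendsto_intros box_bump_tendsto)
    from tendsto_ennrealI[OF this]
    show "(\<lambda>n. ennreal (?\<psi> l u m n z)) \<longlonglongrightarrow> ennreal (disc_bump m z) * indicator (box l u) z"
      by (auto simp: indicator_def)
  qed measurable
  have fin: "(\<integral>\<^sup>+z. ennreal (disc_bump m z) \<partial>L) < \<infinity>" if L: "is_ddc \<kappa> v L" for L m
  proof -
    have [measurable_cong, simp]: "sets L = sets borel" using L by (simp add: is_ddc_def)
    have "(\<integral>\<^sup>+z. ennreal (disc_bump m z) \<partial>L) \<le> (\<integral>\<^sup>+z. indicator (?K m) z \<partial>L)"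
      using disc_bump_eq_0[of _ m] disc_bump_bounds(2)[of m]
      by (intro nn_integral_mono) (auto simp: indicator_def ennreal_le_1 simp del: mem_cball)
    also have "\<dots> = emeasure L (?K m)" by (intro nn_integral_indicator) auto
    also have "\<dots> < \<infinity>" using L K[of m] unfolding is_ddc_def by blast
    finally show ?thesis .
  qed
  have dens: "density M (\<lambda>z. ennreal (disc_bump m z)) = density N (\<lambda>z. ennreal (disc_bump m z))" for m
  proof (rule measure_eqI_generator_eq[where E = "range (\<lambda>(a, b). box a b :: complex set)"
        and \<Omega> = UNIV and A = "\<lambda>n. box (- of_nat n * (1 + \<i>)) (of_nat n * (1 + \<i>))"])
    show "Int_stable (range (\<lambda>(a, b). box a b :: complex set))"
      by (auto simp: Int_stable_def box_Int_box)
    show "emeasure (density M (\<lambda>z. ennreal (disc_bump m z))) X = emeasure (density N (\<lambda>z. ennreal (disc_bump m z))) X"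
      if "X \<in> range (\<lambda>(a, b). box a b)" for X
    proof -
      from that obtain p where "X = (case p of (a, b) \<Rightarrow> box a b)" by (rule imageE)
      then obtain l u where X: "X = box l u" by (cases p) auto
      have "(\<integral>\<^sup>+z\<in>box l u. ennreal (disc_bump m z) \<partial>M) = (\<integral>\<^sup>+z\<in>box l u. ennreal (disc_bump m z) \<partial>N)"
        using lim[OF sM, where l = l and u = u and m = m] lim[OF sN, where l = l and u = u and m = m] unfolding int_eq by (rule LIMSEQ_unique)
      then show ?thesis unfolding X by (simp add: emeasure_density)
    qed
    show "sets (density M (\<lambda>z. ennreal (disc_bump m z))) = sigma_sets UNIV (range (\<lambda>(a, b). box a b))"
      "sets (density N (\<lambda>z. ennreal (disc_bump m z))) = sigma_sets UNIV (range (\<lambda>(a, b). box a b))"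
      by (simp_all add: borel_eq_box)
    show "(\<Union>i. box (- of_nat i * (1 + \<i>)) (of_nat i * (1 + \<i>))) = (UNIV :: complex set)"
    proof (intro equalityI subsetI UNIV_I)
      fix z :: complex
      obtain n where "real n > cmod z" using reals_Archimedean2 by blast
      then have "z \<in> box (- of_nat n * (1 + \<i>)) (of_nat n * (1 + \<i>))"
        using abs_Re_le_cmod[of z] abs_Im_le_cmod[of z] by (auto simp: in_box_complex_iff)
      then show "z \<in> (\<Union>i. box (- of_nat i * (1 + \<i>)) (of_nat i * (1 + \<i>)))" by blast
    qed
    show "emeasure (density M (\<lambda>z. ennreal (disc_bump m z))) (box (- of_nat i * (1 + \<i>)) (of_nat i * (1 + \<i>))) \<noteq> \<infinity>" for i
    proof -
      have "emeasure (density M (\<lambda>z. ennreal (disc_bump m z))) (box (- of_nat i * (1 + \<i>)) (of_nat i * (1 + \<i>)))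
         \<le> emeasure (density M (\<lambda>z. ennreal (disc_bump m z))) UNIV"
        by (intro emeasure_mono) auto
      also have "\<dots> < \<infinity>" using fin[OF M, of m] by (simp add: emeasure_density)
      finally show ?thesis by auto
    qed
  qed auto
  have em: "(\<lambda>m. emeasure (density L (\<lambda>z. ennreal (disc_bump m z))) A) \<longlonglongrightarrow> emeasure L A"
    if L: "is_ddc \<kappa> v L" and A: "A \<in> sets borel" for L A
  proof -
    have [measurable_cong, simp]: "sets L = sets borel" using L by (simp add: is_ddc_def)
    have "(\<lambda>m. \<integral>\<^sup>+z. ennreal (disc_bump m z) * indicator A z \<partial>L) \<longlonglongrightarrow> (\<integral>\<^sup>+z. indicator (unit_disc \<inter> A) z \<partial>L)"
    proof (rule nn_integral_LIMSEQ)
      show "incseq (\<lambda>m z. ennreal (disc_bump m z) * indicator A z)"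
        by (auto simp: incseq_def le_fun_def intro!: mult_right_mono ennreal_leI disc_bump_mono)
      show "(\<lambda>m. ennreal (disc_bump m z) * indicator A z) \<longlonglongrightarrow> indicator (unit_disc \<inter> A) z" for z
        using tendsto_ennrealI[OF disc_bump_tendsto[of z]]
        by (auto simp: indicator_def split: if_splits)
    qed (use A in measurable)
    then have "(\<lambda>m. emeasure (density L (\<lambda>z. ennreal (disc_bump m z))) A) \<longlonglongrightarrow> emeasure L (unit_disc \<inter> A)"
      using A by (simp add: emeasure_density)
    moreover have "emeasure L (unit_disc \<inter> A) = emeasure L A"
    proof -
      have "emeasure L A \<le> emeasure L (unit_disc \<inter> A) + emeasure L (- unit_disc)"
      proof -
        have "emeasure L A \<le> emeasure L ((unit_disc \<inter> A) \<union> (- unit_disc))"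
          using A by (intro emeasure_mono) auto
        also have "\<dots> \<le> emeasure L (unit_disc \<inter> A) + emeasure L (- unit_disc)"
          using A by (intro emeasure_subadditive) auto
        finally show ?thesis .
      qed
      moreover have "emeasure L (unit_disc \<inter> A) \<le> emeasure L A"
        using A by (intro emeasure_mono) auto
      ultimately show ?thesis using L by (auto simp: is_ddc_def)
    qed
    ultimately show ?thesis by simp
  qed
  show ?thesis
  proof (rule measure_eqI)
    fix A assume "A \<in> sets M"
    then have A: "A \<in> sets borel" by simp
    show "emeasure M A = emeasure N A"
      using em[OF M A] em[OF N A] unfolding dens by (rule LIMSEQ_unique)
  qed simp
qed

lemma ddc_eqI: "is_ddc \<kappa> v M \<Longrightarrow> ddc \<kappa> v = M"
  unfolding ddc_def by (rule the_equality) (auto intro: is_ddc_unique)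

section \<open>Maximum principle and Dirichlet problem\<close>

lemma has_line_derivative_shift:
  "has_line_derivative f v D (z + of_real t * v) \<longleftrightarrow>
     ((\<lambda>t. f (z + of_real t * v)) has_real_derivative D) (at t)"
  using DERIV_shift[of "\<lambda>s. f (z + of_real s * v)" D 0 t]
  by (simp add: has_line_derivative_def algebra_simps)

text \<open>The first derivative vanishes at the maximum. A positive second derivative would make it
  positive just to the right, and the function would rise above its maximum.\<close>

lemma second_line_derivative_at_max:
  assumes S: "open S" "z \<in> S"
    and d1: "\<And>w. w \<in> S \<Longrightarrow> has_line_derivative f v (g w) w"
    and d2: "has_line_derivative g v D z"
    and max: "\<And>w. w \<in> S \<Longrightarrow> f w \<le> f z"
  shows "D \<le> 0"
proof (rule ccontr)
  assume "\<not> D \<le> 0"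
  then have D: "D > 0" by simp
  have "continuous (at 0) (\<lambda>t::real. z + of_real t * v)" by (intro continuous_intros)
  then have "eventually (\<lambda>t. z + of_real t * v \<in> S) (nhds (0::real))"
    using S by (auto simp: continuous_at_open eventually_nhds)
  then obtain d where d: "d > 0" "\<And>t::real. \<bar>t\<bar> < d \<Longrightarrow> z + of_real t * v \<in> S"
    by (auto simp: eventually_nhds_metric dist_real_def)
  define F where "F = (\<lambda>t. f (z + of_real t * v))"
  define G where "G = (\<lambda>t. g (z + of_real t * v))"
  have F': "(F has_real_derivative G t) (at t)" if "\<bar>t\<bar> < d" for t
    using d1[OF d(2)[OF that]] unfolding has_line_derivative_shift F_def G_def .
  have G': "(G has_real_derivative D) (at 0)"
    using d2 unfolding has_line_derivative_def G_def .
  have "G 0 = 0"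
    by (rule DERIV_local_max[OF F' d(1)]) (use d max in \<open>auto simp: F_def\<close>)
  then obtain e where e: "e > 0" "\<And>h. 0 < h \<Longrightarrow> h < e \<Longrightarrow> 0 < G h"
    using DERIV_pos_inc_right[OF G' D] by auto
  define h where "h = min d e / 2"
  have h: "0 < h" "h < d" "h < e" using d e by (auto simp: h_def)
  have "F 0 < F h"
  proof (rule DERIV_pos_imp_increasing_open[OF h(1)])
    show "\<exists>y. (F has_real_derivative y) (at t) \<and> 0 < y" if "0 < t" "t < h" for t
      using F'[of t] e(2)[of t] that h by auto
    show "continuous_on {0..h} F"
      by (rule DERIV_continuous_on, rule has_field_derivative_at_within[OF F']) (use h in auto)
  qed
  moreover have "F h \<le> F 0" using max[OF d(2)[of h]] h by (simp add: F_def)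
  ultimately show False by simp
qed

lemma max_principle_strict:
  assumes c: "continuous_on (cball 0 1) w" and p: "pd2 unit_disc w wx wy wxx wyy"
    and pos: "\<And>z. z \<in> unit_disc \<Longrightarrow> wxx z + wyy z > 0"
    and bd: "\<And>z. z \<in> unit_circle \<Longrightarrow> w z \<le> B" and z: "z \<in> cball 0 1"
  shows "w z \<le> B"
proof -
  obtain z0 where z0: "z0 \<in> cball 0 1" "\<And>z. z \<in> cball 0 1 \<Longrightarrow> w z \<le> w z0"
    using continuous_attains_sup[OF compact_cball _ c] by auto
  have "z0 \<notin> unit_disc"
  proof
    assume D: "z0 \<in> unit_disc"
    have "wxx z0 \<le> 0"
      by (rule second_line_derivative_at_max[where S = unit_disc and v = 1 and f = w and g = wx])
         (use D p z0 in \<open>auto simp: pd2_def\<close>)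
    moreover have "wyy z0 \<le> 0"
      by (rule second_line_derivative_at_max[where S = unit_disc and v = \<i> and f = w and g = wy])
         (use D p z0 in \<open>auto simp: pd2_def\<close>)
    ultimately show False using pos[OF D] by linarith
  qed
  then have "z0 \<in> unit_circle" using z0 by auto
  then show ?thesis using bd z0(2)[OF z] by fastforce
qed

lemma pd2_add:
  assumes "pd2 S f fx fy fxx fyy" "pd2 S g gx gy gxx gyy"
  shows "pd2 S (\<lambda>z. f z + g z) (\<lambda>z. fx z + gx z) (\<lambda>z. fy z + gy z) (\<lambda>z. fxx z + gxx z) (\<lambda>z. fyy z + gyy z)"
  using assms unfolding pd2_def by (auto intro!: continuous_intros has_line_derivative_add)

lemma pd2_cmult:
  assumes "pd2 S f fx fy fxx fyy"
  shows "pd2 S (\<lambda>z. c * f z) (\<lambda>z. c * fx z) (\<lambda>z. c * fy z) (\<lambda>z. c * fxx z) (\<lambda>z. c * fyy z)"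
  using assms unfolding pd2_def by (auto intro!: continuous_intros has_line_derivative_cmult)

lemma pd2_diff:
  assumes "pd2 S f fx fy fxx fyy" "pd2 S g gx gy gxx gyy"
  shows "pd2 S (\<lambda>z. f z - g z) (\<lambda>z. fx z - gx z) (\<lambda>z. fy z - gy z) (\<lambda>z. fxx z - gxx z) (\<lambda>z. fyy z - gyy z)"
  using assms unfolding pd2_def by (auto intro!: continuous_intros has_line_derivative_diff)

lemma pd2_Re:
  assumes F: "\<And>z. z \<in> S \<Longrightarrow> (F has_field_derivative F' z) (at z)"
    and F': "\<And>z. z \<in> S \<Longrightarrow> (F' has_field_derivative F'' z) (at z)"
    and c: "continuous_on S F''"
  shows "pd2 S (\<lambda>z. Re (F z)) (\<lambda>z. Re (F' z)) (\<lambda>z. - Im (F' z)) (\<lambda>z. Re (F'' z)) (\<lambda>z. - Re (F'' z))"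
proof -
  have "continuous_on S F" "continuous_on S F'"
    by (rule DERIV_continuous_on[OF has_field_derivative_at_within[OF F]]
             DERIV_continuous_on[OF has_field_derivative_at_within[OF F']], assumption)+
  moreover have "has_line_derivative (\<lambda>z. - Im (F' z)) \<i> (- Re (F'' z)) z" if "z \<in> S" for z
    using has_line_derivative_field[of "\<lambda>z. \<i> * F' z" "\<i> * F'' z" z \<i>] DERIV_cmult[OF F'[OF that], of \<i>]
    by simp
  ultimately show ?thesis
    using c has_line_derivative_field[OF F, of _ 1] has_line_derivative_field[OF F, of _ \<i>]
      has_line_derivative_field[OF F', of _ 1]
    unfolding pd2_def by (auto intro!: continuous_intros)
qed

lemma pd2_norm_squared: "pd2 S (\<lambda>z. (cmod z)\<^sup>2) (\<lambda>z. 2 * Re z) (\<lambda>z. 2 * Im z) (\<lambda>z. 2) (\<lambda>z. 2)"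
proof -
  have e: "(cmod z)\<^sup>2 = Re z * Re z + Im z * Im z" for z
    by (subst cmod_power2) (simp only: power2_eq_square)
  have R: "has_line_derivative Re v (Re v) z" and I: "has_line_derivative Im v (Im v) z" for v z
    by (auto intro!: has_line_derivative_frechet bounded_linear_imp_has_derivative bounded_linear_Re bounded_linear_Im)
  show ?thesis
    unfolding pd2_def e
    using has_line_derivative_add[OF has_line_derivative_mult[OF R R] has_line_derivative_mult[OF I I], of 1]
      has_line_derivative_add[OF has_line_derivative_mult[OF R R] has_line_derivative_mult[OF I I], of \<i>]
      has_line_derivative_cmult[OF R, of 2 1] has_line_derivative_cmult[OF I, of 2 \<i>]
    by (auto intro!: continuous_intros)
qed

text \<open>Adding \<open>e * (cmod z)\<^sup>2\<close> makes the Laplacian strictly positive and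
  raises the bound on the circle by \<open>e\<close> only.\<close>

lemma max_principle:
  assumes c: "continuous_on (cball 0 1) w" and p: "pd2 unit_disc w wx wy wxx wyy"
    and pos: "\<And>z. z \<in> unit_disc \<Longrightarrow> wxx z + wyy z \<ge> 0"
    and bd: "\<And>z. z \<in> unit_circle \<Longrightarrow> w z \<le> B" and z: "z \<in> cball 0 1"
  shows "w z \<le> B"
proof (rule field_le_epsilon)
  fix e :: real assume e: "e > 0"
  have "w z + e * (cmod z)\<^sup>2 \<le> B + e"
  proof (rule max_principle_strict[OF _ pd2_add[OF p pd2_cmult[OF pd2_norm_squared]] _ _ z])
    show "continuous_on (cball 0 1) (\<lambda>z. w z + e * (cmod z)\<^sup>2)" using c by (intro continuous_intros)
    show "0 < wxx z + e * 2 + (wyy z + e * 2)" if "z \<in> unit_disc" for z using pos[OF that] e by simp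
    show "w z + e * (cmod z)\<^sup>2 \<le> B + e" if "z \<in> unit_circle" for z using bd[OF that] that by simp
  qed
  moreover have "0 \<le> e * (cmod z)\<^sup>2" using e by simp
  ultimately show "w z \<le> B + e" by linarith
qed

lemma pderiv_dir_line_derivative:
  assumes "f differentiable (at z)"
  shows "has_line_derivative f v (pderiv_dir v f z) z"
  unfolding pderiv_dir_def
  by (rule has_line_derivative_frechet) (use assms frechet_derivative_works in blast)

lemma Ck_on_2_pd2:
  assumes "Ck_on 2 S f"
  shows "pd2 S f (pderiv_dir 1 f) (pderiv_dir \<i> f)
     (pderiv_dir 1 (pderiv_dir 1 f)) (pderiv_dir \<i> (pderiv_dir \<i> f))"
proof -
  have *: "continuous_on S g" if "\<forall>z\<in>S. g differentiable (at z)" for g :: "complex \<Rightarrow> real"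
    using that by (meson continuous_at_imp_continuous_on differentiable_imp_continuous_within)
  show ?thesis
    using assms unfolding pd2_def by (auto simp: numeral_2_eq_2 intro: pderiv_dir_line_derivative *)
qed

section \<open>The Dirichlet problem solved by an explicit power series\<close>

lemma continuous_on_power_series:
  fixes c :: "nat \<Rightarrow> complex"
  assumes "summable (\<lambda>n. norm (c n))"
  shows "continuous_on (cball 0 1) (\<lambda>z. \<Sum>n. c n * z ^ n)"
proof (rule uniform_limit_theorem)
  show "uniform_limit (cball 0 1) (\<lambda>n z. \<Sum>i<n. c i * z ^ i) (\<lambda>z. \<Sum>n. c n * z ^ n) sequentially"
    by (rule Weierstrass_m_test[OF _ assms])
       (auto simp: norm_mult norm_power intro!: mult_left_le power_le_one)
qed (auto intro!: continuous_intros always_eventually)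

text \<open>Up to a constant factor, \<open>\<Sum> a\<^sub>n cos (n t)\<close> with these coefficients is the Fourier series of
  \<open>sin (t/2) powr (3/2)\<close>, i.e. of \<open>(1 - cos t) powr (3/4)\<close>.\<close>

fun dirichlet_coeff :: "nat \<Rightarrow> real" where
  "dirichlet_coeff 0 = 1"
| "dirichlet_coeff (Suc 0) = - 6 / 7"
| "dirichlet_coeff (Suc (Suc n)) = dirichlet_coeff (Suc n) * ((real n + 1 / 4) / (real n + 11 / 4))"

lemma dirichlet_coeff_neg: "dirichlet_coeff (Suc n) < 0"
proof (induction n)
  case (Suc n)
  have "(real n + 1 / 4) / (real n + 11 / 4) > 0" by (intro divide_pos_pos) auto
  then show ?case using Suc by (simp only: dirichlet_coeff.simps mult_neg_pos)
qed simp

text \<open>The exceptional summand at \<open>n = 0\<close> has its origin in the cosine series: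
  pairing the frequencies n and -n doubles every coefficient except the constant one.\<close>

lemma dirichlet_coeff_rec: "(real n + 7 / 4) * dirichlet_coeff (Suc n) = (real n - 3 / 4) * dirichlet_coeff n - (if n = 0 then 3 / 4 else 0)"
proof (cases n rule: dirichlet_coeff.cases)
  case (3 m)
  have "x * (c * (y / x)) = y * c" if "x > 0" for x y c :: real using that by simp
  from this[of "real m + 11 / 4" "dirichlet_coeff (Suc m)" "real m + 1 / 4"] show ?thesis
    by (simp add: 3 add.commute)
qed simp_all

text \<open>The terms decay like n to the power -3/2. The ratios tend to 1, so Raabe's test is used;
  its limit is 3/2.\<close>

lemma summable_dirichlet_coeff_diffs: "summable (\<lambda>n. (real n + 1) * \<bar>dirichlet_coeff (Suc n)\<bar>)"
proof (rule raabes_test_convergence)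
  let ?f = "\<lambda>n. (real n + 1) * \<bar>dirichlet_coeff (Suc n)\<bar>"
  have pos: "?f n > 0" for n using dirichlet_coeff_neg[of n] by (simp add: mult_pos_neg)
  then show "eventually (\<lambda>n. ?f n > 0) sequentially" by simp
  have "real n * (?f n / ?f (Suc n) - 1) = real n * ((real n + 1) * (real n + 11/4) / ((real n + 2) * (real n + 1/4)) - 1)" for n
  proof -
    have "?f n / ?f (Suc n) = (real n + 1) * (real n + 11/4) / ((real n + 2) * (real n + 1/4))"
    proof -
      have "a * c / (b * (c * (x / y))) = a * y / (b * x)" if "c > 0" "x > 0" "y > 0" "b > 0" for a b c x y :: real
        using that by (simp add: field_simps)
      moreover have "\<bar>dirichlet_coeff (Suc (Suc n))\<bar> = \<bar>dirichlet_coeff (Suc n)\<bar> * ((real n + 1/4) / (real n + 11/4))"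
        by (simp add: abs_mult del: times_divide_eq_right)
      moreover have "real (Suc n) + 1 = real n + 2" by simp
      ultimately show ?thesis using dirichlet_coeff_neg[of n] by (simp only:)
    qed
    then show ?thesis by simp
  qed
  moreover have "(\<lambda>n. real n * ((real n + 1) * (real n + 11/4) / ((real n + 2) * (real n + 1/4)) - 1)) \<longlonglongrightarrow> 3 / 2"
    by real_asymp
  ultimately have "(\<lambda>n. real n * (?f n / ?f (Suc n) - 1)) \<longlonglongrightarrow> 3 / 2" by (simp only:)
  then have "(\<lambda>n. ereal (real n * (?f n / ?f (Suc n) - 1))) \<longlonglongrightarrow> ereal (3 / 2)" by simp
  then have "liminf (\<lambda>n. ereal (real n * (?f n / ?f (Suc n) - 1))) = ereal (3 / 2)"
    by (intro lim_imp_Liminf) auto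
  then show "1 < liminf (\<lambda>n. ereal (real n * (?f n / ?f (Suc n) - 1)))" by simp
qed

lemma summable_abs_dirichlet_coeff: "summable (\<lambda>n. \<bar>dirichlet_coeff n\<bar>)"
proof -
  have "summable (\<lambda>n. \<bar>dirichlet_coeff (Suc n)\<bar>)"
    by (rule summable_comparison_test'[OF summable_dirichlet_coeff_diffs, of 0]) (simp add: mult_le_cancel_right1)
  then show ?thesis using summable_Suc_iff by blast
qed

definition dirichlet_series :: "complex \<Rightarrow> complex" where "dirichlet_series z = (\<Sum>n. of_real (dirichlet_coeff n) * z ^ n)"
definition dirichlet_series' :: "complex \<Rightarrow> complex" where "dirichlet_series' z = (\<Sum>n. diffs (\<lambda>n. of_real (dirichlet_coeff n)) n * z ^ n)"

lemma continuous_on_dirichlet_series: "continuous_on (cball 0 1) dirichlet_series"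
  unfolding dirichlet_series_def[abs_def] using summable_abs_dirichlet_coeff by (intro continuous_on_power_series) simp

lemma summable_norm_diffs_dirichlet_coeff: "summable (\<lambda>n. norm (diffs (\<lambda>n. of_real (dirichlet_coeff n)) n :: complex))"
proof -
  have "norm (diffs (\<lambda>n. of_real (dirichlet_coeff n)) n :: complex) = (real n + 1) * \<bar>dirichlet_coeff (Suc n)\<bar>" for n
  proof -
    have "diffs (\<lambda>n. of_real (dirichlet_coeff n)) n = (of_real ((real n + 1) * dirichlet_coeff (Suc n)) :: complex)"
      by (simp add: diffs_def add.commute)
    then show ?thesis by (simp only: norm_of_real abs_mult)
  qed
  then show ?thesis using summable_dirichlet_coeff_diffs by simp
qed

lemma continuous_on_dirichlet_series': "continuous_on (cball 0 1) dirichlet_series'"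
  unfolding dirichlet_series'_def[abs_def] using summable_norm_diffs_dirichlet_coeff by (rule continuous_on_power_series)

lemma dirichlet_series_has_field_derivative: "z \<in> unit_disc \<Longrightarrow> (dirichlet_series has_field_derivative dirichlet_series' z) (at z)"
  unfolding dirichlet_series_def[abs_def] dirichlet_series'_def
  by (rule termdiffs_strong[where K = 1])
     (use summable_abs_dirichlet_coeff in \<open>auto intro!: summable_rabs_cancel\<close>)

lemma dirichlet_series_sums: "z \<in> cball 0 1 \<Longrightarrow> (\<lambda>n. of_real (dirichlet_coeff n) * z ^ n) sums dirichlet_series z"
  unfolding dirichlet_series_def
  by (rule summable_sums, rule summable_norm_cancel, rule summable_comparison_test'[OF summable_abs_dirichlet_coeff, of 0])
     (auto simp: norm_mult norm_power intro!: mult_left_le power_le_one)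

lemma dirichlet_series'_sums: "z \<in> cball 0 1 \<Longrightarrow> (\<lambda>n. of_nat (Suc n) * of_real (dirichlet_coeff (Suc n)) * z ^ n) sums dirichlet_series' z"
proof -
  assume z: "z \<in> cball 0 1"
  have "summable (\<lambda>n. diffs (\<lambda>n. of_real (dirichlet_coeff n)) n * z ^ n)"
    by (rule summable_norm_cancel, rule summable_comparison_test'[OF summable_norm_diffs_dirichlet_coeff, of 0])
       (use z in \<open>auto simp: norm_mult norm_power intro!: mult_left_le power_le_one\<close>)
  then show ?thesis unfolding dirichlet_series'_def by (simp add: summable_sums diffs_def)
qed

text \<open>The two-term recursion of the coefficients, read as a differential equation for their
  generating function. It reaches the circle because both series converge absolutely there.\<close>

lemma dirichlet_series_identity:
  assumes z: "z \<in> cball 0 1"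
  shows "(1 - z) * (z * dirichlet_series' z) + 3 / 4 * (1 + z) * dirichlet_series z = 3 / 4 * (1 - z)"
proof -
  let ?c = "\<lambda>n. of_real (dirichlet_coeff n) :: complex"
  have F: "(\<lambda>n. ?c n * z ^ n) sums dirichlet_series z" by (rule dirichlet_series_sums[OF z])
  have T1: "(\<lambda>n. of_nat (Suc n) * ?c (Suc n) * z ^ Suc n) sums (z * dirichlet_series' z)"
    using sums_mult[OF dirichlet_series'_sums[OF z], of z] by (simp add: algebra_simps)
  have T: "(\<lambda>n. of_nat n * ?c n * z ^ n) sums (z * dirichlet_series' z)"
    using T1 by (subst (asm) sums_Suc_iff) simp
  have F1: "(\<lambda>n. ?c (Suc n) * z ^ Suc n) sums (dirichlet_series z - 1)"
    using F by (subst sums_Suc_iff) simp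
  have L: "(\<lambda>n. of_nat (Suc n) * ?c (Suc n) * z ^ Suc n + 3 / 4 * (?c (Suc n) * z ^ Suc n)) sums
     (z * dirichlet_series' z + 3 / 4 * (dirichlet_series z - 1))"
    by (intro sums_add T1 sums_mult F1)
  have R: "(\<lambda>n. z * (of_nat n * ?c n * z ^ n - 3 / 4 * (?c n * z ^ n)) - (if n = 0 then 3 / 4 * z else 0)) sums
     (z * (z * dirichlet_series' z - 3 / 4 * dirichlet_series z) - 3 / 4 * z)"
    by (intro sums_diff sums_mult T F) (use sums_single[of 0 "\<lambda>n. 3 / 4 * z"] in simp)
  have "of_nat (Suc n) * ?c (Suc n) * z ^ Suc n + 3 / 4 * (?c (Suc n) * z ^ Suc n)
     = z * (of_nat n * ?c n * z ^ n - 3 / 4 * (?c n * z ^ n)) - (if n = 0 then 3 / 4 * z else 0)" for n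
  proof -
    have "(of_real ((real n + 7 / 4) * dirichlet_coeff (Suc n)) :: complex)
        = of_real ((real n - 3 / 4) * dirichlet_coeff n - (if n = 0 then 3 / 4 else 0))"
      by (simp only: dirichlet_coeff_rec)
    then have "(of_nat n + 7 / 4) * ?c (Suc n) = (of_nat n - 3 / 4) * ?c n - (if n = 0 then 3 / 4 else 0)"
      by (simp split: if_splits)
    then have "(of_nat n + 7 / 4) * ?c (Suc n) * z ^ Suc n =
      ((of_nat n - 3 / 4) * ?c n - (if n = 0 then 3 / 4 else 0)) * z ^ Suc n" by simp
    then show ?thesis by (auto simp: algebra_simps)
  qed
  then have "z * dirichlet_series' z + 3 / 4 * (dirichlet_series z - 1) = z * (z * dirichlet_series' z - 3 / 4 * dirichlet_series z) - 3 / 4 * z"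
    using L R by (simp only: sums_unique2[OF L])
  moreover have "(1 - z) * X + k * (1 + z) * Y = k * (1 - z)"
    if "X + k * (Y - 1) = z * (X - k * Y) - k * z" for k X Y :: complex
    using that by (simp add: algebra_simps)
  ultimately show ?thesis by blast
qed

text \<open>Complex differentiation inside the disc does not give the derivative along the circle;
  differentiating the cosine series term by term does, since the differentiated series converges
  uniformly.\<close>

lemma dirichlet_series_boundary_derivative:
  "((\<lambda>t. Re (dirichlet_series (cis t))) has_real_derivative - Im (cis t * dirichlet_series' (cis t))) (at t)"
proof -
  have Re_sums: "(\<lambda>n. dirichlet_coeff n * cos (real n * t)) sums Re (dirichlet_series (cis t))" for t
    using sums_Re[OF dirichlet_series_sums[of "cis t"]] by (simp add: cos_n_Re_cis_pow_n)
  have Im_sums: "(\<lambda>n. - (real n * dirichlet_coeff n * sin (real n * t))) sums (- Im (cis t * dirichlet_series' (cis t)))" for t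
  proof -
    have "(\<lambda>n. of_nat (Suc n) * of_real (dirichlet_coeff (Suc n)) * cis t ^ Suc n) sums (cis t * dirichlet_series' (cis t))"
      using sums_mult[OF dirichlet_series'_sums[of "cis t"], of "cis t"] by (simp add: algebra_simps)
    then have "(\<lambda>n. of_nat n * of_real (dirichlet_coeff n) * cis t ^ n) sums (cis t * dirichlet_series' (cis t))"
      by (subst (asm) sums_Suc_iff) simp
    from sums_minus[OF sums_Im[OF this]] show ?thesis by (simp add: sin_n_Im_cis_pow_n mult.assoc)
  qed
  have ul: "uniform_limit UNIV (\<lambda>n t. \<Sum>i<n. - (real i * dirichlet_coeff i * sin (real i * t)))
     (\<lambda>t. \<Sum>i. - (real i * dirichlet_coeff i * sin (real i * t))) sequentially"
  proof (rule Weierstrass_m_test)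
    have "summable (\<lambda>n. real (Suc n) * \<bar>dirichlet_coeff (Suc n)\<bar>)" using summable_dirichlet_coeff_diffs by (simp add: add.commute)
    then show "summable (\<lambda>n. real n * \<bar>dirichlet_coeff n\<bar>)" by (rule summable_Suc_iff[THEN iffD1])
    show "norm (- (real n * dirichlet_coeff n * sin (real n * x))) \<le> real n * \<bar>dirichlet_coeff n\<bar>" for n x
      by (auto simp: abs_mult intro!: mult_left_le)
  qed
  have "\<exists>g. \<forall>t\<in>UNIV. (\<lambda>n. dirichlet_coeff n * cos (real n * t)) sums g t \<and>
     (g has_field_derivative (\<Sum>i. - (real i * dirichlet_coeff i * sin (real i * t)))) (at t within UNIV)"
    by (rule has_field_derivative_series[OF _ _ ul, of _ 0])
       (use summable_abs_dirichlet_coeff in \<open>auto intro!: derivative_eq_intros summable_norm_cancel[of dirichlet_coeff]\<close>)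
  then obtain g where g: "\<And>t. (\<lambda>n. dirichlet_coeff n * cos (real n * t)) sums g t"
     "\<And>t. (g has_field_derivative (\<Sum>i. - (real i * dirichlet_coeff i * sin (real i * t)))) (at t)" by auto
  have "g = (\<lambda>t. Re (dirichlet_series (cis t)))"
    using sums_unique2[OF g(1) Re_sums] by auto
  then show ?thesis using g(2)[of t] sums_unique[OF Im_sums[of t]] by simp
qed

lemma dirichlet_series_1: "dirichlet_series 1 = 0"
  using dirichlet_series_identity[of 1] by simp

text \<open>The series vanishes at 1, so its value at -1 is the difference of the two values, in
  which only odd indices survive, each with a positive contribution. The value later serves as a
  divisor in the normalisation.\<close>

lemma Re_dirichlet_series_minus1: "Re (dirichlet_series (- 1)) > 0"
proof -
  have s: "(\<lambda>n. of_real (dirichlet_coeff n) * ((- 1) ^ n - 1 ^ n)) sums (dirichlet_series (- 1) - dirichlet_series 1)"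
    using sums_diff[OF dirichlet_series_sums[of "- 1"] dirichlet_series_sums[of 1]] by (simp add: algebra_simps)
  then have s: "(\<lambda>n. dirichlet_coeff n * ((- 1) ^ n - 1)) sums Re (dirichlet_series (- 1))"
    using sums_Re[OF s] by (simp add: dirichlet_series_1)
  have "(\<Sum>n\<in>{1}. dirichlet_coeff n * ((- 1) ^ n - 1)) \<le> Re (dirichlet_series (- 1))"
    unfolding sums_unique[OF s]
  proof (intro sum_le_suminf sums_summable[OF s])
    fix n :: nat
    show "0 \<le> dirichlet_coeff n * ((- 1) ^ n - 1)"
      by (cases n; cases "even n") (use dirichlet_coeff_neg in \<open>auto simp: less_imp_le mult_nonpos_nonpos\<close>)
  qed auto
  then show ?thesis by simp
qed

text \<open>On the circle the real part of the identity for \<open>(1 - z) z F' + (3/4) (1 + z) F\<close> becomes the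
  differential equation \<open>S' = (3/4) cot (t/2) S\<close>.\<close>

lemma dirichlet_series_boundary_value:
  assumes t: "t \<in> {0<..<2 * pi}"
  shows "Re (dirichlet_series (cis t)) = Re (dirichlet_series (- 1)) * sin (t / 2) powr (3 / 2)"
proof -
  define S where "S = (\<lambda>t. Re (dirichlet_series (cis t)))"
  define S' where "S' = (\<lambda>t. - Im (cis t * dirichlet_series' (cis t)))"
  have dS: "(S has_real_derivative S' t) (at t)" for t
    unfolding S_def S'_def by (rule dirichlet_series_boundary_derivative)
  have ode: "2 * sin (t / 2) * S' t = 3 / 2 * cos (t / 2) * S t" for t
  proof -
    define e where "e = cis (t / 2)"
    have e: "cis t = e * e" "e \<noteq> 0" "cnj e * e = 1" by (simp_all add: e_def cis_mult cis_cnj)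
    \<comment> \<open>Multiplying by the conjugate of the half-angle factor turns
      \<open>1 - cis t\<close> into a purely imaginary number and \<open>1 + cis t\<close> into a
      real one, so that the right-hand side disappears on taking real parts.\<close>
    have h: "cnj e * ((1 - cis t) * (cis t * dirichlet_series' (cis t)) + 3 / 4 * (1 + cis t) * dirichlet_series (cis t)) = cnj e * (3 / 4 * (1 - cis t))"
      by (subst dirichlet_series_identity) auto
    have "cnj e * (1 - cis t) = cnj e - (cnj e * e) * e" "cnj e * (1 + cis t) = cnj e + (cnj e * e) * e"
      by (simp_all add: e(1) algebra_simps)
    then have a: "cnj e * (1 - cis t) = cnj e - e" "cnj e * (1 + cis t) = cnj e + e"
      by (simp_all only: e(3) mult_1)
    have "(cnj e - e) * (cis t * dirichlet_series' (cis t)) + 3 / 4 * (cnj e + e) * dirichlet_series (cis t)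
      = cnj e * ((1 - cis t) * (cis t * dirichlet_series' (cis t)) + 3 / 4 * (1 + cis t) * dirichlet_series (cis t))"
      unfolding a[symmetric] by (simp add: algebra_simps)
    also have "\<dots> = 3 / 4 * (cnj e - e)" unfolding h a[symmetric] by (simp add: algebra_simps)
    finally have "(cnj e - e) * (cis t * dirichlet_series' (cis t)) + 3 / 4 * (cnj e + e) * dirichlet_series (cis t) = 3 / 4 * (cnj e - e)" .
    moreover have "cnj e - e = - (2 * \<i> * of_real (sin (t / 2)))" "cnj e + e = of_real (2 * cos (t / 2))"
      by (auto simp: e_def complex_eq_iff)
    ultimately have "- (2 * \<i> * of_real (sin (t / 2))) * (cis t * dirichlet_series' (cis t)) + 3 / 4 * of_real (2 * cos (t / 2)) * dirichlet_series (cis t)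
       = 3 / 4 * - (2 * \<i> * of_real (sin (t / 2)))" by (simp only:)
    moreover have "Re (- (2 * \<i> * of_real s) * X + 3 / 4 * of_real (2 * c) * Y) = 2 * s * Im X + 3 / 2 * c * Re Y"
      "Re (3 / 4 * - (2 * \<i> * of_real s)) = 0" for s c X Y by simp_all
    ultimately have "2 * sin (t / 2) * Im (cis t * dirichlet_series' (cis t)) + 3 / 2 * cos (t / 2) * Re (dirichlet_series (cis t)) = 0" by metis
    then show ?thesis unfolding S_def S'_def by linarith
  qed
  have sp: "sin (t / 2) > 0" if "t \<in> {0<..<2 * pi}" for t using that by (intro sin_gt_zero) auto
  \<comment> \<open>Quotient by the known solution \<open>sin (t / 2) powr (3 / 2)\<close> of the
    same linear equation: it is constant.\<close>
  have "((\<lambda>t. S t * sin (t / 2) powr (- 3 / 2)) has_real_derivative 0) (at t within {0<..<2 * pi})"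
    if "t \<in> {0<..<2 * pi}" for t
  proof -
    have "((\<lambda>t. S t * sin (t / 2) powr (- 3 / 2)) has_real_derivative
      S' t * sin (t / 2) powr (- 3 / 2) + (- 3 / 2) * sin (t / 2) powr (- 3 / 2 - 1) * (cos (t / 2) * (1 / 2)) * S t) (at t)"
      using sp[OF that] by (auto intro!: derivative_eq_intros dS)
    also have "S' t * sin (t / 2) powr (- 3 / 2) + (- 3 / 2) * sin (t / 2) powr (- 3 / 2 - 1) * (cos (t / 2) * (1 / 2)) * S t
      = sin (t / 2) powr (- 3 / 2 - 1) / 2 * (2 * sin (t / 2) * S' t - 3 / 2 * cos (t / 2) * S t)"
    proof -
      have "sin (t / 2) powr (- 3 / 2) = sin (t / 2) powr (- 3 / 2 - 1) * sin (t / 2) powr 1"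
        by (subst powr_add[symmetric]) simp
      then have "sin (t / 2) powr (- 3 / 2) = sin (t / 2) powr (- 3 / 2 - 1) * sin (t / 2)"
        using sp[OF that] by simp
      then show ?thesis by (simp only: algebra_simps)
    qed
    also have "\<dots> = 0" by (simp add: ode)
    finally show ?thesis by (rule has_field_derivative_at_within)
  qed
  then obtain c where c: "\<And>t. t \<in> {0<..<2 * pi} \<Longrightarrow> S t * sin (t / 2) powr (- 3 / 2) = c"
    using has_field_derivative_zero_constant[of "{0<..<2 * pi}" "\<lambda>t. S t * sin (t / 2) powr (- 3 / 2)"] by auto
  have "c = Re (dirichlet_series (- 1))" using c[of pi] by (simp add: S_def)
  moreover have "sin (t / 2) powr (- 3 / 2) * sin (t / 2) powr (3 / 2) = 1"
    using sp[OF t] by (subst powr_add[symmetric]) simp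
  then have "S t = (S t * sin (t / 2) powr (- 3 / 2)) * sin (t / 2) powr (3 / 2)"
    by (simp only: mult.assoc mult_1_right)
  ultimately show ?thesis using c[OF t] unfolding S_def by (simp only:)
qed

lemma dirichlet_solution:
  obtains G G' :: "complex \<Rightarrow> complex"
  where "continuous_on (cball 0 1) G" "continuous_on (cball 0 1) G'"
    "\<And>z. z \<in> unit_disc \<Longrightarrow> (G has_field_derivative G' z) (at z)"
    "\<And>z. z \<in> unit_circle \<Longrightarrow> Re (G z) = - ((1 - Re z) powr (3 / 4))"
proof
  \<comment> \<open>The power of 2 comes from 1 - cos t = 2 sin(t/2) squared, raised to 3/4.\<close>
  define k where "k = - (2 powr (3 / 4) / Re (dirichlet_series (- 1)))"
  show "continuous_on (cball 0 1) (\<lambda>z. of_real k * dirichlet_series z)" "continuous_on (cball 0 1) (\<lambda>z. of_real k * dirichlet_series' z)"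
    by (intro continuous_intros continuous_on_dirichlet_series continuous_on_dirichlet_series')+
  show "((\<lambda>z. of_real k * dirichlet_series z) has_field_derivative of_real k * dirichlet_series' z) (at z)" if "z \<in> unit_disc" for z
    by (intro DERIV_cmult dirichlet_series_has_field_derivative that)
  fix z :: complex assume "z \<in> unit_circle"
  then have "cmod z = 1" by simp
  then have "z = cis (Arg2pi z)" using Arg2pi_eq[of z] by (simp add: cis_conv_exp)
  then obtain t where t: "0 \<le> t" "t < 2 * pi" "z = cis t"
    using that[of "Arg2pi z"] Arg2pi_ge_0[of z] Arg2pi_lt_2pi[of z] by blast
  show "Re (of_real k * dirichlet_series z) = - ((1 - Re z) powr (3 / 4))"
  proof (cases "t = 0")
    case True
    then show ?thesis using t by (simp add: dirichlet_series_1)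
  next
    case False
    then have t': "t \<in> {0<..<2 * pi}" using t by simp
    have sp: "sin (t / 2) > 0" using t' by (intro sin_gt_zero) auto
    have "1 - cos t = 2 * sin (t / 2) powr 2"
      using cos_double_sin[of "t / 2"] sp by (simp add: powr_numeral)
    then have "(1 - cos t) powr (3 / 4) = 2 powr (3 / 4) * sin (t / 2) powr (3 / 2)"
      by (simp add: powr_mult powr_powr)
    then show ?thesis using dirichlet_series_boundary_value[OF t'] Re_dirichlet_series_minus1 t(3) by (simp add: k_def)
  qed
qed

section \<open>The exhaustion function near the circle\<close>

lemma pd2_cong:
  assumes p: "pd2 S f fx fy fxx fyy" and S: "open S" and eq: "\<And>z. z \<in> S \<Longrightarrow> f z = g z"
  shows "pd2 S g fx fy fxx fyy"
proof -
  have "continuous_on S g" using p eq continuous_on_cong[OF refl eq] by (simp add: pd2_def)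
  moreover have "has_line_derivative g v D z" if "z \<in> S" "has_line_derivative f v D z" for v D z
    by (rule has_line_derivative_eventually[OF that(2) S that(1) eq])
  ultimately show ?thesis using p by (simp add: pd2_def)
qed

locale disc_exhaustion =
  fixes G G' :: "complex \<Rightarrow> complex" and u :: "complex \<Rightarrow> real"
  assumes cont_G: "continuous_on (cball 0 1) G"
    and cont_G': "continuous_on (cball 0 1) G'"
    and der_G: "\<And>z. z \<in> unit_disc \<Longrightarrow> (G has_field_derivative G' z) (at z)"
    and bd_G: "\<And>z. z \<in> unit_circle \<Longrightarrow> Re (G z) = - ((1 - Re z) powr (3 / 4))"
    and u_eq: "\<And>z. z \<in> cball 0 1 \<Longrightarrow> u z = - ((1 - Re z) powr (3 / 4)) - Re (G z)"
begin

definition "lap z = 3 / 16 * (1 - Re z) powr (- 5 / 4)"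
definition "ux z = 3 / 4 * (1 - Re z) powr (- 1 / 4) - Re (G' z)"
definition "uy z = Im (G' z)"
definition "uxx z = 3 / 16 * (1 - Re z) powr (- 5 / 4) - Re (deriv G' z)"
definition "uyy z = Re (deriv G' z)"
text \<open>\<open>Q\<close> and \<open>R\<close> are the derivatives of \<open>u\<close> in the logarithmic radius and in the angle, multiplied by
  \<open>(1 - Re z) powr (1/4)\<close> so as to be continuous on the closed disc; \<open>W\<close> is \<open>|z|\<^sup>2 |\<nabla>u|\<^sup>2\<close> divided by
  the former derivative.\<close>
definition "Q z = 3 / 4 * Re z - (1 - Re z) powr (1 / 4) * Re (z * G' z)"
definition "R z = - (3 / 4) * Im z + (1 - Re z) powr (1 / 4) * Im (z * G' z)"
definition "V z = Q z + (R z)\<^sup>2 / Q z"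
definition "W z = (1 - Re z) powr (- 1 / 4) * V z"

lemma one_minus_Re_pos: "z \<in> unit_disc \<Longrightarrow> 1 - Re z > 0"
  using complex_Re_le_cmod[of z] by simp

lemma one_minus_Re_nonneg: "z \<in> cball 0 1 \<Longrightarrow> 1 - Re z \<ge> 0"
  using complex_Re_le_cmod[of z] by simp

lemma one_minus_Re_pos': "z \<in> cball 0 1 \<Longrightarrow> z \<noteq> 1 \<Longrightarrow> 1 - Re z > 0"
proof (rule ccontr)
  assume z: "z \<in> cball 0 1" "z \<noteq> 1" and "\<not> 1 - Re z > 0"
  then have R: "Re z = 1" using one_minus_Re_nonneg[OF z(1)] by simp
  have "(Re z)\<^sup>2 + (Im z)\<^sup>2 \<le> 1"
    using z(1) power_mono[of "cmod z" 1 2] cmod_power2[of z] by simp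
  then have "Im z = 0" using R by simp
  then show False using R z(2) by (simp add: complex_eq_iff)
qed

lemma lap_pos: "z \<in> unit_disc \<Longrightarrow> lap z > 0"
  using one_minus_Re_pos[of z] by (simp add: lap_def)

lemma der_G': "z \<in> unit_disc \<Longrightarrow> (G' has_field_derivative deriv G' z) (at z)"
  and cont_G'': "continuous_on unit_disc (deriv G')"
proof -
  have "G holomorphic_on unit_disc"
    unfolding holomorphic_on_open[OF open_ball] using der_G by blast
  then have "deriv G holomorphic_on unit_disc" by (intro holomorphic_deriv) auto
  then have h: "G' holomorphic_on unit_disc"
    by (rule holomorphic_transform) (use der_G DERIV_imp_deriv in blast)
  then show "z \<in> unit_disc \<Longrightarrow> (G' has_field_derivative deriv G' z) (at z)"
    by (intro holomorphic_derivI[of _ unit_disc]) auto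
  show "continuous_on unit_disc (deriv G')"
    by (intro holomorphic_on_imp_continuous_on holomorphic_deriv h) auto
qed

lemma continuous_on_one_minus_Re_powr: "a > 0 \<Longrightarrow> continuous_on (cball 0 1) (\<lambda>z. (1 - Re z) powr a)"
  by (intro continuous_on_powr' continuous_intros) (use one_minus_Re_nonneg in auto)

lemma continuous_on_one_minus_Re_powr': "continuous_on (cball 0 1 - {1}) (\<lambda>z. (1 - Re z) powr a)"
  by (intro continuous_on_powr' continuous_intros ballI conjI impI)
     (use one_minus_Re_pos' in \<open>fastforce\<close>)+

lemma cont_u: "continuous_on (cball 0 1) u"
  by (subst continuous_on_cong[OF refl u_eq])
     (auto intro!: continuous_intros continuous_on_one_minus_Re_powr cont_G)

lemma cont_u_disc: "continuous_on unit_disc u"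
  by (rule continuous_on_subset[OF cont_u]) auto

lemma u_boundary: "z \<in> unit_circle \<Longrightarrow> u z = 0"
  using u_eq[of z] bd_G[of z] by simp

text \<open>A holomorphic inner map multiplies the Laplacian by the squared modulus of its
  derivative: the terms containing the second derivative \<open>\<psi>''\<close> occur with opposite
  signs in the two directions, and the part from \<open>G\<close> stays harmonic.\<close>

lemma pd2_comp:
  assumes d1: "\<And>z. z \<in> unit_disc \<Longrightarrow> (\<psi> has_field_derivative \<psi>' z) (at z)"
    and d2: "\<And>z. z \<in> unit_disc \<Longrightarrow> (\<psi>' has_field_derivative \<psi>'' z) (at z)"
    and c: "continuous_on unit_disc \<psi>''"
    and im: "\<And>z. z \<in> unit_disc \<Longrightarrow> \<psi> z \<in> unit_disc"
  shows "\<exists>vx vy vxx vyy. pd2 unit_disc (\<lambda>z. u (\<psi> z)) vx vy vxx vyy \<and>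
    (\<forall>z\<in>unit_disc. vx z = 3 / 4 * (1 - Re (\<psi> z)) powr (- 1 / 4) * Re (\<psi>' z) - Re (G' (\<psi> z) * \<psi>' z) \<and>
       vy z = - (3 / 4 * (1 - Re (\<psi> z)) powr (- 1 / 4) * Im (\<psi>' z)) + Im (G' (\<psi> z) * \<psi>' z) \<and>
       vxx z + vyy z = lap (\<psi> z) * (cmod (\<psi>' z))\<^sup>2)"
proof -
  define q where "q = (\<lambda>z. 1 - Re (\<psi> z))"
  have qpos: "q z > 0" if "z \<in> unit_disc" for z using one_minus_Re_pos[OF im[OF that]] by (simp add: q_def)
  have c0: "continuous_on unit_disc \<psi>" and c1: "continuous_on unit_disc \<psi>'"
    by (rule DERIV_continuous_on[OF has_field_derivative_at_within[OF d1]]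
             DERIV_continuous_on[OF has_field_derivative_at_within[OF d2]], assumption)+
  have cq: "continuous_on unit_disc (\<lambda>z. q z powr a)" for a
    unfolding q_def using qpos c0
    by (intro continuous_on_powr' continuous_intros) (auto simp: q_def less_imp_le, fastforce)
  have dq: "has_line_derivative q v (- Re (\<psi>' z * v)) z" if "z \<in> unit_disc" for z v
    using has_line_derivative_diff[OF has_line_derivative_const[of 1] has_line_derivative_field[OF d1[OF that]], of v]
    by (simp add: q_def)
  have dqp: "has_line_derivative (\<lambda>z. q z powr a) v (a * q z powr (a - 1) * - Re (\<psi>' z * v)) z"
    if "z \<in> unit_disc" for z v a
    by (rule has_line_derivative_chain[OF dq[OF that]])
       (use qpos[OF that] in \<open>auto intro!: derivative_eq_intros\<close>)
  define mx where "mx = (\<lambda>z. 3 / 4 * (q z powr (- 1 / 4) * Re (\<psi>' z)))"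
  define my where "my = (\<lambda>z. - 3 / 4 * (q z powr (- 1 / 4) * Im (\<psi>' z)))"
  define mxx where "mxx = (\<lambda>z. 3 / 16 * q z powr (- 5 / 4) * (Re (\<psi>' z))\<^sup>2 + 3 / 4 * q z powr (- 1 / 4) * Re (\<psi>'' z))"
  define myy where "myy = (\<lambda>z. 3 / 16 * q z powr (- 5 / 4) * (Im (\<psi>' z))\<^sup>2 - 3 / 4 * q z powr (- 1 / 4) * Re (\<psi>'' z))"
  have Imd: "has_line_derivative (\<lambda>z. Im (\<psi>' z)) \<i> (Re (\<psi>'' z)) z" if "z \<in> unit_disc" for z
    using has_line_derivative_field[of "\<lambda>z. - \<i> * \<psi>' z" "- \<i> * \<psi>'' z" z \<i>] DERIV_cmult[OF d2[OF that], of "- \<i>"]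
    by simp
  have m: "pd2 unit_disc (\<lambda>z. - (q z powr (3 / 4))) mx my mxx myy"
    unfolding pd2_def
  proof (intro conjI ballI)
    show "continuous_on unit_disc (\<lambda>z. - (q z powr (3 / 4)))" "continuous_on unit_disc mx"
      "continuous_on unit_disc my" "continuous_on unit_disc mxx" "continuous_on unit_disc myy"
      unfolding mx_def my_def mxx_def myy_def
      by (intro continuous_intros cq c1 c)+
    fix z :: complex assume z: "z \<in> unit_disc"
    show "has_line_derivative (\<lambda>z. - (q z powr (3 / 4))) 1 (mx z) z"
      using has_line_derivative_cmult[OF dqp[OF z, of "3 / 4" 1], of "- 1"] by (simp add: mx_def mult.assoc)
    show "has_line_derivative (\<lambda>z. - (q z powr (3 / 4))) \<i> (my z) z"
      using has_line_derivative_cmult[OF dqp[OF z, of "3 / 4" \<i>], of "- 1"] by (simp add: my_def mult.assoc)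
    have "has_line_derivative mx 1 (3 / 4 * (- 1 / 4 * q z powr (- 1 / 4 - 1) * - Re (\<psi>' z * 1) * Re (\<psi>' z)
       + Re (\<psi>'' z * 1) * q z powr (- 1 / 4))) z"
      unfolding mx_def
      by (intro has_line_derivative_cmult has_line_derivative_mult dqp z has_line_derivative_field d2)
    then show "has_line_derivative mx 1 (mxx z) z"
      by (simp add: mxx_def power2_eq_square algebra_simps)
    have "has_line_derivative my \<i> (- 3 / 4 * (- 1 / 4 * q z powr (- 1 / 4 - 1) * - Re (\<psi>' z * \<i>) * Im (\<psi>' z)
       + Re (\<psi>'' z) * q z powr (- 1 / 4))) z"
      unfolding my_def
      by (intro has_line_derivative_cmult has_line_derivative_mult dqp z Imd)
    then show "has_line_derivative my \<i> (myy z) z"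
      by (simp add: myy_def power2_eq_square algebra_simps)
  qed
  have g1: "((\<lambda>z. G (\<psi> z)) has_field_derivative G' (\<psi> z) * \<psi>' z) (at z)" if "z \<in> unit_disc" for z
    by (rule DERIV_chain2[OF der_G[OF im[OF that]] d1[OF that]])
  have g2: "((\<lambda>z. G' (\<psi> z) * \<psi>' z) has_field_derivative
      deriv G' (\<psi> z) * \<psi>' z * \<psi>' z + \<psi>'' z * G' (\<psi> z)) (at z)" if "z \<in> unit_disc" for z
    by (rule DERIV_mult[OF DERIV_chain2[OF der_G'[OF im[OF that]] d1[OF that]] d2[OF that]])
  have cg: "continuous_on unit_disc (\<lambda>z. deriv G' (\<psi> z) * \<psi>' z * \<psi>' z + \<psi>'' z * G' (\<psi> z))"
    by (intro continuous_intros c c1 continuous_on_compose2[OF cont_G'' c0] continuous_on_compose2[OF cont_G' c0])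
       (use im in \<open>auto simp: less_imp_le\<close>)
  note p = pd2_diff[OF m pd2_Re[OF g1 g2 cg]]
  have ueq: "u (\<psi> z) = - (q z powr (3 / 4)) - Re (G (\<psi> z))" if "z \<in> unit_disc" for z
    using u_eq[of "\<psi> z"] im[OF that] by (simp add: q_def less_imp_le)
  have p': "pd2 unit_disc (\<lambda>z. u (\<psi> z)) (\<lambda>z. mx z - Re (G' (\<psi> z) * \<psi>' z)) (\<lambda>z. my z - - Im (G' (\<psi> z) * \<psi>' z))
     (\<lambda>z. mxx z - Re (deriv G' (\<psi> z) * \<psi>' z * \<psi>' z + \<psi>'' z * G' (\<psi> z)))
     (\<lambda>z. myy z - - Re (deriv G' (\<psi> z) * \<psi>' z * \<psi>' z + \<psi>'' z * G' (\<psi> z)))"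
    by (rule pd2_cong[OF p open_ball ueq[symmetric]])
  show ?thesis
  proof (intro exI conjI, rule p', intro ballI conjI)
    fix z :: complex assume z: "z \<in> unit_disc"
    show "mxx z - Re (deriv G' (\<psi> z) * \<psi>' z * \<psi>' z + \<psi>'' z * G' (\<psi> z)) +
       (myy z - - Re (deriv G' (\<psi> z) * \<psi>' z * \<psi>' z + \<psi>'' z * G' (\<psi> z))) = lap (\<psi> z) * (cmod (\<psi>' z))\<^sup>2"
      by (subst cmod_power2) (simp add: mxx_def myy_def lap_def q_def algebra_simps)
  qed (auto simp: mx_def my_def q_def)
qed

lemma pd2_u: "pd2 unit_disc u ux uy uxx uyy"
proof -
  define q :: "complex \<Rightarrow> real" where "q = (\<lambda>z. 1 - Re z)"
  have qpos: "q z > 0" if "z \<in> unit_disc" for z using one_minus_Re_pos[OF that] by (simp add: q_def)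
  have cq: "continuous_on unit_disc (\<lambda>z. q z powr a)" for a
    unfolding q_def by (rule continuous_on_subset[OF continuous_on_one_minus_Re_powr']) auto
  have dq: "has_line_derivative q v (- Re v) z" for z v
    unfolding has_line_derivative_def q_def by (auto intro!: derivative_eq_intros)
  have dqp: "has_line_derivative (\<lambda>z. q z powr a) v (a * q z powr (a - 1) * - Re v) z"
    if "z \<in> unit_disc" for z v a
    by (rule has_line_derivative_chain[OF dq])
       (use qpos[OF that] in \<open>auto intro!: derivative_eq_intros\<close>)
  have m: "pd2 unit_disc (\<lambda>z. - (q z powr (3 / 4))) (\<lambda>z. 3 / 4 * q z powr (- 1 / 4)) (\<lambda>z. 0)
     (\<lambda>z. 3 / 16 * q z powr (- 5 / 4)) (\<lambda>z. 0)"
    unfolding pd2_def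
  proof (intro conjI ballI)
    fix z :: complex assume z: "z \<in> unit_disc"
    show "has_line_derivative (\<lambda>z. - (q z powr (3 / 4))) 1 (3 / 4 * q z powr (- 1 / 4)) z"
      using has_line_derivative_cmult[OF dqp[OF z, of "3 / 4" 1], of "- 1"] by simp
    show "has_line_derivative (\<lambda>z. - (q z powr (3 / 4))) \<i> 0 z"
      using has_line_derivative_cmult[OF dqp[OF z, of "3 / 4" \<i>], of "- 1"] by simp
    show "has_line_derivative (\<lambda>z. 3 / 4 * q z powr (- 1 / 4)) 1 (3 / 16 * q z powr (- 5 / 4)) z"
      using has_line_derivative_cmult[OF dqp[OF z, of "- 1 / 4" 1], of "3 / 4"] by simp
  qed (auto intro!: continuous_intros cq has_line_derivative_const)
  note p = pd2_diff[OF m pd2_Re[OF der_G der_G' cont_G'']]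
  have ueq: "u z = - (q z powr (3 / 4)) - Re (G z)" if "z \<in> unit_disc" for z
    using u_eq[of z] that by (simp add: q_def less_imp_le)
  have "pd2 unit_disc u (\<lambda>z. 3 / 4 * q z powr (- 1 / 4) - Re (G' z)) (\<lambda>z. 0 - - Im (G' z))
     (\<lambda>z. 3 / 16 * q z powr (- 5 / 4) - Re (deriv G' z)) (\<lambda>z. 0 - - Re (deriv G' z))"
    by (rule pd2_cong[OF p open_ball ueq[symmetric]])
  then show ?thesis
    by (simp add: ux_def[abs_def] uy_def[abs_def] uxx_def[abs_def] uyy_def[abs_def] q_def)
qed

lemma uxx_plus_uyy: "uxx z + uyy z = lap z"
  by (simp add: uxx_def uyy_def lap_def)

lemma continuous_on_lap: "continuous_on unit_disc lap"
  unfolding lap_def[abs_def]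
  by (intro continuous_intros continuous_on_subset[OF continuous_on_one_minus_Re_powr']) auto

section \<open>Boundary growth of the exhaustion function and Hopf's lemma\<close>

lemma u_le:
  assumes "z \<in> cball 0 1"
  shows "u z \<le> - (1 / 128) * (1 - (cmod z)\<^sup>2)"
proof -
  \<comment> \<open>Since \<open>1 - Re z\<close> is at most 2, the Laplacian of \<open>u\<close> is
    at least 3/64, which exceeds 1/32, the Laplacian of \<open>(cmod z)\<^sup>2 / 128\<close>. The
    difference is therefore still subharmonic.\<close>
  have "u z + (- 1 / 128) * (cmod z)\<^sup>2 \<le> - 1 / 128"
  proof (rule max_principle[OF _ pd2_add[OF pd2_u pd2_cmult[OF pd2_norm_squared]] _ _ assms])
    show "continuous_on (cball 0 1) (\<lambda>z. u z + - 1 / 128 * (cmod z)\<^sup>2)"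
      by (intro continuous_intros cont_u)
    show "u z + - 1 / 128 * (cmod z)\<^sup>2 \<le> - 1 / 128" if "z \<in> unit_circle" for z
      using u_boundary[OF that] that by simp
    fix z :: complex assume z: "z \<in> unit_disc"
    have "1 - Re z \<le> 2" using z abs_Re_le_cmod[of z] by auto
    then have "(1 - Re z) powr (5 / 4) \<le> 2 powr (5 / 4)"
      using one_minus_Re_pos[OF z] by (intro powr_mono2) auto
    also have "\<dots> \<le> 2 powr 2" by (intro powr_mono) auto
    finally have le: "(1 - Re z) powr (5 / 4) \<le> 4" by simp
    have "(1 - Re z) powr (- 5 / 4) = 1 / (1 - Re z) powr (5 / 4)"
      using powr_minus_divide[of "1 - Re z" "5 / 4"] by simp
    also have "\<dots> \<ge> 1 / 4"
      using le one_minus_Re_pos[OF z] by (intro divide_left_mono) auto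
    finally have "lap z \<ge> 3 / 64" by (simp add: lap_def)
    then show "0 \<le> uxx z + - 1 / 128 * 2 + (uyy z + - 1 / 128 * 2)"
      using uxx_plus_uyy[of z] by simp
  qed
  then show ?thesis by (simp add: field_simps)
qed

lemma u_neg: "z \<in> unit_disc \<Longrightarrow> u z < 0"
proof -
  assume z: "z \<in> unit_disc"
  then have "(cmod z)\<^sup>2 < 1" by (simp add: abs_square_less_1)
  then have "(1 / 128) * (1 - (cmod z)\<^sup>2) > 0" by simp
  moreover have "u z \<le> - (1 / 128) * (1 - (cmod z)\<^sup>2)" using z by (intro u_le) simp
  ultimately show "u z < 0" by linarith
qed

lemma cont_Q: "continuous_on (cball 0 1) Q" and cont_R: "continuous_on (cball 0 1) R"
  unfolding Q_def[abs_def] R_def[abs_def]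
  by (intro continuous_intros continuous_on_one_minus_Re_powr cont_G'; simp)+

lemma radial_derivative_eq:
  assumes "z \<in> cball 0 1" "z \<noteq> 1"
  shows "Re z * ux z + Im z * uy z = (1 - Re z) powr (- 1 / 4) * Q z"
    "- Im z * ux z + Re z * uy z = (1 - Re z) powr (- 1 / 4) * R z"
proof -
  have p: "(1 - Re z) powr (- 1 / 4) * (1 - Re z) powr (1 / 4) = 1"
    using one_minus_Re_pos'[OF assms] by (subst powr_add[symmetric]) simp
  have "(1 - Re z) powr (- 1 / 4) * Q z = 3 / 4 * (1 - Re z) powr (- 1 / 4) * Re z
     - ((1 - Re z) powr (- 1 / 4) * (1 - Re z) powr (1 / 4)) * Re (z * G' z)"
    by (simp add: Q_def algebra_simps)
  then show "Re z * ux z + Im z * uy z = (1 - Re z) powr (- 1 / 4) * Q z"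
    unfolding p by (simp add: ux_def uy_def algebra_simps)
  have "(1 - Re z) powr (- 1 / 4) * R z = - (3 / 4 * (1 - Re z) powr (- 1 / 4) * Im z)
     + ((1 - Re z) powr (- 1 / 4) * (1 - Re z) powr (1 / 4)) * Im (z * G' z)"
    by (simp add: R_def algebra_simps)
  then show "- Im z * ux z + Re z * uy z = (1 - Re z) powr (- 1 / 4) * R z"
    unfolding p by (simp add: ux_def uy_def algebra_simps)
qed

lemma u_has_derivative:
  assumes "z \<in> unit_disc"
  shows "(u has_derivative (\<lambda>h. ux z * Re h + uy z * Im h)) (at z)"
proof -
  have p: "1 - Re z > 0" using one_minus_Re_pos[OF assms] .
  have "((\<lambda>z. - ((1 - Re z) powr (3 / 4)) - Re (G z)) has_derivative
      (\<lambda>h. 3 / 4 * (1 - Re z) powr (- 1 / 4) * Re h - Re (G' z * h))) (at z)"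
  proof (rule has_derivative_diff)
    have "((\<lambda>x. - (x powr (3 / 4))) has_real_derivative - (3 / 4 * (1 - Re z) powr (- 1 / 4))) (at (1 - Re z))"
      using p by (auto intro!: derivative_eq_intros)
    then have "((\<lambda>x. - (x powr (3 / 4))) has_derivative (\<lambda>h. - (3 / 4 * (1 - Re z) powr (- 1 / 4)) * h)) (at (1 - Re z))"
      unfolding has_field_derivative_def .
    moreover have "((\<lambda>z. 1 - Re z) has_derivative (\<lambda>h. - Re h)) (at z)"
      by (auto intro!: derivative_eq_intros)
    ultimately show "((\<lambda>z. - ((1 - Re z) powr (3 / 4))) has_derivative (\<lambda>h. 3 / 4 * (1 - Re z) powr (- 1 / 4) * Re h)) (at z)"
      using has_derivative_compose by fastforce
    show "((\<lambda>z. Re (G z)) has_derivative (\<lambda>h. Re (G' z * h))) (at z)"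
      using der_G[OF assms] unfolding has_field_derivative_def
      by (rule bounded_linear.has_derivative[OF bounded_linear_Re])
  qed
  then have "(u has_derivative (\<lambda>h. 3 / 4 * (1 - Re z) powr (- 1 / 4) * Re h - Re (G' z * h))) (at z)"
    by (rule has_derivative_transform_within_open[where s = unit_disc])
       (use assms u_eq in \<open>auto simp: less_imp_le\<close>)
  then show ?thesis by (simp add: ux_def uy_def algebra_simps)
qed

lemma u_radial:
  assumes "t < 0"
  shows "((\<lambda>t. u (exp (Complex t \<theta>))) has_real_derivative
     (1 - Re (exp (Complex t \<theta>))) powr (- 1 / 4) * Q (exp (Complex t \<theta>))) (at t)"
proof -
  let ?z = "exp (Complex t \<theta>)"
  have n: "cmod ?z < 1" using assms by simp
  have "((\<lambda>t. Complex t \<theta>) has_vector_derivative 1) (at t)"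
    unfolding Complex_eq has_vector_derivative_def
    by (auto intro!: derivative_eq_intros simp: scaleR_conv_of_real)
  then have "((\<lambda>t. exp (Complex t \<theta>)) has_vector_derivative ?z) (at t)"
    using field_vector_diff_chain_at[of "\<lambda>t. Complex t \<theta>" 1 t exp ?z] by (simp add: o_def)
  then have d: "((\<lambda>t. u (exp (Complex t \<theta>))) has_derivative
      (\<lambda>h. ux ?z * Re (h *\<^sub>R ?z) + uy ?z * Im (h *\<^sub>R ?z))) (at t)"
    unfolding has_vector_derivative_def
    using n by (intro has_derivative_compose[where f = "\<lambda>t. exp (Complex t \<theta>)" and g = u] u_has_derivative) auto
  have e: "(\<lambda>h. ux ?z * Re (h *\<^sub>R ?z) + uy ?z * Im (h *\<^sub>R ?z)) = (*) (Re ?z * ux ?z + Im ?z * uy ?z)"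
    by (auto simp: algebra_simps)
  have ne: "?z \<noteq> 1" using n by (metis norm_one less_irrefl)
  have c: "?z \<in> cball 0 1" using n by (simp del: norm_exp_eq_Re)
  show ?thesis
    using d unfolding has_field_derivative_def e radial_derivative_eq(1)[OF c ne] .
qed

text \<open>Hopf's boundary lemma: the linear upper bound for \<open>u\<close> forces a positive radial derivative.\<close>

lemma Q_circle_pos:
  assumes "z \<in> unit_circle"
  shows "Q z > 0"
\<comment> \<open>At 1 the factor \<open>(1 - Re z) powr (1 / 4)\<close> annihilates the unknown
  term and leaves the value 3/4.\<close>
proof (cases "z = 1")
  case True
  then show ?thesis by (simp add: Q_def)
next
  case False
  obtain \<theta> where \<theta>: "z = cis \<theta>"
    using assms Arg2pi_eq[of z] by (metis cis_conv_exp mem_sphere_0 mult.left_neutral of_real_1)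
  define \<phi> where "\<phi> = (\<lambda>t. u (exp (Complex t \<theta>)))"
  define D where "D = (\<lambda>t. (1 - Re (exp (Complex t \<theta>))) powr (- 1 / 4) * Q (exp (Complex t \<theta>)))"
  have z0: "exp (Complex 0 \<theta>) = z" by (simp add: \<theta> exp_eq_polar)
  have in_c: "exp (Complex t \<theta>) \<in> cball 0 1 - {1}" if "t \<le> 0" for t
  proof (cases "t = 0")
    case True
    then show ?thesis using False assms by (simp add: z0)
  next
    case False
    then have n: "cmod (exp (Complex t \<theta>)) < 1" using that by simp
    then have "exp (Complex t \<theta>) \<noteq> 1" by (metis norm_one less_irrefl)
    with n show ?thesis by (metis DiffI less_imp_le mem_cball_0 singletonD)
  qed
  have ce: "continuous_on {..0} (\<lambda>t. exp (Complex t \<theta>))"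
    unfolding Complex_eq by (intro continuous_intros)
  have cD: "continuous_on {..0} D"
    unfolding D_def
    by (intro continuous_intros continuous_on_compose2[OF continuous_on_one_minus_Re_powr' ce]
          continuous_on_compose2[OF cont_Q ce]) (use in_c in auto)
  have c\<phi>: "continuous_on {..0} \<phi>"
    unfolding \<phi>_def by (rule continuous_on_compose2[OF cont_u ce]) (use in_c in auto)
  \<comment> \<open>Mean value theorem on the ray. On [-1, 0] the quantity 1 - exp (2t) is at least
    2|t|/3, so \<open>u_le\<close> gives a slope of at least 2 / (3 * 128) = 1 / 192.\<close>
  have key: "\<exists>s. t < s \<and> s < 0 \<and> D s \<ge> 1 / 192" if t: "- 1 \<le> t" "t < 0" for t
  proof -
    have "\<exists>l s. t < s \<and> s < 0 \<and> DERIV \<phi> s :> l \<and> \<phi> 0 - \<phi> t = (0 - t) * l"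
    proof (rule MVT)
      show "continuous_on {t..0} \<phi>" by (rule continuous_on_subset[OF c\<phi>]) auto
      show "\<phi> differentiable (at x)" if "t < x" "x < 0" for x
        using u_radial[OF that(2), of \<theta>] unfolding \<phi>_def real_differentiable_def by blast
    qed (use t in auto)
    then obtain l s where s: "t < s" "s < 0" "DERIV \<phi> s :> l" "\<phi> 0 - \<phi> t = (0 - t) * l" by blast
    have l: "l = D s" using u_radial[OF s(2), of \<theta>] s(3) DERIV_unique unfolding \<phi>_def D_def by blast
    have "\<phi> 0 = 0" using u_boundary[of z] assms by (simp add: \<phi>_def z0)
    moreover have "\<phi> t \<le> - (1 / 128) * (1 - (exp t)\<^sup>2)"
      using u_le[of "exp (Complex t \<theta>)"] t by (simp add: \<phi>_def)
    moreover have "1 - (exp t)\<^sup>2 \<ge> - 2 * t / 3"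
    proof -
      have "(exp t)\<^sup>2 = 1 / exp (- 2 * t)"
        by (simp add: exp_double[symmetric] exp_minus divide_inverse)
      also have "\<dots> \<le> 1 / (1 + - 2 * t)"
        using t exp_ge_add_one_self[of "- 2 * t"] by (intro divide_left_mono) auto
      also have "\<dots> \<le> 1 - - 2 * t / 3"
      proof -
        have "1 \<le> (1 - x / 3) * (1 + x)" if "0 \<le> x" "x \<le> 2" for x :: real
          using mult_nonneg_nonneg[of x "2 - x"] that by (simp add: algebra_simps)
        from this[of "- 2 * t"] show ?thesis using t by (simp add: divide_le_eq)
      qed
      finally show ?thesis by simp
    qed
    moreover have "\<phi> t = \<phi> 0 + t * D s" using s(4) l by simp
    moreover have "x \<le> y / 192" if "p = 0" "r \<le> - (1 / 128) * (1 - E)" "- 2 * y / 3 \<le> 1 - E" "r = p + x"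
      for p r E x y :: real using that by (simp add: field_simps)
    ultimately have "t * D s \<le> t / 192" by blast
    then have "(- t) * D s \<ge> (- t) * (1 / 192)" by simp
    then have "D s \<ge> 1 / 192" using t by (simp only: mult_le_cancel_left_pos)
    then show ?thesis using s by blast
  qed
  \<comment> \<open>\<open>u\<close> is known to be differentiable only inside the disc. The bound
    at the intermediate points is carried to the circle by the continuity of \<open>D\<close> up to
    \<open>t = 0\<close>.\<close>
  have "\<exists>s. \<forall>n. - (1 / real (Suc n)) < s n \<and> s n < 0 \<and> D (s n) \<ge> 1 / 192"
    by (intro choice allI key) auto
  then obtain s where s: "\<And>n. - (1 / real (Suc n)) < s n" "\<And>n. s n < 0" "\<And>n. D (s n) \<ge> 1 / 192" by blast
  have "s \<longlonglongrightarrow> 0"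
  proof (rule tendsto_sandwich)
    show "(\<lambda>n. - (1 / real (Suc n))) \<longlonglongrightarrow> 0"
      using tendsto_minus[OF lim_inverse_n'[THEN LIMSEQ_Suc]] by (simp add: divide_inverse)
    show "(\<lambda>n. 0) \<longlonglongrightarrow> (0::real)" by simp
  qed (use s in \<open>auto intro!: always_eventually less_imp_le\<close>)
  then have "(\<lambda>n. D (s n)) \<longlonglongrightarrow> D 0"
    by (rule continuous_on_tendsto_compose[OF cD]) (use s in \<open>auto simp: less_imp_le\<close>)
  then have "1 / 192 \<le> D 0" by (rule LIMSEQ_le_const) (use s in auto)
  then have "0 < (1 - Re z) powr (- 1 / 4) * Q z" by (simp add: D_def z0)
  then show ?thesis by (simp add: zero_less_mult_iff)
qed

text \<open>Positivity on the compact circle spreads inwards by uniform continuity, also near 1,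
  where the gradient itself is unbounded.\<close>

lemma annulus_exists:
  "\<exists>t0 q. t0 < 0 \<and> q > 0 \<and> (\<forall>z. exp t0 \<le> cmod z \<and> cmod z \<le> 1 \<longrightarrow> q \<le> Q z)"
proof -
  have "\<exists>z1\<in>unit_circle. \<forall>z\<in>unit_circle. Q z1 \<le> Q z"
    by (rule continuous_attains_inf) (auto intro: continuous_on_subset[OF cont_Q])
  then obtain z1 where z1: "z1 \<in> unit_circle" "\<And>z. z \<in> unit_circle \<Longrightarrow> Q z1 \<le> Q z" by blast
  define m where "m = Q z1"
  have m: "m > 0" using Q_circle_pos[OF z1(1)] by (simp add: m_def)
  have "uniformly_continuous_on (cball 0 1) Q"
    by (rule compact_uniformly_continuous[OF cont_Q]) simp
  then obtain d where d: "d > 0"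
    "\<And>z w. z \<in> cball 0 1 \<Longrightarrow> w \<in> cball 0 1 \<Longrightarrow> dist w z < d \<Longrightarrow> dist (Q w) (Q z) < m / 2"
    using m unfolding uniformly_continuous_on_def by (metis half_gt_zero)
  define e where "e = max (1 / 2) (1 - d / 2)"
  have e: "0 < e" "e < 1" "1 - d / 2 \<le> e" using d(1) by (auto simp: e_def)
  have "m / 2 \<le> Q z" if z: "e \<le> cmod z" "cmod z \<le> 1" for z
  proof -
    define w where "w = z / of_real (cmod z)"
    have w: "w \<in> unit_circle" using z e by (auto simp: w_def norm_divide)
    have "z - w = w * of_real (cmod z - 1)"
    proof -
      have "w * of_real (cmod z) = z" using z e by (auto simp: w_def)
      then show ?thesis by (simp add: algebra_simps)
    qed
    then have "cmod (z - w) = 1 - cmod z"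
      using w z by (simp add: norm_mult del: of_real_diff)
    then have "dist z w < d" using z e d(1) by (simp add: dist_norm)
    then have "dist (Q z) (Q w) < m / 2" using w z by (intro d(2)) auto
    then show ?thesis using z1(2)[OF w] unfolding dist_real_def m_def by linarith
  qed
  then show ?thesis
    using e m by (intro exI[of _ "ln e"] exI[of _ "m / 2"]) auto
qed

end

text \<open>In the annulus of logarithmic inner radius \<open>t0\<close> the function
  \<open>u\<close> increases strictly along rays; on the disc inside it \<open>u\<close> stays below
  \<open>r0\<close>. Hence for levels between \<open>r0\<close> and 0 the whole level curve lies in
  the annulus.\<close>

locale disc_annulus = disc_exhaustion +
  fixes t0 q C r0 :: real
  assumes t0: "t0 < 0" and q: "q > 0"
    and Q_ge: "\<And>z. exp t0 \<le> cmod z \<Longrightarrow> cmod z \<le> 1 \<Longrightarrow> q \<le> Q z"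
    and V_le: "\<And>z. exp t0 \<le> cmod z \<Longrightarrow> cmod z \<le> 1 \<Longrightarrow> V z \<le> C"
    and r0: "r0 < 0" and u_le_r0: "\<And>z. cmod z \<le> exp t0 \<Longrightarrow> u z \<le> r0"

lemma (in disc_exhaustion) disc_annulus_exists: "\<exists>t0 q C r0. disc_annulus G G' u t0 q C r0"
proof -
  obtain t0 q where t0: "t0 < 0" "q > 0" "\<And>z. exp t0 \<le> cmod z \<Longrightarrow> cmod z \<le> 1 \<Longrightarrow> q \<le> Q z"
    using annulus_exists by blast
  let ?A = "cball 0 1 - ball 0 (exp t0) :: complex set"
  have cA: "compact ?A" by (intro compact_diff) auto
  have "continuous_on ?A V"
    unfolding V_def[abs_def]
    by (intro continuous_intros continuous_on_subset[OF cont_Q] continuous_on_subset[OF cont_R])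
       (use t0(2) t0(3) in \<open>force simp: not_less\<close>)+
  then have "compact (V ` ?A)" using cA by (rule compact_continuous_image)
  then obtain C where C: "\<And>z. z \<in> ?A \<Longrightarrow> norm (V z) \<le> C"
    using compact_imp_bounded by (force simp: bounded_iff)
  have "\<exists>z1\<in>cball 0 (exp t0). \<forall>z\<in>cball 0 (exp t0). u z \<le> u z1"
  proof (rule continuous_attains_sup)
    have "exp t0 \<le> 1" using t0(1) by simp
    then show "continuous_on (cball 0 (exp t0)) u"
      by (intro continuous_on_subset[OF cont_u] subset_cball)
  qed auto
  then obtain z1 where z1: "z1 \<in> cball 0 (exp t0)" "\<And>z. z \<in> cball 0 (exp t0) \<Longrightarrow> u z \<le> u z1" by blast
  have "cmod z1 < 1" using z1(1) t0(1) by (simp add: le_less_trans)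
  then have "u z1 < 0" by (intro u_neg) simp
  then have "disc_annulus G G' u t0 q C (u z1)"
    using t0 C z1 by unfold_locales (auto simp: abs_le_iff not_less)
  then show ?thesis by blast
qed

section \<open>Integration over level curves\<close>

lemma AE_Im_nonzero: "AE z in (lborel :: complex measure). Im z \<noteq> 0"
proof (rule AE_I')
  have "negligible {z::complex. z \<bullet> \<i> = 0}"
    by (rule negligible_standard_hyperplane) (simp add: Basis_complex_def)
  then have "{z. Im z = 0} \<in> null_sets lebesgue" by (simp add: negligible_iff_null_sets)
  moreover have "{z. Im z = 0} \<in> sets (borel :: complex measure)"
    by (intro borel_closed closed_Collect_eq continuous_intros)
  ultimately show "{z. Im z = 0} \<in> null_sets (lborel :: complex measure)"
    by (auto simp: null_sets_def)
qed auto

text \<open>Polar coordinates with logarithmic radius: \<open>exp\<close> is injective on a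
  rectangle of height 2 pi, its Jacobian is \<open>exp (2 * t)\<close>, and the part of the annulus
  it misses lies on the real axis, a null set.\<close>

lemma polar_integral:
  fixes F :: "complex \<Rightarrow> real"
  assumes F: "integrable lborel F"
    and supp: "\<And>z. F z \<noteq> 0 \<Longrightarrow> exp a < cmod z \<and> cmod z < exp b"
  shows "integrable lborel (\<lambda>\<theta>. indicator {0<..<2 * pi} \<theta> * (\<integral>t. indicator {a<..<b} t * (exp (2 * t) * F (exp (Complex t \<theta>))) \<partial>lborel))"
    and "(\<integral>z. F z \<partial>lborel) =
      (\<integral>\<theta>. indicator {0<..<2 * pi} \<theta> * (\<integral>t. indicator {a<..<b} t * (exp (2 * t) * F (exp (Complex t \<theta>))) \<partial>lborel) \<partial>lborel)"
proof -
  define S where "S = {w. a < Re w \<and> Re w < b \<and> 0 < Im w \<and> Im w < 2 * pi}"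
  have Fm: "F \<in> borel_measurable borel" using F by auto
  have oS: "open S" unfolding S_def
    by (intro open_Collect_conj open_Collect_less continuous_intros)
  have inj: "inj_on exp S"
  proof (rule inj_onI)
    fix v w assume vw: "v \<in> S" "w \<in> S" "exp v = exp w"
    then obtain n where n: "v = w + (of_int (2 * n) * pi) * \<i>" unfolding exp_eq by blast
    then have "\<bar>of_int (2 * n) * pi\<bar> < 2 * pi" using vw(1,2) by (auto simp: S_def)
    then have "\<bar>real_of_int n\<bar> < 1" by (simp add: abs_mult)
    then have "n = 0" by linarith
    then show "v = w" using n by simp
  qed
  have oe: "open (exp ` S)"
    by (rule open_mapping_thm3[OF _ oS inj]) (intro holomorphic_intros)
  have [measurable]: "S \<in> sets borel" "exp ` S \<in> sets borel" "F \<in> borel_measurable borel"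
    using oS oe Fm by auto
  have [measurable]: "(exp :: complex \<Rightarrow> complex) \<in> borel_measurable borel"
    by (intro borel_measurable_continuous_onI continuous_intros)
  have cov: "F z * indicator (exp ` S) z = F z" if "Im z \<noteq> 0" for z
  proof (cases "F z = 0")
    case False
    then have z: "exp a < cmod z" "cmod z < exp b" using supp by auto
    have z0: "z \<noteq> 0" using that by auto
    define w where "w = Complex (ln (cmod z)) (Arg2pi z)"
    have "exp w = z"
    proof -
      have "z = of_real (cmod z) * cis (Arg2pi z)" using Arg2pi_eq[of z] by (simp add: cis_conv_exp)
      then show ?thesis using z0 by (simp add: w_def exp_eq_polar[of "Complex _ _"])
    qed
    moreover have "w \<in> S"
    proof -
      have "Arg2pi z \<noteq> 0" using that Arg2pi_eq_0[of z] by (auto simp: complex_is_Real_iff)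
      moreover have "a < ln (cmod z)" "ln (cmod z) < b"
        using z z0 ln_less_cancel_iff[of "exp a" "cmod z"] ln_less_cancel_iff[of "cmod z" "exp b"] by auto
      ultimately show ?thesis
        using Arg2pi_ge_0[of z] Arg2pi_lt_2pi[of z] by (simp add: S_def w_def)
    qed
    ultimately show ?thesis by force
  qed simp
  have d: "distr (density lborel (\<lambda>z. ennreal ((cmod (exp z))\<^sup>2) * indicator S z)) borel exp
     = density lborel (indicator (exp ` S))"
    by (rule distr_holomorphic_lborel) (use oS oe inj in \<open>auto intro: DERIV_exp\<close>)
  have dens: "density lborel (\<lambda>z. ennreal ((cmod (exp z))\<^sup>2) * indicator S z) =
     density lborel (\<lambda>z. ennreal ((cmod (exp z))\<^sup>2 * indicator S z))"
  proof (rule density_cong)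
    show "AE z in lborel. ennreal ((cmod (exp z))\<^sup>2) * indicator S z = ennreal ((cmod (exp z))\<^sup>2 * indicator S z)"
      by (intro AE_I2) (auto split: split_indicator)
  qed measurable
  have dens2: "density lborel (indicator (exp ` S)) = density lborel (\<lambda>z. ennreal (indicator (exp ` S) z))"
  proof (rule density_cong)
    show "AE z in lborel. indicator (exp ` S) z = ennreal (indicator (exp ` S) z)"
      by (intro AE_I2) (auto split: split_indicator)
  qed measurable
  have ae: "AE z in lborel. indicator (exp ` S) z * F z = F z"
    using AE_Im_nonzero by eventually_elim (simp add: cov mult.commute)
  have "(\<integral>z. F z \<partial>lborel) = (\<integral>z. indicator (exp ` S) z * F z \<partial>lborel)"
    using ae oe Fm by (intro integral_cong_AE) auto
  also have "\<dots> = (\<integral>z. F z \<partial>density lborel (indicator (exp ` S)))"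
    unfolding dens2 using oe Fm by (subst integral_density) auto
  also have "\<dots> = (\<integral>z. F (exp z) \<partial>density lborel (\<lambda>z. ennreal ((cmod (exp z))\<^sup>2 * indicator S z)))"
    unfolding d[symmetric] dens using Fm by (subst integral_distr) auto
  also have "\<dots> = (\<integral>z. ((cmod (exp z))\<^sup>2 * indicator S z) * F (exp z) \<partial>lborel)"
    using oS Fm by (subst integral_density) auto
  finally have I1: "(\<integral>z. F z \<partial>lborel) = (\<integral>z. ((cmod (exp z))\<^sup>2 * indicator S z) * F (exp z) \<partial>lborel)" .
  have "integrable lborel (\<lambda>z. indicator (exp ` S) z * F z)"
    using F ae oe Fm by (subst integrable_cong_AE[where g = F]) auto
  then have "integrable (density lborel (indicator (exp ` S))) F"
    unfolding dens2 using oe Fm by (subst integrable_density) auto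
  then have "integrable (density lborel (\<lambda>z. ennreal ((cmod (exp z))\<^sup>2 * indicator S z))) (\<lambda>z. F (exp z))"
    unfolding d[symmetric] dens using Fm by (subst (asm) integrable_distr_eq) auto
  then have i1: "integrable lborel (\<lambda>z. ((cmod (exp z))\<^sup>2 * indicator S z) * F (exp z))"
    using oS Fm by (subst (asm) integrable_density) auto
  let ?H = "\<lambda>t \<theta>. ((cmod (exp (Complex t \<theta>)))\<^sup>2 * indicator S (Complex t \<theta>)) * F (exp (Complex t \<theta>))"
  have H: "?H t \<theta> = indicator {0<..<2 * pi} \<theta> * (indicator {a<..<b} t * (exp (2 * t) * F (exp (Complex t \<theta>))))" for t \<theta>
    by (auto simp: indicator_def S_def exp_double)
  have m: "(\<lambda>(x, y). Complex x y) \<in> borel_measurable (lborel \<Otimes>\<^sub>M lborel)"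
  proof -
    have "(\<lambda>p. Complex (fst p) (snd p)) \<in> borel_measurable borel"
      by (intro borel_measurable_continuous_onI continuous_intros)
    then show ?thesis by (simp add: lborel_prod case_prod_beta)
  qed
  have Hm: "(\<lambda>z. ((cmod (exp z))\<^sup>2 * indicator S z) * F (exp z)) \<in> borel_measurable borel"
    using oS Fm by measurable
  have "integrable (lborel \<Otimes>\<^sub>M lborel) (\<lambda>p. (\<lambda>z. ((cmod (exp z))\<^sup>2 * indicator S z) * F (exp z)) ((\<lambda>(x, y). Complex x y) p))"
    using i1 by (subst (asm) lborel_complex_pair, subst (asm) integrable_distr_eq) (use m Hm in auto)
  then have i2: "integrable (lborel \<Otimes>\<^sub>M lborel) (\<lambda>(t, \<theta>). ?H t \<theta>)" by (simp add: case_prod_beta')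
  have I2: "(\<integral>z. ((cmod (exp z))\<^sup>2 * indicator S z) * F (exp z) \<partial>lborel) =
    (\<integral>p. (\<lambda>z. ((cmod (exp z))\<^sup>2 * indicator S z) * F (exp z)) ((\<lambda>(x, y). Complex x y) p) \<partial>(lborel \<Otimes>\<^sub>M lborel))"
    by (subst lborel_complex_pair, subst integral_distr) (use m Hm in auto)
  also have "\<dots> = (\<integral>(t, \<theta>). ?H t \<theta> \<partial>(lborel \<Otimes>\<^sub>M lborel))" by (simp add: case_prod_beta')
  also have "\<dots> = (\<integral>\<theta>. (\<integral>t. ?H t \<theta> \<partial>lborel) \<partial>lborel)"
    by (rule lborel_pair.integral_snd[OF i2, symmetric])
  also have "\<dots> = (\<integral>\<theta>. indicator {0<..<2 * pi} \<theta> * (\<integral>t. indicator {a<..<b} t * (exp (2 * t) * F (exp (Complex t \<theta>))) \<partial>lborel) \<partial>lborel)"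
    unfolding H by simp
  finally show "(\<integral>z. F z \<partial>lborel) =
      (\<integral>\<theta>. indicator {0<..<2 * pi} \<theta> * (\<integral>t. indicator {a<..<b} t * (exp (2 * t) * F (exp (Complex t \<theta>))) \<partial>lborel) \<partial>lborel)"
    using I1 by simp
  show "integrable lborel (\<lambda>\<theta>. indicator {0<..<2 * pi} \<theta> * (\<integral>t. indicator {a<..<b} t * (exp (2 * t) * F (exp (Complex t \<theta>))) \<partial>lborel))"
    using lborel_pair.integrable_snd[OF i2] unfolding H by simp
qed

text \<open>\<open>smooth_ramp (n x) / n\<close> is a twice differentiable approximation of \<open>max 0 x\<close>; applied to \<open>r - u\<close>
  in Green's identity, its second derivative \<open>tent\<close> concentrates on the level curve.\<close>

definition tent :: "real \<Rightarrow> real" where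
  "tent x = max 0 x - 2 * max 0 (x - 1) + max 0 (x - 2)"
definition smooth_step :: "real \<Rightarrow> real" where
  "smooth_step x = (max 0 x)\<^sup>2 / 2 - (max 0 (x - 1))\<^sup>2 + (max 0 (x - 2))\<^sup>2 / 2"
definition smooth_ramp :: "real \<Rightarrow> real" where
  "smooth_ramp x = max 0 x ^ 3 / 6 - max 0 (x - 1) ^ 3 / 3 + max 0 (x - 2) ^ 3 / 6"

lemma DERIV_max_0_power:
  assumes "n \<ge> 2"
  shows "((\<lambda>x. max 0 x ^ n) has_real_derivative n * max 0 x ^ (n - 1)) (at x)"
proof -
  consider "x > 0" | "x < 0" | "x = 0" by linarith
  then show ?thesis
  proof cases
    case 1
    have "((\<lambda>x. x ^ n) has_real_derivative n * max 0 x ^ (n - 1)) (at x)"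
      using 1 by (auto intro!: derivative_eq_intros)
    then show ?thesis
      by (rule has_field_derivative_transform_within_open[where S = "{0<..}"]) (use 1 in auto)
  next
    case 2
    have "((\<lambda>x. 0) has_real_derivative n * max 0 x ^ (n - 1)) (at x)"
      using 2 assms by (simp add: zero_power)
    then show ?thesis
      by (rule has_field_derivative_transform_within_open[where S = "{..<0}"]) (use 2 assms in auto)
  next
    case 3
    have "((\<lambda>h. (max 0 (0 + h) ^ n - max 0 0 ^ n) / h) \<longlongrightarrow> 0) (at (0::real))"
    proof (rule Lim_null_comparison)
      show "\<forall>\<^sub>F h in at 0. norm ((max 0 (0 + h) ^ n - max 0 0 ^ n) / h) \<le> \<bar>h\<bar> ^ (n - 1)" for n :: nat
      proof (rule always_eventually, rule allI)
        fix h :: real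
        show "norm ((max 0 (0 + h) ^ n - max 0 0 ^ n) / h) \<le> \<bar>h\<bar> ^ (n - 1)"
          by (cases n; cases "h > 0") (auto simp: max_def)
      qed
      have "((\<lambda>h. \<bar>h\<bar> ^ (n - 1)) \<longlongrightarrow> \<bar>0\<bar> ^ (n - 1)) (at (0::real))" by (intro tendsto_intros)
      then show "((\<lambda>h::real. \<bar>h\<bar> ^ (n - 1)) \<longlongrightarrow> 0) (at 0)"
        using assms by (simp add: zero_power)
    qed
    moreover have "real n * max 0 0 ^ (n - 1) = 0" using assms by (simp add: zero_power)
    ultimately show ?thesis unfolding 3 DERIV_def by (simp only:)
  qed
qed

lemma DERIV_max_0_power':
  assumes "n \<ge> 2"
  shows "((\<lambda>x. max 0 (x - c) ^ n) has_real_derivative n * max 0 (x - c) ^ (n - 1)) (at x)"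
proof -
  have "((\<lambda>x. x - c) has_real_derivative 1) (at x)" by (auto intro!: derivative_eq_intros)
  from DERIV_chain2[where f = "\<lambda>x. max 0 x ^ n", OF DERIV_max_0_power[OF assms] this]
  show ?thesis by simp
qed

lemma DERIV_smooth_ramp: "(smooth_ramp has_real_derivative smooth_step x) (at x)"
proof -
  have "(smooth_ramp has_real_derivative
     3 * max 0 x ^ 2 / 6 - 3 * max 0 (x - 1) ^ 2 / 3 + 3 * max 0 (x - 2) ^ 2 / 6) (at x)"
    unfolding smooth_ramp_def[abs_def]
    using DERIV_max_0_power[of 3 x] DERIV_max_0_power'[of 3 1 x] DERIV_max_0_power'[of 3 2 x]
    by (intro DERIV_add DERIV_diff DERIV_cdivide) auto
  then show ?thesis by (simp add: smooth_step_def)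
qed

lemma DERIV_smooth_step: "(smooth_step has_real_derivative tent x) (at x)"
proof -
  have "(smooth_step has_real_derivative
     2 * max 0 x / 2 - 2 * max 0 (x - 1) + 2 * max 0 (x - 2) / 2) (at x)"
    unfolding smooth_step_def[abs_def]
    using DERIV_max_0_power[of 2 x] DERIV_max_0_power'[of 2 1 x] DERIV_max_0_power'[of 2 2 x]
    by (intro DERIV_add DERIV_diff DERIV_cdivide) auto
  then show ?thesis by (simp add: tent_def)
qed

lemma tent_nonneg: "tent x \<ge> 0"
  and tent_eq_0: "x \<le> 0 \<or> x \<ge> 2 \<Longrightarrow> tent x = 0"
  unfolding tent_def by (auto simp: max_def)

lemma continuous_on_tent: "continuous_on S tent"
  unfolding tent_def[abs_def] by (intro continuous_intros)

lemma smooth_step_eq: "x \<le> 0 \<Longrightarrow> smooth_step x = 0" "x \<ge> 2 \<Longrightarrow> smooth_step x = 1"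
  by (auto simp: smooth_step_def max_def power2_eq_square field_simps)

lemma smooth_step_mono: "x \<le> y \<Longrightarrow> smooth_step x \<le> smooth_step y"
  by (rule DERIV_nonneg_imp_nondecreasing) (use DERIV_smooth_step tent_nonneg in blast)+

lemma smooth_step_bounds: "0 \<le> smooth_step x" "smooth_step x \<le> 1"
  using smooth_step_mono[of "min 0 x" x] smooth_step_mono[of x "max 2 x"] by (auto simp: smooth_step_eq)

lemma smooth_ramp_eq_0: "x \<le> 0 \<Longrightarrow> smooth_ramp x = 0"
  by (simp add: smooth_ramp_def max_def)

lemma smooth_ramp_mono: "x \<le> y \<Longrightarrow> smooth_ramp x \<le> smooth_ramp y"
  by (rule DERIV_nonneg_imp_nondecreasing) (use DERIV_smooth_ramp smooth_step_bounds(1) in blast)+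

text \<open>After rescaling, \<open>smooth_ramp (n * x) / n\<close> stays below
  \<open>max 0 x\<close> by at most \<open>2 / n\<close>.\<close>

lemma smooth_ramp_bounds: "0 \<le> smooth_ramp x" "smooth_ramp x \<le> max 0 x" "max 0 x - 2 \<le> smooth_ramp x"
proof -
  show 0: "0 \<le> smooth_ramp x" for x
    using smooth_ramp_mono[of "min 0 x" x] by (simp add: smooth_ramp_eq_0)
  have "smooth_ramp x - x \<le> smooth_ramp 0 - 0" if "0 \<le> x"
  proof (rule DERIV_nonpos_imp_nonincreasing[OF that])
    show "\<exists>y. ((\<lambda>x. smooth_ramp x - x) has_real_derivative y) (at x) \<and> y \<le> 0" for x
      using DERIV_diff[OF DERIV_smooth_ramp[of x] DERIV_ident] smooth_step_bounds(2)[of x]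
      by (intro exI[of _ "smooth_step x - 1"]) auto
  qed
  then show "smooth_ramp x \<le> max 0 x" by (cases "x \<ge> 0") (auto simp: smooth_ramp_eq_0)
  have "smooth_ramp 2 - 2 \<le> smooth_ramp x - x" if "2 \<le> x"
  proof (rule DERIV_nonneg_imp_nondecreasing[OF that])
    show "\<exists>y. ((\<lambda>x. smooth_ramp x - x) has_real_derivative y) (at t) \<and> 0 \<le> y" if "2 \<le> t" for t
      using DERIV_diff[OF DERIV_smooth_ramp[of t] DERIV_ident] smooth_step_eq(2)[OF that]
      by (intro exI[of _ "smooth_step t - 1"]) auto
  qed
  then show "max 0 x - 2 \<le> smooth_ramp x" using 0[of x] 0[of 2] by (cases "x \<ge> 2") auto
qed

section \<open>Level curves as radial graphs\<close>

context disc_annulus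
begin

text \<open>The closed annulus loses the point 1, where \<open>W\<close> has its pole;
  \<open>w\<close> gets the default value 0 there and off the annulus, which makes it Borel on the
  whole plane.\<close>

definition "A = {z. exp t0 \<le> cmod z \<and> cmod z \<le> 1} - {1}"
definition "w z = (if z \<in> A then W z else 0)"

lemma V_ge: "exp t0 \<le> cmod z \<Longrightarrow> cmod z \<le> 1 \<Longrightarrow> q \<le> V z"
proof -
  assume z: "exp t0 \<le> cmod z" "cmod z \<le> 1"
  then have Q: "q \<le> Q z" by (rule Q_ge)
  then have "0 \<le> (R z)\<^sup>2 / Q z" using q by (intro divide_nonneg_nonneg) auto
  then show "q \<le> V z" using Q unfolding V_def by linarith
qed

lemma A_sub: "A \<subseteq> cball 0 1 - {1}"
  by (auto simp: A_def)

lemma cont_W: "continuous_on A W"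
proof -
  have "continuous_on A Q" "continuous_on A R"
    using cont_Q cont_R by (auto elim!: continuous_on_subset simp: A_def)
  moreover have "Q z \<noteq> 0" if "z \<in> A" for z using Q_ge[of z] q that by (force simp: A_def)
  ultimately show ?thesis
    unfolding W_def[abs_def] V_def
    by (intro continuous_intros continuous_on_subset[OF continuous_on_one_minus_Re_powr' A_sub]) auto
qed

lemma borel_A [measurable]: "A \<in> sets borel"
proof -
  have "closed {z::complex. exp t0 \<le> cmod z \<and> cmod z \<le> 1}"
    by (intro closed_Collect_conj closed_Collect_le continuous_intros)
  then show ?thesis unfolding A_def by (intro sets.Diff) auto
qed

lemma borel_w [measurable]: "w \<in> borel_measurable borel"
  unfolding w_def[abs_def]
  by (rule borel_measurable_continuous_on_if[OF borel_A cont_W continuous_on_const])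

lemma w_bounds:
  assumes "z \<in> A"
  shows "q * (1 - Re z) powr (- 1 / 4) \<le> w z" "w z \<le> C * (1 - Re z) powr (- 1 / 4)"
proof -
  have "q \<le> V z" "V z \<le> C" using V_ge[of z] V_le[of z] assms by (auto simp: A_def)
  then show "q * (1 - Re z) powr (- 1 / 4) \<le> w z" "w z \<le> C * (1 - Re z) powr (- 1 / 4)"
    using assms mult_right_mono[of q "V z" "(1 - Re z) powr (- 1 / 4)"]
      mult_right_mono[of "V z" C "(1 - Re z) powr (- 1 / 4)"]
    by (auto simp: w_def W_def mult.commute)
qed

lemma w_nonneg: "w z \<ge> 0"
proof (cases "z \<in> A")
  case True
  have "0 \<le> q * (1 - Re z) powr (- 1 / 4)" using q by simp
  then show ?thesis using w_bounds(1)[OF True] by linarith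
qed (simp add: w_def)

text \<open>The left-hand side is the sum of the squares of the derivatives in the logarithmic
  radius and in the angle. Splitting off the former as a factor leaves \<open>w\<close>; that factor
  later becomes the Jacobian of \<open>U\<close> along the ray.\<close>

lemma gradient_eq:
  assumes "z \<in> A" "cmod z < 1"
  shows "(cmod z)\<^sup>2 * ((ux z)\<^sup>2 + (uy z)\<^sup>2) = ((1 - Re z) powr (- 1 / 4) * Q z) * w z"
proof -
  define a where "a = (1 - Re z) powr (- 1 / 4)"
  have Q: "Q z \<noteq> 0" using Q_ge[of z] q assms by (force simp: A_def)
  have e: "Re z * ux z + Im z * uy z = a * Q z" "- Im z * ux z + Re z * uy z = a * R z"
    using radial_derivative_eq[of z] assms by (auto simp: A_def a_def)
  have "(cmod z)\<^sup>2 * ((ux z)\<^sup>2 + (uy z)\<^sup>2) =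
     (Re z * ux z + Im z * uy z)\<^sup>2 + (- Im z * ux z + Re z * uy z)\<^sup>2"
    by (subst cmod_power2) (simp add: power2_eq_square algebra_simps)
  also have "\<dots> = (a * Q z) * (a * (Q z + (R z)\<^sup>2 / Q z))"
    unfolding e using Q by (simp add: power2_eq_square field_simps)
  finally show ?thesis using assms by (simp add: w_def W_def V_def a_def)
qed

definition "U \<theta> t = u (exp (Complex t \<theta>))"
definition "U' \<theta> t = (1 - Re (exp (Complex t \<theta>))) powr (- 1 / 4) * Q (exp (Complex t \<theta>))"

lemma exp_polar_in_A: "t0 \<le> t \<Longrightarrow> t < 0 \<Longrightarrow> exp (Complex t \<theta>) \<in> A"
proof -
  assume t: "t0 \<le> t" "t < 0"
  then have "cmod (exp (Complex t \<theta>)) < 1" by simp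
  then have "exp (Complex t \<theta>) \<noteq> 1" by (metis norm_one less_irrefl)
  then show ?thesis using t by (simp add: A_def)
qed

lemma exp_polar_in_disc: "t < 0 \<Longrightarrow> exp (Complex t \<theta>) \<in> unit_disc"
  by simp

lemma continuous_on_exp_polar: "continuous_on S (\<lambda>t. exp (Complex t \<theta>))"
  unfolding Complex_eq by (intro continuous_intros)

lemma U_deriv: "t < 0 \<Longrightarrow> (U \<theta> has_real_derivative U' \<theta> t) (at t)"
  unfolding U_def[abs_def] U'_def by (rule u_radial)

lemma U'_pos: "t0 \<le> t \<Longrightarrow> t < 0 \<Longrightarrow> U' \<theta> t > 0"
proof -
  assume t: "t0 \<le> t" "t < 0"
  have "q \<le> Q (exp (Complex t \<theta>))" using t by (intro Q_ge) auto
  moreover have "1 - Re (exp (Complex t \<theta>)) > 0"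
    using one_minus_Re_pos[OF exp_polar_in_disc[OF t(2)]] .
  ultimately show ?thesis using q by (simp add: U'_def)
qed

lemma cont_U: "continuous_on {..0} (U \<theta>)"
  unfolding U_def[abs_def]
  by (rule continuous_on_compose2[OF cont_u continuous_on_exp_polar]) auto

lemma cont_U': "continuous_on {..<0} (U' \<theta>)"
proof -
  have *: "exp (Complex t \<theta>) \<in> cball 0 1 - {1}" if "t < 0" for t
    using one_minus_Re_pos[OF exp_polar_in_disc[OF that, of \<theta>]] that by auto
  show ?thesis
    unfolding U'_def[abs_def]
    by (intro continuous_intros continuous_on_compose2[OF continuous_on_one_minus_Re_powr' continuous_on_exp_polar]
          continuous_on_compose2[OF cont_Q continuous_on_exp_polar]) (use * in auto)
qed

lemma U_strict:
  assumes st: "t0 \<le> s" "s < t" "t \<le> 0"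
  shows "U \<theta> s < U \<theta> t"
proof (rule DERIV_pos_imp_increasing_open[OF st(2)])
  show "continuous_on {s..t} (U \<theta>)" by (rule continuous_on_subset[OF cont_U]) (use st in auto)
  show "\<exists>y. (U \<theta> has_real_derivative y) (at x) \<and> 0 < y" if "s < x" "x < t" for x
    using U_deriv[of x \<theta>] U'_pos[of x \<theta>] st that by (intro exI[of _ "U' \<theta> x"]) auto
qed

lemma U_less_iff: "t0 \<le> s \<Longrightarrow> s \<le> 0 \<Longrightarrow> t0 \<le> t \<Longrightarrow> t \<le> 0 \<Longrightarrow> U \<theta> s < U \<theta> t \<longleftrightarrow> s < t"
  by (metis U_strict linorder_neqE_linordered_idom order_less_asym order_less_irrefl)

lemma U_t0: "t \<le> t0 \<Longrightarrow> U \<theta> t \<le> r0"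
  unfolding U_def by (rule u_le_r0) simp

lemma U_0: "U \<theta> 0 = 0"
  unfolding U_def by (rule u_boundary) simp

text \<open>The level curve \<open>u = r\<close> in polar form: \<open>T\<close> is the logarithmic
  radius at angle \<theta>, \<open>P\<close> (below) the point. The description is meaningful for
  \<open>r0 < r < 0\<close>.\<close>

definition "T r \<theta> = (THE t. t0 < t \<and> t < 0 \<and> U \<theta> t = r)"
definition "P r \<theta> = exp (Complex (T r \<theta>) \<theta>)"

lemma T_props:
  assumes r: "r0 < r" "r < 0"
  shows "t0 < T r \<theta>" "T r \<theta> < 0" "U \<theta> (T r \<theta>) = r"
proof -
  have "\<exists>t\<ge>t0. t \<le> 0 \<and> U \<theta> t = r"
    using r U_t0[of t0 \<theta>] U_0[of \<theta>] t0
    by (intro IVT') (auto intro: continuous_on_subset[OF cont_U])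
  then obtain t where t: "t0 \<le> t" "t \<le> 0" "U \<theta> t = r" by blast
  then have t': "t0 < t" "t < 0"
    using r U_t0[of t0 \<theta>] U_0[of \<theta>] by (auto simp: order.strict_iff_order)
  have "\<exists>!t. t0 < t \<and> t < 0 \<and> U \<theta> t = r"
  proof (rule ex1I[of _ t])
    fix s assume "t0 < s \<and> s < 0 \<and> U \<theta> s = r"
    then show "s = t" using t t' U_less_iff[of s t \<theta>] U_less_iff[of t s \<theta>] by auto
  qed (use t t' in auto)
  from theI'[OF this] show "t0 < T r \<theta>" "T r \<theta> < 0" "U \<theta> (T r \<theta>) = r"
    by (auto simp: T_def)
qed

lemma less_T_iff:
  assumes r: "r0 < r" "r < 0" and "t0 \<le> t" "t \<le> 0"
  shows "t < T r \<theta> \<longleftrightarrow> U \<theta> t < r" "T r \<theta> < t \<longleftrightarrow> r < U \<theta> t"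
  using U_less_iff[of t "T r \<theta>" \<theta>] U_less_iff[of "T r \<theta>" t \<theta>] T_props[OF r, of \<theta>] assms by auto

lemma P_props:
  assumes r: "r0 < r" "r < 0"
  shows "P r \<theta> \<in> A" "P r \<theta> \<in> unit_disc" "u (P r \<theta>) = r"
  using exp_polar_in_A[of "T r \<theta>" \<theta>] T_props[OF r, of \<theta>] by (auto simp: P_def U_def)

text \<open>By monotonicity along rays, \<open>T r \<theta> < y\<close> means
  \<open>r < U \<theta> y\<close>, an open condition on \<theta>.\<close>

lemma borel_T [measurable]:
  assumes r: "r0 < r" "r < 0"
  shows "T r \<in> borel_measurable borel"
proof (rule borel_measurableI_less)
  fix y
  have "{\<theta>. T r \<theta> < y} \<in> sets borel"
  proof -
    consider "y \<le> t0" | "y \<ge> 0" | "t0 < y" "y < 0" by linarith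
    then show ?thesis
    proof cases
      case 1
      then have "{\<theta>. T r \<theta> < y} = {}" using T_props(1)[OF r] by (auto simp: not_less intro: less_imp_le order.trans)
      then show ?thesis by simp
    next
      case 2
      then have "{\<theta>. T r \<theta> < y} = UNIV" using T_props(2)[OF r] by (auto intro: less_le_trans)
      then show ?thesis by simp
    next
      case 3
      have c: "continuous_on UNIV (\<lambda>\<theta>. exp (Complex y \<theta>))"
        unfolding Complex_eq by (intro continuous_intros)
      have "continuous_on UNIV (\<lambda>\<theta>. u (exp (Complex y \<theta>)))"
        by (rule continuous_on_compose2[OF cont_u c]) (use 3 in auto)
      then have "open {\<theta>. r < U \<theta> y}"
        unfolding U_def by (intro open_Collect_less continuous_on_const)
      moreover have "{\<theta>. T r \<theta> < y} = {\<theta>. r < U \<theta> y}" using less_T_iff(2)[OF r, of y] 3 by auto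
      ultimately show ?thesis by simp
    qed
  qed
  then show "{x \<in> space borel. T r x < y} \<in> sets borel" by simp
qed

lemma borel_P [measurable]:
  assumes r: "r0 < r" "r < 0"
  shows "P r \<in> borel_measurable borel"
proof -
  note [measurable] = borel_T[OF r]
  have "(\<lambda>z::complex. exp z) \<in> borel_measurable borel"
    by (intro borel_measurable_continuous_onI continuous_intros)
  then show ?thesis unfolding P_def[abs_def] Complex_eq by measurable
qed

lemma compact_sublevel:
  assumes "r < 0"
  shows "compact {z \<in> cball 0 1. u z \<le> r}" "{z \<in> cball 0 1. u z \<le> r} \<subseteq> unit_disc"
proof -
  have "closed {z \<in> cball 0 1. u z \<le> r}"
    by (intro continuous_on_closed_Collect_le cont_u continuous_on_const closed_cball)
  moreover have "{z \<in> cball 0 1. u z \<le> r} = cball 0 1 \<inter> {z \<in> cball 0 1. u z \<le> r}" by auto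
  ultimately show "compact {z \<in> cball 0 1. u z \<le> r}" by (metis compact_Int_closed compact_cball)
  show "{z \<in> cball 0 1. u z \<le> r} \<subseteq> unit_disc"
  proof
    fix z assume z: "z \<in> {z \<in> cball 0 1. u z \<le> r}"
    then have "cmod z \<noteq> 1" using u_boundary[of z] assms by auto
    then show "z \<in> unit_disc" using z by simp
  qed
qed

text \<open>The tent in the variable \<open>U \<theta> t\<close> is an approximate delta at \<open>t = T r \<theta>\<close>.\<close>
definition "ker r n \<theta> t = n * tent (n * (r - U \<theta> t)) * U' \<theta> t"

text \<open>The kernel is the derivative of \<open>- smooth_step (n * (r - U \<theta> t))\<close>,
  which runs from -1 at \<open>t0\<close> to 0 at \<open>T r \<theta>\<close>; the condition
  \<open>n * (r - r0) \<ge> 2\<close> places the whole tent between these endpoints.\<close>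

lemma kernel_integral:
  assumes r: "r0 < r" "r < 0" and n: "n > 0" "n * (r - r0) \<ge> 2"
  shows "set_integrable lborel {t0..T r \<theta>} (ker r n \<theta>)"
    "(LINT t:{t0..T r \<theta>}|lborel. ker r n \<theta> t) = 1"
    "t0 \<le> t \<Longrightarrow> t < 0 \<Longrightarrow> ker r n \<theta> t \<ge> 0"
proof -
  note T = T_props[OF r, of \<theta>]
  have cU: "continuous_on {..<0} (U \<theta>)" by (rule continuous_on_subset[OF cont_U]) auto
  have ck: "continuous_on {..<0} (ker r n \<theta>)"
    unfolding ker_def[abs_def]
    by (intro continuous_intros cont_U' cU continuous_on_compose2[OF continuous_on_tent[of UNIV]]) auto
  show "set_integrable lborel {t0..T r \<theta>} (ker r n \<theta>)"
    by (rule borel_integrable_atLeastAtMost', rule continuous_on_subset[OF ck]) (use T in auto)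
  have d: "((\<lambda>t. - smooth_step (n * (r - U \<theta> t))) has_real_derivative ker r n \<theta> t) (at t)" if "t < 0" for t
  proof -
    have "((\<lambda>t. n * (r - U \<theta> t)) has_real_derivative - n * U' \<theta> t) (at t)"
      by (auto intro!: derivative_eq_intros U_deriv that)
    from DERIV_minus[OF DERIV_chain2[OF DERIV_smooth_step this]] show ?thesis
      by (simp add: ker_def mult_ac)
  qed
  have "(\<integral>t. ker r n \<theta> t * indicator {t0..T r \<theta>} t \<partial>lborel) =
     - smooth_step (n * (r - U \<theta> (T r \<theta>))) - - smooth_step (n * (r - U \<theta> t0))"
    using T d ck by (intro integral_FTC_Icc_real) (auto simp: continuous_on_eq_continuous_at)
  moreover have "n * (r - U \<theta> t0) \<ge> 2"
  proof -
    have "n * (r - r0) \<le> n * (r - U \<theta> t0)" using U_t0[of t0 \<theta>] n by (intro mult_left_mono) auto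
    then show ?thesis using n by linarith
  qed
  ultimately show "(LINT t:{t0..T r \<theta>}|lborel. ker r n \<theta> t) = 1"
    using T by (simp add: smooth_step_eq set_lebesgue_integral_def mult.commute)
  show "t0 \<le> t \<Longrightarrow> t < 0 \<Longrightarrow> ker r n \<theta> t \<ge> 0"
    unfolding ker_def using n U'_pos[of t \<theta>] tent_nonneg by (intro mult_nonneg_nonneg) auto
qed

text \<open>An average against a probability density that lives where \<open>U\<close> differs from
  \<open>r\<close> by at most \<open>2 / n\<close>.\<close>

lemma kernel_estimate:
  assumes r: "r0 < r" "r < 0" and n: "n > 0" "n * (r - r0) \<ge> 2"
    and \<Psi>: "continuous_on {t0..T r \<theta>} \<Psi>"
    and le: "\<And>t. t0 \<le> t \<Longrightarrow> t \<le> T r \<theta> \<Longrightarrow> r - 2 / n \<le> U \<theta> t \<Longrightarrow> \<bar>\<Psi> t - c\<bar> \<le> \<epsilon>"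
  shows "\<bar>(LINT t:{t0..T r \<theta>}|lborel. ker r n \<theta> t * \<Psi> t) - c\<bar> \<le> \<epsilon>"
proof -
  note T = T_props[OF r, of \<theta>] and k = kernel_integral[OF r n, where \<theta> = \<theta>]
  have cU: "continuous_on {t0..T r \<theta>} (U \<theta>)" by (rule continuous_on_subset[OF cont_U]) (use T in auto)
  have cU': "continuous_on {t0..T r \<theta>} (U' \<theta>)" by (rule continuous_on_subset[OF cont_U']) (use T in auto)
  have ck: "continuous_on {t0..T r \<theta>} (ker r n \<theta>)"
    unfolding ker_def[abs_def]
    by (intro continuous_intros cU cU' continuous_on_compose2[OF continuous_on_tent[of UNIV]]) auto
  have i1: "set_integrable lborel {t0..T r \<theta>} (\<lambda>t. ker r n \<theta> t * \<Psi> t)"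
    by (rule borel_integrable_atLeastAtMost') (intro continuous_intros ck \<Psi>)
  have i2: "set_integrable lborel {t0..T r \<theta>} (\<lambda>t. ker r n \<theta> t * (\<Psi> t - c))"
    by (rule borel_integrable_atLeastAtMost') (intro continuous_intros ck \<Psi>)
  have kc: "(LINT t:{t0..T r \<theta>}|lborel. ker r n \<theta> t * c) = c"
    using k(2) by simp
  have ikc: "set_integrable lborel {t0..T r \<theta>} (\<lambda>t. ker r n \<theta> t * c)"
    using k(1) by simp
  have "(LINT t:{t0..T r \<theta>}|lborel. ker r n \<theta> t * \<Psi> t) - c
      = (LINT t:{t0..T r \<theta>}|lborel. ker r n \<theta> t * \<Psi> t) - (LINT t:{t0..T r \<theta>}|lborel. ker r n \<theta> t * c)"
    unfolding kc ..
  also have "\<dots> = (LINT t:{t0..T r \<theta>}|lborel. ker r n \<theta> t * \<Psi> t - ker r n \<theta> t * c)"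
    using i1 ikc by (rule set_integral_diff(2)[symmetric])
  also have "\<dots> = (LINT t:{t0..T r \<theta>}|lborel. ker r n \<theta> t * (\<Psi> t - c))"
    by (simp add: algebra_simps)
  finally have e: "(LINT t:{t0..T r \<theta>}|lborel. ker r n \<theta> t * \<Psi> t) - c =
     (LINT t:{t0..T r \<theta>}|lborel. ker r n \<theta> t * (\<Psi> t - c))" .
  have ie: "set_integrable lborel {t0..T r \<theta>} (\<lambda>t. ker r n \<theta> t * \<epsilon>)"
    using k(1) by simp
  have pt: "\<bar>ker r n \<theta> t * (\<Psi> t - c)\<bar> \<le> ker r n \<theta> t * \<epsilon>" if t: "t \<in> {t0..T r \<theta>}" for t
  proof (cases "r - 2 / n \<le> U \<theta> t")
    case True
    then show ?thesis
      using le[of t] t k(3)[of t] T by (auto simp: abs_mult intro!: mult_left_mono)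
  next
    case False
    then have "n * (r - U \<theta> t) \<ge> 2" using n by (simp add: field_simps)
    then show ?thesis by (simp add: ker_def tent_eq_0)
  qed
  have "\<bar>LINT t:{t0..T r \<theta>}|lborel. ker r n \<theta> t * (\<Psi> t - c)\<bar>
      \<le> (LINT t:{t0..T r \<theta>}|lborel. \<bar>ker r n \<theta> t * (\<Psi> t - c)\<bar>)"
    using set_integral_norm_bound[OF i2] by simp
  also have "\<dots> \<le> (LINT t:{t0..T r \<theta>}|lborel. ker r n \<theta> t * \<epsilon>)"
    using set_integrable_abs[OF i2] ie pt by (rule set_integral_mono)
  also have "\<dots> = \<epsilon>" using k(2) by simp
  finally show ?thesis unfolding e .
qed

end

lemma integrable_extend_zero:
  fixes g :: "complex \<Rightarrow> real"
  assumes "continuous_on S g" "open S" "compact K" "K \<subseteq> S" "\<And>z. z \<in> S - K \<Longrightarrow> g z = 0"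
  shows "integrable lborel (\<lambda>z. if z \<in> S then g z else 0)"
  by (rule integrable_continuous_compact_support[OF continuous_on_extend_zero[OF assms] assms(3)])
     (use assms in auto)

section \<open>From Green's identity to integrals over level curves\<close>

context disc_annulus
begin

lemma kernel_tendsto:
  assumes r: "r0 < r" "r < 0" and N: "N > 0" "N * (r - r0) \<ge> 2"
    and \<Psi>: "continuous_on {t0..T r \<theta>} \<Psi>"
  shows "(\<lambda>m. LINT t:{t0..T r \<theta>}|lborel. ker r (real m + N) \<theta> t * \<Psi> t) \<longlonglongrightarrow> \<Psi> (T r \<theta>)"
proof (rule LIMSEQ_I)
  fix e :: real assume e: "e > 0"
  note T = T_props[OF r, of \<theta>]
  obtain d where d: "d > 0" "\<And>t. t \<in> {t0..T r \<theta>} \<Longrightarrow> dist t (T r \<theta>) < d \<Longrightarrow> dist (\<Psi> t) (\<Psi> (T r \<theta>)) < e / 2"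
    using \<Psi> T e unfolding continuous_on_iff by (metis atLeastAtMost_iff half_gt_zero less_imp_le order_refl)
  \<comment> \<open>A point \<open>s\<close> slightly inside the level curve converts closeness in
    value into closeness in radius: once \<open>2 / n\<close> is below
    \<open>r - U \<theta> s\<close>, the kernel charges only the interval from \<open>s\<close> to
    \<open>T r \<theta>\<close>.\<close>
  define s where "s = max t0 (T r \<theta> - d / 2)"
  have s: "t0 \<le> s" "s < T r \<theta>" "T r \<theta> - s < d" using d T by (auto simp: s_def)
  have Us: "U \<theta> s < r" using less_T_iff(1)[OF r, of s \<theta>] s T by auto
  obtain m0 where m0: "real m0 > 2 / (r - U \<theta> s)" using reals_Archimedean2 by blast
  show "\<exists>no. \<forall>m\<ge>no. norm ((LINT t:{t0..T r \<theta>}|lborel. ker r (real m + N) \<theta> t * \<Psi> t) - \<Psi> (T r \<theta>)) < e"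
  proof (intro exI allI impI)
    fix m assume "m \<ge> m0"
    then have m: "real m + N > 2 / (r - U \<theta> s)" using m0 N by linarith
    have Nm: "(real m + N) * (r - r0) \<ge> 2"
      using N mult_nonneg_nonneg[of "real m" "r - r0"] r by (simp add: algebra_simps)
    have "\<bar>(LINT t:{t0..T r \<theta>}|lborel. ker r (real m + N) \<theta> t * \<Psi> t) - \<Psi> (T r \<theta>)\<bar> \<le> e / 2"
    proof (rule kernel_estimate[OF r _ Nm \<Psi>])
      fix t assume t: "t0 \<le> t" "t \<le> T r \<theta>" "r - 2 / (real m + N) \<le> U \<theta> t"
      have "2 / (real m + N) < r - U \<theta> s" using m Us N by (simp add: field_simps)
      then have "U \<theta> s < U \<theta> t" using t(3) by linarith
      then have "s < t" using U_less_iff[of s t \<theta>] s t T by auto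
      then have "dist t (T r \<theta>) < d" using s t by (simp add: dist_real_def)
      then have "dist (\<Psi> t) (\<Psi> (T r \<theta>)) < e / 2" using d(2)[of t] t by auto
      then show "\<bar>\<Psi> t - \<Psi> (T r \<theta>)\<bar> \<le> e / 2" by (simp add: dist_real_def)
    qed (use N in simp)
    then show "norm ((LINT t:{t0..T r \<theta>}|lborel. ker r (real m + N) \<theta> t * \<Psi> t) - \<Psi> (T r \<theta>)) < e"
      using e by simp
  qed
qed

text \<open>In polar coordinates the Jacobian \<open>exp (2 * t)\<close> combines with the squared
  gradient to \<open>U' * w\<close>, and the tent times \<open>U'\<close> is the kernel. Beyond the
  level curve and inside the inner disc the tent vanishes.\<close>

lemma polar_integrand:
  fixes \<psi> :: "complex \<Rightarrow> real"
  assumes r: "r0 < r" "r < 0" and n: "n > 0" "n * (r - r0) \<ge> 2"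
  defines "F \<equiv> \<lambda>z. if z \<in> unit_disc then \<psi> z * (n * tent (n * (r - u z)) * ((ux z)\<^sup>2 + (uy z)\<^sup>2)) else 0"
  shows "F z \<noteq> 0 \<Longrightarrow> exp t0 < cmod z \<and> cmod z < exp 0"
    and "indicator {t0<..<0} t * (exp (2 * t) * F (exp (Complex t \<theta>))) =
      indicator {t0..T r \<theta>} t * (ker r n \<theta> t * (\<psi> (exp (Complex t \<theta>)) * w (exp (Complex t \<theta>))))"
proof -
  note T = T_props[OF r, of \<theta>]
  have z0: "tent (n * (r - x)) = 0" if "x \<le> r0" for x
  proof -
    have "n * (r - r0) \<le> n * (r - x)" using that n by (intro mult_left_mono) auto
    then show ?thesis using n by (intro tent_eq_0) linarith
  qed
  show "exp t0 < cmod z \<and> cmod z < exp 0" if "F z \<noteq> 0"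
  proof -
    have z: "cmod z < 1" "tent (n * (r - u z)) \<noteq> 0" using that by (auto simp: F_def split: if_splits)
    then have "\<not> cmod z \<le> exp t0" using z0 u_le_r0 by blast
    then show ?thesis using z by simp
  qed
  show "indicator {t0<..<0} t * (exp (2 * t) * F (exp (Complex t \<theta>))) =
      indicator {t0..T r \<theta>} t * (ker r n \<theta> t * (\<psi> (exp (Complex t \<theta>)) * w (exp (Complex t \<theta>))))"
  proof -
    let ?z = "exp (Complex t \<theta>)"
    consider "t = t0" | "t0 < t" "t < 0" | "t < t0 \<or> 0 \<le> t" by linarith
    then show ?thesis
    proof cases
      case 1
      then show ?thesis using z0[OF U_t0[of t \<theta>]] by (simp add: ker_def)
    next
      case 2
      have zA: "?z \<in> A" using 2 by (intro exp_polar_in_A) auto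
      have g: "exp (2 * t) * ((ux ?z)\<^sup>2 + (uy ?z)\<^sup>2) = U' \<theta> t * w ?z"
        using gradient_eq[OF zA] 2 by (simp add: U'_def exp_double)
      have "exp (2 * t) * F ?z = \<psi> ?z * (n * tent (n * (r - U \<theta> t))) * (exp (2 * t) * ((ux ?z)\<^sup>2 + (uy ?z)\<^sup>2))"
        using 2 by (simp add: F_def U_def)
      then have eq: "exp (2 * t) * F ?z = ker r n \<theta> t * (\<psi> ?z * w ?z)"
        unfolding g by (simp add: ker_def)
      show ?thesis
      proof (cases "t \<le> T r \<theta>")
        case True
        then show ?thesis using 2 eq by simp
      next
        case False
        then have "r < U \<theta> t" using less_T_iff(2)[OF r, of t \<theta>] 2 by auto
        then have "ker r n \<theta> t = 0" using n by (simp add: ker_def tent_eq_0 mult_pos_neg less_imp_le)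
        then show ?thesis using eq by simp
      qed
    next
      case 3
      then show ?thesis using T by (auto simp: indicator_def)
    qed
  qed
qed

text \<open>Green's identity for \<open>smooth_ramp (n * (r - u)) / n\<close>, which is supported in
  a compact sublevel set. Its Laplacian splits into the tent times n times the squared gradient,
  concentrating on the level curve, minus the smooth step times \<open>lap\<close>.\<close>

lemma smoothed_identity:
  assumes r: "r0 < r" "r < 0" and n: "n > 0"
    and p: "pd2 unit_disc \<psi> \<psi>x \<psi>y \<psi>xx \<psi>yy"
  defines "F \<equiv> \<lambda>z. if z \<in> unit_disc then \<psi> z * (n * tent (n * (r - u z)) * ((ux z)\<^sup>2 + (uy z)\<^sup>2)) else 0"
    and "F1 \<equiv> \<lambda>z. if z \<in> unit_disc then smooth_ramp (n * (r - u z)) / n * (\<psi>xx z + \<psi>yy z) else 0"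
    and "F2 \<equiv> \<lambda>z. if z \<in> unit_disc then \<psi> z * (smooth_step (n * (r - u z)) * lap z) else 0"
  shows "integrable lborel F" "integrable lborel F1" "integrable lborel F2"
    "(\<integral>z. F z \<partial>lborel) = (\<integral>z. F1 z \<partial>lborel) + (\<integral>z. F2 z \<partial>lborel)"
proof -
  let ?K = "{z \<in> cball 0 1. u z \<le> r}"
  note K = compact_sublevel[OF r(2)]
  note pu = pd2_u[unfolded pd2_def] and pp = p[unfolded pd2_def]
  have nn: "n * (r - u z) \<le> 0" if "z \<in> unit_disc - ?K" for z
  proof -
    have "r \<le> u z" using that by (auto simp: less_imp_le)
    then show ?thesis using n by (simp add: mult_nonneg_nonpos)
  qed
  have s: "continuous_on UNIV smooth_step" and t: "continuous_on UNIV smooth_ramp"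
    by (rule DERIV_continuous_on[OF has_field_derivative_at_within[OF DERIV_smooth_step]]
             DERIV_continuous_on[OF has_field_derivative_at_within[OF DERIV_smooth_ramp]])+
  have cu: "continuous_on unit_disc (\<lambda>z. n * (r - u z))" by (intro continuous_intros cont_u_disc)
  have cs: "continuous_on unit_disc (\<lambda>z. smooth_step (n * (r - u z)))"
    and ct: "continuous_on unit_disc (\<lambda>z. tent (n * (r - u z)))"
    and cr: "continuous_on unit_disc (\<lambda>z. smooth_ramp (n * (r - u z)))"
    by (rule continuous_on_compose2[OF s cu subset_UNIV] continuous_on_compose2[OF t cu subset_UNIV]
          continuous_on_compose2[OF continuous_on_tent cu subset_UNIV])+
  define a where "a = (\<lambda>z. smooth_ramp (n * (r - u z)) / n)"
  have DR: "((\<lambda>s. smooth_ramp (n * (r - s)) / n) has_real_derivative - smooth_step (n * (r - s))) (at s)" for s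
  proof -
    have "((\<lambda>s. n * (r - s)) has_real_derivative - n) (at s)" by (auto intro!: derivative_eq_intros)
    from DERIV_cdivide[OF DERIV_chain2[OF DERIV_smooth_ramp this], of n] show ?thesis using n by simp
  qed
  have DS: "((\<lambda>s. - smooth_step (n * (r - s))) has_real_derivative n * tent (n * (r - s))) (at s)" for s
  proof -
    have "((\<lambda>s. n * (r - s)) has_real_derivative - n) (at s)" by (auto intro!: derivative_eq_intros)
    from DERIV_minus[OF DERIV_chain2[OF DERIV_smooth_step this]] show ?thesis by (simp add: mult.commute)
  qed
  have pa: "pd2 unit_disc a (\<lambda>z. - smooth_step (n * (r - u z)) * ux z) (\<lambda>z. - smooth_step (n * (r - u z)) * uy z)
     (\<lambda>z. n * tent (n * (r - u z)) * ux z * ux z + uxx z * - smooth_step (n * (r - u z)))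
     (\<lambda>z. n * tent (n * (r - u z)) * uy z * uy z + uyy z * - smooth_step (n * (r - u z)))"
    unfolding pd2_def a_def
    using pu by (intro conjI ballI has_line_derivative_mult has_line_derivative_chain[OF _ DR]
      has_line_derivative_chain[OF _ DS] continuous_intros cs ct cr) (use n in auto)
  have "(LINT z:unit_disc|lborel. a z * (\<psi>xx z + \<psi>yy z) - \<psi> z *
     ((n * tent (n * (r - u z)) * ux z * ux z + uxx z * - smooth_step (n * (r - u z))) +
      (n * tent (n * (r - u z)) * uy z * uy z + uyy z * - smooth_step (n * (r - u z))))) = 0"
    by (rule green_identity[OF pa p open_ball K])
       (use nn in \<open>auto simp: a_def smooth_ramp_eq_0 smooth_step_eq tent_eq_0\<close>)
  moreover have "a z * (\<psi>xx z + \<psi>yy z) - \<psi> z *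
     ((n * tent (n * (r - u z)) * ux z * ux z + uxx z * - smooth_step (n * (r - u z))) +
      (n * tent (n * (r - u z)) * uy z * uy z + uyy z * - smooth_step (n * (r - u z))))
    = F1 z + F2 z - F z" if "z \<in> unit_disc" for z
    using that unfolding uxx_plus_uyy[symmetric] F_def F1_def F2_def a_def
    by (simp add: power2_eq_square algebra_simps)
  ultimately have 0: "(\<integral>z. F1 z + F2 z - F z \<partial>lborel) = 0"
    unfolding set_lebesgue_integral_def
    by (subst (asm) Bochner_Integration.integral_cong[OF refl, where g = "\<lambda>z. F1 z + F2 z - F z"])
       (auto simp: indicator_def F_def F1_def F2_def)
  show i: "integrable lborel F"
    unfolding F_def using pu pp
    by (intro integrable_extend_zero[OF _ open_ball K] continuous_intros ct) (use nn in \<open>auto simp: tent_eq_0\<close>)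
  show i1: "integrable lborel F1"
    unfolding F1_def using pp
    by (intro integrable_extend_zero[OF _ open_ball K] continuous_intros cr) (use nn n in \<open>auto simp: smooth_ramp_eq_0\<close>)
  show i2: "integrable lborel F2"
    unfolding F2_def using pp
    by (intro integrable_extend_zero[OF _ open_ball K] continuous_intros cs continuous_on_lap) (use nn in \<open>auto simp: smooth_step_eq\<close>)
  show "(\<integral>z. F z \<partial>lborel) = (\<integral>z. F1 z \<partial>lborel) + (\<integral>z. F2 z \<partial>lborel)"
    using 0 i i1 i2 by simp
qed

text \<open>The Lelong-Jensen formula; its left-hand side is the integral of \<open>\<psi>\<close> over the level curve \<open>u = r\<close>.\<close>

lemma level_identity:
  assumes r: "r0 < r" "r < 0" and p: "pd2 unit_disc \<psi> \<psi>x \<psi>y \<psi>xx \<psi>yy"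
  shows "integrable lborel (\<lambda>\<theta>. indicator {0<..<2 * pi} \<theta> * (\<psi> (P r \<theta>) * w (P r \<theta>)))"
    "integrable lborel (\<lambda>z. if z \<in> unit_disc \<and> u z < r then \<psi> z * lap z else 0)"
    "integrable lborel (\<lambda>z. if z \<in> unit_disc then max 0 (r - u z) * (\<psi>xx z + \<psi>yy z) else 0)"
    "(\<integral>\<theta>. indicator {0<..<2 * pi} \<theta> * (\<psi> (P r \<theta>) * w (P r \<theta>)) \<partial>lborel) =
      (\<integral>z. (if z \<in> unit_disc \<and> u z < r then \<psi> z * lap z else 0) \<partial>lborel) +
      (\<integral>z. (if z \<in> unit_disc then max 0 (r - u z) * (\<psi>xx z + \<psi>yy z) else 0) \<partial>lborel)"
proof -
  let ?K = "{z \<in> cball 0 1. u z \<le> r}"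
  note K = compact_sublevel[OF r(2)]
  note pp = p[unfolded pd2_def]
  have c\<psi>: "continuous_on unit_disc \<psi>" using pp by blast
  \<comment> \<open>A shift of the smoothing parameter that makes the kernel condition hold for
    every index from 0 on.\<close>
  define N where "N = 1 + 2 / (r - r0)"
  have N: "N > 0" "N * (r - r0) \<ge> 2"
  proof -
    show "N > 0" using r by (simp add: N_def add_pos_pos)
    have "N * (r - r0) = (r - r0) + 2" using r by (simp add: N_def field_simps)
    then show "N * (r - r0) \<ge> 2" using r by simp
  qed
  define n where "n = (\<lambda>m. real m + N)"
  have n: "n m > 0" "n m * (r - r0) \<ge> 2" for m
    using N mult_nonneg_nonneg[of "real m" "r - r0"] r by (auto simp: n_def algebra_simps intro: add_nonneg_pos)
  define F where "F = (\<lambda>m z. if z \<in> unit_disc then \<psi> z * (n m * tent (n m * (r - u z)) * ((ux z)\<^sup>2 + (uy z)\<^sup>2)) else 0)"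
  define F1 where "F1 = (\<lambda>m z. if z \<in> unit_disc then smooth_ramp (n m * (r - u z)) / n m * (\<psi>xx z + \<psi>yy z) else 0)"
  define F2 where "F2 = (\<lambda>m z. if z \<in> unit_disc then \<psi> z * (smooth_step (n m * (r - u z)) * lap z) else 0)"
  define L1 where "L1 = (\<lambda>z. if z \<in> unit_disc then max 0 (r - u z) * (\<psi>xx z + \<psi>yy z) else 0)"
  define L2 where "L2 = (\<lambda>z. if z \<in> unit_disc \<and> u z < r then \<psi> z * lap z else 0)"
  note S = smoothed_identity[OF r n(1) p, folded F_def F1_def F2_def]
  have SF: "integrable lborel (F m)" "integrable lborel (F1 m)" "integrable lborel (F2 m)"
    "(\<integral>z. F m z \<partial>lborel) = (\<integral>z. F1 m z \<partial>lborel) + (\<integral>z. F2 m z \<partial>lborel)" for m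
    using smoothed_identity[OF r n(1) p, of m] unfolding F_def F1_def F2_def by blast+
  have ninf: "filterlim n at_top sequentially"
    unfolding n_def add.commute[of _ N]
    by (rule filterlim_tendsto_add_at_top[OF tendsto_const filterlim_real_sequentially])
  have i1: "integrable lborel L1"
    unfolding L1_def using pp
    by (intro integrable_extend_zero[OF _ open_ball K] continuous_intros cont_u_disc) auto
  have lim1: "(\<lambda>m. \<integral>z. F1 m z \<partial>lborel) \<longlonglongrightarrow> (\<integral>z. L1 z \<partial>lborel)"
  proof (rule integral_dominated_convergence[where w = "\<lambda>z. \<bar>L1 z\<bar>"])
    show "L1 \<in> borel_measurable lborel" "\<And>m. F1 m \<in> borel_measurable lborel" using i1 SF by auto
    show "integrable lborel (\<lambda>z. \<bar>L1 z\<bar>)" using i1 by simp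
    show "AE z in lborel. (\<lambda>m. F1 m z) \<longlonglongrightarrow> L1 z"
    proof (rule AE_I2)
      fix z
      have "(\<lambda>m. smooth_ramp (n m * (r - u z)) / n m) \<longlonglongrightarrow> max 0 (r - u z)"
      proof (rule tendsto_sandwich)
        have nm: "max 0 (n m * (r - u z)) = n m * max 0 (r - u z)" for m
          using n(1)[of m] by (auto simp: max_def mult_le_0_iff zero_le_mult_iff)
        show "eventually (\<lambda>m. max 0 (r - u z) - 2 / n m \<le> smooth_ramp (n m * (r - u z)) / n m) sequentially"
        proof (intro always_eventually allI)
          fix m
          have "(n m * max 0 (r - u z) - 2) / n m \<le> smooth_ramp (n m * (r - u z)) / n m"
            using smooth_ramp_bounds(3)[of "n m * (r - u z)"] n(1)[of m] by (intro divide_right_mono) (auto simp: nm)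
          then show "max 0 (r - u z) - 2 / n m \<le> smooth_ramp (n m * (r - u z)) / n m"
            using n(1)[of m] by (simp add: diff_divide_distrib)
        qed
        show "eventually (\<lambda>m. smooth_ramp (n m * (r - u z)) / n m \<le> max 0 (r - u z)) sequentially"
        proof (intro always_eventually allI)
          fix m
          have "smooth_ramp (n m * (r - u z)) / n m \<le> (n m * max 0 (r - u z)) / n m"
            using smooth_ramp_bounds(2)[of "n m * (r - u z)"] n(1)[of m] by (intro divide_right_mono) (auto simp: nm)
          then show "smooth_ramp (n m * (r - u z)) / n m \<le> max 0 (r - u z)"
            using n(1)[of m] by simp
        qed
        have "(\<lambda>m. max 0 (r - u z) - 2 / n m) \<longlonglongrightarrow> max 0 (r - u z) - 0"
          by (intro tendsto_diff tendsto_const tendsto_divide_0[OF tendsto_const] filterlim_at_top_imp_at_infinity ninf)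
        then show "(\<lambda>m. max 0 (r - u z) - 2 / n m) \<longlonglongrightarrow> max 0 (r - u z)" by simp
      qed simp
      then have "(\<lambda>m. smooth_ramp (n m * (r - u z)) / n m * (\<psi>xx z + \<psi>yy z)) \<longlonglongrightarrow>
          max 0 (r - u z) * (\<psi>xx z + \<psi>yy z)" by (rule tendsto_mult_right)
      then show "(\<lambda>m. F1 m z) \<longlonglongrightarrow> L1 z"
        unfolding F1_def L1_def by (cases "z \<in> unit_disc") (simp_all only: if_True if_False tendsto_const)
    qed
    fix m
    show "AE z in lborel. norm (F1 m z) \<le> \<bar>L1 z\<bar>"
    proof (rule AE_I2)
      fix z
      have "smooth_ramp (n m * (r - u z)) \<le> n m * max 0 (r - u z)"
        using smooth_ramp_bounds(2)[of "n m * (r - u z)"] n(1)[of m]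
        by (auto simp: max_def mult_le_0_iff zero_le_mult_iff split: if_splits)
      then have "\<bar>smooth_ramp (n m * (r - u z)) / n m\<bar> \<le> \<bar>max 0 (r - u z)\<bar>"
        using smooth_ramp_bounds(1)[of "n m * (r - u z)"] n(1)[of m] by (simp add: divide_le_eq mult.commute)
      then show "norm (F1 m z) \<le> \<bar>L1 z\<bar>"
        unfolding F1_def L1_def real_norm_def
        by (cases "z \<in> unit_disc") (simp_all only: if_True if_False abs_mult mult_right_mono abs_ge_zero abs_zero order_refl)
    qed
  qed
  have dom: "integrable lborel (\<lambda>z. indicator ?K z * \<bar>\<psi> z * lap z\<bar>)"
  proof -
    have "continuous_on ?K (\<lambda>z. \<bar>\<psi> z * lap z\<bar>)"
      by (intro continuous_intros continuous_on_subset[OF c\<psi> K(2)] continuous_on_subset[OF continuous_on_lap K(2)])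
    from borel_integrable_compact[OF K(1) this] show ?thesis by simp
  qed
  have L2m: "L2 \<in> borel_measurable lborel"
  proof -
    have "open {z \<in> unit_disc. u z < r}"
    proof -
      have "{z \<in> unit_disc. u z < r} = unit_disc \<inter> u -` {..<r}" by auto
      then show ?thesis
        using continuous_open_preimage[OF cont_u_disc open_ball, of "{..<r}"] by (simp only:) simp
    qed
    moreover have "continuous_on {z \<in> unit_disc. u z < r} (\<lambda>z. \<psi> z * lap z)"
      by (intro continuous_intros continuous_on_subset[OF c\<psi>] continuous_on_subset[OF continuous_on_lap]) auto
    ultimately have "(\<lambda>z. if z \<in> {z \<in> unit_disc. u z < r} then \<psi> z * lap z else 0) \<in> borel_measurable borel"
      by (intro borel_measurable_continuous_on_if continuous_on_const) auto
    then show ?thesis by (simp add: L2_def)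
  qed
  have L2le: "norm (L2 z) \<le> indicator ?K z * \<bar>\<psi> z * lap z\<bar>" for z
    by (auto simp: L2_def indicator_def less_imp_le)
  have i2: "integrable lborel L2"
    by (rule Bochner_Integration.integrable_bound[OF dom L2m]) (use L2le in auto)
  have lim2: "(\<lambda>m. \<integral>z. F2 m z \<partial>lborel) \<longlonglongrightarrow> (\<integral>z. L2 z \<partial>lborel)"
  proof (rule integral_dominated_convergence[OF L2m _ dom])
    show "\<And>m. F2 m \<in> borel_measurable lborel" using SF by auto
    show "AE z in lborel. (\<lambda>m. F2 m z) \<longlonglongrightarrow> L2 z"
    proof (rule AE_I2)
      fix z
      have "(\<lambda>m. smooth_step (n m * (r - u z))) \<longlonglongrightarrow> (if u z < r then 1 else 0)"
      proof (cases "u z < r")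
        case True
        have "eventually (\<lambda>m. n m \<ge> 2 / (r - u z)) sequentially"
          using ninf by (simp add: filterlim_at_top)
        then have "eventually (\<lambda>m. smooth_step (n m * (r - u z)) = 1) sequentially"
          by (rule eventually_mono) (use True in \<open>auto intro!: smooth_step_eq simp: field_simps\<close>)
        then show ?thesis using True by (simp add: tendsto_eventually)
      next
        case False
        then have "smooth_step (n m * (r - u z)) = 0" for m
          using n(1)[of m] by (intro smooth_step_eq) (simp add: mult_nonneg_nonpos)
        then show ?thesis using False by simp
      qed
      then have "(\<lambda>m. \<psi> z * (smooth_step (n m * (r - u z)) * lap z)) \<longlonglongrightarrow> \<psi> z * ((if u z < r then 1 else 0) * lap z)"
        by (intro tendsto_mult tendsto_const)
      then show "(\<lambda>m. F2 m z) \<longlonglongrightarrow> L2 z"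
        unfolding F2_def L2_def by (cases "z \<in> unit_disc"; cases "u z < r")
          (simp_all only: if_True if_False tendsto_const simp_thms mult_1 mult_zero_left mult_zero_right)
    qed
    fix m
    show "AE z in lborel. norm (F2 m z) \<le> indicator ?K z * \<bar>\<psi> z * lap z\<bar>"
    proof (rule AE_I2)
      fix z
      show "norm (F2 m z) \<le> indicator ?K z * \<bar>\<psi> z * lap z\<bar>"
      proof (cases "z \<in> unit_disc \<and> u z \<le> r")
        case True
        then show ?thesis
          using smooth_step_bounds[of "n m * (r - u z)"]
          by (auto simp: F2_def abs_mult less_imp_le intro!: mult_left_mono mult_left_le_one_le)
      next
        case False
        then have "F2 m z = 0"
          using n(1)[of m] by (auto simp: F2_def not_le smooth_step_eq mult_nonneg_nonpos)
        then show ?thesis by simp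
      qed
    qed
  qed
  define \<Psi> where "\<Psi> = (\<lambda>\<theta> t. \<psi> (exp (Complex t \<theta>)) * w (exp (Complex t \<theta>)))"
  define J where "J = (\<lambda>m \<theta>. LINT t:{t0..T r \<theta>}|lborel. ker r (n m) \<theta> t * \<Psi> \<theta> t)"
  have cw: "continuous_on (unit_disc \<inter> A) w"
    by (rule continuous_on_eq[OF continuous_on_subset[OF cont_W]]) (auto simp: w_def)
  have c\<Psi>: "continuous_on {t0..T r \<theta>} (\<Psi> \<theta>)" for \<theta>
  proof -
    have "exp (Complex t \<theta>) \<in> unit_disc \<inter> A" if "t \<in> {t0..T r \<theta>}" for t
      using exp_polar_in_A[of t \<theta>] T_props[OF r, of \<theta>] that by auto
    then show ?thesis
      unfolding \<Psi>_def
      by (intro continuous_intros continuous_on_compose2[OF cw continuous_on_exp_polar]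
        continuous_on_compose2[OF c\<psi> continuous_on_exp_polar]) auto
  qed
  have Jeq: "(\<integral>t. indicator {t0<..<0} t * (exp (2 * t) * F m (exp (Complex t \<theta>))) \<partial>lborel) = J m \<theta>" for m \<theta>
    unfolding J_def set_lebesgue_integral_def \<Psi>_def F_def polar_integrand(2)[OF r n] by simp
  have polar: "integrable lborel (\<lambda>\<theta>. indicator {0<..<2 * pi} \<theta> * J m \<theta>)"
    "(\<integral>z. F m z \<partial>lborel) = (\<integral>\<theta>. indicator {0<..<2 * pi} \<theta> * J m \<theta> \<partial>lborel)" for m
    using polar_integral[OF SF(1)[of m], of t0 0] polar_integrand(1)[OF r n[of m], where \<psi> = \<psi>]
    unfolding Jeq by (auto simp: F_def)
  \<comment> \<open>The kernels are probability densities, so one bound of the integrand on this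
    compact set, which stays away from the pole, dominates all the averages
    \<open>J\<close>.\<close>
  obtain B where B: "\<And>z. z \<in> ?K \<inter> {z. exp t0 \<le> cmod z} \<Longrightarrow> norm (\<psi> z * w z) \<le> B"
  proof -
    have "compact (?K \<inter> {z. exp t0 \<le> cmod z})"
      by (intro compact_Int_closed K(1) closed_Collect_le continuous_intros)
    moreover have "?K \<inter> {z. exp t0 \<le> cmod z} \<subseteq> unit_disc \<inter> A"
    proof
      fix z assume z: "z \<in> ?K \<inter> {z. exp t0 \<le> cmod z}"
      then have "z \<in> unit_disc" using K(2) by blast
      moreover from this have "z \<noteq> 1" by auto
      ultimately show "z \<in> unit_disc \<inter> A" using z by (simp add: A_def)
    qed
    then have "continuous_on (?K \<inter> {z. exp t0 \<le> cmod z}) (\<lambda>z. \<psi> z * w z)"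
      by (intro continuous_intros continuous_on_subset[OF cw] continuous_on_subset[OF c\<psi>]) auto
    ultimately have "compact ((\<lambda>z. \<psi> z * w z) ` (?K \<inter> {z. exp t0 \<le> cmod z}))"
      using compact_continuous_image by blast
    then show ?thesis using that compact_imp_bounded by (force simp: bounded_iff)
  qed
  have JB: "\<bar>J m \<theta>\<bar> \<le> B" for m \<theta>
  proof -
    have "\<bar>J m \<theta> - 0\<bar> \<le> B"
      unfolding J_def
    proof (rule kernel_estimate[OF r n c\<Psi>])
      fix t assume t: "t0 \<le> t" "t \<le> T r \<theta>"
      then have "U \<theta> t \<le> r" using less_T_iff(2)[OF r, of t \<theta>] T_props[OF r, of \<theta>] by auto
      then have "exp (Complex t \<theta>) \<in> ?K \<inter> {z. exp t0 \<le> cmod z}"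
        using t T_props[OF r, of \<theta>] by (auto simp: U_def)
      then show "\<bar>\<Psi> \<theta> t - 0\<bar> \<le> B" using B unfolding \<Psi>_def by simp
    qed
    then show ?thesis by simp
  qed
  have \<Psi>T: "\<Psi> \<theta> (T r \<theta>) = \<psi> (P r \<theta>) * w (P r \<theta>)" for \<theta> by (simp add: \<Psi>_def P_def)
  let ?L = "\<lambda>\<theta>. indicator {0<..<2 * pi} \<theta> * (\<psi> (P r \<theta>) * w (P r \<theta>))"
  have Lm: "?L \<in> borel_measurable lborel"
  proof -
    note [measurable] = borel_P[OF r]
    have "(\<lambda>z. if z \<in> unit_disc then \<psi> z else 0) \<in> borel_measurable borel"
      by (intro borel_measurable_continuous_on_if c\<psi> continuous_on_const) auto
    then have "(\<lambda>\<theta>. if P r \<theta> \<in> unit_disc then \<psi> (P r \<theta>) else 0) \<in> borel_measurable borel"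
      using measurable_compose[OF borel_P[OF r], of _ borel] by blast
    moreover have "(\<lambda>\<theta>. if P r \<theta> \<in> unit_disc then \<psi> (P r \<theta>) else 0) = (\<lambda>\<theta>. \<psi> (P r \<theta>))"
      using P_props(2)[OF r] by auto
    ultimately have [measurable]: "(\<lambda>\<theta>. \<psi> (P r \<theta>)) \<in> borel_measurable borel" by simp
    show ?thesis by measurable
  qed
  have dB: "integrable lborel (\<lambda>\<theta>::real. indicator {0<..<2 * pi} \<theta> * B)"
    by simp
  have pt: "(\<lambda>m. indicator {0<..<2 * pi} \<theta> * J m \<theta>) \<longlonglongrightarrow> ?L \<theta>" for \<theta>
    unfolding \<Psi>T[symmetric] J_def n_def
    by (intro tendsto_mult tendsto_const kernel_tendsto[OF r N c\<Psi>])
  have lim: "(\<lambda>m. \<integral>\<theta>. indicator {0<..<2 * pi} \<theta> * J m \<theta> \<partial>lborel) \<longlonglongrightarrow> (\<integral>\<theta>. ?L \<theta> \<partial>lborel)"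
    "integrable lborel ?L"
  proof -
    have *: "AE \<theta> in lborel. norm (indicator {0<..<2 * pi} \<theta> * J m \<theta>) \<le> indicator {0<..<2 * pi} \<theta> * B" for m
      using JB by (intro AE_I2) (auto simp: indicator_def)
    show "(\<lambda>m. \<integral>\<theta>. indicator {0<..<2 * pi} \<theta> * J m \<theta> \<partial>lborel) \<longlonglongrightarrow> (\<integral>\<theta>. ?L \<theta> \<partial>lborel)"
      by (rule integral_dominated_convergence[OF Lm _ dB _ *]) (use polar(1) pt in auto)
    show "integrable lborel ?L"
      by (rule integrable_dominated_convergence[where s = "\<lambda>m \<theta>. indicator {0<..<2 * pi} \<theta> * J m \<theta>", OF Lm _ dB _ *]) (use polar(1) pt in auto)
  qed
  have "(\<integral>\<theta>. ?L \<theta> \<partial>lborel) = (\<integral>z. L1 z \<partial>lborel) + (\<integral>z. L2 z \<partial>lborel)"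
    using lim(1) tendsto_add[OF lim1 lim2] unfolding polar(2)[symmetric] SF(4) by (rule LIMSEQ_unique)
  then show "(\<integral>\<theta>. ?L \<theta> \<partial>lborel) =
      (\<integral>z. (if z \<in> unit_disc \<and> u z < r then \<psi> z * lap z else 0) \<partial>lborel) +
      (\<integral>z. (if z \<in> unit_disc then max 0 (r - u z) * (\<psi>xx z + \<psi>yy z) else 0) \<partial>lborel)"
    by (simp add: L1_def L2_def)
  show "integrable lborel ?L" by (rule lim(2))
  show "integrable lborel (\<lambda>z. if z \<in> unit_disc \<and> u z < r then \<psi> z * lap z else 0)"
    using i2 by (simp add: L2_def)
  show "integrable lborel (\<lambda>z. if z \<in> unit_disc then max 0 (r - u z) * (\<psi>xx z + \<psi>yy z) else 0)"
    using i1 by (simp add: L1_def)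
qed

end

section \<open>Monge-Ampere measures of the exhaustion function\<close>

text \<open>Needed because the measure of \<open>max u r\<close> is found as a sum, a part carried
  by the level curve and an absolutely continuous part above it; the definition of
  \<open>MA_measure\<close> subtracts the second part again.\<close>

definition add_measure :: "'a measure \<Rightarrow> 'a measure \<Rightarrow> 'a measure" where
  "add_measure M N = measure_of (space M) (sets M) (\<lambda>A. emeasure M A + emeasure N A)"

lemma sets_add_measure [simp, measurable_cong]: "sets (add_measure M N) = sets M"
  and space_add_measure [simp]: "space (add_measure M N) = space M"
  by (simp_all add: add_measure_def)

lemma emeasure_add_measure:
  assumes "sets N = sets M" "A \<in> sets M"
  shows "emeasure (add_measure M N) A = emeasure M A + emeasure N A"
  unfolding add_measure_def
proof (rule emeasure_measure_of_sigma)
  show "sigma_algebra (space M) (sets M)" ..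
  show "positive (sets M) (\<lambda>A. emeasure M A + emeasure N A)" by (simp add: positive_def)
  show "countably_additive (sets M) (\<lambda>A. emeasure M A + emeasure N A)"
  proof (rule countably_additiveI)
    fix B :: "nat \<Rightarrow> _" assume B: "range B \<subseteq> sets M" "disjoint_family B"
    have "(\<Sum>i. emeasure M (B i) + emeasure N (B i)) = (\<Sum>i. emeasure M (B i)) + (\<Sum>i. emeasure N (B i))"
      by (rule suminf_add[symmetric]) auto
    also have "\<dots> = emeasure M (\<Union>i. B i) + emeasure N (\<Union>i. B i)"
      using B assms(1) by (simp add: suminf_emeasure)
    finally show "(\<Sum>i. emeasure M (B i) + emeasure N (B i)) = emeasure M (\<Union>i. B i) + emeasure N (\<Union>i. B i)" .
  qed
qed fact

lemma nn_integral_add_measure: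
  assumes [measurable_cong]: "sets N = sets M" and f: "f \<in> borel_measurable M"
  shows "(\<integral>\<^sup>+x. f x \<partial>add_measure M N) = (\<integral>\<^sup>+x. f x \<partial>M) + (\<integral>\<^sup>+x. f x \<partial>N)"
  using f
proof (induction rule: borel_measurable_induct)
  case (cong f g)
  moreover have "space N = space M" using assms(1) by (rule sets_eq_imp_space_eq)
  ultimately have "(\<integral>\<^sup>+x. f x \<partial>M) = (\<integral>\<^sup>+x. g x \<partial>M)" "(\<integral>\<^sup>+x. f x \<partial>N) = (\<integral>\<^sup>+x. g x \<partial>N)"
    "(\<integral>\<^sup>+x. f x \<partial>add_measure M N) = (\<integral>\<^sup>+x. g x \<partial>add_measure M N)"
    by (intro nn_integral_cong; simp)+
  with cong show ?case by (simp only:)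
next
  case (set A)
  then show ?case using assms(1) by (simp add: emeasure_add_measure)
next
  case (mult u c)
  then show ?case by (simp add: nn_integral_cmult distrib_left)
next
  case (add u v)
  then show ?case by (simp add: nn_integral_add ac_simps)
next
  case (seq W)
  have [measurable]: "W i \<in> borel_measurable M" for i using seq by simp
  have "(\<integral>\<^sup>+x. (SUP i. W i) x \<partial>add_measure M N) = (SUP i. \<integral>\<^sup>+x. W i x \<partial>add_measure M N)"
    unfolding SUP_apply using seq(3) by (intro nn_integral_monotone_convergence_SUP) measurable
  also have "\<dots> = (SUP i. (\<integral>\<^sup>+x. W i x \<partial>M) + (\<integral>\<^sup>+x. W i x \<partial>N))" using seq by simp
  also have "\<dots> = (SUP i. \<integral>\<^sup>+x. W i x \<partial>M) + (SUP i. \<integral>\<^sup>+x. W i x \<partial>N)"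
    using seq(3) by (intro ennreal_SUP_add) (auto simp: incseq_def le_fun_def intro!: nn_integral_mono)
  also have "\<dots> = (\<integral>\<^sup>+x. (SUP i. W i) x \<partial>M) + (\<integral>\<^sup>+x. (SUP i. W i) x \<partial>N)"
    unfolding SUP_apply using seq(3)
    by (subst (1 2) nn_integral_monotone_convergence_SUP) (auto, measurable)
  finally show ?case .
qed

lemma integral_add_measure:
  fixes f :: "'a \<Rightarrow> real"
  assumes [measurable_cong]: "sets N = sets M" and "integrable M f" "integrable N f"
  shows "(\<integral>x. f x \<partial>add_measure M N) = (\<integral>x. f x \<partial>M) + (\<integral>x. f x \<partial>N)"
proof -
  have fm [measurable]: "f \<in> borel_measurable M" using assms by auto
  have a: "(\<integral>\<^sup>+x. ennreal (g x) \<partial>M) < \<infinity>" "(\<integral>\<^sup>+x. ennreal (g x) \<partial>N) < \<infinity>" if "g = f \<or> g = (\<lambda>x. - f x)" for g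
    using that assms(2,3) real_integrable_def[of M f] real_integrable_def[of N f] by (auto simp: less_top)
  have nn: "(\<integral>\<^sup>+x. ennreal (g x) \<partial>add_measure M N) = (\<integral>\<^sup>+x. ennreal (g x) \<partial>M) + (\<integral>\<^sup>+x. ennreal (g x) \<partial>N)"
    if "g = f \<or> g = (\<lambda>x. - f x)" for g
    by (rule nn_integral_add_measure[OF assms(1)]) (use that in \<open>auto\<close>)
  have "integrable (add_measure M N) f"
    unfolding real_integrable_def using a nn by (auto simp: less_top[symmetric])
  then show ?thesis
    using assms(2,3) nn a by (simp add: real_lebesgue_integral_def enn2real_plus)
qed

section \<open>An integrable bound uniform over the level curves\<close>

lemma sin_ge_linear:
  assumes "0 \<le> x" "x \<le> pi / 2"
  shows "2 * x / pi \<le> sin x"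
proof -
  have c: "convex_on {0..pi / 2} (\<lambda>x. - sin x)"
  proof (rule f''_ge0_imp_convex)
    show "((\<lambda>x. - sin x) has_real_derivative - cos x) (at x)" for x :: real
      by (auto intro!: derivative_eq_intros)
    show "((\<lambda>x. - cos x) has_real_derivative sin x) (at x)" for x :: real
      by (auto intro!: derivative_eq_intros)
    show "sin x \<ge> 0" if "x \<in> {0..pi / 2}" for x using that by (intro sin_ge_zero) auto
  qed simp
  have "- sin ((1 - 2 * x / pi) *\<^sub>R 0 + (2 * x / pi) *\<^sub>R (pi / 2)) \<le> (1 - 2 * x / pi) * (- sin 0) + (2 * x / pi) * (- sin (pi / 2))"
    using assms by (intro convex_onD[OF c]) (auto simp: field_simps)
  then show ?thesis by simp
qed

text \<open>An integrable bound for \<open>(1 - Re z) powr (- 1/4)\<close> along all the level curves.\<close>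

definition boundary_weight :: "real \<Rightarrow> real" where
  "boundary_weight \<theta> = (\<theta> / pi) powr (- 1 / 2) + ((2 * pi - \<theta>) / pi) powr (- 1 / 2)"

text \<open>Half of 1 - cos \<theta> is the square of sin(\<theta>/2), so the power -1/4 becomes the
  power -1/2 of that sine, which is bounded below by the distance to the nearer endpoint of the
  period.\<close>

lemma powr_le_boundary_weight:
  assumes \<theta>: "\<theta> \<in> {0<..<2 * pi}" and x: "x \<ge> (1 - cos \<theta>) / 2"
  shows "x powr (- 1 / 4) \<le> boundary_weight \<theta>"
proof -
  have sp: "sin (\<theta> / 2) > 0" using \<theta> by (intro sin_gt_zero) auto
  have s: "(1 - cos \<theta>) / 2 = sin (\<theta> / 2) powr 2"
    using cos_double_sin[of "\<theta> / 2"] sp by (simp add: powr_numeral)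
  have "x powr (- 1 / 4) \<le> (sin (\<theta> / 2) powr 2) powr (- 1 / 4)"
    using x s sp by (intro powr_mono2') auto
  also have "\<dots> = sin (\<theta> / 2) powr (- 1 / 2)" by (simp add: powr_powr)
  also have "\<dots> \<le> boundary_weight \<theta>"
  proof (cases "\<theta> \<le> pi")
    case True
    then have "\<theta> / pi \<le> sin (\<theta> / 2)" using sin_ge_linear[of "\<theta> / 2"] \<theta> by simp
    then have "sin (\<theta> / 2) powr (- 1 / 2) \<le> (\<theta> / pi) powr (- 1 / 2)"
      using \<theta> by (intro powr_mono2') auto
    then show ?thesis by (simp add: boundary_weight_def add_increasing2)
  next
    case False
    have "sin (\<theta> / 2) = sin (pi - \<theta> / 2)" by simp
    then have "(2 * pi - \<theta>) / pi \<le> sin (\<theta> / 2)"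
      using sin_ge_linear[of "pi - \<theta> / 2"] \<theta> False by (simp add: field_simps)
    then have "sin (\<theta> / 2) powr (- 1 / 2) \<le> ((2 * pi - \<theta>) / pi) powr (- 1 / 2)"
      using \<theta> by (intro powr_mono2') auto
    then show ?thesis by (simp add: boundary_weight_def add_increasing)
  qed
  finally show ?thesis .
qed

lemma integrable_boundary_weight:
  "integrable lborel (\<lambda>\<theta>. indicator {0<..<2 * pi} \<theta> * boundary_weight \<theta>)"
proof -
  have "(\<lambda>x::real. x powr (- 1 / 2)) absolutely_integrable_on {0..2 * pi}"
    by (intro nonnegative_absolutely_integrable_1 integrable_on_powr_from_0) auto
  then have "integrable lebesgue (\<lambda>x::real. indicator {0..2 * pi} x * x powr (- 1 / 2))"
    by (simp add: set_integrable_def)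
  then have i0: "integrable lborel (\<lambda>x::real. indicator {0..2 * pi} x * x powr (- 1 / 2))"
    by (subst (asm) integrable_completion) auto
  then have i1: "integrable lborel (\<lambda>x::real. indicator {0..2 * pi} (2 * pi + (- 1) * x) * (2 * pi + (- 1) * x) powr (- 1 / 2))"
    using lborel_integrable_real_affine[of "\<lambda>x. indicator {0..2 * pi} x * x powr (- 1 / 2)" "- 1" "2 * pi"] by simp
  have "integrable lborel (\<lambda>x. (1 / pi) powr (- 1 / 2) * (indicator {0..2 * pi} x * x powr (- 1 / 2)) +
     (1 / pi) powr (- 1 / 2) * (indicator {0..2 * pi} (2 * pi + (- 1) * x) * (2 * pi + (- 1) * x) powr (- 1 / 2)))"
    using i0 i1 by (intro Bochner_Integration.integrable_add integrable_mult_right)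
  then show ?thesis
  proof (rule Bochner_Integration.integrable_bound)
    show "(\<lambda>\<theta>. indicator {0<..<2 * pi} \<theta> * boundary_weight \<theta>) \<in> borel_measurable lborel"
      unfolding boundary_weight_def by measurable
    show "AE \<theta> in lborel. norm (indicator {0<..<2 * pi} \<theta> * boundary_weight \<theta>) \<le>
      norm ((1 / pi) powr (- 1 / 2) * (indicator {0..2 * pi} \<theta> * \<theta> powr (- 1 / 2)) +
     (1 / pi) powr (- 1 / 2) * (indicator {0..2 * pi} (2 * pi + (- 1) * \<theta>) * (2 * pi + (- 1) * \<theta>) powr (- 1 / 2)))"
    proof (rule AE_I2)
      fix \<theta> :: real
      show "norm (indicator {0<..<2 * pi} \<theta> * boundary_weight \<theta>) \<le>
        norm ((1 / pi) powr (- 1 / 2) * (indicator {0..2 * pi} \<theta> * \<theta> powr (- 1 / 2)) +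
        (1 / pi) powr (- 1 / 2) * (indicator {0..2 * pi} (2 * pi + (- 1) * \<theta>) * (2 * pi + (- 1) * \<theta>) powr (- 1 / 2)))"
      proof (cases "\<theta> \<in> {0<..<2 * pi}")
        case True
        have "boundary_weight \<theta> = (1 / pi) powr (- 1 / 2) * \<theta> powr (- 1 / 2) + (1 / pi) powr (- 1 / 2) * (2 * pi + (- 1) * \<theta>) powr (- 1 / 2)"
          using True powr_mult[of "1 / pi" \<theta> "- 1 / 2"] powr_mult[of "1 / pi" "2 * pi - \<theta>" "- 1 / 2"]
          by (simp add: boundary_weight_def)
        then show ?thesis using True by simp
      qed simp
    qed
  qed
qed

lemma line_derivative_eq_0:
  assumes "has_line_derivative f v D z" "open S" "z \<in> S" "\<And>z. z \<in> S \<Longrightarrow> f z = 0"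
  shows "D = 0"
proof -
  have "has_line_derivative (\<lambda>z. 0) v D z"
    by (rule has_line_derivative_eventually[OF assms(1-3)]) (use assms in auto)
  then show ?thesis
    using has_line_derivative_const[of 0 v z] unfolding has_line_derivative_def by (rule DERIV_unique)
qed

lemma pd2_subset: "pd2 S f fx fy fxx fyy \<Longrightarrow> T \<subseteq> S \<Longrightarrow> pd2 T f fx fy fxx fyy"
  unfolding pd2_def by (meson continuous_on_subset subsetD)

lemma pd2_const: "pd2 S (\<lambda>z. c) (\<lambda>z. 0) (\<lambda>z. 0) (\<lambda>z. 0) (\<lambda>z. 0)"
  unfolding pd2_def by (auto intro!: has_line_derivative_const)

lemma pd2_vanish:
  assumes p: "pd2 S f fx fy fxx fyy" and S: "open S" and z: "z \<in> S" and f: "\<And>z. z \<in> S \<Longrightarrow> f z = 0"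
  shows "fx z = 0 \<and> fy z = 0 \<and> fxx z = 0 \<and> fyy z = 0"
proof -
  have d: "has_line_derivative f 1 (fx z) z \<and> has_line_derivative f \<i> (fy z) z \<and>
      has_line_derivative fx 1 (fxx z) z \<and> has_line_derivative fy \<i> (fyy z) z" if "z \<in> S" for z
    using p that by (simp add: pd2_def)
  have x: "fx z = 0" and y: "fy z = 0" if "z \<in> S" for z
    using line_derivative_eq_0[of f 1 "fx z" z S] line_derivative_eq_0[of f \<i> "fy z" z S] d[OF that] S that f by auto
  then show ?thesis
    using line_derivative_eq_0[of fx 1 "fxx z" z S] line_derivative_eq_0[of fy \<i> "fyy z" z S] d[OF z] S z by auto
qed

section \<open>The Monge-Ampere measures in explicit form\<close>

context disc_annulus
begin

text \<open>Moving a boundary point inwards along its ray can at most halve its horizontal distance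
  to 1, depending on the sign of the cosine; the bound is therefore independent of the
  level.\<close>

lemma w_P_le:
  assumes r: "r0 < r" "r < 0" and \<theta>: "\<theta> \<in> {0<..<2 * pi}"
  shows "w (P r \<theta>) \<le> C * boundary_weight \<theta>"
proof -
  note T = T_props[OF r, of \<theta>] and PA = P_props(1)[OF r, of \<theta>]
  have ReP: "Re (P r \<theta>) = exp (T r \<theta>) * cos \<theta>"
    by (simp add: P_def exp_eq_polar)
  have e: "0 < exp (T r \<theta>)" "exp (T r \<theta>) < 1" using T by auto
  have half: "(1 - c) / 2 \<le> 1 - x" if "x \<le> c \<or> x \<le> 0" "- 1 \<le> c" "c \<le> 1" for c x :: real
    using that by (auto simp: field_simps)
  have "(1 - cos \<theta>) / 2 \<le> 1 - Re (P r \<theta>)"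
  proof (cases "cos \<theta> \<ge> 0")
    case True
    then have "exp (T r \<theta>) * cos \<theta> \<le> cos \<theta>" using e by (simp add: mult_left_le_one_le)
    then show ?thesis unfolding ReP by (intro half) auto
  next
    case False
    then have "exp (T r \<theta>) * cos \<theta> \<le> 0" using e by (simp add: mult_nonneg_nonpos)
    then show ?thesis unfolding ReP by (intro half) auto
  qed
  then have le: "(1 - Re (P r \<theta>)) powr (- 1 / 4) \<le> boundary_weight \<theta>"
    by (rule powr_le_boundary_weight[OF \<theta>])
  have "0 \<le> C"
    using V_ge[of "P r \<theta>"] V_le[of "P r \<theta>"] q PA by (force simp: A_def)
  then show ?thesis
    using w_bounds(2)[OF PA] mult_left_mono[OF le] by (meson order.trans)
qed

text \<open>The explicit candidate for \<open>MA_measure \<kappa> u r\<close>: the density \<kappa>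
  w in the polar angle, carried to the level curve by \<open>P\<close>. The two densities that
  follow stand for the measure of \<open>u\<close> on the whole disc and on the part where
  \<open>u\<close> is at least \<open>r\<close>.\<close>

definition "nu \<kappa> r = distr (density lborel (\<lambda>\<theta>. ennreal (indicator {0<..<2 * pi} \<theta> * (\<kappa> * w (P r \<theta>))))) borel (P r)"
definition "ddc_u \<kappa> = density lborel (\<lambda>z. ennreal (if z \<in> unit_disc then \<kappa> * lap z else 0))"
definition "ddc_above \<kappa> r = density lborel (\<lambda>z. ennreal (if z \<in> unit_disc \<and> \<not> u z < r then \<kappa> * lap z else 0))"

lemma sets_nu [simp, measurable_cong]: "sets (nu \<kappa> r) = sets borel"
  and sets_ddc_u [simp, measurable_cong]: "sets (ddc_u \<kappa>) = sets borel"
  and sets_ddc_above [simp, measurable_cong]: "sets (ddc_above \<kappa> r) = sets borel"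
  by (auto simp: nu_def ddc_u_def ddc_above_def)

lemma nn_integral_nu:
  assumes r: "r0 < r" "r < 0" and f: "f \<in> borel_measurable borel"
  shows "(\<integral>\<^sup>+z. f z \<partial>nu \<kappa> r) =
    (\<integral>\<^sup>+\<theta>. ennreal (indicator {0<..<2 * pi} \<theta> * (\<kappa> * w (P r \<theta>))) * f (P r \<theta>) \<partial>lborel)"
proof -
  note [measurable] = borel_P[OF r] f
  show ?thesis unfolding nu_def by (simp add: nn_integral_distr nn_integral_density)
qed

lemma integral_nu:
  fixes f :: "complex \<Rightarrow> real"
  assumes r: "r0 < r" "r < 0" and \<kappa>: "\<kappa> > 0" and f: "f \<in> borel_measurable borel"
  shows "(\<integral>z. f z \<partial>nu \<kappa> r) = \<kappa> * (\<integral>\<theta>. indicator {0<..<2 * pi} \<theta> * (f (P r \<theta>) * w (P r \<theta>)) \<partial>lborel)"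
    and "integrable (nu \<kappa> r) f \<longleftrightarrow> integrable lborel (\<lambda>\<theta>. indicator {0<..<2 * pi} \<theta> * (f (P r \<theta>) * w (P r \<theta>)))"
proof -
  note [measurable] = borel_P[OF r] f
  have nn: "0 \<le> indicator {0<..<2 * pi} \<theta> * (\<kappa> * w (P r \<theta>))" for \<theta>
    using \<kappa> w_nonneg by simp
  have e: "indicator {0<..<2 * pi} \<theta> * (\<kappa> * w (P r \<theta>)) * f (P r \<theta>) =
     \<kappa> * (indicator {0<..<2 * pi} \<theta> * (f (P r \<theta>) * w (P r \<theta>)))" for \<theta> by simp
  show "(\<integral>z. f z \<partial>nu \<kappa> r) = \<kappa> * (\<integral>\<theta>. indicator {0<..<2 * pi} \<theta> * (f (P r \<theta>) * w (P r \<theta>)) \<partial>lborel)"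
    unfolding nu_def by (simp add: integral_distr integral_density nn e)
  show "integrable (nu \<kappa> r) f \<longleftrightarrow> integrable lborel (\<lambda>\<theta>. indicator {0<..<2 * pi} \<theta> * (f (P r \<theta>) * w (P r \<theta>)))"
    unfolding nu_def using \<kappa> by (simp add: integrable_distr_eq integrable_density nn e)
qed

lemma nu_finite:
  assumes r: "r0 < r" "r < 0" and \<kappa>: "\<kappa> > 0"
  shows "emeasure (nu \<kappa> r) UNIV \<le> ennreal (\<kappa> * C * (\<integral>\<theta>. indicator {0<..<2 * pi} \<theta> * boundary_weight \<theta> \<partial>lborel))"
proof -
  have i: "integrable lborel (\<lambda>\<theta>. \<kappa> * C * (indicator {0<..<2 * pi} \<theta> * boundary_weight \<theta>))"
    using integrable_boundary_weight by (rule integrable_mult_right)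
  have le: "indicator {0<..<2 * pi} \<theta> * (\<kappa> * w (P r \<theta>)) \<le> \<kappa> * C * (indicator {0<..<2 * pi} \<theta> * boundary_weight \<theta>)" for \<theta>
    using w_P_le[OF r, of \<theta>] \<kappa> by (auto simp: indicator_def)
  have "emeasure (nu \<kappa> r) UNIV = (\<integral>\<^sup>+z. 1 \<partial>nu \<kappa> r)"
    using sets_eq_imp_space_eq[OF sets_nu] by (simp add: nn_integral_const)
  also have "\<dots> = (\<integral>\<^sup>+\<theta>. ennreal (indicator {0<..<2 * pi} \<theta> * (\<kappa> * w (P r \<theta>))) \<partial>lborel)"
    by (subst nn_integral_nu[OF r]) auto
  also have "\<dots> \<le> (\<integral>\<^sup>+\<theta>. ennreal (\<kappa> * C * (indicator {0<..<2 * pi} \<theta> * boundary_weight \<theta>)) \<partial>lborel)"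
    by (intro nn_integral_mono ennreal_leI le)
  also have "\<dots> = ennreal (\<integral>\<theta>. \<kappa> * C * (indicator {0<..<2 * pi} \<theta> * boundary_weight \<theta>) \<partial>lborel)"
  proof (rule nn_integral_eq_integral[OF i], rule AE_I2)
    fix \<theta>
    have "0 \<le> indicator {0<..<2 * pi} \<theta> * (\<kappa> * w (P r \<theta>))" using \<kappa> w_nonneg by simp
    then show "0 \<le> \<kappa> * C * (indicator {0<..<2 * pi} \<theta> * boundary_weight \<theta>)" using le[of \<theta>] by linarith
  qed
  finally show ?thesis by simp
qed

lemma borel_lap [measurable]: "lap \<in> borel_measurable borel"
  unfolding lap_def[abs_def] by measurable

lemma borel_u_disc: "{z \<in> unit_disc. u z < r} \<in> sets borel"
proof -
  have "{z \<in> unit_disc. u z < r} = unit_disc \<inter> u -` {..<r}" by auto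
  then show ?thesis
    using continuous_open_preimage[OF cont_u_disc open_ball, of "{..<r}"] by (simp only:) simp
qed

lemma borel_density_above [measurable]:
  "(\<lambda>z. if z \<in> unit_disc \<and> \<not> u z < r then \<kappa> * lap z else 0) \<in> borel_measurable borel"
proof -
  have "(\<lambda>z. if z \<in> unit_disc \<and> \<not> u z < r then \<kappa> * lap z else 0) =
    (\<lambda>z. if z \<in> unit_disc - {z \<in> unit_disc. u z < r} then \<kappa> * lap z else 0)" by auto
  also have "\<dots> \<in> borel_measurable borel"
    using borel_u_disc[of r] by (intro measurable_If_set) auto
  finally show ?thesis .
qed

text \<open>With the constant 1 as \<psi>, the Lelong-Jensen formula equates the mass below a level
  with the mass on the level curve, which is bounded uniformly; the levels
  \<open>r0 / (n + 2)\<close> increase to 0 and monotone convergence concludes.\<close>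

lemma lap_mass_finite: "(\<integral>\<^sup>+z. ennreal (if z \<in> unit_disc then lap z else 0) \<partial>lborel) < \<infinity>"
proof -
  define r where "r = (\<lambda>n. r0 / real (n + 2))"
  have rr: "r0 < r n" "r n < 0" for n
  proof -
    show "r n < 0" using r0 by (simp add: r_def divide_neg_pos)
    have "r0 * (real n + 1) < 0" using r0 by (intro mult_neg_pos) auto
    then show "r0 < r n" by (simp add: r_def pos_less_divide_eq algebra_simps)
  qed
  have incr: "r n \<le> r m" if "n \<le> m" for n m
    using r0 that by (simp add: r_def divide_left_mono_neg)
  have lim0: "r \<longlonglongrightarrow> 0"
    unfolding r_def by (intro real_tendsto_divide_at_top[OF tendsto_const] filterlim_compose[OF filterlim_real_sequentially] filterlim_add_const_nat_at_top)
  let ?f = "\<lambda>n z. ennreal (if z \<in> unit_disc \<and> u z < r n then lap z else 0)"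
  have "(\<lambda>n. \<integral>\<^sup>+z. ?f n z \<partial>lborel) \<longlonglongrightarrow> (\<integral>\<^sup>+z. ennreal (if z \<in> unit_disc then lap z else 0) \<partial>lborel)"
  proof (rule nn_integral_LIMSEQ)
    show "incseq ?f"
      unfolding incseq_def le_fun_def
      using incr lap_pos by (auto intro!: ennreal_leI less_imp_le) (meson not_less order.trans)
    show "?f n \<in> borel_measurable lborel" for n
    proof -
      have "(\<lambda>z. if z \<in> {z \<in> unit_disc. u z < r n} then lap z else 0) \<in> borel_measurable borel"
        using borel_u_disc[of "r n"] by (intro measurable_If_set) auto
      then show ?thesis by simp
    qed
    show "(\<lambda>n. ?f n z) \<longlonglongrightarrow> ennreal (if z \<in> unit_disc then lap z else 0)" for z
    proof (cases "z \<in> unit_disc")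
      case True
      have "eventually (\<lambda>n. u z < r n) sequentially"
        using order_tendstoD(1)[OF lim0 u_neg[OF True]] .
      then have "eventually (\<lambda>n. ?f n z = ennreal (if z \<in> unit_disc then lap z else 0)) sequentially"
        by (rule eventually_mono) (use True in simp)
      then show ?thesis by (rule tendsto_eventually)
    qed auto
  qed
  moreover have "(\<integral>\<^sup>+z. ?f n z \<partial>lborel) \<le> ennreal (C * (\<integral>\<theta>. indicator {0<..<2 * pi} \<theta> * boundary_weight \<theta> \<partial>lborel))" for n
  proof -
    note L = level_identity[OF rr pd2_const[of unit_disc 1], of n, unfolded mult_1]
    have "(\<integral>\<^sup>+z. ?f n z \<partial>lborel) = ennreal (\<integral>z. (if z \<in> unit_disc \<and> u z < r n then lap z else 0) \<partial>lborel)"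
      by (rule nn_integral_eq_integral) (use L(2) lap_pos in \<open>auto simp: less_imp_le\<close>)
    also have "(\<integral>z. (if z \<in> unit_disc \<and> u z < r n then lap z else 0) \<partial>lborel)
        = (\<integral>\<theta>. indicator {0<..<2 * pi} \<theta> * w (P (r n) \<theta>) \<partial>lborel)"
      using L(4) by (simp cong: if_cong)
    also have "\<dots> \<le> (\<integral>\<theta>. C * (indicator {0<..<2 * pi} \<theta> * boundary_weight \<theta>) \<partial>lborel)"
    proof (rule integral_mono)
      show "integrable lborel (\<lambda>\<theta>. indicator {0<..<2 * pi} \<theta> * w (P (r n) \<theta>))" using L(1) by simp
      show "integrable lborel (\<lambda>\<theta>. C * (indicator {0<..<2 * pi} \<theta> * boundary_weight \<theta>))"
        using integrable_boundary_weight by (rule integrable_mult_right)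
      show "indicator {0<..<2 * pi} \<theta> * w (P (r n) \<theta>) \<le> C * (indicator {0<..<2 * pi} \<theta> * boundary_weight \<theta>)" for \<theta>
        using w_P_le[OF rr[of n], of \<theta>] by (auto simp: indicator_def)
    qed
    finally show ?thesis by (simp add: ennreal_leI)
  qed
  ultimately have "(\<integral>\<^sup>+z. ennreal (if z \<in> unit_disc then lap z else 0) \<partial>lborel)
     \<le> ennreal (C * (\<integral>\<theta>. indicator {0<..<2 * pi} \<theta> * boundary_weight \<theta> \<partial>lborel))"
    by (intro LIMSEQ_le_const2) auto
  then show ?thesis using ennreal_less_top le_less_trans by (auto simp: top_unique less_top[symmetric])
qed

end

lemma test_function_pd2:
  assumes "test_function \<psi>"
  obtains K where "compact K" "K \<subseteq> unit_disc" "\<And>z. z \<notin> K \<Longrightarrow> \<psi> z = 0"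
    "pd2 unit_disc \<psi> (pderiv_dir 1 \<psi>) (pderiv_dir \<i> \<psi>)
       (pderiv_dir 1 (pderiv_dir 1 \<psi>)) (pderiv_dir \<i> (pderiv_dir \<i> \<psi>))"
    "\<And>z. z \<notin> K \<Longrightarrow> pderiv_dir 1 \<psi> z = 0 \<and> pderiv_dir \<i> \<psi> z = 0 \<and>
       pderiv_dir 1 (pderiv_dir 1 \<psi>) z = 0 \<and> pderiv_dir \<i> (pderiv_dir \<i> \<psi>) z = 0"
proof -
  obtain K where K: "compact K" "K \<subseteq> unit_disc" "\<And>z. z \<notin> K \<Longrightarrow> \<psi> z = 0"
    using assms by (auto simp: test_function_def)
  have p: "pd2 UNIV \<psi> (pderiv_dir 1 \<psi>) (pderiv_dir \<i> \<psi>)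
       (pderiv_dir 1 (pderiv_dir 1 \<psi>)) (pderiv_dir \<i> (pderiv_dir \<i> \<psi>))"
    by (rule Ck_on_2_pd2) (use assms in \<open>simp add: test_function_def\<close>)
  have oK: "open (- K)" using compact_imp_closed[OF K(1)] by (rule open_Compl)
  show ?thesis
  proof (rule that[OF K])
    show "pd2 unit_disc \<psi> (pderiv_dir 1 \<psi>) (pderiv_dir \<i> \<psi>)
       (pderiv_dir 1 (pderiv_dir 1 \<psi>)) (pderiv_dir \<i> (pderiv_dir \<i> \<psi>))"
      by (rule pd2_subset[OF p subset_UNIV])
    show "pderiv_dir 1 \<psi> z = 0 \<and> pderiv_dir \<i> \<psi> z = 0 \<and>
       pderiv_dir 1 (pderiv_dir 1 \<psi>) z = 0 \<and> pderiv_dir \<i> (pderiv_dir \<i> \<psi>) z = 0" if "z \<notin> K" for z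
      by (rule pd2_vanish[OF pd2_subset[OF p subset_UNIV] oK]) (use that K in auto)
  qed
qed

context disc_annulus
begin

lemma test_function_green:
  assumes "test_function \<psi>"
  shows "integrable lborel (\<lambda>z. if z \<in> unit_disc then u z * laplacian \<psi> z else 0)"
    "integrable lborel (\<lambda>z. if z \<in> unit_disc then \<psi> z * lap z else 0)"
    "(\<integral>z. (if z \<in> unit_disc then \<psi> z * lap z else 0) \<partial>lborel) =
     (\<integral>z. (if z \<in> unit_disc then u z * laplacian \<psi> z else 0) \<partial>lborel)"
proof -
  obtain K where K: "compact K" "K \<subseteq> unit_disc" "\<And>z. z \<notin> K \<Longrightarrow> \<psi> z = 0"
    and p: "pd2 unit_disc \<psi> (pderiv_dir 1 \<psi>) (pderiv_dir \<i> \<psi>)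
       (pderiv_dir 1 (pderiv_dir 1 \<psi>)) (pderiv_dir \<i> (pderiv_dir \<i> \<psi>))"
    and z: "\<And>z. z \<notin> K \<Longrightarrow> pderiv_dir 1 \<psi> z = 0 \<and> pderiv_dir \<i> \<psi> z = 0 \<and>
       pderiv_dir 1 (pderiv_dir 1 \<psi>) z = 0 \<and> pderiv_dir \<i> (pderiv_dir \<i> \<psi>) z = 0"
    using test_function_pd2[OF assms] by blast
  have c: "continuous_on unit_disc \<psi>" "continuous_on unit_disc (laplacian \<psi>)"
    using p unfolding pd2_def laplacian_def[abs_def] by (auto intro!: continuous_intros)
  show 1: "integrable lborel (\<lambda>z. if z \<in> unit_disc then u z * laplacian \<psi> z else 0)"
    by (intro integrable_extend_zero[OF _ open_ball K(1,2)] continuous_intros cont_u_disc c)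
       (use z in \<open>auto simp: laplacian_def\<close>)
  show 2: "integrable lborel (\<lambda>z. if z \<in> unit_disc then \<psi> z * lap z else 0)"
    by (intro integrable_extend_zero[OF _ open_ball K(1,2)] continuous_intros continuous_on_lap c)
       (use K in auto)
  have "(LINT z:unit_disc|lborel. \<psi> z * (uxx z + uyy z) -
      u z * (pderiv_dir 1 (pderiv_dir 1 \<psi>) z + pderiv_dir \<i> (pderiv_dir \<i> \<psi>) z)) = 0"
    by (rule green_identity[OF p pd2_u open_ball K(1,2)]) (use z K in auto)
  then have "(\<integral>z. (if z \<in> unit_disc then \<psi> z * lap z else 0) - (if z \<in> unit_disc then u z * laplacian \<psi> z else 0) \<partial>lborel) = 0"
    unfolding set_lebesgue_integral_def uxx_plus_uyy laplacian_def[symmetric]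
    by (subst (asm) Bochner_Integration.integral_cong[OF refl, where g = "\<lambda>z. (if z \<in> unit_disc then \<psi> z * lap z else 0) - (if z \<in> unit_disc then u z * laplacian \<psi> z else 0)"])
       (auto simp: indicator_def)
  then show "(\<integral>z. (if z \<in> unit_disc then \<psi> z * lap z else 0) \<partial>lborel) =
     (\<integral>z. (if z \<in> unit_disc then u z * laplacian \<psi> z else 0) \<partial>lborel)"
    using 1 2 by simp
qed

lemma set_lebesgue_integral_if:
  "(LINT z:unit_disc|lborel. f z) = (\<integral>z. (if z \<in> unit_disc then f z else (0::real)) \<partial>lborel)"
  unfolding set_lebesgue_integral_def by (intro Bochner_Integration.integral_cong) (auto simp: indicator_def)

lemma borel_density_u [measurable]:
  "(\<lambda>z. if z \<in> unit_disc then \<kappa> * lap z else 0) \<in> borel_measurable borel"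
  by (intro measurable_If_set) auto

lemma ddc_u_finite:
  assumes "\<kappa> > 0"
  shows "emeasure (ddc_u \<kappa>) UNIV < \<infinity>" "emeasure (ddc_above \<kappa> r) UNIV < \<infinity>"
proof -
  have "emeasure (ddc_u \<kappa>) UNIV = (\<integral>\<^sup>+z. ennreal (if z \<in> unit_disc then \<kappa> * lap z else 0) \<partial>lborel)"
    unfolding ddc_u_def by (simp add: emeasure_density)
  also have "\<dots> = (\<integral>\<^sup>+z. ennreal \<kappa> * ennreal (if z \<in> unit_disc then lap z else 0) \<partial>lborel)"
    using assms lap_pos by (intro nn_integral_cong) (auto simp: ennreal_mult less_imp_le)
  also have "\<dots> = ennreal \<kappa> * (\<integral>\<^sup>+z. ennreal (if z \<in> unit_disc then lap z else 0) \<partial>lborel)"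
    using borel_density_u[of 1] by (intro nn_integral_cmult) (simp cong: if_cong)
  also have "\<dots> < \<infinity>" using lap_mass_finite by (simp add: ennreal_mult_less_top)
  finally show 1: "emeasure (ddc_u \<kappa>) UNIV < \<infinity>" .
  have "emeasure (ddc_above \<kappa> r) UNIV = (\<integral>\<^sup>+z. ennreal (if z \<in> unit_disc \<and> \<not> u z < r then \<kappa> * lap z else 0) \<partial>lborel)"
    unfolding ddc_above_def using borel_density_above[of r \<kappa>] by (subst emeasure_density) simp_all
  also have "\<dots> \<le> (\<integral>\<^sup>+z. ennreal (if z \<in> unit_disc then \<kappa> * lap z else 0) \<partial>lborel)"
    by (intro nn_integral_mono) auto
  also have "\<dots> = emeasure (ddc_u \<kappa>) UNIV"
    unfolding ddc_u_def by (simp add: emeasure_density)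
  finally show "emeasure (ddc_above \<kappa> r) UNIV < \<infinity>" using 1 by (rule le_less_trans)
qed

lemma is_ddc_u:
  assumes \<kappa>: "\<kappa> > 0"
  shows "is_ddc \<kappa> u (ddc_u \<kappa>)"
  unfolding is_ddc_def
proof (intro conjI allI impI)
  show "emeasure (ddc_u \<kappa>) (- unit_disc) = 0"
  proof -
    have "emeasure (ddc_u \<kappa>) (- unit_disc) =
        (\<integral>\<^sup>+z. ennreal (if z \<in> unit_disc then \<kappa> * lap z else 0) * indicator (- unit_disc) z \<partial>lborel)"
      unfolding ddc_u_def by (subst emeasure_density) (auto intro!: borel_density_u[THEN measurable_compose] )
    also have "\<dots> = (\<integral>\<^sup>+z. 0 \<partial>(lborel :: complex measure))" by (intro nn_integral_cong) auto
    finally show ?thesis by simp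
  qed
  fix K :: "complex set"
  have "emeasure (ddc_u \<kappa>) K \<le> emeasure (ddc_u \<kappa>) UNIV" by (intro emeasure_mono) auto
  then show "emeasure (ddc_u \<kappa>) K < \<infinity>" using ddc_u_finite(1)[OF \<kappa>] by (rule le_less_trans)
next
  fix \<psi> assume t: "test_function \<psi>"
  have [measurable]: "\<psi> \<in> borel_measurable borel"
    by (intro borel_measurable_continuous_onI test_function_continuous t)
  have "(\<integral>z. \<psi> z \<partial>ddc_u \<kappa>) = (\<integral>z. (if z \<in> unit_disc then \<kappa> * lap z else 0) * \<psi> z \<partial>lborel)"
    unfolding ddc_u_def using \<kappa> lap_pos by (subst integral_density) (auto simp: less_imp_le)
  also have "\<dots> = (\<integral>z. \<kappa> * (if z \<in> unit_disc then \<psi> z * lap z else 0) \<partial>lborel)"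
    by (intro Bochner_Integration.integral_cong) auto
  also have "\<dots> = \<kappa> * (LINT z:unit_disc|lborel. u z * laplacian \<psi> z)"
    using test_function_green(3)[OF t] by (simp add: set_lebesgue_integral_if)
  finally show "(\<integral>z. \<psi> z \<partial>ddc_u \<kappa>) = \<kappa> * (LINT z:unit_disc|lborel. u z * laplacian \<psi> z)" .
qed simp

text \<open>The maximum of \<open>u\<close> and \<open>r\<close> is u + max 0 (r - u). Adding the
  integral of \<open>\<psi> * lap\<close> over the part with \<open>u \<ge> r\<close> to the
  Lelong-Jensen formula completes the first term to the whole disc, where Green's identity moves the
  Laplacian onto \<psi>.\<close>

lemma is_ddc_max:
  assumes \<kappa>: "\<kappa> > 0" and r: "r0 < r" "r < 0"
  shows "is_ddc \<kappa> (\<lambda>z. max (u z) r) (add_measure (nu \<kappa> r) (ddc_above \<kappa> r))"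
  unfolding is_ddc_def
proof (intro conjI allI impI)
  let ?M = "add_measure (nu \<kappa> r) (ddc_above \<kappa> r)"
  note [measurable] = borel_P[OF r]
  have em: "emeasure ?M B = emeasure (nu \<kappa> r) B + emeasure (ddc_above \<kappa> r) B" if "B \<in> sets borel" for B
    using that by (simp add: emeasure_add_measure)
  show "emeasure ?M (- unit_disc) = 0"
  proof -
    have "emeasure (ddc_above \<kappa> r) (- unit_disc) =
        (\<integral>\<^sup>+z. ennreal (if z \<in> unit_disc \<and> \<not> u z < r then \<kappa> * lap z else 0) * indicator (- unit_disc) z \<partial>lborel)"
      unfolding ddc_above_def by (subst emeasure_density) (use borel_density_above[of r \<kappa>] in simp_all)
    also have "\<dots> = (\<integral>\<^sup>+z. 0 \<partial>(lborel :: complex measure))" by (intro nn_integral_cong) auto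
    finally have 1: "emeasure (ddc_above \<kappa> r) (- unit_disc) = 0" by simp
    have "emeasure (nu \<kappa> r) (- unit_disc) = (\<integral>\<^sup>+z. indicator (- unit_disc) z \<partial>nu \<kappa> r)" by simp
    also have "\<dots> = (\<integral>\<^sup>+\<theta>. 0 \<partial>(lborel :: real measure))"
      by (subst nn_integral_nu[OF r]) (use P_props(2)[OF r] in \<open>auto intro!: nn_integral_cong\<close>)
    finally show ?thesis using 1 em[of "- unit_disc"] by simp
  qed
  have fin: "emeasure ?M UNIV < \<infinity>"
    using em[of UNIV] ddc_u_finite(2)[OF \<kappa>, of r] nu_finite[OF r \<kappa>] by (auto simp: less_top[symmetric] top_unique)
  fix K :: "complex set"
  have "emeasure ?M K \<le> emeasure ?M UNIV" by (intro emeasure_mono) auto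
  then show "emeasure ?M K < \<infinity>" using fin by (rule le_less_trans)
next
  fix \<psi> assume t: "test_function \<psi>"
  have [measurable]: "\<psi> \<in> borel_measurable borel"
    by (intro borel_measurable_continuous_onI test_function_continuous t)
  obtain K where p: "pd2 unit_disc \<psi> (pderiv_dir 1 \<psi>) (pderiv_dir \<i> \<psi>)
       (pderiv_dir 1 (pderiv_dir 1 \<psi>)) (pderiv_dir \<i> (pderiv_dir \<i> \<psi>))"
    using test_function_pd2[OF t] by blast
  note L = level_identity[OF r p, folded laplacian_def] and g = test_function_green[OF t]
  have nnd: "0 \<le> (if z \<in> unit_disc \<and> \<not> u z < r then \<kappa> * lap z else 0)" for z
    using \<kappa> lap_pos[of z] by (auto simp: less_imp_le)
  have split: "(if z \<in> unit_disc \<and> \<not> u z < r then \<kappa> * lap z else 0) * \<psi> z =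
      \<kappa> * ((if z \<in> unit_disc then \<psi> z * lap z else 0) - (if z \<in> unit_disc \<and> u z < r then \<psi> z * lap z else 0))" for z
    by auto
  have i2: "integrable lborel (\<lambda>z. (if z \<in> unit_disc \<and> \<not> u z < r then \<kappa> * lap z else 0) * \<psi> z)"
    unfolding split using g(2) L(2) by (intro integrable_mult_right Bochner_Integration.integrable_diff)
  have "(\<integral>z. \<psi> z \<partial>add_measure (nu \<kappa> r) (ddc_above \<kappa> r)) = (\<integral>z. \<psi> z \<partial>nu \<kappa> r) + (\<integral>z. \<psi> z \<partial>ddc_above \<kappa> r)"
  proof (rule integral_add_measure)
    show "integrable (nu \<kappa> r) \<psi>" using L(1) integral_nu(2)[OF r \<kappa>] by simp
    show "integrable (ddc_above \<kappa> r) \<psi>"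
      unfolding ddc_above_def using i2 nnd borel_density_above[of r \<kappa>] by (subst integrable_density) auto
  qed simp
  also have "(\<integral>z. \<psi> z \<partial>nu \<kappa> r) = \<kappa> * ((\<integral>z. (if z \<in> unit_disc \<and> u z < r then \<psi> z * lap z else 0) \<partial>lborel) +
      (\<integral>z. (if z \<in> unit_disc then max 0 (r - u z) * laplacian \<psi> z else 0) \<partial>lborel))"
    using integral_nu(1)[OF r \<kappa>, of \<psi>] L(4) by simp
  also have "(\<integral>z. \<psi> z \<partial>ddc_above \<kappa> r) = (\<integral>z. (if z \<in> unit_disc \<and> \<not> u z < r then \<kappa> * lap z else 0) * \<psi> z \<partial>lborel)"
    unfolding ddc_above_def using nnd borel_density_above[of r \<kappa>] by (subst integral_density) auto
  also have "\<dots> = \<kappa> * ((\<integral>z. (if z \<in> unit_disc then \<psi> z * lap z else 0) \<partial>lborel) -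
      (\<integral>z. (if z \<in> unit_disc \<and> u z < r then \<psi> z * lap z else 0) \<partial>lborel))"
    unfolding split using g(2) L(2) by simp
  also have "\<kappa> * ((\<integral>z. (if z \<in> unit_disc \<and> u z < r then \<psi> z * lap z else 0) \<partial>lborel) +
      (\<integral>z. (if z \<in> unit_disc then max 0 (r - u z) * laplacian \<psi> z else 0) \<partial>lborel)) +
      \<kappa> * ((\<integral>z. (if z \<in> unit_disc then \<psi> z * lap z else 0) \<partial>lborel) -
      (\<integral>z. (if z \<in> unit_disc \<and> u z < r then \<psi> z * lap z else 0) \<partial>lborel))
    = \<kappa> * ((\<integral>z. (if z \<in> unit_disc then max 0 (r - u z) * laplacian \<psi> z else 0) \<partial>lborel) +
      (\<integral>z. (if z \<in> unit_disc then u z * laplacian \<psi> z else 0) \<partial>lborel))"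
    unfolding g(3) by (simp add: algebra_simps)
  also have "\<dots> = \<kappa> * (\<integral>z. (if z \<in> unit_disc then max 0 (r - u z) * laplacian \<psi> z else 0) +
      (if z \<in> unit_disc then u z * laplacian \<psi> z else 0) \<partial>lborel)"
    using L(3) g(1) by simp
  also have "(\<integral>z. (if z \<in> unit_disc then max 0 (r - u z) * laplacian \<psi> z else 0) +
      (if z \<in> unit_disc then u z * laplacian \<psi> z else 0) \<partial>lborel) = (LINT z:unit_disc|lborel. max (u z) r * laplacian \<psi> z)"
    unfolding set_lebesgue_integral_if
    by (intro Bochner_Integration.integral_cong) (auto simp: max_def algebra_simps)
  finally show "(\<integral>z. \<psi> z \<partial>add_measure (nu \<kappa> r) (ddc_above \<kappa> r)) = \<kappa> * (LINT z:unit_disc|lborel. max (u z) r * laplacian \<psi> z)" .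
qed simp

text \<open>Uniqueness identifies both measures in the definition. Since both are finite,
  \<open>diff_measure\<close> is a genuine difference and cancels the part above the level.\<close>

lemma MA_measure_eq:
  assumes \<kappa>: "\<kappa> > 0" and r: "r0 < r" "r < 0"
  shows "MA_measure \<kappa> u r = nu \<kappa> r"
proof -
  let ?S = "unit_disc - sublevel u r"
  have S: "?S \<in> sets borel" using borel_u_disc[of r] by (auto simp: sublevel_def)
  have above: "density (ddc_u \<kappa>) (indicator ?S) = ddc_above \<kappa> r"
    unfolding ddc_u_def ddc_above_def
  proof (subst density_density_eq)
    show "(\<lambda>z. ennreal (if z \<in> unit_disc then \<kappa> * lap z else 0)) \<in> borel_measurable lborel"
      using borel_density_u by simp
    show "(indicator ?S :: _ \<Rightarrow> ennreal) \<in> borel_measurable lborel" using S by simp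
    have "(\<lambda>z. ennreal (if z \<in> unit_disc then \<kappa> * lap z else 0) * indicator ?S z) =
       (\<lambda>z. ennreal (if z \<in> unit_disc \<and> \<not> u z < r then \<kappa> * lap z else 0))"
      by (auto simp: fun_eq_iff sublevel_def)
    then show "density lborel (\<lambda>z. ennreal (if z \<in> unit_disc then \<kappa> * lap z else 0) * indicator ?S z) =
       density lborel (\<lambda>z. ennreal (if z \<in> unit_disc \<and> \<not> u z < r then \<kappa> * lap z else 0))" by simp
  qed
  have fN: "emeasure (ddc_above \<kappa> r) UNIV < \<infinity>" and fn: "emeasure (nu \<kappa> r) UNIV < \<infinity>"
    using ddc_u_finite(2)[OF \<kappa>] nu_finite[OF r \<kappa>] by (auto simp: less_top[symmetric] top_unique)
  have sp: "space (ddc_above \<kappa> r) = UNIV" "space (nu \<kappa> r) = UNIV"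
    using sets_eq_imp_space_eq[OF sets_ddc_above] sets_eq_imp_space_eq[OF sets_nu] by auto
  have em: "emeasure (add_measure (nu \<kappa> r) (ddc_above \<kappa> r)) B = emeasure (nu \<kappa> r) B + emeasure (ddc_above \<kappa> r) B"
    if "B \<in> sets borel" for B
    using that by (simp add: emeasure_add_measure)
  have M: "MA_measure \<kappa> u r = diff_measure (add_measure (nu \<kappa> r) (ddc_above \<kappa> r)) (ddc_above \<kappa> r)"
    unfolding MA_measure_def ddc_eqI[OF is_ddc_max[OF \<kappa> r]] ddc_eqI[OF is_ddc_u[OF \<kappa>]] above ..
  show ?thesis
  proof (rule measure_eqI)
    fix B assume "B \<in> sets (MA_measure \<kappa> u r)"
    then have B: "B \<in> sets borel" by (simp add: M)
    have fB: "emeasure (ddc_above \<kappa> r) B \<noteq> \<infinity>"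
    proof -
      have "emeasure (ddc_above \<kappa> r) B \<le> emeasure (ddc_above \<kappa> r) UNIV" by (intro emeasure_mono) auto
      then show ?thesis using fN by auto
    qed
    have "emeasure (MA_measure \<kappa> u r) B = emeasure (add_measure (nu \<kappa> r) (ddc_above \<kappa> r)) B - emeasure (ddc_above \<kappa> r) B"
      unfolding M
    proof (rule emeasure_diff_measure)
      show "finite_measure (add_measure (nu \<kappa> r) (ddc_above \<kappa> r))" "finite_measure (ddc_above \<kappa> r)"
        using fN fn em[of UNIV] by (auto intro!: finite_measureI simp: sp)
    qed (use B em in auto)
    also have "\<dots> = emeasure (nu \<kappa> r) B" using em[OF B] fB by simp
    finally show "emeasure (MA_measure \<kappa> u r) B = emeasure (nu \<kappa> r) B" .
  qed (simp add: M)
qed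

lemma T_tendsto:
  assumes S: "\<And>n. r0 < S n" "\<And>n. S n < 0" "S \<longlonglongrightarrow> 0"
  shows "(\<lambda>n. T (S n) \<theta>) \<longlonglongrightarrow> 0"
proof (rule LIMSEQ_I)
  fix e :: real assume e: "e > 0"
  define t where "t = max t0 (- (e / 2))"
  have t: "t0 \<le> t" "t < 0" "- e < t" using e t0 by (auto simp: t_def)
  have "U \<theta> t < 0" using U_less_iff[of t 0 \<theta>] t U_0[of \<theta>] t0 by auto
  then have "eventually (\<lambda>n. U \<theta> t < S n) sequentially" using order_tendstoD(1)[OF S(3)] by blast
  then obtain N where N: "\<And>n. n \<ge> N \<Longrightarrow> U \<theta> t < S n" by (auto simp: eventually_sequentially)
  show "\<exists>no. \<forall>n\<ge>no. norm (T (S n) \<theta> - 0) < e"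
  proof (intro exI allI impI)
    fix n assume "n \<ge> N"
    then have "t < T (S n) \<theta>" using less_T_iff(1)[OF S(1,2), of t n \<theta>] t N[of n] by auto
    then show "norm (T (S n) \<theta> - 0) < e" using T_props(2)[OF S(1,2), of n \<theta>] t by simp
  qed
qed

lemma cis_in_A: "\<theta> \<in> {0<..<2 * pi} \<Longrightarrow> cis \<theta> \<in> A"
proof -
  assume \<theta>: "\<theta> \<in> {0<..<2 * pi}"
  have "cis \<theta> \<noteq> 1"
  proof
    assume "cis \<theta> = 1"
    then have "cos \<theta> = 1" by (metis cis.simps(1) one_complex.simps(1))
    then obtain n :: int where "\<theta> = of_int n * 2 * pi" using cos_one_2pi_int by blast
    then have "0 < of_int n * (2 * pi)" "of_int n * (2 * pi) < 1 * (2 * pi)" using \<theta> by auto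
    then have "0 < real_of_int n" "real_of_int n < 1"
      by (simp_all only: zero_less_mult_iff mult_less_cancel_right) (use pi_gt_zero in auto)
    then have "0 < n" "n < 1" by (simp_all only: of_int_0_less_iff of_int_less_1_iff)
    then show False by simp
  qed
  then show ?thesis using t0 by (simp add: A_def)
qed

text \<open>As the level tends to 0 the points \<open>P r \<theta>\<close> converge radially to the
  circle, and \<open>boundary_weight\<close> dominates the densities: the limit has the density
  \<kappa> w in the angle.\<close>

lemma nu_limit:
  fixes h :: "complex \<Rightarrow> real"
  assumes \<kappa>: "\<kappa> > 0" and h: "continuous_on (cball 0 1) h"
  shows "integrable lborel (\<lambda>\<theta>. indicator {0<..<2 * pi} \<theta> * (h (cis \<theta>) * w (cis \<theta>)))"
    "((\<lambda>r. LINT z:cball 0 1|nu \<kappa> r. h z) \<longlongrightarrow>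
      \<kappa> * (\<integral>\<theta>. indicator {0<..<2 * pi} \<theta> * (h (cis \<theta>) * w (cis \<theta>)) \<partial>lborel)) (at_left 0)"
proof -
  \<comment> \<open>Extension by 0 makes \<open>h\<close>, which is controlled on the closed disc
    only, Borel measurable on the plane.\<close>
  define hb where "hb = (\<lambda>z. indicator (cball 0 1) z *\<^sub>R h z)"
  have hbm [measurable]: "hb \<in> borel_measurable borel"
    unfolding hb_def by (intro borel_measurable_continuous_on_indicator h) auto
  obtain B where B: "\<And>z. z \<in> cball 0 1 \<Longrightarrow> norm (h z) \<le> B"
  proof -
    obtain B where "\<And>x. x \<in> h ` cball 0 1 \<Longrightarrow> norm x \<le> B"
      using compact_imp_bounded[OF compact_continuous_image[OF h compact_cball]] unfolding bounded_iff by blast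
    then show ?thesis using that[of B] by blast
  qed
  have B0: "B \<ge> 0" using B[of 0] by simp
  have hbB: "\<bar>hb z\<bar> \<le> B" for z using B[of z] B0 by (auto simp: hb_def indicator_def)
  have cism [measurable]: "cis \<in> borel_measurable borel"
    by (intro borel_measurable_continuous_onI continuous_intros)
  let ?g = "\<lambda>\<theta>. indicator {0<..<2 * pi} \<theta> * (hb (cis \<theta>) * w (cis \<theta>))"
  have geq: "?g = (\<lambda>\<theta>. indicator {0<..<2 * pi} \<theta> * (h (cis \<theta>) * w (cis \<theta>)))"
    by (auto simp: hb_def)
  have gm: "?g \<in> borel_measurable lborel" by measurable
  have dom: "integrable lborel (\<lambda>\<theta>. B * C * (indicator {0<..<2 * pi} \<theta> * boundary_weight \<theta>))"
    using integrable_boundary_weight by (rule integrable_mult_right)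
  have key: "integrable lborel ?g \<and> (\<lambda>n. \<integral>\<theta>. indicator {0<..<2 * pi} \<theta> * (hb (P (S n) \<theta>) * w (P (S n) \<theta>)) \<partial>lborel) \<longlonglongrightarrow> (\<integral>\<theta>. ?g \<theta> \<partial>lborel)"
    if S: "\<And>n. r0 < S n" "\<And>n. S n < 0" "S \<longlonglongrightarrow> 0" for S :: "nat \<Rightarrow> real"
  proof -
    let ?f = "\<lambda>n \<theta>. indicator {0<..<2 * pi} \<theta> * (hb (P (S n) \<theta>) * w (P (S n) \<theta>))"
    have fm: "?f n \<in> borel_measurable lborel" for n
    proof -
      note [measurable] = borel_P[OF S(1,2)]
      show ?thesis by measurable
    qed
    have lim: "(\<lambda>n. ?f n \<theta>) \<longlonglongrightarrow> ?g \<theta>" for \<theta>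
    proof (cases "\<theta> \<in> {0<..<2 * pi}")
      case True
      have "(\<lambda>n. exp (Complex (T (S n) \<theta>) \<theta>)) \<longlonglongrightarrow> exp (Complex 0 \<theta>)"
        unfolding Complex_eq by (intro tendsto_intros T_tendsto S)
      then have Pl: "(\<lambda>n. P (S n) \<theta>) \<longlonglongrightarrow> cis \<theta>" by (simp add: P_def exp_eq_polar[of "Complex 0 \<theta>"])
      have "(\<lambda>n. W (P (S n) \<theta>)) \<longlonglongrightarrow> W (cis \<theta>)"
        by (rule continuous_on_tendsto_compose[OF cont_W Pl cis_in_A[OF True]])
           (use P_props(1)[OF S(1,2)] in simp)
      then have wl: "(\<lambda>n. w (P (S n) \<theta>)) \<longlonglongrightarrow> w (cis \<theta>)"
        using P_props(1)[OF S(1,2)] cis_in_A[OF True] by (simp add: w_def)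
      have "(\<lambda>n. h (P (S n) \<theta>)) \<longlonglongrightarrow> h (cis \<theta>)"
        by (rule continuous_on_tendsto_compose[OF h Pl])
           (use P_props(2)[OF S(1,2)] in \<open>auto simp: less_imp_le\<close>)
      moreover have "hb (P (S n) \<theta>) = h (P (S n) \<theta>)" for n
        using P_props(2)[OF S(1,2), of n \<theta>] by (simp add: hb_def less_imp_le)
      moreover have "hb (cis \<theta>) = h (cis \<theta>)" by (simp add: hb_def)
      ultimately have hl: "(\<lambda>n. hb (P (S n) \<theta>)) \<longlonglongrightarrow> hb (cis \<theta>)" by simp
      show ?thesis by (intro tendsto_mult tendsto_const hl wl)
    qed simp
    have le: "norm (?f n \<theta>) \<le> B * C * (indicator {0<..<2 * pi} \<theta> * boundary_weight \<theta>)" for n \<theta>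
    proof (cases "\<theta> \<in> {0<..<2 * pi}")
      case True
      have "\<bar>hb (P (S n) \<theta>)\<bar> * w (P (S n) \<theta>) \<le> B * (C * boundary_weight \<theta>)"
        using hbB w_P_le[OF S(1,2) True] B0 w_nonneg by (intro mult_mono) auto
      then show ?thesis using True w_nonneg by (simp add: abs_mult)
    qed simp
    show ?thesis
    proof
      show "integrable lborel ?g"
        by (rule integrable_dominated_convergence[where s = ?f, OF gm fm dom]) (use lim le in auto)
      show "(\<lambda>n. \<integral>\<theta>. ?f n \<theta> \<partial>lborel) \<longlonglongrightarrow> (\<integral>\<theta>. ?g \<theta> \<partial>lborel)"
        by (rule integral_dominated_convergence[OF gm fm dom]) (use lim le in auto)
    qed
  qed
  have eq: "(LINT z:cball 0 1|nu \<kappa> r. h z) = \<kappa> * (\<integral>\<theta>. indicator {0<..<2 * pi} \<theta> * (hb (P r \<theta>) * w (P r \<theta>)) \<partial>lborel)"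
    if "r0 < r" "r < 0" for r
    using integral_nu(1)[OF that \<kappa> hbm] by (simp add: set_lebesgue_integral_def hb_def)
  show "((\<lambda>r. LINT z:cball 0 1|nu \<kappa> r. h z) \<longlongrightarrow>
      \<kappa> * (\<integral>\<theta>. indicator {0<..<2 * pi} \<theta> * (h (cis \<theta>) * w (cis \<theta>)) \<partial>lborel)) (at_left 0)"
  proof (rule tendsto_at_left_sequentially[OF r0])
    fix S :: "nat \<Rightarrow> real" assume S: "\<And>n. S n < 0" "\<And>n. r0 < S n" "S \<longlonglongrightarrow> 0"
    show "(\<lambda>n. LINT z:cball 0 1|nu \<kappa> (S n). h z) \<longlonglongrightarrow>
      \<kappa> * (\<integral>\<theta>. indicator {0<..<2 * pi} \<theta> * (h (cis \<theta>) * w (cis \<theta>)) \<partial>lborel)"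
      unfolding eq[OF S(2,1)] geq[symmetric] using key[OF S(2,1,3)] by (intro tendsto_mult_left) blast
  qed
  \<comment> \<open>The integrability of the limit does not depend on the levels, so any one
    sequence tending to 0 yields it.\<close>
  define S where "S = (\<lambda>n. r0 / real (n + 2))"
  have "r0 < S n" "S n < 0" for n
  proof -
    show "S n < 0" using r0 by (simp add: S_def divide_neg_pos)
    have "r0 * (real n + 1) < 0" using r0 by (intro mult_neg_pos) auto
    then show "r0 < S n" by (simp add: S_def pos_less_divide_eq algebra_simps)
  qed
  moreover have "S \<longlonglongrightarrow> 0"
    unfolding S_def by (intro real_tendsto_divide_at_top[OF tendsto_const] filterlim_compose[OF filterlim_real_sequentially] filterlim_add_const_nat_at_top)
  ultimately show "integrable lborel (\<lambda>\<theta>. indicator {0<..<2 * pi} \<theta> * (h (cis \<theta>) * w (cis \<theta>)))"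
    using key unfolding geq by blast
qed

end

section \<open>Arc length, Moebius maps and the boundary density\<close>

text \<open>The indicator of an open set is the increasing limit of truncated multiples of the
  distance to its complement, and open sets generate the Borel sets.\<close>

lemma measure_eqI_continuous:
  fixes M N :: "complex measure"
  assumes [measurable_cong, simp]: "sets M = sets borel" "sets N = sets borel"
    and fin: "emeasure M UNIV \<noteq> \<infinity>"
    and eq: "\<And>h :: complex \<Rightarrow> real. continuous_on UNIV h \<Longrightarrow> (\<And>z. 0 \<le> h z \<and> h z \<le> 1) \<Longrightarrow>
      (\<integral>\<^sup>+z. ennreal (h z) \<partial>M) = (\<integral>\<^sup>+z. ennreal (h z) \<partial>N)"
  shows "M = N"
proof (rule measure_eqI_generator_eq[where E = "{S. open S}" and \<Omega> = UNIV and A = "\<lambda>_. UNIV"])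
  fix X :: "complex set" assume "X \<in> {S. open S}"
  then have X: "open X" by simp
  show "emeasure M X = emeasure N X"
  proof (cases "X = UNIV")
    case True
    have sp: "space M = UNIV" "space N = UNIV"
      using sets_eq_imp_space_eq[OF assms(1)] sets_eq_imp_space_eq[OF assms(2)] by auto
    show ?thesis using eq[of "\<lambda>_. 1"] True sp by (auto simp: nn_integral_const)
  next
    case False
    then have ne: "- X \<noteq> {}" by auto
    have cl: "closed (- X)" using X by (rule closed_Compl)
    define h where "h = (\<lambda>n z. min 1 (real n * infdist z (- X)))"
    have lim: "(\<lambda>n. \<integral>\<^sup>+z. ennreal (h n z) \<partial>L) \<longlonglongrightarrow> (\<integral>\<^sup>+z. indicator X z \<partial>L)"
      if [measurable_cong]: "sets L = sets borel" for L :: "complex measure"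
    proof (rule nn_integral_LIMSEQ)
      show "incseq (\<lambda>n z. ennreal (h n z))"
        unfolding incseq_def le_fun_def h_def
        by (auto intro!: ennreal_leI min.mono mult_right_mono infdist_nonneg)
      show "(\<lambda>z. ennreal (h n z)) \<in> borel_measurable L" for n
      proof -
        have [measurable]: "h n \<in> borel_measurable borel"
          unfolding h_def by (intro borel_measurable_continuous_onI continuous_intros)
        show ?thesis by measurable
      qed
      show "(\<lambda>n. ennreal (h n z)) \<longlonglongrightarrow> indicator X z" for z
      proof (cases "z \<in> X")
        case True
        then have pos: "infdist z (- X) > 0"
          using in_closed_iff_infdist_zero[OF cl ne, of z] infdist_nonneg[of z "- X"] by auto
        then obtain n0 where n0: "1 / infdist z (- X) < real n0" using reals_Archimedean2 by blast
        have "eventually (\<lambda>n. ennreal (h n z) = indicator X z) sequentially"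
        proof (rule eventually_sequentiallyI[of n0])
          fix n assume "n \<ge> n0"
          then have "1 / infdist z (- X) < real n" using n0 by linarith
          then have "1 \<le> real n * infdist z (- X)" using pos by (simp add: field_simps)
          then show "ennreal (h n z) = indicator X z" using True by (simp add: h_def)
        qed
        then show ?thesis by (rule tendsto_eventually)
      next
        case False
        then have "infdist z (- X) = 0" by simp
        then show ?thesis using False by (simp add: h_def)
      qed
    qed
    have "(\<integral>\<^sup>+z. ennreal (h n z) \<partial>M) = (\<integral>\<^sup>+z. ennreal (h n z) \<partial>N)" for n
      unfolding h_def by (rule eq) (auto intro!: continuous_intros mult_nonneg_nonneg infdist_nonneg)
    then have "(\<integral>\<^sup>+z. indicator X z \<partial>M) = (\<integral>\<^sup>+z. indicator X z \<partial>N)"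
      using LIMSEQ_unique[OF lim[of M]] lim[of N] by simp
    then show ?thesis using X by simp
  qed
next
  show "Int_stable {S. open (S :: complex set)}" by (auto simp: Int_stable_def)
  show "sets M = sigma_sets UNIV {S. open S}" "sets N = sigma_sets UNIV {S. open S}"
    by (simp_all add: borel_def)
qed (use fin in auto)

lemma nn_integral_arc_length:
  assumes [measurable]: "f \<in> borel_measurable borel"
  shows "(\<integral>\<^sup>+z. f z \<partial>arc_length) = (\<integral>\<^sup>+\<theta>. f (cis \<theta>) * indicator {0<..<2 * pi} \<theta> \<partial>lborel) / ennreal (2 * pi)"
proof -
  have [measurable]: "cis \<in> borel_measurable borel"
    by (intro borel_measurable_continuous_onI continuous_intros)
  have "(\<integral>\<^sup>+z. f z \<partial>arc_length) = (\<integral>\<^sup>+\<theta>. f (cis \<theta>) \<partial>uniform_measure lborel {0..<2 * pi})"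
    unfolding arc_length_def by (intro nn_integral_distr) measurable
  also have "\<dots> = (\<integral>\<^sup>+\<theta>. f (cis \<theta>) * indicator {0..<2 * pi} \<theta> \<partial>lborel) / emeasure lborel {0..<2 * pi}"
    by (intro nn_integral_uniform_measure) measurable
  also have "(\<integral>\<^sup>+\<theta>. f (cis \<theta>) * indicator {0..<2 * pi} \<theta> \<partial>lborel) = (\<integral>\<^sup>+\<theta>. f (cis \<theta>) * indicator {0<..<2 * pi} \<theta> \<partial>lborel)"
    by (rule nn_integral_cong_AE) (use AE_lborel_singleton[of 0] in \<open>eventually_elim, auto simp: indicator_def\<close>)
  finally show ?thesis by simp
qed

lemma sets_arc_length [simp, measurable_cong]: "sets arc_length = sets borel"
  by (simp add: arc_length_def)

lemma emeasure_arc_length_UNIV: "emeasure arc_length UNIV = 1"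
proof -
  have "emeasure arc_length UNIV = (\<integral>\<^sup>+z. 1 \<partial>arc_length)"
    using sets_eq_imp_space_eq[OF sets_arc_length] by (simp add: nn_integral_const)
  also have "\<dots> = emeasure lborel {0<..<2 * pi} / ennreal (2 * pi)"
    by (subst nn_integral_arc_length) (simp_all del: emeasure_lborel_Ioo)
  also have "\<dots> = 1" by (simp add: divide_ennreal)
  finally show ?thesis .
qed

lemma finite_measure_arc_length: "finite_measure arc_length"
  using sets_eq_imp_space_eq[OF sets_arc_length] by (intro finite_measureI) (simp add: emeasure_arc_length_UNIV)

text \<open>Moves null sets of the circle to the angle, where differentiable maps are known to
  preserve them.\<close>

lemma AE_arc_length_iff:
  assumes "{z. \<not> Pr z} \<in> sets borel"
  shows "(AE z in arc_length. Pr z) \<longleftrightarrow> negligible {\<theta> \<in> {0<..<2 * pi}. \<not> Pr (cis \<theta>)}"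
proof -
  have c [measurable]: "cis \<in> borel_measurable borel"
    by (intro borel_measurable_continuous_onI continuous_intros)
  have vm: "cis -` {z. \<not> Pr z} \<in> sets borel" using measurable_sets[OF c assms] by simp
  have s: "{\<theta> \<in> {0<..<2 * pi}. \<not> Pr (cis \<theta>)} = {0<..<2 * pi} \<inter> cis -` {z. \<not> Pr z}" by auto
  have sb: "{\<theta> \<in> {0<..<2 * pi}. \<not> Pr (cis \<theta>)} \<in> sets borel" unfolding s using vm by simp
  have "(AE z in arc_length. Pr z) \<longleftrightarrow> emeasure arc_length {z. \<not> Pr z} = 0"
    using assms sets_eq_imp_space_eq[OF sets_arc_length] by (subst AE_iff_measurable[OF _ refl]) auto
  also have "emeasure arc_length {z. \<not> Pr z} = (\<integral>\<^sup>+z. indicator {z. \<not> Pr z} z \<partial>arc_length)"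
    using assms by simp
  also have "\<dots> = (\<integral>\<^sup>+\<theta>. indicator {z. \<not> Pr z} (cis \<theta>) * indicator {0<..<2 * pi} \<theta> \<partial>lborel) / ennreal (2 * pi)"
    by (rule nn_integral_arc_length[OF borel_measurable_indicator[OF assms]])
  also have "(\<integral>\<^sup>+\<theta>. indicator {z. \<not> Pr z} (cis \<theta>) * indicator {0<..<2 * pi} \<theta> \<partial>lborel)
      = (\<integral>\<^sup>+\<theta>. indicator {\<theta> \<in> {0<..<2 * pi}. \<not> Pr (cis \<theta>)} \<theta> \<partial>lborel)"
    by (intro nn_integral_cong) (auto simp: indicator_def)
  also have "\<dots> = emeasure lborel {\<theta> \<in> {0<..<2 * pi}. \<not> Pr (cis \<theta>)}" using sb by (intro nn_integral_indicator) simp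
  finally have "(AE z in arc_length. Pr z) \<longleftrightarrow> emeasure lborel {\<theta> \<in> {0<..<2 * pi}. \<not> Pr (cis \<theta>)} = 0"
    by (simp add: ennreal_divide_eq_0_iff)
  also have "\<dots> \<longleftrightarrow> emeasure lebesgue {\<theta> \<in> {0<..<2 * pi}. \<not> Pr (cis \<theta>)} = 0" using sb by simp
  also have "\<dots> \<longleftrightarrow> negligible {\<theta> \<in> {0<..<2 * pi}. \<not> Pr (cis \<theta>)}"
    using sb by (auto simp: negligible_iff_null_sets null_sets_def)
  finally show ?thesis .
qed

section \<open>Automorphisms of the disc\<close>

definition moebius :: "complex \<Rightarrow> complex \<Rightarrow> complex \<Rightarrow> complex" where
  "moebius e a z = e * ((z - a) / (1 - cnj a * z))"

text \<open>The inverse written as a map of the same family, so that every estimate for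
  \<open>moebius\<close> also applies to it.\<close>

definition moebius_inv :: "complex \<Rightarrow> complex \<Rightarrow> complex \<Rightarrow> complex" where
  "moebius_inv e a = moebius (cnj e) (- (e * a))"

locale moebius_map =
  fixes e a :: complex
  assumes e: "cmod e = 1" and a: "cmod a < 1"
begin

text \<open>The maximum of the modulus of the derivative on the closed disc, hence a Lipschitz
  constant there; its reciprocal is the minimum.\<close>

definition "lip = (1 + cmod a) / (1 - cmod a)"

lemma lip_ge_1: "lip \<ge> 1"
  using a by (simp add: lip_def field_simps)

lemma e_cnj [simp]: "e * cnj e = 1" "cnj e * e = 1"
  using e complex_norm_square[of e] by (simp_all add: mult.commute)

lemma denom_ge: "cmod z \<le> 1 \<Longrightarrow> 1 - cmod a \<le> cmod (1 - cnj a * z)"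
proof -
  assume "cmod z \<le> 1"
  then have "cmod (cnj a * z) \<le> cmod a" by (simp add: norm_mult mult_left_le)
  then show ?thesis using norm_triangle_ineq2[of 1 "cnj a * z"] by simp
qed

lemma denom_nonzero: "cmod z \<le> 1 \<Longrightarrow> 1 - cnj a * z \<noteq> 0"
  using denom_ge[of z] a by auto

lemma one_minus_norm:
  assumes "cmod z \<le> 1"
  shows "1 - (cmod (moebius e a z))\<^sup>2 = (1 - (cmod a)\<^sup>2) * (1 - (cmod z)\<^sup>2) / (cmod (1 - cnj a * z))\<^sup>2"
proof -
  have d: "cmod (1 - cnj a * z) \<noteq> 0" using denom_nonzero[OF assms] by simp
  have "(cmod (1 - cnj a * z))\<^sup>2 - (cmod (z - a))\<^sup>2 = (1 - (cmod a)\<^sup>2) * (1 - (cmod z)\<^sup>2)"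
    unfolding cmod_power2 by (simp add: power2_eq_square algebra_simps)
  moreover have "(cmod (moebius e a z))\<^sup>2 = (cmod (z - a))\<^sup>2 / (cmod (1 - cnj a * z))\<^sup>2"
    using e by (simp add: moebius_def norm_mult norm_divide power_divide)
  ultimately show ?thesis using d by (simp add: field_simps)
qed

lemma in_disc: "z \<in> unit_disc \<Longrightarrow> moebius e a z \<in> unit_disc"
  and in_cball: "z \<in> cball 0 1 \<Longrightarrow> moebius e a z \<in> cball 0 1"
  and in_circle: "z \<in> unit_circle \<Longrightarrow> moebius e a z \<in> unit_circle"
proof -
  have a2: "1 - (cmod a)\<^sup>2 > 0" using a by (simp add: abs_square_less_1)
  have d: "(cmod (1 - cnj a * z))\<^sup>2 > 0" if "cmod z \<le> 1" for z using denom_nonzero[OF that] by simp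
  show "moebius e a z \<in> unit_disc" if "z \<in> unit_disc" for z
  proof -
    have "1 - (cmod z)\<^sup>2 > 0" using that by (simp add: abs_square_less_1)
    then have "1 - (cmod (moebius e a z))\<^sup>2 > 0"
      using one_minus_norm[of z] a2 d[of z] that by simp
    then show ?thesis by (simp add: abs_square_less_1)
  qed
  show "moebius e a z \<in> cball 0 1" if "z \<in> cball 0 1" for z
  proof -
    have "1 - (cmod z)\<^sup>2 \<ge> 0" using that by (simp add: abs_square_le_1)
    then have "1 - (cmod (moebius e a z))\<^sup>2 \<ge> 0"
      using one_minus_norm[of z] a2 d[of z] that by simp
    then show ?thesis by (simp add: abs_square_le_1)
  qed
  show "moebius e a z \<in> unit_circle" if "z \<in> unit_circle" for z
    using one_minus_norm[of z] that by (simp add: abs_square_eq_1)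
qed

lemma moebius_diff:
  assumes "cmod z \<le> 1" "cmod y \<le> 1"
  shows "moebius e a z - moebius e a y = e * of_real (1 - (cmod a)\<^sup>2) * (z - y) / ((1 - cnj a * z) * (1 - cnj a * y))"
proof -
  have aa: "of_real (1 - (cmod a)\<^sup>2) = 1 - a * cnj a" using complex_norm_square[of a] by simp
  show ?thesis
    unfolding aa using denom_nonzero[OF assms(1)] denom_nonzero[OF assms(2)]
    by (simp add: moebius_def field_simps)
qed

lemma one_minus_a2: "1 - (cmod a)\<^sup>2 = (1 - cmod a) * (1 + cmod a)" "1 - (cmod a)\<^sup>2 > 0"
  using a by (simp_all add: power2_eq_square algebra_simps abs_square_less_1[unfolded power2_eq_square])

lemma lipschitz:
  assumes "cmod z \<le> 1" "cmod y \<le> 1"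
  shows "cmod (moebius e a z - moebius e a y) \<le> lip * cmod (z - y)"
proof -
  have "cmod (moebius e a z - moebius e a y) =
      (1 - (cmod a)\<^sup>2) * cmod (z - y) / (cmod (1 - cnj a * z) * cmod (1 - cnj a * y))"
    unfolding moebius_diff[OF assms] using e one_minus_a2(2) by (simp add: norm_mult norm_divide del: of_real_diff)
  also have "\<dots> \<le> (1 - (cmod a)\<^sup>2) * cmod (z - y) / ((1 - cmod a) * (1 - cmod a))"
    using denom_ge assms a one_minus_a2(2) denom_nonzero[OF assms(1)] denom_nonzero[OF assms(2)] by (intro divide_left_mono mult_mono mult_pos_pos mult_nonneg_nonneg) auto
  also have "\<dots> = lip * cmod (z - y)"
    unfolding one_minus_a2(1) using a by (simp add: lip_def)
  finally show ?thesis .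
qed

text \<open>Twice 1 - Re x is the sum of the squared distance from x to 1 and of 1 minus the squared
  modulus of x. The first summand grows by at most the square of \<open>lip\<close> because 1 is
  fixed, the second by at most the factor \<open>lip\<close>.\<close>

lemma one_minus_Re_moebius:
  assumes z: "z \<in> cball 0 1" and fix1: "moebius e a 1 = 1"
  shows "1 - Re (moebius e a z) \<le> lip\<^sup>2 * (1 - Re z)"
proof -
  have id: "2 * (1 - Re x) = (cmod (1 - x))\<^sup>2 + (1 - (cmod x)\<^sup>2)" for x
    unfolding cmod_power2 by (simp add: power2_eq_square algebra_simps)
  have "cmod (1 - moebius e a z) \<le> lip * cmod (1 - z)"
    using lipschitz[of 1 z] z fix1 by simp
  then have 1: "(cmod (1 - moebius e a z))\<^sup>2 \<le> lip\<^sup>2 * (cmod (1 - z))\<^sup>2"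
    by (metis norm_ge_zero power_mono power_mult_distrib)
  have z2: "1 - (cmod z)\<^sup>2 \<ge> 0" using z by (simp add: abs_square_le_1)
  have "1 - (cmod (moebius e a z))\<^sup>2 \<le> (1 - (cmod a)\<^sup>2) * (1 - (cmod z)\<^sup>2) / ((1 - cmod a) * (1 - cmod a))"
    unfolding one_minus_norm[OF z[unfolded mem_cball_0]] power2_eq_square[of "cmod (1 - cnj a * z)"]
    using denom_ge[of z] denom_nonzero[of z] z a one_minus_a2(2) z2
    by (intro divide_left_mono mult_mono mult_pos_pos mult_nonneg_nonneg) auto
  also have "\<dots> = lip * (1 - (cmod z)\<^sup>2)"
    unfolding one_minus_a2(1) using a by (simp add: lip_def)
  also have "\<dots> \<le> lip\<^sup>2 * (1 - (cmod z)\<^sup>2)"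
    using z2 lip_ge_1 by (intro mult_right_mono) (auto simp: power2_eq_square)
  finally have "2 * (1 - Re (moebius e a z)) \<le> lip\<^sup>2 * (2 * (1 - Re z))"
    unfolding id using 1 by (simp add: algebra_simps)
  moreover have "x \<le> k * y" if "2 * x \<le> k * (2 * y)" for x k y :: real using that by simp
  ultimately show ?thesis by blast
qed

definition "dmoebius z = e * of_real (1 - (cmod a)\<^sup>2) / (1 - cnj a * z)\<^sup>2"
definition "ddmoebius z = 2 * cnj a * e * of_real (1 - (cmod a)\<^sup>2) / (1 - cnj a * z) ^ 3"

lemma moebius_deriv:
  assumes "cmod z \<le> 1"
  shows "(moebius e a has_field_derivative dmoebius z) (at z)"
    "(dmoebius has_field_derivative ddmoebius z) (at z)"
proof -
  have aa: "of_real (1 - (cmod a)\<^sup>2) = 1 - a * cnj a" using complex_norm_square[of a] by simp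
  note d = denom_nonzero[OF assms]
  show "(moebius e a has_field_derivative dmoebius z) (at z)"
    unfolding moebius_def[abs_def] dmoebius_def aa
    by (rule derivative_eq_intros refl d)+ (simp add: power2_eq_square algebra_simps)
  have "((\<lambda>z. e * of_real (1 - (cmod a)\<^sup>2) / (1 - cnj a * z)\<^sup>2) has_field_derivative
     (0 * (1 - cnj a * z)\<^sup>2 - e * of_real (1 - (cmod a)\<^sup>2) * (2 * (1 - cnj a * z) * (- cnj a))) / ((1 - cnj a * z)\<^sup>2 * (1 - cnj a * z)\<^sup>2)) (at z)"
    using d by (intro DERIV_divide DERIV_const) (auto intro!: derivative_eq_intros)
  also have "(0 * (1 - cnj a * z)\<^sup>2 - e * of_real (1 - (cmod a)\<^sup>2) * (2 * (1 - cnj a * z) * (- cnj a))) / ((1 - cnj a * z)\<^sup>2 * (1 - cnj a * z)\<^sup>2)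
     = ddmoebius z"
  proof -
    have "(0 * D\<^sup>2 - E * (2 * D * (- c))) / (D\<^sup>2 * D\<^sup>2) = 2 * c * E / D ^ 3" if "D \<noteq> 0" for D E c :: complex
      using that by (simp add: power2_eq_square power3_eq_cube mult_ac)
    from this[OF d, of "e * of_real (1 - (cmod a)\<^sup>2)" "cnj a"] show ?thesis by (simp only: ddmoebius_def mult.assoc)
  qed
  finally show "(dmoebius has_field_derivative ddmoebius z) (at z)" by (simp add: dmoebius_def[abs_def])
qed

lemma continuous_on_moebius: "continuous_on (cball 0 1) (moebius e a)"
  by (rule DERIV_continuous_on[OF has_field_derivative_at_within[OF moebius_deriv(1)]]) simp

lemma moebius_holomorphic: "moebius e a holomorphic_on unit_disc"
  unfolding holomorphic_on_open[OF open_ball]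
proof
  fix z :: complex assume "z \<in> unit_disc"
  then have "cmod z \<le> 1" by simp
  from moebius_deriv(1)[OF this] show "\<exists>f'. (moebius e a has_field_derivative f') (at z)" by blast
qed

lemma continuous_on_ddmoebius: "continuous_on unit_disc ddmoebius"
  unfolding ddmoebius_def[abs_def]
  by (intro continuous_intros) (use denom_nonzero in force)

lemma moebius_borel [measurable]: "moebius e a \<in> borel_measurable borel"
  and dmoebius_borel [measurable]: "dmoebius \<in> borel_measurable borel"
  unfolding moebius_def[abs_def] dmoebius_def[abs_def] by measurable

lemma inv_moebius:
  assumes "cmod z \<le> 1"
  shows "moebius_inv e a (moebius e a z) = z"
proof -
  have d: "1 - cnj a * z \<noteq> 0" by (rule denom_nonzero[OF assms])
  have aa: "1 - cnj a * a \<noteq> 0" using denom_nonzero[of a] a by simp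
  have n: "moebius e a z + e * a = e * (z * (1 - cnj a * a)) / (1 - cnj a * z)"
    using d by (simp add: moebius_def field_simps)
  have "cnj e * cnj a * moebius e a z = (cnj e * e) * (cnj a * ((z - a) / (1 - cnj a * z)))"
    by (simp add: moebius_def mult_ac)
  then have m: "1 + cnj e * cnj a * moebius e a z = (1 - cnj a * a) / (1 - cnj a * z)"
    using d by (simp add: field_simps)
  have "moebius_inv e a (moebius e a z) = cnj e * ((moebius e a z + e * a) / (1 + cnj e * cnj a * moebius e a z))"
    by (simp add: moebius_inv_def moebius_def[of "cnj e"])
  also have "\<dots> = cnj e * (e * z)" unfolding n m using d aa by simp
  also have "\<dots> = z" by (simp add: mult.assoc[symmetric])
  finally show ?thesis .
qed

end

lemma moebius_map_inv: "moebius_map e a \<Longrightarrow> moebius_map (cnj e) (- (e * a))"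
  by (simp add: moebius_map_def norm_mult)

lemma (in moebius_map) moebius_inv_inv: "moebius_inv (cnj e) (- (e * a)) = moebius e a"
  by (simp add: moebius_inv_def mult.assoc[symmetric])

lemma (in moebius_map) moebius_inv:
  assumes "cmod z \<le> 1"
  shows "moebius e a (moebius_inv e a z) = z"
  using moebius_map.inv_moebius[OF moebius_map_inv[OF moebius_map_axioms] assms]
  unfolding moebius_inv_inv by (simp add: moebius_inv_def)

text \<open>Densities are determined only almost everywhere, so passing to their composition with
  the inverse map requires that null sets are carried to null sets. In the angle the map is
  differentiable away from one branch point.\<close>

lemma (in moebius_map) negligible_moebius:
  assumes Pm: "{z. \<not> Pr z} \<in> sets borel" and Pm': "{z. \<not> Pr (moebius_inv e a z)} \<in> sets borel"
    and P: "AE z in arc_length. Pr z"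
  shows "AE z in arc_length. Pr (moebius_inv e a z)"
proof -
  define N0 where "N0 = {\<theta> \<in> {0<..<2 * pi}. \<not> Pr (cis \<theta>)}"
  have N0: "negligible N0" using P AE_arc_length_iff[OF Pm] by (simp add: N0_def)
  define N0' where "N0' = {\<theta> \<in> N0. moebius e a (cis \<theta>) \<notin> \<real>\<^sub>\<ge>\<^sub>0}"
  \<comment> \<open>The angle of the image between 0 and 2 pi. The logarithm of the negative puts
    the branch cut on the positive real axis, whose preimages \<open>N0'\<close> leaves out.\<close>
  define g where "g = (\<lambda>\<theta>. Im (Ln (- moebius e a (cis \<theta>))) + pi)"
  have "negligible N0'" by (rule negligible_subset[OF N0]) (auto simp: N0'_def)
  moreover have "g differentiable_on N0'"
    unfolding differentiable_on_def
  proof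
    fix \<theta> assume \<theta>: "\<theta> \<in> N0'"
    have nr: "- moebius e a (cis \<theta>) \<notin> \<real>\<^sub>\<le>\<^sub>0"
      using \<theta> by (auto simp: N0'_def complex_nonpos_Reals_iff complex_nonneg_Reals_iff)
    have c: "(cis has_vector_derivative (\<i> * cis \<theta>)) (at \<theta>)"
      unfolding cis_conv_exp
      by (rule has_vector_derivative_eq_rhs, rule field_vector_diff_chain_at[unfolded o_def, where f = "\<lambda>t. \<i> * of_real t"])
         (auto intro!: derivative_eq_intros simp: has_vector_derivative_def scaleR_conv_of_real)
    have "((\<lambda>z. Ln (- moebius e a z)) has_field_derivative inverse (- moebius e a (cis \<theta>)) * - dmoebius (cis \<theta>)) (at (cis \<theta>))"
      by (rule DERIV_chain2[OF has_field_derivative_Ln[OF nr] DERIV_minus[OF moebius_deriv(1)]]) simp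
    from field_vector_diff_chain_at[OF c this]
    have "((\<lambda>t. Ln (- moebius e a (cis t))) has_vector_derivative
       (\<i> * cis \<theta> * (inverse (- moebius e a (cis \<theta>)) * - dmoebius (cis \<theta>)))) (at \<theta>)"
      by (simp add: o_def)
    then have "((\<lambda>t. Im (Ln (- moebius e a (cis t)))) has_derivative
       (\<lambda>h. Im (h *\<^sub>R (\<i> * cis \<theta> * (inverse (- moebius e a (cis \<theta>)) * - dmoebius (cis \<theta>)))))) (at \<theta>)"
      unfolding has_vector_derivative_def by (rule bounded_linear.has_derivative[OF bounded_linear_Im])
    then have "(\<lambda>t. Im (Ln (- moebius e a (cis t)))) differentiable (at \<theta>)" unfolding differentiable_def by blast
    then show "g differentiable (at \<theta> within N0')"
      unfolding g_def by (rule differentiable_at_withinI[OF differentiable_add[OF _ differentiable_const]])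
  qed
  ultimately have "negligible (g ` N0')" by (intro negligible_differentiable_image_negligible) auto
  then have neg: "negligible (g ` N0' \<union> {0} \<union> {Arg2pi (moebius e a 1)})" by simp
  have "{\<theta> \<in> {0<..<2 * pi}. \<not> Pr (moebius_inv e a (cis \<theta>))} \<subseteq> g ` N0' \<union> {0} \<union> {Arg2pi (moebius e a 1)}"
  proof
    fix \<theta> assume \<theta>: "\<theta> \<in> {\<theta> \<in> {0<..<2 * pi}. \<not> Pr (moebius_inv e a (cis \<theta>))}"
    define z where "z = moebius_inv e a (cis \<theta>)"
    have z1: "cmod z = 1"
      using moebius_map.in_circle[OF moebius_map_inv[OF moebius_map_axioms], of "cis \<theta>"] by (simp add: z_def moebius_inv_def)
    have mz: "moebius e a z = cis \<theta>" unfolding z_def by (rule moebius_inv) simp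
    have Ac: "Arg2pi (cis \<theta>) = \<theta>" using \<theta> by (intro Arg2pi_unique[of 1]) (auto simp: cis_conv_exp)
    show "\<theta> \<in> g ` N0' \<union> {0} \<union> {Arg2pi (moebius e a 1)}"
    proof (cases "z = 1")
      case True
      then show ?thesis using mz Ac by simp
    next
      case False
      have zc: "z = cis (Arg2pi z)" using Arg2pi_eq[of z] z1 by (simp add: cis_conv_exp)
      have A0: "Arg2pi z \<noteq> 0" using zc False by (metis cis_zero)
      then have "Arg2pi z \<in> N0"
        using \<theta> Arg2pi_ge_0[of z] Arg2pi_lt_2pi[of z] zc by (simp add: N0_def z_def[symmetric])
      moreover have "cis \<theta> \<notin> \<real>\<^sub>\<ge>\<^sub>0"
      proof
        assume "cis \<theta> \<in> \<real>\<^sub>\<ge>\<^sub>0"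
        then have "Arg2pi (cis \<theta>) = 0" by (simp add: Arg2pi_eq_0 complex_nonneg_Reals_iff complex_is_Real_iff)
        then show False using Ac \<theta> by simp
      qed
      ultimately have "Arg2pi z \<in> N0'" using mz zc by (simp add: N0'_def)
      moreover have "g (Arg2pi z) = \<theta>"
        using Arg2pi_Ln[of "cis \<theta>"] Ac \<theta> mz zc by (simp add: g_def)
      ultimately show ?thesis by force
    qed
  qed
  then have "negligible {\<theta> \<in> {0<..<2 * pi}. \<not> Pr (moebius_inv e a (cis \<theta>))}"
    by (rule negligible_subset[OF neg])
  then show ?thesis using AE_arc_length_iff[OF Pm'] by simp
qed

text \<open>Up to the factor \<open>l\<^sup>2 - 1\<close> the integrand is the Poisson kernel of the
  point \<open>b / l\<close>, whose mean over the circle is 1.\<close>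

lemma poisson_integral:
  assumes b: "cmod b = 1" and l: "l > 1"
  shows "integrable lborel (\<lambda>\<theta>. indicator {0<..<2 * pi} \<theta> * (1 / (cmod (of_real l - cnj b * cis \<theta>))\<^sup>2))"
    "(\<integral>\<theta>. indicator {0<..<2 * pi} \<theta> * (1 / (cmod (of_real l - cnj b * cis \<theta>))\<^sup>2) \<partial>lborel) = 2 * pi / (l\<^sup>2 - 1)"
proof -
  define w where "w = (\<lambda>\<theta>. cnj b * cis \<theta>)"
  have w1: "cmod (w \<theta>) = 1" for \<theta> using b by (simp add: w_def norm_mult)
  have Rew: "Re (of_real l - w \<theta>) > 0" for \<theta> using complex_Re_le_cmod[of "w \<theta>"] w1[of \<theta>] l by simp
  have nz: "of_real l - w \<theta> \<noteq> 0" for \<theta>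
  proof
    assume "of_real l - w \<theta> = 0"
    then show False using Rew[of \<theta>] by (simp only:) simp
  qed
  have l2: "l\<^sup>2 - 1 > 0" using l by (simp add: one_less_power)
  define g where "g = (\<lambda>\<theta>. 1 / (cmod (of_real l - w \<theta>))\<^sup>2)"
  have cg: "continuous_on UNIV g"
    unfolding g_def w_def[abs_def] using nz by (intro continuous_intros) (auto simp: w_def)
  \<comment> \<open>The derivative of \<theta> - 2 arg(l - w) is the real part of (l + w) / (l - w),
    the Poisson kernel. As \<open>l - w\<close> stays in the right half plane, the logarithm is
    smooth and periodic, and its endpoint values cancel later.\<close>
  have dirichlet_series: "((\<lambda>\<theta>. (\<theta> - 2 * Im (Ln (of_real l - w \<theta>))) / (l\<^sup>2 - 1)) has_real_derivative g \<theta>) (at \<theta>)" for \<theta>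
  proof -
    have c: "(cis has_vector_derivative (\<i> * cis \<theta>)) (at \<theta>)"
      unfolding cis_conv_exp
      by (rule has_vector_derivative_eq_rhs, rule field_vector_diff_chain_at[unfolded o_def, where f = "\<lambda>t. \<i> * of_real t"])
         (auto intro!: derivative_eq_intros simp: has_vector_derivative_def scaleR_conv_of_real)
    have "((\<lambda>z. Ln (of_real l - cnj b * z)) has_field_derivative (inverse (of_real l - cnj b * cis \<theta>) * - cnj b)) (at (cis \<theta>))"
    proof (rule DERIV_chain2[OF has_field_derivative_Ln])
      show "of_real l - cnj b * cis \<theta> \<notin> \<real>\<^sub>\<le>\<^sub>0"
        using Rew[of \<theta>] by (auto simp: complex_nonpos_Reals_iff w_def)
      show "((\<lambda>z. of_real l - cnj b * z) has_field_derivative - cnj b) (at (cis \<theta>))"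
        by (auto intro!: derivative_eq_intros)
    qed
    from field_vector_diff_chain_at[OF c this]
    have "((\<lambda>t. Ln (of_real l - w t)) has_vector_derivative (\<i> * cis \<theta> * (inverse (of_real l - w \<theta>) * - cnj b))) (at \<theta>)"
      by (simp add: o_def w_def)
    then have "((\<lambda>t. Im (Ln (of_real l - w t))) has_real_derivative Im (\<i> * cis \<theta> * (inverse (of_real l - w \<theta>) * - cnj b))) (at \<theta>)"
      using has_vector_derivative_def has_real_derivative_iff_has_vector_derivative
        bounded_linear.has_vector_derivative[OF bounded_linear_Im] by blast
    then have "((\<lambda>\<theta>. (\<theta> - 2 * Im (Ln (of_real l - w \<theta>))) / (l\<^sup>2 - 1)) has_real_derivative
       (1 - 2 * Im (\<i> * cis \<theta> * (inverse (of_real l - w \<theta>) * - cnj b))) / (l\<^sup>2 - 1)) (at \<theta>)"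
      by (intro DERIV_cdivide DERIV_diff DERIV_cmult DERIV_ident)
    moreover have "1 - 2 * Im (\<i> * cis \<theta> * (inverse (of_real l - w \<theta>) * - cnj b)) = (l\<^sup>2 - 1) * g \<theta>"
    proof -
      have e1: "\<i> * cis \<theta> * (inverse (of_real l - w \<theta>) * - cnj b) = - (\<i> * (w \<theta> / (of_real l - w \<theta>)))"
        by (simp add: w_def divide_inverse mult_ac)
      have "w \<theta> / (of_real l - w \<theta>) = w \<theta> * cnj (of_real l - w \<theta>) / of_real ((cmod (of_real l - w \<theta>))\<^sup>2)"
        by (rule complex_div_cnj)
      then have "Re (w \<theta> / (of_real l - w \<theta>)) = Re (w \<theta> * cnj (of_real l - w \<theta>)) / (cmod (of_real l - w \<theta>))\<^sup>2"
        by (simp only: Re_divide_of_real)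
      also have "Re (w \<theta> * cnj (of_real l - w \<theta>)) = l * Re (w \<theta>) - 1"
        using w1[of \<theta>] cmod_power2[of "w \<theta>"] by (simp add: power2_eq_square algebra_simps)
      finally have e2: "Re (w \<theta> / (of_real l - w \<theta>)) = (l * Re (w \<theta>) - 1) * g \<theta>" by (simp add: g_def)
      have e3: "(cmod (of_real l - w \<theta>))\<^sup>2 = l\<^sup>2 - 2 * l * Re (w \<theta>) + 1"
        using w1[of \<theta>] cmod_power2[of "w \<theta>"] by (subst cmod_power2) (simp add: power2_eq_square algebra_simps)
      have "1 = (l\<^sup>2 - 2 * l * Re (w \<theta>) + 1) * g \<theta>"
        unfolding e3[symmetric] g_def using nz[of \<theta>] by simp
      moreover have e4: "Im (- (\<i> * X)) = - Re X" for X by simp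
      ultimately show ?thesis unfolding e1 e4 e2 by (simp add: algebra_simps)
    qed
    ultimately show ?thesis using l2 by simp
  qed
  have "integrable lborel (\<lambda>\<theta>. indicator {0..2 * pi} \<theta> *\<^sub>R g \<theta>)"
    by (rule borel_integrable_compact) (auto intro: continuous_on_subset[OF cg])
  then have i: "integrable lborel (\<lambda>\<theta>. g \<theta> * indicator {0..2 * pi} \<theta>)" by (simp add: mult.commute)
  have I: "(\<integral>\<theta>. g \<theta> * indicator {0..2 * pi} \<theta> \<partial>lborel) =
     (2 * pi - 2 * Im (Ln (of_real l - w (2 * pi)))) / (l\<^sup>2 - 1) - (0 - 2 * Im (Ln (of_real l - w 0))) / (l\<^sup>2 - 1)"
    using cg by (intro integral_FTC_Icc_real dirichlet_series) (auto simp: continuous_on_eq_continuous_at)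
  have w0: "w (2 * pi) = w 0" by (simp add: w_def)
  have ae: "AE \<theta> in lborel. g \<theta> * indicator {0..2 * pi} \<theta> = indicator {0<..<2 * pi} \<theta> * g \<theta>"
    using AE_lborel_singleton[of "0 :: real"] AE_lborel_singleton[of "2 * pi"]
    by eventually_elim (auto simp: indicator_def)
  have gm: "g \<in> borel_measurable borel" by (rule borel_measurable_continuous_onI[OF cg])
  have "integrable lborel (\<lambda>\<theta>. indicator {0<..<2 * pi} \<theta> * g \<theta>)"
  proof (rule integrable_cong_AE_imp[OF i _ ae])
    show "(\<lambda>\<theta>. indicator {0<..<2 * pi} \<theta> * g \<theta>) \<in> borel_measurable lborel" using gm by measurable
  qed
  then show "integrable lborel (\<lambda>\<theta>. indicator {0<..<2 * pi} \<theta> * (1 / (cmod (of_real l - cnj b * cis \<theta>))\<^sup>2))"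
    by (simp add: g_def w_def)
  have "(\<integral>\<theta>. g \<theta> * indicator {0..2 * pi} \<theta> \<partial>lborel) = (\<integral>\<theta>. indicator {0<..<2 * pi} \<theta> * g \<theta> \<partial>lborel)"
    using ae gm by (intro integral_cong_AE) auto
  then have "(\<integral>\<theta>. indicator {0<..<2 * pi} \<theta> * g \<theta> \<partial>lborel) = 2 * pi / (l\<^sup>2 - 1)"
    unfolding I w0 by (simp add: diff_divide_distrib)
  then show "(\<integral>\<theta>. indicator {0<..<2 * pi} \<theta> * (1 / (cmod (of_real l - cnj b * cis \<theta>))\<^sup>2) \<partial>lborel) = 2 * pi / (l\<^sup>2 - 1)"
    by (simp add: g_def w_def)
qed

lemma powr_minus_quarter_gt:
  fixes x Y :: real
  assumes "Y > 0" "0 < x" "x < Y powr (- 4)"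
  shows "Y < x powr (- 1 / 4)"
proof -
  have "(Y powr (- 4)) powr (- 1 / 4) < x powr (- 1 / 4)"
    using assms by (intro powr_less_mono2_neg) auto
  then show ?thesis using assms(1) by (simp add: powr_powr)
qed

section \<open>The density of the boundary measure\<close>

context disc_annulus
begin

text \<open>The factor 2 pi compensates for the normalisation of \<open>arc_length\<close> to total
  mass 1.\<close>

definition "bweight \<kappa> z = ennreal (2 * pi * \<kappa> * w z)"

lemma borel_bweight [measurable]: "bweight \<kappa> \<in> borel_measurable borel"
  unfolding bweight_def[abs_def] by measurable

lemma C_pos: "C > 0"
proof -
  have "q \<le> V 1" "V 1 \<le> C" using V_ge[of 1] V_le[of 1] t0 by auto
  then show ?thesis using q by linarith
qed

lemma eventually_at_left_0: "eventually (\<lambda>r. r0 < r \<and> r < 0) (at_left 0)"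
  using eventually_at_left_real[OF r0] by (rule eventually_mono) auto

text \<open>The limits of the integrals of continuous functions are unique and are known from
  \<open>nu_limit\<close>; such functions determine the finite measure.\<close>

lemma boundary_measure_eq:
  assumes \<kappa>: "\<kappa> > 0" and mu: "is_boundary_MA_measure \<kappa> u \<mu>"
  shows "\<mu> = density arc_length (bweight \<kappa>)"
proof (rule measure_eqI_continuous)
  have smu [simp, measurable_cong]: "sets \<mu> = sets borel" and fmu: "finite_measure \<mu>"
    and null: "emeasure \<mu> (- cball 0 1) = 0"
    using mu by (auto simp: is_boundary_MA_measure_def)
  have cism [measurable]: "cis \<in> borel_measurable borel"
    by (intro borel_measurable_continuous_onI continuous_intros)
  show "sets \<mu> = sets borel" "sets (density arc_length (bweight \<kappa>)) = sets borel" by simp_all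
  show "emeasure \<mu> UNIV \<noteq> \<infinity>"
    using finite_measure.emeasure_finite[OF fmu] by simp
  fix h :: "complex \<Rightarrow> real" assume h: "continuous_on UNIV h" and h01: "\<And>z. 0 \<le> h z \<and> h z \<le> 1"
  have hm [measurable]: "h \<in> borel_measurable borel" by (rule borel_measurable_continuous_onI[OF h])
  have hc: "continuous_on (cball 0 1) h" by (rule continuous_on_subset[OF h]) auto
  have "((\<lambda>r. LINT z:cball 0 1|MA_measure \<kappa> u r. h z) \<longlongrightarrow> (LINT z:cball 0 1|\<mu>. h z)) (at_left 0)"
    using mu hc by (simp add: is_boundary_MA_measure_def)
  moreover have "eventually (\<lambda>r. (LINT z:cball 0 1|MA_measure \<kappa> u r. h z) = (LINT z:cball 0 1|nu \<kappa> r. h z)) (at_left 0)"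
    using eventually_at_left_0 by (rule eventually_mono) (simp add: MA_measure_eq[OF \<kappa>])
  ultimately have "((\<lambda>r. LINT z:cball 0 1|nu \<kappa> r. h z) \<longlongrightarrow> (LINT z:cball 0 1|\<mu>. h z)) (at_left 0)"
    by (simp add: filterlim_cong)
  then have I: "(LINT z:cball 0 1|\<mu>. h z) = \<kappa> * (\<integral>\<theta>. indicator {0<..<2 * pi} \<theta> * (h (cis \<theta>) * w (cis \<theta>)) \<partial>lborel)"
    using nu_limit(2)[OF \<kappa> hc] by (intro tendsto_unique[of "at_left (0::real)"]) auto
  have ih: "integrable \<mu> h"
    using h01 smu by (intro finite_measure.integrable_const_bound[OF fmu, of _ 1]) (auto intro: AE_I2)
  have "(\<integral>\<^sup>+z. ennreal (h z) \<partial>\<mu>) = ennreal (\<integral>z. h z \<partial>\<mu>)"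
    using h01 by (intro nn_integral_eq_integral ih) auto
  also have "(\<integral>z. h z \<partial>\<mu>) = (LINT z:cball 0 1|\<mu>. h z)"
    unfolding set_lebesgue_integral_def
  proof (rule integral_cong_AE)
    have "AE z in \<mu>. z \<in> cball 0 1"
      by (rule AE_I[OF _ null]) auto
    then show "AE z in \<mu>. h z = indicator (cball 0 1) z *\<^sub>R h z" by eventually_elim auto
    have [measurable]: "cball (0::complex) 1 \<in> sets borel" by auto
    show "h \<in> borel_measurable \<mu>" using hm measurable_cong_sets[OF smu refl] by blast
    have "(\<lambda>z. indicator (cball 0 1) z *\<^sub>R h z) \<in> borel_measurable borel" by measurable
    then show "(\<lambda>z. indicator (cball 0 1) z *\<^sub>R h z) \<in> borel_measurable \<mu>"
      using measurable_cong_sets[OF smu refl] by blast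
  qed
  also note I
  also have "ennreal (\<kappa> * (\<integral>\<theta>. indicator {0<..<2 * pi} \<theta> * (h (cis \<theta>) * w (cis \<theta>)) \<partial>lborel))
     = ennreal (\<integral>\<theta>. \<kappa> * (indicator {0<..<2 * pi} \<theta> * (h (cis \<theta>) * w (cis \<theta>))) \<partial>lborel)" by simp
  also have "\<dots> = (\<integral>\<^sup>+\<theta>. ennreal (\<kappa> * (indicator {0<..<2 * pi} \<theta> * (h (cis \<theta>) * w (cis \<theta>)))) \<partial>lborel)"
    using nu_limit(1)[OF \<kappa> hc] h01 w_nonneg \<kappa> by (intro nn_integral_eq_integral[symmetric] integrable_mult_right) auto
  finally have L: "(\<integral>\<^sup>+z. ennreal (h z) \<partial>\<mu>) = (\<integral>\<^sup>+\<theta>. ennreal (\<kappa> * (indicator {0<..<2 * pi} \<theta> * (h (cis \<theta>) * w (cis \<theta>)))) \<partial>lborel)" .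
  have "(\<integral>\<^sup>+z. ennreal (h z) \<partial>density arc_length (bweight \<kappa>)) = (\<integral>\<^sup>+z. bweight \<kappa> z * ennreal (h z) \<partial>arc_length)"
    by (intro nn_integral_density) measurable
  also have "\<dots> = (\<integral>\<^sup>+\<theta>. bweight \<kappa> (cis \<theta>) * ennreal (h (cis \<theta>)) * indicator {0<..<2 * pi} \<theta> \<partial>lborel) / ennreal (2 * pi)"
    by (rule nn_integral_arc_length) measurable
  also have "(\<integral>\<^sup>+\<theta>. bweight \<kappa> (cis \<theta>) * ennreal (h (cis \<theta>)) * indicator {0<..<2 * pi} \<theta> \<partial>lborel)
     = (\<integral>\<^sup>+\<theta>. ennreal (2 * pi) * ennreal (\<kappa> * (indicator {0<..<2 * pi} \<theta> * (h (cis \<theta>) * w (cis \<theta>)))) \<partial>lborel)"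
    using h01 w_nonneg \<kappa>
    by (intro nn_integral_cong) (auto simp: bweight_def indicator_def ennreal_mult[symmetric] mult_ac)
  also have "\<dots> = ennreal (2 * pi) * (\<integral>\<^sup>+\<theta>. ennreal (\<kappa> * (indicator {0<..<2 * pi} \<theta> * (h (cis \<theta>) * w (cis \<theta>)))) \<partial>lborel)"
    by (intro nn_integral_cmult) measurable
  also have "\<dots> / ennreal (2 * pi) = (\<integral>\<^sup>+\<theta>. ennreal (\<kappa> * (indicator {0<..<2 * pi} \<theta> * (h (cis \<theta>) * w (cis \<theta>)))) \<partial>lborel)"
    by (simp add: ennreal_mult_divide_eq mult.commute[of "ennreal (2 * pi)"] mult.commute[of "2 * ennreal pi"])
  finally show "(\<integral>\<^sup>+z. ennreal (h z) \<partial>\<mu>) = (\<integral>\<^sup>+z. ennreal (h z) \<partial>density arc_length (bweight \<kappa>))"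
    using L by simp
qed

lemma density_AE_bweight:
  assumes \<kappa>: "\<kappa> > 0" and mu: "is_boundary_MA_measure \<kappa> u \<mu>"
    and \<beta>: "\<beta> \<in> borel_measurable borel" and d: "\<mu> = density arc_length \<beta>"
  shows "AE z in arc_length. \<beta> z = bweight \<kappa> z"
proof -
  interpret finite_measure arc_length by (rule finite_measure_arc_length)
  show ?thesis
    by (rule density_unique) (use \<beta> boundary_measure_eq[OF \<kappa> mu] d in auto)
qed

lemma w_circle:
  assumes "z \<in> unit_circle" "z \<noteq> 1"
  shows "q * (1 - Re z) powr (- 1 / 4) \<le> w z" "w z \<le> C * (1 - Re z) powr (- 1 / 4)" "1 - Re z > 0"
proof -
  have "z \<in> A" using assms t0 by (auto simp: A_def)
  then show "q * (1 - Re z) powr (- 1 / 4) \<le> w z" "w z \<le> C * (1 - Re z) powr (- 1 / 4)"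
    using w_bounds by auto
  show "1 - Re z > 0" using one_minus_Re_pos'[of z] assms by simp
qed

lemma w_1: "w 1 = 0"
  by (simp add: w_def A_def)

lemma one_minus_Re_circle: "z \<in> unit_circle \<Longrightarrow> 1 - Re z = (cmod (1 - z))\<^sup>2 / 2"
proof -
  assume "z \<in> unit_circle"
  then have "(Re z)\<^sup>2 + (Im z)\<^sup>2 = 1" using cmod_power2[of z] by simp
  then show ?thesis unfolding cmod_power2 by (simp add: power2_eq_square algebra_simps)
qed

end

section \<open>Domination of the boundary density and the fixed point\<close>

definition "domination \<beta> \<psi> \<longleftrightarrow> (\<exists>K>0. \<forall>E\<in>sets borel. E \<subseteq> unit_circle \<longrightarrow>
  (\<integral>\<^sup>+\<eta>\<in>E. \<beta> (\<psi> \<eta>) \<partial>arc_length) \<le> ennreal K * (\<integral>\<^sup>+\<eta>\<in>E. \<beta> \<eta> \<partial>arc_length))"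

locale exhaustion_moebius = disc_annulus G G' u t0 q C r0 + moebius_map e a
  for G G' u t0 q C r0 e a
begin

abbreviation "\<phi> \<equiv> moebius e a"
abbreviation "\<psi> \<equiv> moebius_inv e a"

lemma inv_circle: "z \<in> unit_circle \<Longrightarrow> \<psi> z \<in> unit_circle"
  using moebius_map.in_circle[OF moebius_map_inv[OF moebius_map_axioms], of z] by (simp add: moebius_inv_def)

lemma borel_inv [measurable]: "\<psi> \<in> borel_measurable borel"
  unfolding moebius_inv_def by (rule moebius_map.moebius_borel[OF moebius_map_inv[OF moebius_map_axioms]])

text \<open>Replaces the given density, known almost everywhere, and the given inverse, known on the
  circle, by the concrete \<open>bweight\<close> and \<open>moebius_inv\<close>; the composed
  density is handled by \<open>negligible_moebius\<close>.\<close>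

lemma domination_cong:
  assumes \<beta>: "\<beta> \<in> borel_measurable borel" and eq: "AE z in arc_length. \<beta> z = bweight \<kappa> z"
    and inv: "\<And>z. z \<in> unit_circle \<Longrightarrow> \<psi>' z = \<psi> z"
  shows "domination \<beta> \<psi>' \<longleftrightarrow> domination (bweight \<kappa>) \<psi>"
proof -
  note [measurable] = \<beta>
  have "{z. \<not> \<beta> z = bweight \<kappa> z} \<in> sets borel" by measurable
  moreover have "{z. \<not> \<beta> (\<psi> z) = bweight \<kappa> (\<psi> z)} \<in> sets borel" by measurable
  ultimately have eq': "AE z in arc_length. \<beta> (\<psi> z) = bweight \<kappa> (\<psi> z)"
    using negligible_moebius[of "\<lambda>z. \<beta> z = bweight \<kappa> z", OF _ _ eq] by blast
  have 1: "(\<integral>\<^sup>+\<eta>\<in>E. \<beta> \<eta> \<partial>arc_length) = (\<integral>\<^sup>+\<eta>\<in>E. bweight \<kappa> \<eta> \<partial>arc_length)" for E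
    by (rule nn_integral_cong_AE) (use eq in \<open>eventually_elim, simp\<close>)
  have "(\<integral>\<^sup>+\<eta>\<in>E. \<beta> (\<psi>' \<eta>) \<partial>arc_length) = (\<integral>\<^sup>+\<eta>\<in>E. bweight \<kappa> (\<psi> \<eta>) \<partial>arc_length)" if "E \<subseteq> unit_circle" for E
  proof -
    have "(\<integral>\<^sup>+\<eta>\<in>E. \<beta> (\<psi>' \<eta>) \<partial>arc_length) = (\<integral>\<^sup>+\<eta>\<in>E. \<beta> (\<psi> \<eta>) \<partial>arc_length)"
      using that inv by (intro nn_integral_cong) (auto simp: indicator_def)
    also have "\<dots> = (\<integral>\<^sup>+\<eta>\<in>E. bweight \<kappa> (\<psi> \<eta>) \<partial>arc_length)"
      by (rule nn_integral_cong_AE) (use eq' in \<open>eventually_elim, simp\<close>)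
    finally show ?thesis .
  qed
  then show ?thesis
    unfolding domination_def 1 by (intro ex_cong1 conj_cong ball_cong imp_cong refl) (simp only:)
qed

text \<open>A pointwise inequality: the weight lies between \<open>q\<close> and \<open>C\<close>
  times the power -1/4 of 1 - Re, and when 1 is fixed this distance at the point and at its preimage
  is comparable. The constant \<open>K\<close> collects the three factors.\<close>

lemma domination_if_fixed:
  assumes \<kappa>: "\<kappa> > 0" and fix1: "\<phi> 1 = 1"
  shows "domination (bweight \<kappa>) \<psi>"
proof -
  define k where "k = (1 / lip\<^sup>2) powr (- 1 / 4)"
  have lip0: "lip\<^sup>2 > 0" using lip_ge_1 by simp
  have k: "k > 0" using lip_ge_1 by (simp add: k_def)
  define K where "K = C * k / q"
  have K: "K > 0" using C_pos k q by (simp add: K_def)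
  have le: "w (\<psi> z) \<le> K * w z" if z: "z \<in> unit_circle" for z
  \<comment> \<open>At the fixed point both sides are 0, by the default value of
    \<open>w\<close>.\<close>
  proof (cases "z = 1")
    case True
    have "\<psi> 1 = 1" using inv_moebius[of 1] fix1 by simp
    then show ?thesis using True w_1 by simp
  next
    case False
    have m: "\<phi> (\<psi> z) = z" using moebius_inv[of z] z by simp
    then have ne: "\<psi> z \<noteq> 1" using fix1 False by metis
    note wz = w_circle[OF z False] and wp = w_circle[OF inv_circle[OF z] ne]
    have "1 - Re z \<le> lip\<^sup>2 * (1 - Re (\<psi> z))"
      using one_minus_Re_moebius[of "\<psi> z"] inv_circle[OF z] fix1 m by simp
    then have "1 / lip\<^sup>2 * (1 - Re z) \<le> 1 - Re (\<psi> z)" using lip0 by (simp add: divide_le_eq mult.commute)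
    then have "(1 - Re (\<psi> z)) powr (- 1 / 4) \<le> (1 / lip\<^sup>2 * (1 - Re z)) powr (- 1 / 4)"
      using wz(3) lip0 by (intro powr_mono2') (auto intro: divide_pos_pos)
    also have "\<dots> = k * (1 - Re z) powr (- 1 / 4)"
      using wz(3) unfolding k_def by (intro powr_mult)
    finally have "C * (1 - Re (\<psi> z)) powr (- 1 / 4) \<le> C * (k * (1 - Re z) powr (- 1 / 4))"
      using C_pos by simp
    also have "\<dots> = K * (q * (1 - Re z) powr (- 1 / 4))" using q by (simp add: K_def)
    also have "\<dots> \<le> K * w z" using wz(1) K by simp
    finally show ?thesis using wp(2) by linarith
  qed
  have le': "bweight \<kappa> (\<psi> z) \<le> ennreal K * bweight \<kappa> z" if "z \<in> unit_circle" for z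
  proof -
    have "2 * pi * \<kappa> * w (\<psi> z) \<le> K * (2 * pi * \<kappa> * w z)"
      using mult_left_mono[OF le[OF that], of "2 * pi * \<kappa>"] \<kappa> by (simp add: mult_ac)
    then show ?thesis
      unfolding bweight_def using K \<kappa> w_nonneg by (subst ennreal_mult[symmetric]) (auto intro: ennreal_leI)
  qed
  show ?thesis
    unfolding domination_def
  proof (intro exI[of _ K] conjI K ballI impI)
    fix E :: "complex set" assume E [measurable]: "E \<in> sets borel" and sub: "E \<subseteq> unit_circle"
    have "(\<integral>\<^sup>+\<eta>\<in>E. bweight \<kappa> (\<psi> \<eta>) \<partial>arc_length) \<le> (\<integral>\<^sup>+\<eta>. ennreal K * (bweight \<kappa> \<eta> * indicator E \<eta>) \<partial>arc_length)"
      using sub le' by (intro nn_integral_mono) (auto simp: indicator_def)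
    also have "\<dots> = ennreal K * (\<integral>\<^sup>+\<eta>\<in>E. bweight \<kappa> \<eta> \<partial>arc_length)"
      by (intro nn_integral_cmult) measurable
    finally show "(\<integral>\<^sup>+\<eta>\<in>E. bweight \<kappa> (\<psi> \<eta>) \<partial>arc_length) \<le> ennreal K * (\<integral>\<^sup>+\<eta>\<in>E. bweight \<kappa> \<eta> \<partial>arc_length)" .
  qed
qed

lemma inv_lipschitz: "\<exists>L>0. \<forall>z y. cmod z \<le> 1 \<longrightarrow> cmod y \<le> 1 \<longrightarrow> cmod (\<psi> z - \<psi> y) \<le> L * cmod (z - y)"
proof -
  interpret m: moebius_map "cnj e" "- (e * a)" by (rule moebius_map_inv[OF moebius_map_axioms])
  show ?thesis
    using m.lipschitz m.lip_ge_1 unfolding moebius_inv_def by (intro exI[of _ m.lip]) auto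
qed

text \<open>Otherwise the pole of the transported weight sits at b = \<phi> 1, where the weight
  itself is bounded. On a small punctured arc around b the former is at least
  \<open>K * B + 1\<close> and the latter at most \<open>B\<close>.\<close>

lemma fixed_if_domination:
  assumes \<kappa>: "\<kappa> > 0" and dom: "domination (bweight \<kappa>) \<psi>"
  shows "\<phi> 1 = 1"
proof (rule ccontr)
  assume ne: "\<phi> 1 \<noteq> 1"
  define b where "b = \<phi> 1"
  have b: "b \<in> unit_circle" using in_circle[of 1] by (simp add: b_def)
  have \<psi>b: "\<psi> b = 1" using inv_moebius[of 1] by (simp add: b_def)
  define d where "d = cmod (1 - b)"
  have d: "d > 0" using ne by (simp add: d_def b_def)
  obtain L where L: "L > 0" "\<And>z y. cmod z \<le> 1 \<Longrightarrow> cmod y \<le> 1 \<Longrightarrow> cmod (\<psi> z - \<psi> y) \<le> L * cmod (z - y)"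
    using inv_lipschitz by blast
  obtain K where K: "K > 0" "\<And>E. E \<in> sets borel \<Longrightarrow> E \<subseteq> unit_circle \<Longrightarrow>
      (\<integral>\<^sup>+\<eta>\<in>E. bweight \<kappa> (\<psi> \<eta>) \<partial>arc_length) \<le> ennreal K * (\<integral>\<^sup>+\<eta>\<in>E. bweight \<kappa> \<eta> \<partial>arc_length)"
    using dom unfolding domination_def by blast
  \<comment> \<open>Points of the circle within \<open>d / 2\<close> of \<open>b\<close> keep
    distance \<open>d / 2\<close> from 1, and on the circle 1 - Re z is half the squared distance to
    1, hence at least \<open>d\<^sup>2 / 8\<close>.\<close>
  define B where "B = C * (d\<^sup>2 / 8) powr (- 1 / 4)"
  have B: "B > 0" using C_pos d by (simp add: B_def)
  \<comment> \<open>The weight has to reach \<open>K * B + 1 = q * Y\<close>; this happens as soon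
    as the squared distance of the preimage from 1 is below \<open>Y powr (- 4)\<close>, which the
    radius chosen next guarantees through the Lipschitz bound of the inverse.\<close>
  define Y where "Y = (K * B + 1) / q"
  have Y: "Y > 0" using K(1) B q by (simp add: Y_def add_pos_pos)
  define \<delta> where "\<delta> = min (d / 2) (sqrt (Y powr (- 4)) / L)"
  have \<delta>: "\<delta> > 0" "\<delta> \<le> d / 2" "\<delta> \<le> sqrt (Y powr (- 4)) / L" 
    using d Y L(1) by (simp_all only: \<delta>_def min.cobounded1 min.cobounded2) simp
  define E where "E = unit_circle \<inter> ball b \<delta> - {b}"
  have Eb [measurable]: "E \<in> sets borel" unfolding E_def by auto
  have Esub: "E \<subseteq> unit_circle" by (auto simp: E_def)
  have up: "w z \<le> B" if z: "z \<in> E" for z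
  proof -
    have zc: "z \<in> unit_circle" and zb: "cmod (b - z) < \<delta>" using z by (auto simp: E_def dist_norm)
    have "d \<le> cmod (1 - z) + cmod (b - z)"
      unfolding d_def using norm_triangle_ineq4[of "1 - z" "b - z"] by simp
    then have dz: "d / 2 \<le> cmod (1 - z)" using zb \<delta>(2) by linarith
    then have ne1: "z \<noteq> 1" using d by auto
    have "d\<^sup>2 / 8 \<le> 1 - Re z"
    proof -
      have "(d / 2)\<^sup>2 \<le> (cmod (1 - z))\<^sup>2" using dz d by (intro power_mono) auto
      then show ?thesis unfolding one_minus_Re_circle[OF zc] by (simp add: power_divide)
    qed
    then have "(1 - Re z) powr (- 1 / 4) \<le> (d\<^sup>2 / 8) powr (- 1 / 4)"
      using d by (intro powr_mono2') auto
    then show ?thesis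
      using w_circle(2)[OF zc ne1] mult_left_mono[of _ "(d\<^sup>2 / 8) powr (- 1 / 4)" C] C_pos unfolding B_def
      by (meson less_imp_le order.trans)
  qed
  have low: "K * B + 1 \<le> w (\<psi> z)" if z: "z \<in> E" for z
  proof -
    have zc: "z \<in> unit_circle" and zb: "cmod (z - b) < \<delta>" and znb: "z \<noteq> b"
      using z by (auto simp: E_def dist_norm norm_minus_commute)
    have "\<psi> z \<noteq> 1" using znb moebius_inv[of z] zc by (auto simp: b_def)
    note wp = w_circle[OF inv_circle[OF zc] this]
    have "cmod (1 - \<psi> z) \<le> L * cmod (b - z)" using L(2)[of b z] b zc \<psi>b by simp
    also have "\<dots> < L * \<delta>" using zb L(1) by (simp add: norm_minus_commute)
    also have "\<dots> \<le> sqrt (Y powr (- 4))" using \<delta>(3) L(1) by (simp add: field_simps)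
    finally have "(cmod (1 - \<psi> z))\<^sup>2 < (sqrt (Y powr (- 4)))\<^sup>2" by (intro power_strict_mono) auto
    then have sq: "(cmod (1 - \<psi> z))\<^sup>2 < Y powr (- 4)" by simp
    have "x / 2 < y" if "x < y" "0 \<le> x" for x y :: real using that by simp
    from this[OF sq] have "1 - Re (\<psi> z) < Y powr (- 4)"
      unfolding one_minus_Re_circle[OF inv_circle[OF zc]] by simp
    then have "Y < (1 - Re (\<psi> z)) powr (- 1 / 4)" using powr_minus_quarter_gt[OF Y wp(3)] by simp
    then have "q * Y \<le> w (\<psi> z)" using wp(1) mult_left_mono[of Y _ q] q by (meson less_imp_le order.trans)
    then show ?thesis using q by (simp add: Y_def)
  qed
  define c where "c = 2 * pi * \<kappa>"
  have c: "c > 0" using \<kappa> by (simp add: c_def)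
  have cE: "emeasure arc_length E = (\<integral>\<^sup>+z. indicator E z \<partial>arc_length)" by simp
  have "ennreal (c * (K * B + 1)) * emeasure arc_length E = (\<integral>\<^sup>+z. ennreal (c * (K * B + 1)) * indicator E z \<partial>arc_length)"
    by (simp add: nn_integral_cmult_indicator)
  also have "\<dots> \<le> (\<integral>\<^sup>+\<eta>\<in>E. bweight \<kappa> (\<psi> \<eta>) \<partial>arc_length)"
    using low c by (intro nn_integral_mono) (auto simp: indicator_def bweight_def c_def[symmetric] intro!: ennreal_leI)
  also have "\<dots> \<le> ennreal K * (\<integral>\<^sup>+\<eta>\<in>E. bweight \<kappa> \<eta> \<partial>arc_length)" by (rule K(2)[OF Eb Esub])
  also have "\<dots> \<le> ennreal K * (\<integral>\<^sup>+\<eta>. ennreal (c * B) * indicator E \<eta> \<partial>arc_length)"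
    using up c by (intro mult_left_mono nn_integral_mono) (auto simp: indicator_def bweight_def c_def[symmetric] intro!: ennreal_leI)
  also have "\<dots> = ennreal (c * (K * B)) * emeasure arc_length E"
  proof -
    have "(\<integral>\<^sup>+\<eta>. ennreal (c * B) * indicator E \<eta> \<partial>arc_length) = ennreal (c * B) * emeasure arc_length E"
      by (rule nn_integral_cmult_indicator) simp
    moreover have "ennreal K * ennreal (c * B) = ennreal (c * (K * B))"
      using K(1) c B by (subst ennreal_mult[symmetric]) (auto simp: mult_ac)
    ultimately show ?thesis by (simp only: mult.assoc[symmetric])
  qed
  finally have le: "ennreal (c * (K * B + 1)) * emeasure arc_length E \<le> ennreal (c * (K * B)) * emeasure arc_length E" .
  have fin: "emeasure arc_length E < \<infinity>"
    using finite_measure.emeasure_finite[OF finite_measure_arc_length, of E] by (simp add: less_top)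
  \<comment> \<open>In the angle the arc is a nonempty open set up to one point, so it is not
    negligible.\<close>
  have pos: "emeasure arc_length E > 0"
  proof (rule ccontr)
    assume "\<not> emeasure arc_length E > 0"
    then have "emeasure arc_length E = 0" by simp
    then have ae: "AE z in arc_length. z \<notin> E"
      by (intro AE_I[of _ _ E]) auto
    have sb: "{z. \<not> z \<notin> E} \<in> sets borel" using Eb by simp
    have "negligible {\<theta> \<in> {0<..<2 * pi}. \<not> cis \<theta> \<notin> E}"
      using ae AE_arc_length_iff[of "\<lambda>z. z \<notin> E", OF sb] by simp
    then have N: "negligible ({\<theta> \<in> {0<..<2 * pi}. \<not> cis \<theta> \<notin> E} \<union> {Arg2pi b})" by simp
    define I where "I = {0<..<2 * pi} \<inter> cis -` ball b \<delta>"
    have bc: "b = cis (Arg2pi b)" using Arg2pi_eq[of b] b by (simp add: cis_conv_exp)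
    have "Arg2pi b \<noteq> 0" using bc ne by (metis b_def cis_zero)
    then have "Arg2pi b \<in> I"
      using Arg2pi_ge_0[of b] Arg2pi_lt_2pi[of b] \<delta>(1) bc by (simp add: I_def)
    moreover have "open I"
    proof -
      have "open (cis -` ball b \<delta>)" by (intro open_vimage open_ball continuous_intros)
      then show ?thesis unfolding I_def by (intro open_Int) auto
    qed
    moreover have "negligible I"
    proof (rule negligible_subset[OF N], rule subsetI)
      fix \<theta> assume \<theta>: "\<theta> \<in> I"
      have "Arg2pi (cis \<theta>) = \<theta>" using \<theta> by (intro Arg2pi_unique[of 1]) (auto simp: cis_conv_exp I_def)
      then show "\<theta> \<in> {\<theta> \<in> {0<..<2 * pi}. \<not> cis \<theta> \<notin> E} \<union> {Arg2pi b}"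
        using \<theta> by (cases "cis \<theta> = b") (auto simp: I_def E_def)
    qed
    ultimately show False using open_not_negligible by blast
  qed
  obtain m where m: "emeasure arc_length E = ennreal m" "m \<ge> 0" using fin by (cases "emeasure arc_length E") auto
  have "m > 0" using pos m by simp
  have "c * (K * B + 1) * m \<le> c * (K * B) * m"
    using le K(1) B c m unfolding m(1) by (simp add: ennreal_mult[symmetric] ennreal_le_iff)
  then have "c * m \<le> 0" by (simp add: algebra_simps)
  then show False using mult_pos_pos[OF c \<open>m > 0\<close>] by simp
qed

end

section \<open>Composition operators\<close>

context disc_annulus
begin

lemma borel_level: "level u r \<in> sets borel"
proof -
  have "level u r = {z \<in> unit_disc. \<not> u z < r} - (unit_disc \<inter> u -` {r<..})" by (auto simp: level_def)
  moreover have "unit_disc \<inter> u -` {r<..} \<in> sets borel"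
    using continuous_open_preimage[OF cont_u_disc open_ball, of "{r<..}"] by simp
  moreover have "{z \<in> unit_disc. \<not> u z < r} = unit_disc - {z \<in> unit_disc. u z < r}" by auto
  moreover have "unit_disc - {z \<in> unit_disc. u z < r} \<in> sets borel" using borel_u_disc[of r] by auto
  ultimately show ?thesis by simp
qed

lemma Hp_integral_eq:
  assumes \<kappa>: "\<kappa> > 0" and r: "r0 < r" "r < 0" and p: "1 \<le> p" and f: "continuous_on unit_disc f"
  shows "Hp_integral \<kappa> u p f r =
    (\<integral>\<^sup>+\<theta>. ennreal (\<kappa> * (indicator {0<..<2 * pi} \<theta> * (cmod (f (P r \<theta>)) powr p * w (P r \<theta>)))) \<partial>lborel)"
proof -
  let ?F = "\<lambda>z. ennreal (cmod (f z) powr p) * indicator (level u r) z"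
  have c: "continuous_on (level u r) (\<lambda>z. cmod (f z) powr p)"
    using p by (intro continuous_on_powr' continuous_intros continuous_on_subset[OF f]) (auto simp: level_def)
  have "(\<lambda>z. indicator (level u r) z *\<^sub>R (cmod (f z) powr p)) \<in> borel_measurable borel"
    by (rule borel_measurable_continuous_on_indicator[OF borel_level c])
  then have m1: "(\<lambda>z. ennreal (indicator (level u r) z *\<^sub>R (cmod (f z) powr p))) \<in> borel_measurable borel"
    by measurable
  have m2: "(\<lambda>z. ennreal (indicator (level u r) z *\<^sub>R (cmod (f z) powr p))) = ?F"
    by (auto simp: indicator_def)
  have m: "?F \<in> borel_measurable borel" using m1 unfolding m2 .
  have lev: "P r \<theta> \<in> level u r" for \<theta> using P_props(2,3)[OF r] by (simp add: level_def)
  have "Hp_integral \<kappa> u p f r = (\<integral>\<^sup>+\<theta>. ennreal (indicator {0<..<2 * pi} \<theta> * (\<kappa> * w (P r \<theta>))) * ?F (P r \<theta>) \<partial>lborel)"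
    unfolding Hp_integral_def MA_measure_eq[OF \<kappa> r] by (rule nn_integral_nu[OF r m])
  also have "\<dots> = (\<integral>\<^sup>+\<theta>. ennreal (\<kappa> * (indicator {0<..<2 * pi} \<theta> * (cmod (f (P r \<theta>)) powr p * w (P r \<theta>)))) \<partial>lborel)"
    using \<kappa> w_nonneg lev
    by (intro nn_integral_cong) (auto simp: indicator_def ennreal_mult[symmetric] mult_ac)
  finally show ?thesis .
qed

text \<open>For functions continuous up to the circle the limit of the means is a boundary integral,
  so norms of test functions can be computed there.\<close>

lemma Hp_integral_tendsto:
  assumes \<kappa>: "\<kappa> > 0" and p: "1 \<le> p" and f: "continuous_on (cball 0 1) f"
  shows "integrable lborel (\<lambda>\<theta>. indicator {0<..<2 * pi} \<theta> * (cmod (f (cis \<theta>)) powr p * w (cis \<theta>)))"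
    and "(Hp_integral \<kappa> u p f \<longlongrightarrow>
      ennreal (\<kappa> * (\<integral>\<theta>. indicator {0<..<2 * pi} \<theta> * (cmod (f (cis \<theta>)) powr p * w (cis \<theta>)) \<partial>lborel))) (at_left 0)"
proof -
  define h where "h = (\<lambda>z. cmod (f z) powr p)"
  have h: "continuous_on (cball 0 1) h"
    unfolding h_def using p by (intro continuous_on_powr' continuous_intros f) auto
  show "integrable lborel (\<lambda>\<theta>. indicator {0<..<2 * pi} \<theta> * (cmod (f (cis \<theta>)) powr p * w (cis \<theta>)))"
    using nu_limit(1)[OF \<kappa> h] by (simp add: h_def)
  have fd: "continuous_on unit_disc f" by (rule continuous_on_subset[OF f]) auto
  have eq: "Hp_integral \<kappa> u p f r = ennreal (LINT z:cball 0 1|nu \<kappa> r. h z)" if r: "r0 < r" "r < 0" for r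
  proof -
    define hb where "hb = (\<lambda>z. indicator (cball 0 1) z *\<^sub>R h z)"
    have hbm: "hb \<in> borel_measurable borel"
      unfolding hb_def by (intro borel_measurable_continuous_on_indicator h) auto
    obtain B where B: "\<And>z. z \<in> cball 0 1 \<Longrightarrow> norm (h z) \<le> B"
    proof -
      obtain B where "\<And>x. x \<in> h ` cball 0 1 \<Longrightarrow> norm x \<le> B"
        using compact_imp_bounded[OF compact_continuous_image[OF h compact_cball]] unfolding bounded_iff by blast
      then show ?thesis using that[of B] by blast
    qed
    have hbB: "norm (hb z) \<le> B" for z using B[of z] B[of 0] by (auto simp: hb_def indicator_def)
    have "finite_measure (nu \<kappa> r)"
      using nu_finite[OF r \<kappa>] sets_eq_imp_space_eq[OF sets_nu[of \<kappa> r]]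
      by (intro finite_measureI) (auto simp: less_top[symmetric] top_unique)
    then have ih: "integrable (nu \<kappa> r) hb"
      using hbm hbB by (intro finite_measure.integrable_const_bound[of _ _ B]) (auto intro: AE_I2)
    note i = ih[unfolded integral_nu(2)[OF r \<kappa> hbm]]
    have hbP: "hb (P r \<theta>) = h (P r \<theta>)" for \<theta> using P_props(2)[OF r, of \<theta>] by (simp add: hb_def less_imp_le)
    have "(LINT z:cball 0 1|nu \<kappa> r. h z) = \<kappa> * (\<integral>\<theta>. indicator {0<..<2 * pi} \<theta> * (h (P r \<theta>) * w (P r \<theta>)) \<partial>lborel)"
      using integral_nu(1)[OF r \<kappa> hbm] unfolding hbP by (simp add: set_lebesgue_integral_def hb_def)
    also have "\<dots> = (\<integral>\<theta>. \<kappa> * (indicator {0<..<2 * pi} \<theta> * (h (P r \<theta>) * w (P r \<theta>))) \<partial>lborel)" by simp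
    finally have 1: "ennreal (LINT z:cball 0 1|nu \<kappa> r. h z) =
       ennreal (\<integral>\<theta>. \<kappa> * (indicator {0<..<2 * pi} \<theta> * (h (P r \<theta>) * w (P r \<theta>))) \<partial>lborel)" by simp
    also have "\<dots> = (\<integral>\<^sup>+\<theta>. ennreal (\<kappa> * (indicator {0<..<2 * pi} \<theta> * (h (P r \<theta>) * w (P r \<theta>)))) \<partial>lborel)"
      using i[unfolded hbP] w_nonneg \<kappa>
      by (intro nn_integral_eq_integral[symmetric] integrable_mult_right) (auto simp: h_def)
    finally show ?thesis unfolding Hp_integral_eq[OF \<kappa> r p fd] by (simp add: h_def)
  qed
  have "((\<lambda>r. ennreal (LINT z:cball 0 1|nu \<kappa> r. h z)) \<longlongrightarrow>
      ennreal (\<kappa> * (\<integral>\<theta>. indicator {0<..<2 * pi} \<theta> * (h (cis \<theta>) * w (cis \<theta>)) \<partial>lborel))) (at_left 0)"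
    by (intro tendsto_ennrealI nu_limit(2)[OF \<kappa> h])
  moreover have "eventually (\<lambda>r. ennreal (LINT z:cball 0 1|nu \<kappa> r. h z) = Hp_integral \<kappa> u p f r) (at_left 0)"
    using eventually_at_left_0 by (rule eventually_mono) (simp add: eq)
  ultimately show "(Hp_integral \<kappa> u p f \<longlongrightarrow>
      ennreal (\<kappa> * (\<integral>\<theta>. indicator {0<..<2 * pi} \<theta> * (cmod (f (cis \<theta>)) powr p * w (cis \<theta>)) \<partial>lborel))) (at_left 0)"
    unfolding h_def by (rule Lim_transform_eventually)
qed

lemma Hp_if_tendsto:
  assumes "f holomorphic_on unit_disc" "(Hp_integral \<kappa> u p f \<longlongrightarrow> ennreal c) (at_left 0)" "0 \<le> c"
  shows "f \<in> Hp \<kappa> u p" "Hp_norm \<kappa> u p f = c powr (1 / p)"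
proof -
  have "Limsup (at_left 0) (Hp_integral \<kappa> u p f) = ennreal c"
    by (rule lim_imp_Limsup[OF _ assms(2)]) simp
  then show "f \<in> Hp \<kappa> u p" using assms(1) by (simp add: Hp_def)
  have "Lim (at_left 0) (Hp_integral \<kappa> u p f) = ennreal c"
    by (rule tendsto_Lim[OF _ assms(2)]) simp
  then show "Hp_norm \<kappa> u p f = c powr (1 / p)" using assms(3) by (simp add: Hp_norm_def)
qed

end

lemma one_minus_cos_le: "1 - cos x \<le> x\<^sup>2 / 2" for x :: real
proof -
  have "1 - cos x = 2 * (sin (x / 2))\<^sup>2" using cos_double_sin[of "x / 2"] by simp
  also have "\<dots> \<le> 2 * (x / 2)\<^sup>2"
    using iffD1[OF abs_le_square_iff abs_sin_x_le_abs_x[of "x / 2"]] by simp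
  finally show ?thesis by (simp add: power2_eq_square)
qed

section \<open>Necessity of the fixed point for boundedness\<close>

context exhaustion_moebius
begin

text \<open>The test functions are \<open>f z = (1 + \<epsilon> - cnj b z)\<^sup>-\<^sup>2\<close> with \<open>b = \<phi> 1\<close>: comparing \<open>|f|\<^sup>p\<close> with
  the Poisson kernel, its weighted mean is at most of order \<open>\<epsilon> powr (1 - 2 p)\<close>, while that of \<open>f \<circ> \<phi>\<close> is
  larger by a factor \<open>\<epsilon> powr (- 1/2)\<close> because of the pole of the density at 1.\<close>

lemma fixed_if_bounded:
  assumes \<kappa>: "\<kappa> > 0" and p: "1 \<le> p" and bdd: "bounded_operator_on_Hp \<kappa> u p (composition_operator \<phi>)"
  shows "\<phi> 1 = 1"
proof (rule ccontr)
  assume ne: "\<phi> 1 \<noteq> 1"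
  obtain C0 where C0: "\<And>f. f \<in> Hp \<kappa> u p \<Longrightarrow> Hp_norm \<kappa> u p (f \<circ> \<phi>) \<le> C0 * Hp_norm \<kappa> u p f"
    using bdd by (auto simp: bounded_operator_on_Hp_def composition_operator_def)
  define b where "b = \<phi> 1"
  have b: "cmod b = 1" using in_circle[of 1] by (simp add: b_def)
  have bb: "cnj b * b = 1" using b complex_norm_square[of b] by (simp add: mult.commute)
  have nb: "cmod (1 - cnj b * z) = cmod (b - z)" for z
  proof -
    have "1 - cnj b * z = cnj b * (b - z)" using bb by (simp add: algebra_simps)
    then show ?thesis using b by (simp add: norm_mult)
  qed
  define d where "d = cmod (1 - b)"
  have d: "d > 0" using ne by (simp add: d_def b_def)
  define I where "I = (\<lambda>f. \<integral>\<theta>. indicator {0<..<2 * pi} \<theta> * (cmod (f (cis \<theta>)) powr p * w (cis \<theta>)) \<partial>lborel)"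
  have I_nonneg: "I f \<ge> 0" for f unfolding I_def using w_nonneg by (intro integral_nonneg_AE AE_I2) simp
  \<comment> \<open>The p-th power turns the bound for norms into one for integrals; the maximum
    with 1 keeps the constant positive.\<close>
  define K1 where "K1 = (max C0 1) powr p"
  have K1: "K1 > 0" by (simp add: K1_def)
  have IK: "I (f \<circ> \<phi>) \<le> K1 * I f" if f: "continuous_on (cball 0 1) f" "f holomorphic_on unit_disc" for f
  proof -
    have fc: "continuous_on (cball 0 1) (f \<circ> \<phi>)"
      unfolding comp_def by (rule continuous_on_compose2[OF f(1) continuous_on_moebius]) (use in_cball in auto)
    have fh: "f \<circ> \<phi> holomorphic_on unit_disc"
      by (rule holomorphic_on_compose_gen[OF moebius_holomorphic f(2)]) (use in_disc in auto)
    note 1 = Hp_if_tendsto[OF f(2) Hp_integral_tendsto(2)[OF \<kappa> p f(1)]]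
    note 2 = Hp_if_tendsto[OF fh Hp_integral_tendsto(2)[OF \<kappa> p fc]]
    have n0: "0 \<le> \<kappa> * I f" "0 \<le> \<kappa> * I (f \<circ> \<phi>)" using \<kappa> I_nonneg by auto
    have "(\<kappa> * I (f \<circ> \<phi>)) powr (1 / p) \<le> C0 * (\<kappa> * I f) powr (1 / p)"
      using C0[OF 1(1)] 1(2) 2(2) n0 by (simp add: I_def)
    also have "\<dots> \<le> max C0 1 * (\<kappa> * I f) powr (1 / p)" by (intro mult_right_mono) auto
    finally have "((\<kappa> * I (f \<circ> \<phi>)) powr (1 / p)) powr p \<le> (max C0 1 * (\<kappa> * I f) powr (1 / p)) powr p"
      using p by (intro powr_mono2) auto
    then have "\<kappa> * I (f \<circ> \<phi>) \<le> K1 * (\<kappa> * I f)"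
      using p n0 abs_of_nonneg[OF I_nonneg] abs_of_pos[OF \<kappa>] by (simp add: powr_mult powr_powr K1_def)
    then show ?thesis using \<kappa> by (simp add: mult.left_commute)
  qed
  define B where "B = C * (d\<^sup>2 / 8) powr (- 1 / 4)"
  have B: "B > 0" using C_pos d by (simp add: B_def)
  have up: "w z \<le> B" if zc: "z \<in> unit_circle" and zb: "cmod (b - z) < d / 2" for z
  proof -
    have "d \<le> cmod (1 - z) + cmod (b - z)"
      unfolding d_def using norm_triangle_ineq4[of "1 - z" "b - z"] by simp
    then have dz: "d / 2 \<le> cmod (1 - z)" using zb by linarith
    then have ne1: "z \<noteq> 1" using d by auto
    have "d\<^sup>2 / 8 \<le> 1 - Re z"
    proof -
      have "(d / 2)\<^sup>2 \<le> (cmod (1 - z))\<^sup>2" using dz d by (intro power_mono) auto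
      then show ?thesis unfolding one_minus_Re_circle[OF zc] by (simp add: power_divide)
    qed
    then have "(1 - Re z) powr (- 1 / 4) \<le> (d\<^sup>2 / 8) powr (- 1 / 4)"
      using d by (intro powr_mono2') auto
    then show ?thesis
      using w_circle(2)[OF zc ne1] mult_left_mono[of _ "(d\<^sup>2 / 8) powr (- 1 / 4)" C] C_pos unfolding B_def
      by (meson less_imp_le order.trans)
  qed
  define M0 where "M0 = (\<integral>\<theta>. indicator {0<..<2 * pi} \<theta> * (1 * w (cis \<theta>)) \<partial>lborel)"
  have i0: "integrable lborel (\<lambda>\<theta>. indicator {0<..<2 * pi} \<theta> * (1 * w (cis \<theta>)))"
    by (rule nu_limit(1)[OF \<kappa>, of "\<lambda>_. 1"]) auto
  have M0: "M0 \<ge> 0" unfolding M0_def using w_nonneg by (intro integral_nonneg_AE AE_I2) simp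
  \<comment> \<open>Bounds the contribution of the points at distance at least \<open>d / 2\<close>
    from \<open>b\<close>, where the test functions stay bounded uniformly.\<close>
  define D1 where "D1 = (d / 2) powr (- (2 * p)) * M0"
  have D1: "D1 \<ge> 0" using M0 by (simp add: D1_def)
  \<comment> \<open>Here \<open>e\<close> is the small parameter of the test function, not the
    unimodular factor of the map. Both estimates have been multiplied by
    \<open>e powr (2 * p - 1)\<close>: the left-hand side is unbounded as \<open>e\<close> tends to
    0, the right-hand side is constant.\<close>
  have main: "(1 + lip) powr (- (2 * p)) * (q * (e\<^sup>2 / 2) powr (- 1 / 4)) \<le> K1 * (D1 + pi * B)" if e: "0 < e" "e \<le> 1" for e
  proof -
    define l where "l = 1 + e"
    have l: "l > 1" using e by (simp add: l_def)
    define f where "f = (\<lambda>z. 1 / (of_real l - cnj b * z)\<^sup>2)"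
    have den: "e \<le> cmod (of_real l - cnj b * z)" "cmod (b - z) \<le> cmod (of_real l - cnj b * z)"
      "cmod (of_real l - cnj b * z) \<le> e + cmod (b - z)" if "cmod z \<le> 1" for z
    proof -
      have c1: "cmod (cnj b * z) \<le> 1" using that b by (simp add: norm_mult)
      show "e \<le> cmod (of_real l - cnj b * z)"
      proof -
        have "cmod (of_real l) = l" using l by simp
        moreover have "e = l - 1" by (simp add: l_def)
        ultimately show ?thesis using norm_triangle_ineq2[of "of_real l" "cnj b * z"] c1 by linarith
      qed
      have R: "Re (cnj b * z) \<le> 1" using complex_Re_le_cmod[of "cnj b * z"] c1 by linarith
      have "(cmod (of_real l - cnj b * z))\<^sup>2 - (cmod (1 - cnj b * z))\<^sup>2 = e * (e + 2 * (1 - Re (cnj b * z)))"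
        unfolding cmod_power2 l_def by (simp add: power2_eq_square algebra_simps)
      also have "\<dots> \<ge> 0" using e R by (intro mult_nonneg_nonneg) auto
      finally have "(cmod (1 - cnj b * z))\<^sup>2 \<le> (cmod (of_real l - cnj b * z))\<^sup>2" by simp
      then show "cmod (b - z) \<le> cmod (of_real l - cnj b * z)"
        unfolding nb by (rule power2_le_imp_le) simp
      have eq: "of_real l - cnj b * z = of_real e + (1 - cnj b * z)" by (simp add: l_def)
      show "cmod (of_real l - cnj b * z) \<le> e + cmod (b - z)"
        unfolding eq using norm_triangle_ineq[of "of_real e" "1 - cnj b * z"] e by (simp only: nb) simp
    qed
    have dnz: "of_real l - cnj b * z \<noteq> 0" if "cmod z \<le> 1" for z using den(1)[OF that] e by auto
    have f: "continuous_on (cball 0 1) f" "f holomorphic_on unit_disc"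
      unfolding f_def using dnz by (auto intro!: continuous_intros holomorphic_intros)
    have fp: "cmod (f z) powr p = cmod (of_real l - cnj b * z) powr (- (2 * p))" if "cmod z \<le> 1" for z
    proof -
      have pos: "cmod (of_real l - cnj b * z) > 0" using dnz[OF that] by simp
      have "cmod (f z) = cmod (of_real l - cnj b * z) powr (- 2)"
        unfolding f_def using pos by (simp add: norm_divide norm_power powr_minus_divide powr_numeral)
      then show ?thesis by (simp add: powr_powr)
    qed
    have fc: "continuous_on (cball 0 1) (f \<circ> \<phi>)"
      unfolding comp_def by (rule continuous_on_compose2[OF f(1) continuous_on_moebius]) (use in_cball in auto)
    let ?rhs = "\<lambda>\<theta>. (d / 2) powr (- (2 * p)) * (indicator {0<..<2 * pi} \<theta> * (1 * w (cis \<theta>))) +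
        B * e powr (2 - 2 * p) * (indicator {0<..<2 * pi} \<theta> * (1 / (cmod (of_real l - cnj b * cis \<theta>))\<^sup>2))"
    note pi' = poisson_integral[OF b l]
    have "I f \<le> (\<integral>\<theta>. ?rhs \<theta> \<partial>lborel)"
      unfolding I_def
    proof (rule integral_mono[OF Hp_integral_tendsto(1)[OF \<kappa> p f(1)]])
      show "integrable lborel ?rhs"
        by (intro Bochner_Integration.integrable_add integrable_mult_right i0 pi'(1))
      fix \<theta> :: real
      define D where "D = cmod (of_real l - cnj b * cis \<theta>)"
      have De: "e \<le> D" "cmod (b - cis \<theta>) \<le> D" using den[of "cis \<theta>"] by (auto simp: D_def)
      have Dp: "D > 0" using De e by linarith
      \<comment> \<open>Near \<open>b\<close> the weight is at most \<open>B\<close>, and 2 - 2p of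
        the exponents are spent on \<open>D \<ge> e\<close>, which leaves the integrable Poisson
        kernel; away from \<open>b\<close> the bound \<open>D \<ge> d / 2\<close> suffices.\<close>
      have split: "D powr (- (2 * p)) * w (cis \<theta>) \<le> (d / 2) powr (- (2 * p)) * w (cis \<theta>) + B * e powr (2 - 2 * p) * (1 / D\<^sup>2)"
      proof (cases "cmod (b - cis \<theta>) < d / 2")
        case True
        have "D powr (- (2 * p)) = D powr (2 - 2 * p) * D powr (- 2)" by (subst powr_add[symmetric]) simp
        also have "\<dots> = D powr (2 - 2 * p) * (1 / D\<^sup>2)" using Dp by (simp add: powr_minus_divide powr_numeral)
        also have "\<dots> \<le> e powr (2 - 2 * p) * (1 / D\<^sup>2)"
          using De(1) e p by (intro mult_right_mono powr_mono2') auto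
        finally have "D powr (- (2 * p)) * w (cis \<theta>) \<le> e powr (2 - 2 * p) * (1 / D\<^sup>2) * B"
          using up[OF _ True] w_nonneg by (intro mult_mono) auto
        moreover have "0 \<le> (d / 2) powr (- (2 * p)) * w (cis \<theta>)" using w_nonneg by simp
        ultimately show ?thesis by (simp add: mult_ac)
      next
        case False
        then have "D powr (- (2 * p)) \<le> (d / 2) powr (- (2 * p))" using De(2) d p by (intro powr_mono2') auto
        then have "D powr (- (2 * p)) * w (cis \<theta>) \<le> (d / 2) powr (- (2 * p)) * w (cis \<theta>)"
          using w_nonneg by (intro mult_right_mono)
        moreover have "0 \<le> B * e powr (2 - 2 * p) * (1 / D\<^sup>2)" using B by simp
        ultimately show ?thesis by linarith
      qed
      then show "indicator {0<..<2 * pi} \<theta> * (cmod (f (cis \<theta>)) powr p * w (cis \<theta>)) \<le> ?rhs \<theta>"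
        unfolding D_def using fp[of "cis \<theta>"] by (cases "\<theta> \<in> {0<..<2 * pi}") simp_all
    qed
    also have "\<dots> = D1 + B * e powr (2 - 2 * p) * (2 * pi / (l\<^sup>2 - 1))"
      by (subst Bochner_Integration.integral_add[OF integrable_mult_right[OF i0] integrable_mult_right[OF pi'(1)]])
         (simp only: integral_mult_right_zero pi'(2) D1_def M0_def)
    also have "\<dots> \<le> D1 + pi * B * e powr (1 - 2 * p)"
    proof -
      have ee: "e powr (2 - 2 * p) = e powr (1 - 2 * p) * e"
        using e powr_add[of e "1 - 2 * p" 1] by simp
      have "2 * pi / (l\<^sup>2 - 1) \<le> 2 * pi / (2 * e)"
        using e by (intro divide_left_mono) (auto simp: l_def power2_eq_square algebra_simps intro!: add_pos_pos mult_pos_pos)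
      then have "B * e powr (2 - 2 * p) * (2 * pi / (l\<^sup>2 - 1)) \<le> B * e powr (2 - 2 * p) * (pi / e)"
        using B by (intro mult_left_mono) auto
      also have "\<dots> = pi * B * e powr (1 - 2 * p)"
        unfolding ee using e by simp
      finally show ?thesis by simp
    qed
    finally have upper: "I f \<le> D1 + pi * B * e powr (1 - 2 * p)" .
    \<comment> \<open>A lower bound of the integrand for angles between 0 and \<open>e\<close>: the
      image point is within \<open>lip * e\<close> of \<open>b\<close>, so the denominator is at
      most \<open>(1 + lip) * e\<close>, and 1 - cos \<theta> is at most
      \<open>e\<^sup>2 / 2\<close>.\<close>
    define c where "c = ((1 + lip) * e) powr (- (2 * p)) * (q * (e\<^sup>2 / 2) powr (- 1 / 4))"
    have lower: "e * c \<le> I (f \<circ> \<phi>)"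
    proof -
      have "(\<integral>\<theta>. indicator {0<..<e} \<theta> * c \<partial>lborel) \<le> I (f \<circ> \<phi>)"
        unfolding I_def
      proof (rule integral_mono[OF _ Hp_integral_tendsto(1)[OF \<kappa> p fc]])
        show "integrable lborel (\<lambda>\<theta>. indicator {0<..<e} \<theta> * c)" using e by simp
        fix \<theta> :: real
        show "indicator {0<..<e} \<theta> * c \<le> indicator {0<..<2 * pi} \<theta> * (cmod ((f \<circ> \<phi>) (cis \<theta>)) powr p * w (cis \<theta>))"
        proof (cases "\<theta> \<in> {0<..<e}")
          case True
          have \<theta>: "\<theta> \<in> {0<..<2 * pi}" using True e pi_gt3 by auto
          have cz: "cis \<theta> \<in> unit_circle" by simp
          have c1: "cis \<theta> \<noteq> 1" using cis_in_A[OF \<theta>] by (auto simp: A_def)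
          have cosle: "1 - cos \<theta> \<le> \<theta>\<^sup>2 / 2" by (rule one_minus_cos_le)
          have t2: "\<theta>\<^sup>2 \<le> e\<^sup>2" using True by (intro power_mono) auto
          have "(cmod (1 - cis \<theta>))\<^sup>2 \<le> \<theta>\<^sup>2" using one_minus_Re_circle[OF cz] cosle by simp
          then have n1: "cmod (1 - cis \<theta>) \<le> \<theta>" by (rule power2_le_imp_le) (use True in simp)
          have \<phi>c: "cmod (\<phi> (cis \<theta>)) \<le> 1" using in_cball[of "cis \<theta>"] by simp
          have "cmod (b - \<phi> (cis \<theta>)) \<le> lip * cmod (1 - cis \<theta>)"
            unfolding b_def by (intro lipschitz) auto
          also have "\<dots> \<le> lip * e" using n1 True lip_ge_1 by (intro mult_left_mono) auto
          finally have "cmod (of_real l - cnj b * \<phi> (cis \<theta>)) \<le> (1 + lip) * e"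
            using den(3)[OF \<phi>c] by (simp add: algebra_simps)
          moreover have "cmod (of_real l - cnj b * \<phi> (cis \<theta>)) > 0" using dnz[OF \<phi>c] by simp
          ultimately have 1: "((1 + lip) * e) powr (- (2 * p)) \<le> cmod ((f \<circ> \<phi>) (cis \<theta>)) powr p"
            using fp[OF \<phi>c] p by (simp add: powr_mono2')
          have "1 - Re (cis \<theta>) \<le> e\<^sup>2 / 2" using cosle t2 by simp
          then have "(e\<^sup>2 / 2) powr (- 1 / 4) \<le> (1 - Re (cis \<theta>)) powr (- 1 / 4)"
            using w_circle(3)[OF cz c1] by (intro powr_mono2') auto
          then have 2: "q * (e\<^sup>2 / 2) powr (- 1 / 4) \<le> w (cis \<theta>)"
            using w_circle(1)[OF cz c1] q mult_left_mono[of "(e\<^sup>2 / 2) powr (- 1 / 4)" _ q]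
            by (meson less_imp_le order.trans)
          have "c \<le> cmod ((f \<circ> \<phi>) (cis \<theta>)) powr p * w (cis \<theta>)"
            unfolding c_def using 1 2 q by (intro mult_mono) auto
          then show ?thesis using True \<theta> by simp
        qed (use w_nonneg in simp)
      qed
      then show ?thesis using e by (simp add: mult.commute)
    qed
    have "e * c \<le> K1 * (D1 + pi * B * e powr (1 - 2 * p))"
      using lower IK[OF f] mult_left_mono[OF upper, of K1] K1 by linarith
    then have "e * c * e powr (2 * p - 1) \<le> K1 * (D1 + pi * B * e powr (1 - 2 * p)) * e powr (2 * p - 1)"
      by (intro mult_right_mono) auto
    moreover have "e * c * e powr (2 * p - 1) = (1 + lip) powr (- (2 * p)) * (q * (e\<^sup>2 / 2) powr (- 1 / 4))"
    proof -
      have "((1 + lip) * e) powr (- (2 * p)) = (1 + lip) powr (- (2 * p)) * e powr (- (2 * p))"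
        using e lip_ge_1 by (intro powr_mult)
      moreover have "e * e powr (- (2 * p)) * e powr (2 * p - 1) = 1"
      proof -
        have "e powr 1 * e powr (- (2 * p)) * e powr (2 * p - 1) = 1"
          unfolding powr_add[symmetric] using e by simp
        then show ?thesis using e by simp
      qed
      ultimately show ?thesis unfolding c_def by (simp add: mult_ac)
    qed
    moreover have "K1 * (D1 + pi * B * e powr (1 - 2 * p)) * e powr (2 * p - 1) \<le> K1 * (D1 + pi * B)"
    proof -
      have "e powr (1 - 2 * p) * e powr (2 * p - 1) = 1" unfolding powr_add[symmetric] using e by simp
      then have "(D1 + pi * B * e powr (1 - 2 * p)) * e powr (2 * p - 1) = D1 * e powr (2 * p - 1) + pi * B"
        by (simp add: distrib_right mult.assoc)
      moreover have "e powr (2 * p - 1) \<le> 1" using e p by (intro powr_le1) auto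
      then have "D1 * e powr (2 * p - 1) \<le> D1" using D1 by (intro mult_left_le)
      ultimately have "(D1 + pi * B * e powr (1 - 2 * p)) * e powr (2 * p - 1) \<le> D1 + pi * B" by linarith
      then show ?thesis using K1 by (simp add: mult.assoc)
    qed
    ultimately show ?thesis by linarith
  qed
  define k where "k = (1 + lip) powr (- (2 * p)) * q"
  have k: "k > 0" using lip_ge_1 q by (simp add: k_def)
  define Y where "Y = K1 * (D1 + pi * B) / k + 1"
  have Y: "Y > 0" using K1 D1 B k by (simp add: Y_def add_nonneg_pos)
  \<comment> \<open>Chosen so that \<open>e\<^sup>2 / 2\<close> is below
    \<open>Y powr (- 4)\<close>, whereupon its power -1/4 exceeds \<open>Y\<close> and contradicts
    \<open>main\<close>.\<close>
  define e where "e = min 1 (Y powr (- 2))"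
  have e: "0 < e" "e \<le> 1" "e \<le> Y powr (- 2)" using Y by (auto simp: e_def)
  have "e\<^sup>2 \<le> (Y powr (- 2))\<^sup>2" using e by (intro power_mono) auto
  also have "(Y powr (- 2))\<^sup>2 = Y powr (- 4)"
    unfolding power2_eq_square powr_add[symmetric] by simp
  finally have e2: "e\<^sup>2 \<le> Y powr (- 4)" .
  have "x / 2 < y" if "x \<le> y" "0 < x" for x y :: real using that by simp
  from this[OF e2] have "e\<^sup>2 / 2 < Y powr (- 4)" using e(1) by simp
  then have "Y < (e\<^sup>2 / 2) powr (- 1 / 4)" using e(1) by (intro powr_minus_quarter_gt[OF Y]) auto
  then have "k * Y < k * (e\<^sup>2 / 2) powr (- 1 / 4)" using k by simp
  also have "\<dots> \<le> K1 * (D1 + pi * B)" using main[OF e(1,2)] by (simp add: k_def mult.assoc)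
  also have "K1 * (D1 + pi * B) = k * Y - k" using k by (simp add: Y_def field_simps)
  finally show False using k by simp
qed

end

text \<open>\<open>|f|\<^sup>p\<close> need not be twice differentiable at the zeros of \<open>f\<close>, hence the summand \<open>e\<close>.\<close>

lemma pd2_norm_powr:
  fixes f f' f'' :: "complex \<Rightarrow> complex" and e q :: real
  assumes d1: "\<And>z. z \<in> S \<Longrightarrow> (f has_field_derivative f' z) (at z)"
    and d2: "\<And>z. z \<in> S \<Longrightarrow> (f' has_field_derivative f'' z) (at z)"
    and c: "continuous_on S f''" and e: "e > 0"
  shows "\<exists>gx gy gxx gyy. pd2 S (\<lambda>z. ((cmod (f z))\<^sup>2 + e) powr q) gx gy gxx gyy \<and>
    (\<forall>z\<in>S. gxx z + gyy z =
      4 * q * ((cmod (f z))\<^sup>2 + e) powr (q - 2) * (cmod (f' z))\<^sup>2 * (e + q * (cmod (f z))\<^sup>2))"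
proof -
  define s where "s = (\<lambda>z. (Re (f z) * Re (f z) + Im (f z) * Im (f z)) + e)"
  have s: "(cmod (f z))\<^sup>2 + e = s z" for z
    by (subst cmod_power2) (simp add: s_def power2_eq_square)
  have spos: "s z > 0" for z unfolding s_def using e by (intro add_nonneg_pos add_nonneg_nonneg) auto
  define m where "m = (\<lambda>v z. 2 * (Re (f z) * Re (f' z * v) + Im (f z) * Im (f' z * v)))"
  define n where "n = (\<lambda>v z. 2 * (Re (f' z * v) * Re (f' z * v) + Im (f' z * v) * Im (f' z * v)
      + (Re (f z) * Re (f'' z * v * v) + Im (f z) * Im (f'' z * v * v))))"
  have c0: "continuous_on S f" and c1: "continuous_on S f'"
    by (rule DERIV_continuous_on[OF has_field_derivative_at_within[OF d1]]
             DERIV_continuous_on[OF has_field_derivative_at_within[OF d2]], assumption)+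
  have cs: "continuous_on S (\<lambda>z. s z powr b)" for b
  proof -
    have "continuous_on S s" unfolding s_def by (intro continuous_intros c0)
    then show ?thesis using spos
      by (intro continuous_on_powr continuous_on_const) (auto simp: less_imp_neq[symmetric])
  qed
  have cm: "continuous_on S (m v)" for v unfolding m_def by (intro continuous_intros c0 c1)
  have cn: "continuous_on S (n v)" for v unfolding n_def by (intro continuous_intros c0 c1 c)
  have R: "has_line_derivative (\<lambda>z. Re (f z)) v (Re (f' z * v)) z"
    and I: "has_line_derivative (\<lambda>z. Im (f z)) v (Im (f' z * v)) z" if "z \<in> S" for z v
    using has_line_derivative_field[OF d1[OF that], of v]
      has_line_derivative_field[OF DERIV_cmult[OF d1[OF that], of "- \<i>"], of v] by simp_all
  have R': "has_line_derivative (\<lambda>z. Re (f' z * v)) v (Re (f'' z * v * v)) z"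
    and I': "has_line_derivative (\<lambda>z. Im (f' z * v)) v (Im (f'' z * v * v)) z" if "z \<in> S" for z v
    using has_line_derivative_field[OF DERIV_cmult_right[OF d2[OF that], of v], of v]
      has_line_derivative_field[OF DERIV_cmult[OF DERIV_cmult_right[OF d2[OF that], of v], of "- \<i>"], of v]
    by (simp_all add: algebra_simps)
  have ds: "has_line_derivative s v (m v z) z" if "z \<in> S" for z v
    using has_line_derivative_add[OF has_line_derivative_add[OF
        has_line_derivative_mult[OF R[OF that] R[OF that]] has_line_derivative_mult[OF I[OF that] I[OF that]]]
        has_line_derivative_const[of e], of v]
    unfolding s_def m_def by (simp add: algebra_simps)
  have dsp: "has_line_derivative (\<lambda>z. s z powr b) v (b * s z powr (b - 1) * m v z) z"
    if "z \<in> S" for z v b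
    by (rule has_line_derivative_chain[OF ds[OF that]])
       (use spos[of z] in \<open>auto intro!: derivative_eq_intros\<close>)
  have dm: "has_line_derivative (m v) v (n v z) z" if "z \<in> S" for z v
    using has_line_derivative_cmult[OF has_line_derivative_add[OF
        has_line_derivative_mult[OF R[OF that] R'[OF that]] has_line_derivative_mult[OF I[OF that] I'[OF that]]], of 2 v]
    unfolding m_def n_def by (simp add: algebra_simps)
  define g1 where "g1 = (\<lambda>v z. q * (s z powr (q - 1) * m v z))"
  define g2 where "g2 = (\<lambda>v z. q * ((q - 1) * s z powr (q - 2) * m v z * m v z + n v z * s z powr (q - 1)))"
  have dg1: "has_line_derivative (g1 v) v (g2 v z) z" if "z \<in> S" for z v
    using has_line_derivative_cmult[OF has_line_derivative_mult[OF dsp[OF that] dm[OF that]], of q "q - 1" v]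
    unfolding g1_def g2_def by (simp add: mult.assoc)
  have "pd2 S (\<lambda>z. s z powr q) (g1 1) (g1 \<i>) (g2 1) (g2 \<i>)"
    unfolding pd2_def
  proof (intro conjI ballI)
    show "continuous_on S (g1 1)" "continuous_on S (g1 \<i>)" "continuous_on S (g2 1)" "continuous_on S (g2 \<i>)"
      unfolding g1_def g2_def by (intro continuous_intros cs cm cn)+
    show "has_line_derivative (\<lambda>z. s z powr q) 1 (g1 1 z) z" "has_line_derivative (\<lambda>z. s z powr q) \<i> (g1 \<i> z) z"
      if "z \<in> S" for z
      using dsp[OF that, of q] by (simp_all add: g1_def mult.assoc)
  qed (use cs dg1 in auto)
  \<comment> \<open>By Cauchy-Riemann the derivatives in the two directions are \<open>f'\<close>
    and \<open>\<i> * f'\<close>. The squared first order terms therefore add up to a multiple of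
    the squared moduli of \<open>f\<close> and \<open>f'\<close>, while the terms with
    \<open>f''\<close> cancel.\<close>
  moreover have "g2 1 z + g2 \<i> z = 4 * q * s z powr (q - 2) * (cmod (f' z))\<^sup>2 * (e + q * (cmod (f z))\<^sup>2)" for z
  proof -
    have p: "s z powr (q - 1) = s z powr (q - 2) * s z"
      using spos[of z] powr_add[of "s z" "q - 2" 1] by simp
    have f2: "(cmod (f z))\<^sup>2 = s z - e" using s[of z] by simp
    have sz: "s z = Re (f z) * Re (f z) + Im (f z) * Im (f z) + e" by (simp add: s_def)
    have f1: "(cmod (f' z))\<^sup>2 = Re (f' z) * Re (f' z) + Im (f' z) * Im (f' z)"
      by (subst cmod_power2) (simp add: power2_eq_square)
    have "m 1 z * m 1 z + m \<i> z * m \<i> z = 4 * (s z - e) * (cmod (f' z))\<^sup>2"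
      unfolding f1 sz m_def by simp algebra
    moreover have "n 1 z + n \<i> z = 4 * (cmod (f' z))\<^sup>2" unfolding f1 n_def by simp
    moreover have "g2 1 z + g2 \<i> z = q * ((q - 1) * s z powr (q - 2) * (m 1 z * m 1 z + m \<i> z * m \<i> z)
        + (n 1 z + n \<i> z) * (s z powr (q - 2) * s z))"
      unfolding g2_def p by algebra
    ultimately show ?thesis unfolding f2 by algebra
  qed
  ultimately show ?thesis unfolding s by blast
qed

section \<open>Means over the level curves\<close>

lemma increasing_tendsto_at_left_0:
  fixes m :: "real \<Rightarrow> real"
  assumes r0: "r0 < 0" and mono: "\<And>r s. r0 < r \<Longrightarrow> r \<le> s \<Longrightarrow> s < 0 \<Longrightarrow> m r \<le> m s"
    and bd: "\<And>r. r0 < r \<Longrightarrow> r < 0 \<Longrightarrow> m r \<le> B"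
  shows "\<exists>c. (m \<longlongrightarrow> c) (at_left 0) \<and> (\<forall>r. r0 < r \<longrightarrow> r < 0 \<longrightarrow> m r \<le> c) \<and> c \<le> B"
proof (intro exI conjI allI impI)
  let ?c = "SUP r\<in>{r0<..<0}. m r"
  have b: "bdd_above (m ` {r0<..<0})" using bd by (intro bdd_aboveI[of _ B]) auto
  have ne: "{r0<..<0} \<noteq> {}" using r0 by simp
  show ub: "m r \<le> ?c" if "r0 < r" "r < 0" for r using that by (intro cSUP_upper b) auto
  show "?c \<le> B" using bd by (intro cSUP_least ne) auto
  show "(m \<longlongrightarrow> ?c) (at_left 0)"
  proof (rule order_tendstoI)
    fix x assume "x < ?c"
    then obtain r where r: "r0 < r" "r < 0" "x < m r" using less_cSUP_iff[OF ne b] by auto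
    then have "eventually (\<lambda>s. s \<in> {r<..<0}) (at_left 0)" by (intro eventually_at_left_real)
    moreover have "x < m s" if "s \<in> {r<..<0}" for s using r mono[of r s] that by auto
    ultimately show "eventually (\<lambda>s. x < m s) (at_left 0)" by (rule eventually_mono)
  next
    fix x assume x: "?c < x"
    have "eventually (\<lambda>s. s \<in> {r0<..<0}) (at_left 0)" using r0 by (intro eventually_at_left_real)
    then show "eventually (\<lambda>s. m s < x) (at_left 0)"
      by eventually_elim (use x ub in fastforce)
  qed
qed

context disc_annulus
begin

text \<open>\<open>Hp_integral\<close> as a real number and without the factor \<kappa>. The variant
  \<open>mean_eps\<close> below uses the smooth regularisation of the power, to which the
  Lelong-Jensen formula applies.\<close>

definition mean :: "real \<Rightarrow> (complex \<Rightarrow> complex) \<Rightarrow> real \<Rightarrow> real" where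
  "mean p f r = (\<integral>\<theta>. indicator {0<..<2 * pi} \<theta> * (cmod (f (P r \<theta>)) powr p * w (P r \<theta>)) \<partial>lborel)"

definition mean_eps :: "real \<Rightarrow> real \<Rightarrow> (complex \<Rightarrow> complex) \<Rightarrow> real \<Rightarrow> real" where
  "mean_eps p e f r = (\<integral>\<theta>. indicator {0<..<2 * pi} \<theta> * (((cmod (f (P r \<theta>)))\<^sup>2 + e) powr (p / 2) * w (P r \<theta>)) \<partial>lborel)"

lemma pd2_holomorphic_powr:
  assumes f: "f holomorphic_on unit_disc" and e: "e > 0"
  shows "\<exists>gx gy gxx gyy. pd2 unit_disc (\<lambda>z. ((cmod (f z))\<^sup>2 + e) powr b) gx gy gxx gyy \<and>
    (\<forall>z\<in>unit_disc. gxx z + gyy z =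
      4 * b * ((cmod (f z))\<^sup>2 + e) powr (b - 2) * (cmod (deriv f z))\<^sup>2 * (e + b * (cmod (f z))\<^sup>2))"
proof (rule pd2_norm_powr[OF _ _ _ e])
  have f': "deriv f holomorphic_on unit_disc" using f by (intro holomorphic_deriv) auto
  show "(f has_field_derivative deriv f z) (at z)" "(deriv f has_field_derivative deriv (deriv f) z) (at z)"
    if "z \<in> unit_disc" for z
    by (rule holomorphic_derivI[OF f open_ball that] holomorphic_derivI[OF f' open_ball that])+
  show "continuous_on unit_disc (deriv (deriv f))"
    by (rule holomorphic_on_imp_continuous_on[OF holomorphic_deriv[OF f' open_ball]])
qed

text \<open>The regularised integrands increase with the regularisation, so the one with value 1
  dominates all that are used.\<close>

lemma mean_limit:
  assumes r: "r0 < r" "r < 0" and p: "1 \<le> p" and f: "f holomorphic_on unit_disc"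
  shows "integrable lborel (\<lambda>\<theta>. indicator {0<..<2 * pi} \<theta> * (cmod (f (P r \<theta>)) powr p * w (P r \<theta>)))"
    and "(\<lambda>n. mean_eps p (1 / Suc n) f r) \<longlonglongrightarrow> mean p f r"
proof -
  let ?F = "\<lambda>e \<theta>. indicator {0<..<2 * pi} \<theta> * (((cmod (f (P r \<theta>)))\<^sup>2 + e) powr (p / 2) * w (P r \<theta>)) :: real"
  let ?G = "\<lambda>\<theta>. indicator {0<..<2 * pi} \<theta> * (cmod (f (P r \<theta>)) powr p * w (P r \<theta>)) :: real"
  have int: "integrable lborel (?F e)" if e: "e > 0" for e
    using pd2_holomorphic_powr[OF f e, of "p / 2"] level_identity(1)[OF r] by blast
  have lim: "(\<lambda>n. ?F (1 / Suc n) \<theta>) \<longlonglongrightarrow> ?G \<theta>" for \<theta>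
  proof -
    have pw: "((cmod (f (P r \<theta>)))\<^sup>2 + 0) powr (p / 2) = cmod (f (P r \<theta>)) powr p"
      by (cases "f (P r \<theta>) = 0") (use p in \<open>auto simp: powr_powr simp flip: powr_numeral\<close>)
    have n: "(\<lambda>n. 1 / real (Suc n)) \<longlonglongrightarrow> 0"
      using LIMSEQ_inverse_real_of_nat by (simp only: inverse_eq_divide)
    have "(\<lambda>n. ((cmod (f (P r \<theta>)))\<^sup>2 + 1 / Suc n) powr (p / 2)) \<longlonglongrightarrow> ((cmod (f (P r \<theta>)))\<^sup>2 + 0) powr (p / 2)"
      using p by (intro tendsto_powr2 tendsto_add tendsto_const n always_eventually) auto
    then show ?thesis unfolding pw by (intro tendsto_mult_left tendsto_mult_right)
  qed
  have bd: "norm (?F (1 / Suc n) \<theta>) \<le> ?F 1 \<theta>" for n \<theta>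
    using w_nonneg[of "P r \<theta>"] p
    by (auto simp: abs_mult indicator_def intro!: mult_right_mono powr_mono2)
  have m1: "?F (1 / Suc n) \<in> borel_measurable lborel" for n using int[of "1 / Suc n"] by (intro borel_measurable_integrable) simp
  have m: "?G \<in> borel_measurable lborel"
    by (rule borel_measurable_LIMSEQ_real[OF lim m1])
  show "integrable lborel ?G"
    by (rule integrable_dominated_convergence[where s = "\<lambda>n. ?F (1 / Suc n)" and w = "?F 1"])
       (use m m1 int lim bd in auto)
  show "(\<lambda>n. mean_eps p (1 / Suc n) f r) \<longlonglongrightarrow> mean p f r"
    unfolding mean_eps_def mean_def
    by (rule integral_dominated_convergence[where w = "?F 1"]) (use m m1 int lim bd in auto)
qed

lemma mean_nonneg: "0 \<le> mean p f r"
  unfolding mean_def by (intro integral_nonneg_AE AE_I2) (simp add: w_nonneg)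

lemma mean_le:
  assumes "r0 < r" "r < 0" "r0 < s" "s < 0" "1 \<le> p" "f holomorphic_on unit_disc" "g holomorphic_on unit_disc"
    and le: "\<And>e. e > 0 \<Longrightarrow> mean_eps p e f r \<le> K * mean_eps p e g s"
  shows "mean p f r \<le> K * mean p g s"
  by (rule LIMSEQ_le[OF mean_limit(2)[of r p f] tendsto_mult_left[OF mean_limit(2)[of s p g]]])
     (use assms in auto)

text \<open>The regularised power of the modulus is subharmonic, so both integrals in the
  Lelong-Jensen formula grow with the level. Hence the limit in the norm exists as soon as the means
  are bounded.\<close>

lemma mean_mono:
  assumes r: "r0 < r" "r \<le> s" "s < 0" and p: "1 \<le> p" and f: "f holomorphic_on unit_disc"
  shows "mean p f r \<le> mean p f s"
proof -
  have "mean_eps p e f r \<le> 1 * mean_eps p e f s" if e: "e > 0" for e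
  proof -
    obtain gx gy gxx gyy where g: "pd2 unit_disc (\<lambda>z. ((cmod (f z))\<^sup>2 + e) powr (p / 2)) gx gy gxx gyy"
      "\<And>z. z \<in> unit_disc \<Longrightarrow> gxx z + gyy z = 4 * (p / 2) * ((cmod (f z))\<^sup>2 + e) powr (p / 2 - 2) *
        (cmod (deriv f z))\<^sup>2 * (e + p / 2 * (cmod (f z))\<^sup>2)"
      using pd2_holomorphic_powr[OF f e, of "p / 2"] by blast
    have pos: "0 \<le> gxx z + gyy z" if "z \<in> unit_disc" for z
      unfolding g(2)[OF that] using p e by (intro mult_nonneg_nonneg add_nonneg_nonneg) auto
    have r': "r < 0" "r0 < s" using r by auto
    note A = level_identity[OF r(1) r'(1) g(1)] and B = level_identity[OF r'(2) r(3) g(1)]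
    have "(if z \<in> unit_disc \<and> u z < r then ((cmod (f z))\<^sup>2 + e) powr (p / 2) * lap z else 0)
      \<le> (if z \<in> unit_disc \<and> u z < s then ((cmod (f z))\<^sup>2 + e) powr (p / 2) * lap z else 0)" for z
      using r less_imp_le[OF lap_pos, of z] by (auto intro!: mult_nonneg_nonneg)
    moreover have "(if z \<in> unit_disc then max 0 (r - u z) * (gxx z + gyy z) else 0)
      \<le> (if z \<in> unit_disc then max 0 (s - u z) * (gxx z + gyy z) else 0)" for z
      using r pos[of z] by (auto intro!: mult_right_mono)
    ultimately show ?thesis
      unfolding mean_eps_def A(4) B(4) mult_1 by (intro add_mono integral_mono A(2,3) B(2,3))
  qed
  then have "mean p f r \<le> 1 * mean p f s" using r by (intro mean_le p f) auto
  then show ?thesis by simp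
qed

lemma Hp_integral_mean:
  assumes \<kappa>: "\<kappa> > 0" and r: "r0 < r" "r < 0" and p: "1 \<le> p" and f: "f holomorphic_on unit_disc"
  shows "Hp_integral \<kappa> u p f r = ennreal (\<kappa> * mean p f r)"
  unfolding Hp_integral_eq[OF \<kappa> r p holomorphic_on_imp_continuous_on[OF f]] mean_def
    integral_mult_right_zero[symmetric]
  by (rule nn_integral_eq_integral) (use mean_limit(1)[OF r p f] \<kappa> w_nonneg in auto)

lemma Hp_integral_tendsto_mean:
  assumes \<kappa>: "\<kappa> > 0" and p: "1 \<le> p" and f: "f holomorphic_on unit_disc" and lim: "(mean p f \<longlongrightarrow> c) (at_left 0)"
  shows "(Hp_integral \<kappa> u p f \<longlongrightarrow> ennreal (\<kappa> * c)) (at_left 0)"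
proof -
  have "((\<lambda>r. ennreal (\<kappa> * mean p f r)) \<longlongrightarrow> ennreal (\<kappa> * c)) (at_left 0)"
    by (intro tendsto_intros lim)
  moreover have "eventually (\<lambda>s. s \<in> {r0<..<0}) (at_left 0)" using r0 by (intro eventually_at_left_real)
  then have "eventually (\<lambda>r. ennreal (\<kappa> * mean p f r) = Hp_integral \<kappa> u p f r) (at_left 0)"
    by eventually_elim (use Hp_integral_mean[OF \<kappa> _ _ p f] in simp)
  ultimately show ?thesis by (rule Lim_transform_eventually)
qed

text \<open>A finite \<open>Limsup\<close> controls the means only near level 0; monotonicity
  extends the bound to all levels.\<close>

lemma mean_bounded:
  assumes \<kappa>: "\<kappa> > 0" and p: "1 \<le> p" and f: "f \<in> Hp \<kappa> u p"
  obtains B where "\<And>r. r0 < r \<Longrightarrow> r < 0 \<Longrightarrow> mean p f r \<le> B"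
proof -
  have h: "f holomorphic_on unit_disc" and L: "Limsup (at_left 0) (Hp_integral \<kappa> u p f) < \<infinity>"
    using f by (auto simp: Hp_def)
  obtain b where b: "Limsup (at_left 0) (Hp_integral \<kappa> u p f) < b" "b < \<infinity>" using dense[OF L] by blast
  have ev: "eventually (\<lambda>r. Hp_integral \<kappa> u p f r < b) (at_left 0)" using Limsup_lessD[OF b(1)] .
  have "mean p f r \<le> enn2real b / \<kappa>" if r: "r0 < r" "r < 0" for r
  proof -
    have "eventually (\<lambda>s. s \<in> {r<..<0}) (at_left 0)" using r by (intro eventually_at_left_real)
    with ev have "eventually (\<lambda>s. Hp_integral \<kappa> u p f s < b \<and> s \<in> {r<..<0}) (at_left 0)" by eventually_elim simp
    then obtain s where s: "Hp_integral \<kappa> u p f s < b" "r < s" "s < 0"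
      using eventually_happens' trivial_limit_at_left_real by fastforce
    then have "ennreal (\<kappa> * mean p f s) < b" using r Hp_integral_mean[OF \<kappa> _ _ p h, of s] by simp
    moreover have "0 \<le> \<kappa> * mean p f s" using \<kappa> mean_nonneg by simp
    ultimately have "\<kappa> * mean p f s \<le> enn2real b"
      using b(2) by (metis enn2real_ennreal enn2real_mono less_imp_le infinity_ennreal_def)
    moreover have "mean p f r \<le> mean p f s" using r s by (intro mean_mono p h) auto
    ultimately show ?thesis using \<kappa>
      by (simp add: field_simps) (meson mult_left_mono less_imp_le order_trans)
  qed
  then show ?thesis using that by blast
qed

end

section \<open>Transport of the means by a disc automorphism\<close>

context moebius_map
begin

lemma image_disc: "moebius e a ` unit_disc = unit_disc"
proof (intro subset_antisym subsetI)
  fix z :: complex assume z: "z \<in> unit_disc"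
  then have "moebius_inv e a z \<in> unit_disc"
    using moebius_map.in_disc[OF moebius_map_inv[OF moebius_map_axioms], of z] by (simp add: moebius_inv_def)
  moreover have "z = moebius e a (moebius_inv e a z)" using moebius_inv[of z] z by simp
  ultimately show "z \<in> moebius e a ` unit_disc" by blast
qed (use in_disc in blast)

lemma integral_moebius:
  fixes h :: "complex \<Rightarrow> real"
  assumes h: "integrable lborel h" and 0: "\<And>z. z \<notin> unit_disc \<Longrightarrow> h z = 0"
  shows "integrable lborel (\<lambda>z. ((cmod (dmoebius z))\<^sup>2 * indicator unit_disc z) * h (moebius e a z))"
    and "(\<integral>z. ((cmod (dmoebius z))\<^sup>2 * indicator unit_disc z) * h (moebius e a z) \<partial>lborel) = (\<integral>z. h z \<partial>lborel)"
proof -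
  have hm[measurable]: "h \<in> borel_measurable borel" using borel_measurable_integrable[OF h] by simp
  have im: "indicat_real unit_disc \<in> borel_measurable borel" by (rule borel_measurable_indicator) simp
  let ?w = "\<lambda>z. (cmod (dmoebius z))\<^sup>2 * indicator unit_disc z :: real"
  have wm[measurable]: "?w \<in> borel_measurable borel"
    by (intro borel_measurable_times borel_measurable_power borel_measurable_norm dmoebius_borel borel_measurable_indicator) auto
  have D: "distr (density lborel (\<lambda>z. ennreal (?w z))) borel (moebius e a) = density lborel (\<lambda>z. ennreal (indicator unit_disc z))"
  proof -
    have "inj_on (moebius e a) unit_disc"
      by (rule inj_on_inverseI[of _ "moebius_inv e a"]) (simp add: inv_moebius)
    then have "distr (density lborel (\<lambda>z. ennreal ((cmod (dmoebius z))\<^sup>2) * indicator unit_disc z)) borel (moebius e a)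
      = density lborel (indicator (moebius e a ` unit_disc))"
      by (intro distr_holomorphic_lborel moebius_deriv) (auto simp: image_disc)
    then show ?thesis unfolding image_disc by (simp add: ennreal_mult' ennreal_indicator)
  qed
  have ind: "(\<lambda>z. indicator unit_disc z *\<^sub>R h z) = h"
    by (rule ext) (use 0 in \<open>auto simp: indicator_def\<close>)
  have mm: "moebius e a \<in> measurable (density lborel (\<lambda>z. ennreal (?w z))) borel" by simp
  have mc: "(\<lambda>z. h (moebius e a z)) \<in> borel_measurable lborel" by simp
  have "integrable (density lborel (\<lambda>z. ennreal (indicator unit_disc z))) h"
    using h by (subst integrable_density) (auto simp: ind[unfolded real_scaleR_def] im)
  then have "integrable (density lborel (\<lambda>z. ennreal (?w z))) (\<lambda>z. h (moebius e a z))"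
    unfolding D[symmetric] by (subst (asm) integrable_distr_eq) (use mm in auto)
  then show "integrable lborel (\<lambda>z. ?w z * h (moebius e a z))"
    by (subst (asm) integrable_density) (use mc in auto)
  have "(\<integral>z. ?w z * h (moebius e a z) \<partial>lborel) = (\<integral>z. h (moebius e a z) \<partial>density lborel (\<lambda>z. ennreal (?w z)))"
    by (subst integral_density) (use mc in auto)
  also have "\<dots> = (\<integral>z. h z \<partial>distr (density lborel (\<lambda>z. ennreal (?w z))) borel (moebius e a))"
    by (subst integral_distr) (use mm in auto)
  also have "\<dots> = (\<integral>z. h z \<partial>lborel)"
    unfolding D by (subst integral_density) (auto simp: ind[unfolded real_scaleR_def] im)
  finally show "(\<integral>z. ?w z * h (moebius e a z) \<partial>lborel) = (\<integral>z. h z \<partial>lborel)" .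
qed

lemma norm_dmoebius_ge:
  assumes z: "cmod z \<le> 1"
  shows "1 / lip \<le> cmod (dmoebius z)"
proof -
  have "cmod (cnj a * z) \<le> cmod a" using z by (simp add: norm_mult mult_left_le)
  then have le: "cmod (1 - cnj a * z) \<le> 1 + cmod a" using norm_triangle_ineq4[of 1 "cnj a * z"] by simp
  have pos: "0 < cmod (1 - cnj a * z)" using denom_nonzero[OF z] by simp
  have "1 / lip = (1 - (cmod a)\<^sup>2) / (1 + cmod a)\<^sup>2"
  proof -
    have "1 + cmod a \<noteq> 0" using norm_ge_zero[of a] by linarith
    then show ?thesis unfolding one_minus_a2(1) lip_def by (simp add: power2_eq_square)
  qed
  also have "\<dots> \<le> (1 - (cmod a)\<^sup>2) / (cmod (1 - cnj a * z))\<^sup>2"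
    using le pos one_minus_a2(2) by (intro divide_left_mono power_mono mult_pos_pos zero_less_power add_pos_nonneg) auto
  also have "\<dots> = cmod (dmoebius z)"
    unfolding dmoebius_def using e one_minus_a2(2) by (simp add: norm_mult norm_divide norm_power del: of_real_diff)
  finally show ?thesis .
qed

end

context exhaustion_moebius
begin

text \<open>The first factor arises from comparing \<open>1 - Re\<close> at a point and at its
  image, raised to the power -5/4 of \<open>lap\<close>; the second from the lower bound
  \<open>1 / lip\<close> for the modulus of the derivative.\<close>

definition "dil = lip\<^sup>2 powr (5 / 4) * lip\<^sup>2"

lemma dil_ge_1: "1 \<le> dil"
proof -
  have "1 \<le> lip\<^sup>2" using lip_ge_1 by (simp add: one_le_power)
  moreover from this have "1 \<le> lip\<^sup>2 powr (5 / 4)" by (intro ge_one_powr_ge_zero) auto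
  ultimately show ?thesis using mult_mono[of 1 "lip\<^sup>2 powr (5 / 4)" 1 "lip\<^sup>2"] by (simp add: dil_def)
qed

lemma lap_le:
  assumes fix1: "\<phi> 1 = 1" and z: "z \<in> unit_disc"
  shows "lap z \<le> dil * (lap (\<phi> z) * (cmod (dmoebius z))\<^sup>2)"
proof -
  have L: "0 < lip\<^sup>2" using lip_ge_1 by simp
  define x where "x = 1 - Re z"
  define y where "y = 1 - Re (\<phi> z)"
  have x: "0 < x" and y: "0 < y" using one_minus_Re_pos z in_disc[OF z] by (auto simp: x_def y_def)
  have "y \<le> lip\<^sup>2 * x" using one_minus_Re_moebius[OF _ fix1, of z] z by (simp add: x_def y_def)
  then have "(lip\<^sup>2 * x) powr (- 5 / 4) \<le> y powr (- 5 / 4)" using y by (intro powr_mono2') auto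
  then have "lip\<^sup>2 powr (5 / 4) * (lip\<^sup>2 powr (- 5 / 4) * x powr (- 5 / 4)) \<le> lip\<^sup>2 powr (5 / 4) * y powr (- 5 / 4)"
    using x L by (intro mult_left_mono) (auto simp: powr_mult)
  moreover have "lip\<^sup>2 powr (5 / 4) * lip\<^sup>2 powr (- 5 / 4) = 1" using L by (simp flip: powr_add)
  ultimately have 1: "x powr (- 5 / 4) \<le> lip\<^sup>2 powr (5 / 4) * y powr (- 5 / 4)" by (simp flip: mult.assoc)
  have "1 \<le> lip * cmod (dmoebius z)"
    using norm_dmoebius_ge[of z] z lip_ge_1 by (simp add: field_simps)
  then have "1 \<le> (lip * cmod (dmoebius z))\<^sup>2" by (rule one_le_power)
  then have "lip\<^sup>2 powr (5 / 4) * y powr (- 5 / 4) * 1 \<le> lip\<^sup>2 powr (5 / 4) * y powr (- 5 / 4) * (lip * cmod (dmoebius z))\<^sup>2"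
    by (intro mult_left_mono) auto
  with 1 have "x powr (- 5 / 4) \<le> dil * (y powr (- 5 / 4) * (cmod (dmoebius z))\<^sup>2)"
    by (simp add: dil_def power_mult_distrib mult_ac)
  then show ?thesis by (simp add: lap_def x_def y_def)
qed

lemma u_ge:
  assumes fix1: "\<phi> 1 = 1" and z: "z \<in> cball 0 1"
  shows "dil * u (\<phi> z) \<le> u z"
proof -
  obtain vx vy vxx vyy where v: "pd2 unit_disc (\<lambda>z. u (\<phi> z)) vx vy vxx vyy"
    "\<And>z. z \<in> unit_disc \<Longrightarrow> vxx z + vyy z = lap (\<phi> z) * (cmod (dmoebius z))\<^sup>2"
    using pd2_comp[of \<phi> dmoebius ddmoebius] moebius_deriv continuous_on_ddmoebius in_disc by (force simp: less_imp_le)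
  have "dil * u (\<phi> z) - u z \<le> 0"
  proof (rule max_principle[OF _ pd2_diff[OF pd2_cmult[OF v(1)] pd2_u] _ _ z])
    have "continuous_on (cball 0 1) (\<lambda>z. u (\<phi> z))"
      by (rule continuous_on_compose2[OF cont_u continuous_on_moebius]) (use in_cball in blast)
    then show "continuous_on (cball 0 1) (\<lambda>z. dil * u (\<phi> z) - u z)" by (intro continuous_intros cont_u)
    show "0 \<le> dil * vxx z - uxx z + (dil * vyy z - uyy z)" if "z \<in> unit_disc" for z
    proof -
      have "dil * vxx z + dil * vyy z = dil * (vxx z + vyy z)" by (simp add: distrib_left)
      then show ?thesis using lap_le[OF fix1 that] v(2)[OF that] uxx_plus_uyy[of z] that by simp
    qed
    show "dil * u (\<phi> z) - u z \<le> 0" if "z \<in> unit_circle" for z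
      using u_boundary[OF that] u_boundary[OF in_circle[OF that]] by simp
  qed
  then show ?thesis by simp
qed

lemma level_compare:
  assumes fix1: "\<phi> 1 = 1" and r: "r0 < r" "r < 0"
  shows "r0 < r / dil" "r / dil < 0"
proof -
  have d: "0 < dil" using dil_ge_1 by simp
  show "r / dil < 0" using d r by (simp add: divide_neg_pos)
  have "r * dil \<le> r * 1" using r dil_ge_1 by (intro mult_left_mono_neg) auto
  then have "r \<le> r / dil" using d by (simp add: pos_le_divide_eq)
  then show "r0 < r / dil" using r by simp
qed

text \<open>Compares the two Lelong-Jensen formulas term by term. The map sends the sublevel set of
  \<open>r\<close> into that of \<open>r / dil\<close>, and the positive part of
  \<open>r - u\<close> is at most \<open>dil\<close> times that of \<open>r / dil - u\<close> at the
  image. The squared derivative in \<open>lap_le\<close> and in the transformed Laplacian is exactly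
  the Jacobian.\<close>

lemma mean_moebius_le:
  assumes fix1: "\<phi> 1 = 1" and r: "r0 < r" "r < 0" and p: "1 \<le> p" and f: "f holomorphic_on unit_disc"
  shows "mean p (f \<circ> \<phi>) r \<le> dil * mean p f (r / dil)"
proof (rule mean_le[OF r level_compare[OF fix1 r] p _ f])
  show h: "(f \<circ> \<phi>) holomorphic_on unit_disc"
    by (rule holomorphic_on_compose_gen[OF moebius_holomorphic f]) (use in_disc in blast)
  fix e :: real assume e: "e > 0"
  note d = dil_ge_1
  define s where "s = r / dil"
  have s: "r0 < s" "s < 0" unfolding s_def by (rule level_compare[OF fix1 r])+
  define g where "g = (\<lambda>z. ((cmod (f z))\<^sup>2 + e) powr (p / 2))"
  define L where "L = (\<lambda>z. 4 * (p / 2) * ((cmod (f z))\<^sup>2 + e) powr (p / 2 - 2) *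
        (cmod (deriv f z))\<^sup>2 * (e + p / 2 * (cmod (f z))\<^sup>2))"
  have Lpos: "0 \<le> L z" for z unfolding L_def using p e by (intro mult_nonneg_nonneg add_nonneg_nonneg) auto
  obtain gx gy gxx gyy where g: "pd2 unit_disc g gx gy gxx gyy"
      "\<And>z. z \<in> unit_disc \<Longrightarrow> gxx z + gyy z = L z"
    using pd2_holomorphic_powr[OF f e, of "p / 2"] unfolding g_def L_def by blast
  \<comment> \<open>Regularisation commutes with composition, so the explicit formula applied to
    \<open>f \<circ> \<phi>\<close> shows the Laplacian of \<open>g\<close> at the image times the
    squared modulus of the derivative of the map.\<close>
  obtain hx hy hxx hyy where h: "pd2 unit_disc (\<lambda>z. g (\<phi> z)) hx hy hxx hyy"
      "\<And>z. z \<in> unit_disc \<Longrightarrow> hxx z + hyy z = L (\<phi> z) * (cmod (dmoebius z))\<^sup>2"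
  proof -
    have "deriv (f \<circ> \<phi>) z = deriv f (\<phi> z) * dmoebius z" if z: "z \<in> unit_disc" for z
    proof (rule DERIV_imp_deriv)
      show "(f \<circ> \<phi> has_field_derivative deriv f (\<phi> z) * dmoebius z) (at z)"
        using z by (intro DERIV_chain holomorphic_derivI[OF f open_ball in_disc] moebius_deriv(1)) auto
    qed
    then show ?thesis
      using that pd2_holomorphic_powr[OF h e, of "p / 2"] unfolding g_def L_def
      by (auto simp: norm_mult power_mult_distrib mult_ac)
  qed
  define H1 where "H1 = (\<lambda>z. if z \<in> unit_disc \<and> u z < s then g z * lap z else 0)"
  define H2 where "H2 = (\<lambda>z. if z \<in> unit_disc then max 0 (s - u z) * (gxx z + gyy z) else 0)"
  let ?J = "\<lambda>z. (cmod (dmoebius z))\<^sup>2 * indicator unit_disc z :: real"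
  note A = level_identity[OF r h(1)] and B = level_identity[OF s g(1), folded H1_def H2_def]
  have z1: "H1 z = 0" "H2 z = 0" if "z \<notin> unit_disc" for z using that by (simp_all add: H1_def H2_def)
  note C1 = integral_moebius[OF B(2) z1(1)] and C2 = integral_moebius[OF B(3) z1(2)]
  have le1: "(if z \<in> unit_disc \<and> u z < r then g (\<phi> z) * lap z else 0) \<le> dil * (?J z * H1 (\<phi> z))" for z
  proof (cases "z \<in> unit_disc \<and> u z < r")
    case True
    then have z: "z \<in> unit_disc" and zr: "u z < r" by auto
    have "dil * u (\<phi> z) < r" using u_ge[OF fix1, of z] z zr by simp
    then have "u (\<phi> z) < s" using d by (simp add: s_def pos_less_divide_eq mult.commute)
    then have "H1 (\<phi> z) = g (\<phi> z) * lap (\<phi> z)" using in_disc[OF z] by (simp add: H1_def)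
    moreover have "g (\<phi> z) * lap z \<le> g (\<phi> z) * (dil * (lap (\<phi> z) * (cmod (dmoebius z))\<^sup>2))"
      using lap_le[OF fix1 z] by (intro mult_left_mono) (auto simp: g_def)
    ultimately show ?thesis using True z by (simp add: mult_ac)
  next
    case False
    have "0 \<le> H1 (\<phi> z)" using lap_pos[of "\<phi> z"] by (auto simp: H1_def g_def)
    then show ?thesis using False d by auto
  qed
  have le2: "(if z \<in> unit_disc then max 0 (r - u z) * (hxx z + hyy z) else 0) \<le> dil * (?J z * H2 (\<phi> z))" for z
  proof (cases "z \<in> unit_disc")
    case True
    have "r - u z \<le> r - dil * u (\<phi> z)" using u_ge[OF fix1, of z] True by simp
    also have "\<dots> = dil * (s - u (\<phi> z))" using d by (simp add: s_def right_diff_distrib)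
    also have "\<dots> \<le> dil * max 0 (s - u (\<phi> z))" using d by (intro mult_left_mono) auto
    finally have "max 0 (r - u z) \<le> dil * max 0 (s - u (\<phi> z))" using d by simp
    then have "max 0 (r - u z) * (hxx z + hyy z) \<le> dil * max 0 (s - u (\<phi> z)) * (hxx z + hyy z)"
      using Lpos unfolding h(2)[OF True] by (intro mult_right_mono) auto
    then show ?thesis using True in_disc[OF True] h(2)[OF True] g(2)[OF in_disc[OF True]]
      by (simp add: H2_def mult_ac)
  qed simp
  have "mean_eps p e (f \<circ> \<phi>) r \<le> (\<integral>z. dil * (?J z * H1 (\<phi> z)) \<partial>lborel) + (\<integral>z. dil * (?J z * H2 (\<phi> z)) \<partial>lborel)"
    unfolding mean_eps_def o_def A(4)[unfolded g_def]
    by (intro add_mono integral_mono A(2,3)[unfolded g_def] integrable_mult_right C1(1) C2(1)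
        le1[unfolded g_def] le2)
  also have "\<dots> = dil * (\<integral>z. H1 z \<partial>lborel) + dil * (\<integral>z. H2 z \<partial>lborel)"
    using C1(2) C2(2) by simp
  also have "\<dots> = dil * mean_eps p e f s"
    unfolding mean_eps_def B(4)[unfolded g_def] by (simp add: distrib_left)
  finally show "mean_eps p e (f \<circ> \<phi>) r \<le> dil * mean_eps p e f (r / dil)" by (simp add: s_def)
qed

lemma bounded_if_fixed:
  assumes \<kappa>: "\<kappa> > 0" and p: "1 \<le> p" and fix1: "\<phi> 1 = 1"
  shows "bounded_operator_on_Hp \<kappa> u p (composition_operator \<phi>)"
proof -
  have main: "f \<circ> \<phi> \<in> Hp \<kappa> u p \<and> Hp_norm \<kappa> u p (f \<circ> \<phi>) \<le> dil powr (1 / p) * Hp_norm \<kappa> u p f"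
    if f: "f \<in> Hp \<kappa> u p" for f
  proof -
    note d = dil_ge_1
    have h: "f holomorphic_on unit_disc" using f by (simp add: Hp_def)
    have h': "(f \<circ> \<phi>) holomorphic_on unit_disc"
      by (rule holomorphic_on_compose_gen[OF moebius_holomorphic h]) (use in_disc in blast)
    obtain B where B: "\<And>r. r0 < r \<Longrightarrow> r < 0 \<Longrightarrow> mean p f r \<le> B" using mean_bounded[OF \<kappa> p f] by blast
    obtain c where c: "(mean p f \<longlongrightarrow> c) (at_left 0)" "\<And>r. r0 < r \<Longrightarrow> r < 0 \<Longrightarrow> mean p f r \<le> c"
      using increasing_tendsto_at_left_0[of r0 "mean p f" B, OF r0 mean_mono[OF _ _ _ p h] B] by blast
    have "mean p (f \<circ> \<phi>) r \<le> dil * c" if r: "r0 < r" "r < 0" for r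
    proof -
      have "dil * mean p f (r / dil) \<le> dil * c"
        using d by (intro mult_left_mono c(2) level_compare[OF fix1 r]) auto
      then show ?thesis using mean_moebius_le[OF fix1 r p h] by simp
    qed
    \<comment> \<open>The means of the composition are increasing and bounded by
      \<open>dil * c\<close>, so they converge; comparing limits gives the operator bound, with a
      p-th root in the norm.\<close>
    then obtain c' where c': "(mean p (f \<circ> \<phi>) \<longlongrightarrow> c') (at_left 0)"
      "\<And>r. r0 < r \<Longrightarrow> r < 0 \<Longrightarrow> mean p (f \<circ> \<phi>) r \<le> c'" "c' \<le> dil * c"
      using increasing_tendsto_at_left_0[of r0 "mean p (f \<circ> \<phi>)" "dil * c", OF r0 mean_mono[OF _ _ _ p h']] by blast
    have "r0 < r0 / 2" "r0 / 2 < 0" using r0 by auto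
    then have c0: "0 \<le> c" "0 \<le> c'"
      using c(2)[of "r0 / 2"] c'(2)[of "r0 / 2"] mean_nonneg[of p f "r0 / 2"] mean_nonneg[of p "f \<circ> \<phi>" "r0 / 2"]
      by linarith+
    have k0: "0 \<le> \<kappa> * c" "0 \<le> \<kappa> * c'" using \<kappa> c0 by simp_all
    note l = Hp_if_tendsto(2)[OF h Hp_integral_tendsto_mean[OF \<kappa> p h c(1)] k0(1)]
      and l' = Hp_if_tendsto[OF h' Hp_integral_tendsto_mean[OF \<kappa> p h' c'(1)] k0(2)]
    have "\<kappa> * c' \<le> \<kappa> * (dil * c)" using \<kappa> c'(3) by (intro mult_left_mono) auto
    also have "\<dots> = dil * (\<kappa> * c)" by (simp add: mult_ac)
    finally have "(\<kappa> * c') powr (1 / p) \<le> (dil * (\<kappa> * c)) powr (1 / p)" using p k0 by (intro powr_mono2) auto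
    also have "\<dots> = dil powr (1 / p) * (\<kappa> * c) powr (1 / p)" by (rule powr_mult)
    finally show ?thesis using l l' by simp
  qed
  then show ?thesis unfolding bounded_operator_on_Hp_def composition_operator_def by blast
qed

end

section \<open>Identification of the harmonic part and conclusion\<close>

lemma harmonic_on_unique_Re:
  assumes h: "harmonic_on unit_disc \<rho>" and c: "continuous_on (cball 0 1) \<rho>"
    and cG: "continuous_on (cball 0 1) G" and G: "G holomorphic_on unit_disc"
    and eq: "\<And>z. z \<in> unit_circle \<Longrightarrow> \<rho> z = Re (G z)" and z: "z \<in> cball 0 1"
  shows "\<rho> z = Re (G z)"
proof -
  have G': "deriv G holomorphic_on unit_disc" using G by (intro holomorphic_deriv) auto
  have c2: "Ck_on 2 unit_disc \<rho>" and l: "\<And>z. z \<in> unit_disc \<Longrightarrow> laplacian \<rho> z = 0"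
    using h by (auto simp: harmonic_on_def)
  note p1 = Ck_on_2_pd2[OF c2]
    and p2 = pd2_Re[OF holomorphic_derivI[OF G open_ball] holomorphic_derivI[OF G' open_ball]
        holomorphic_on_imp_continuous_on[OF holomorphic_deriv[OF G' open_ball]]]
  have cR: "continuous_on (cball 0 1) (\<lambda>z. Re (G z))" by (intro continuous_intros cG)
  \<comment> \<open>The difference is harmonic and vanishes on the circle; the maximum principle is
    applied to it and to its negative.\<close>
  have "\<rho> z - Re (G z) \<le> 0"
    by (rule max_principle[OF continuous_on_diff[OF c cR] pd2_diff[OF p1 p2] _ _ z])
       (use l eq in \<open>auto simp: laplacian_def\<close>)
  moreover have "Re (G z) - \<rho> z \<le> 0"
    by (rule max_principle[OF continuous_on_diff[OF cR c] pd2_diff[OF p2 p1] _ _ z])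
       (use l eq in \<open>auto simp: laplacian_def add_eq_0_iff\<close>)
  ultimately show ?thesis by simp
qed

lemma (in exhaustion_moebius) inv_into_circle:
  assumes z: "z \<in> unit_circle"
  shows "inv_into unit_circle \<phi> z = \<psi> z"
proof (rule inv_into_f_eq)
  show "inj_on \<phi> unit_circle"
    by (rule inj_on_inverseI[of _ \<psi>]) (simp add: inv_moebius)
  show "\<phi> (\<psi> z) = z" using z by (simp add: moebius_inv)
qed (rule inv_circle[OF z])

theorem theorem5p1:
  fixes p \<theta> \<kappa> :: real
    and a :: complex
    and \<phi> :: "complex \<Rightarrow> complex"
    and f0 \<rho> u :: "complex \<Rightarrow> real"
    and \<mu> :: "complex measure"
    and \<beta> :: "complex \<Rightarrow> ennreal"
  assumes "1 \<le> p"
    and "a \<in> unit_disc"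
    and "\<kappa> > 0"
    and "\<phi> = (\<lambda>z. exp (\<i> * of_real \<theta>) * ((z - a) / (1 - cnj a * z)))"
    and "f0 = (\<lambda>z. - ((1 - Re z) powr (3 / 4)))"
    and "harmonic_on unit_disc \<rho>"
    and "continuous_on (cball 0 1) \<rho>"
    and "\<And>\<xi>. \<xi> \<in> unit_circle \<Longrightarrow> \<rho> \<xi> = f0 \<xi>"
    and "u = (\<lambda>z. f0 z - \<rho> z)"
    and "is_boundary_MA_measure \<kappa> u \<mu>"
    and "\<beta> \<in> borel_measurable borel"
    and "\<mu> = density arc_length \<beta>"
  shows "(bounded_operator_on_Hp \<kappa> u p (composition_operator \<phi>) \<longleftrightarrow>
           (\<exists>K>0. \<forall>E\<in>sets borel. E \<subseteq> unit_circle \<longrightarrow>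
              (\<integral>\<^sup>+\<eta>\<in>E. \<beta> (inv_into unit_circle \<phi> \<eta>) \<partial>arc_length)
                \<le> ennreal K * (\<integral>\<^sup>+\<eta>\<in>E. \<beta> \<eta> \<partial>arc_length)))
       \<and> ((\<exists>K>0. \<forall>E\<in>sets borel. E \<subseteq> unit_circle \<longrightarrow>
              (\<integral>\<^sup>+\<eta>\<in>E. \<beta> (inv_into unit_circle \<phi> \<eta>) \<partial>arc_length)
                \<le> ennreal K * (\<integral>\<^sup>+\<eta>\<in>E. \<beta> \<eta> \<partial>arc_length))
           \<longleftrightarrow> \<phi> 1 = 1)"
proof -
  obtain G G' where G: "continuous_on (cball 0 1) G" "continuous_on (cball 0 1) G'"
    "\<And>z. z \<in> unit_disc \<Longrightarrow> (G has_field_derivative G' z) (at z)"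
    "\<And>z. z \<in> unit_circle \<Longrightarrow> Re (G z) = - ((1 - Re z) powr (3 / 4))"
    using dirichlet_solution by blast
  have hG: "G holomorphic_on unit_disc"
    unfolding holomorphic_on_open[OF open_ball] using G(3) by blast
  have "\<rho> z = Re (G z)" if "z \<in> unit_circle" for z
    unfolding assms(8)[OF that] G(4)[OF that] assms(5) ..
  \<comment> \<open>The function \<rho> is given only through the Dirichlet problem; uniqueness
    replaces it by the series, whose derivative is controlled up to the circle.\<close>
  then have eq: "\<rho> z = Re (G z)" if "z \<in> cball 0 1" for z
    using that by (rule harmonic_on_unique_Re[OF assms(6,7) G(1) hG])
  interpret disc_exhaustion G G' u
  proof (rule disc_exhaustion.intro[OF G])
    show "u z = - ((1 - Re z) powr (3 / 4)) - Re (G z)" if "z \<in> cball 0 1" for z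
      unfolding assms(5,9) eq[OF that] ..
  qed
  obtain t0 q C r0 where "disc_annulus G G' u t0 q C r0" using disc_annulus_exists by blast
  then interpret disc_annulus G G' u t0 q C r0 .
  define e where "e = exp (\<i> * of_real \<theta>)"
  interpret exhaustion_moebius G G' u t0 q C r0 e a
    by unfold_locales (use assms(2) in \<open>auto simp: e_def norm_exp_eq_Re\<close>)
  have \<phi>: "\<phi> = moebius e a" unfolding assms(4) e_def moebius_def[abs_def] ..
  have "domination \<beta> (inv_into unit_circle \<phi>) \<longleftrightarrow> domination (bweight \<kappa>) (moebius_inv e a)"
    unfolding \<phi>
    by (rule domination_cong[OF assms(11) density_AE_bweight[OF assms(3,10,11,12)] inv_into_circle])
  also have "\<dots> \<longleftrightarrow> \<phi> 1 = 1"
    using domination_if_fixed[OF assms(3)] fixed_if_domination[OF assms(3)] unfolding \<phi> by blast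
  finally have 1: "domination \<beta> (inv_into unit_circle \<phi>) \<longleftrightarrow> \<phi> 1 = 1" .
  have 2: "bounded_operator_on_Hp \<kappa> u p (composition_operator \<phi>) \<longleftrightarrow> \<phi> 1 = 1"
    using bounded_if_fixed[OF assms(3,1)] fixed_if_bounded[OF assms(3,1)] unfolding \<phi> by blast
  show ?thesis using 1 2 unfolding domination_def by blast
qed

end
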